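(* Consider the $133$ triangulations (up to isomorphism) with exactly $9$ vertices (the minimal number) of the non-orientable closed surface $N_3$ of genus $3$. At least $4$ of them are polyhedrally realizable in $\mathbb{R}^3$. At least $3$ of them are not polyhedrally realizable in $\mathbb{R}^3$, due to the fact that triple points are infeasible for them.
   Context: $N_h$ denotes the connected sum of $h$ projective planes (the non-orientable closed surface of genus $h$). A triangulation of a closed connected surface $S$ is a finite two-dimensional simplicial complex $\Delta$ whose underlying space $|\Delta|$ is homeomorphic to $S$; triangulations are counted up to combinatorial (simplicial) isomorphism. The minimal number of vertices of a triangulation of $N_3$ is $9$, and there are exactly $133$ triangulations of $N_3$ with $9$ vertices, from the known enumeration. Let $V$ be the vertex set of $\Delta$. Each map $\psi\colon V\to\mathbb{R}^3$ induces a simplexwise linear map $\phi_\psi\colon|\Delta|\to\mathbb{R}^3$. Since the surface is non-orientable, a polyhedral realization of $\Delta$ in $\mathbb{R}^3$ is a map $\phi_\psi$ that is locally injective (a simplexwise linear immersion); $\Delta$ is polyhedrally realizable if such a $\psi$ exists. Triple points: a triple point of an immersed surface is a point of $\mathbb{R}^3$ in which three disks of the surface intersect (in general position, like three coordinate planes). Two triangles of $\Delta$ are adjacent if they share an edge. Triple points are infeasible for $\Delta$ if the following necessary combinatorial condition fails: there exist three pairwise vertex-disjoint triangles of $\Delta$ such that, for each pair $abc$, $def$ of these three triangles, at most $4$ of the $6$ triangles adjacent to $abc$ or to $def$ have all three of their vertices in $\{a,b,c,d,e,f\}$. *)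

theory Defs
  imports "HOL-Analysis.Analysis"
begin

section \<open>The surfaces $N_h$\<close>

definition projective_plane :: "'a topology \<Rightarrow> bool" where
  "projective_plane X \<longleftrightarrow>
    (\<exists>q. quotient_map (top_of_set (sphere (0 :: real ^ 3) 1)) X q \<and>
         (\<forall>x \<in> sphere 0 1. \<forall>y \<in> sphere 0 1. q x = q y \<longleftrightarrow> y = x \<or> y = - x))"

text \<open>
  The space \<open>Z\<close> is obtained from \<open>X\<close> and \<open>Y\<close> by removing the interiors of the embedded closed
  disks \<open>f\<close> and \<open>g\<close> and identifying the two boundary circles via \<open>f s \<sim> g s\<close>.
  The summand \<open>X\<close> carries the tag \<open>False\<close>, the summand \<open>Y\<close> the tag \<open>True\<close>.
\<close>

definition punctured_sum ::
  "'a topology \<Rightarrow> (real ^ 2 \<Rightarrow> 'a) \<Rightarrow> 'a topology \<Rightarrow> (real ^ 2 \<Rightarrow> 'a) \<Rightarrow> (bool \<times> 'a) topology" where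
  "punctured_sum X f Y g =
    sum_topology
      (\<lambda>b. if b then subtopology Y (topspace Y - g ` ball 0 1)
                else subtopology X (topspace X - f ` ball 0 1)) UNIV"

definition connected_sum :: "'a topology \<Rightarrow> 'a topology \<Rightarrow> 'b topology \<Rightarrow> bool" where
  "connected_sum X Y Z \<longleftrightarrow>
    (\<exists>f g q.
      embedding_map (top_of_set (cball (0 :: real ^ 2) 1)) X f \<and>
      embedding_map (top_of_set (cball (0 :: real ^ 2) 1)) Y g \<and>
      quotient_map (punctured_sum X f Y g) Z q \<and>
      (\<forall>p \<in> topspace (punctured_sum X f Y g). \<forall>p' \<in> topspace (punctured_sum X f Y g).
         q p = q p' \<longleftrightarrow> p = p' \<or> (\<exists>s \<in> sphere 0 1. {p, p'} = {(False, f s), (True, g s)})))"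

text \<open>
  \<open>nonorientable_surface h Z\<close>: the space \<open>Z\<close> is a copy of $N_h$, the connected sum of
  \<open>h \<ge> 1\<close> projective planes. The points are taken from the type \<open>nat \<Rightarrow> real\<close> only in order to
  have a fixed type for all \<open>h\<close>; every compact metrizable space has a homeomorphic copy there.
\<close>

inductive nonorientable_surface :: "nat \<Rightarrow> (nat \<Rightarrow> real) topology \<Rightarrow> bool" where
  base: "projective_plane X \<Longrightarrow> nonorientable_surface 1 X"
| step: "nonorientable_surface h X \<Longrightarrow> projective_plane Y \<Longrightarrow> connected_sum X Y Z
          \<Longrightarrow> nonorientable_surface (Suc h) Z"


section \<open>Simplicial complexes and triangulations\<close>

text \<open>
  An abstract simplicial complex is given by its set of nonempty faces; all singletons of
  vertices are faces, so its vertex set is \<open>\<Union>K\<close>.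
\<close>

definition abstract_complex :: "'v set set \<Rightarrow> bool" where
  "abstract_complex K \<longleftrightarrow>
    finite K \<and> (\<forall>F \<in> K. finite F \<and> F \<noteq> {}) \<and> (\<forall>F \<in> K. \<forall>G. G \<subseteq> F \<and> G \<noteq> {} \<longrightarrow> G \<in> K)"

definition triangles :: "'v set set \<Rightarrow> 'v set set" where
  "triangles K = {F \<in> K. card F = 3}"

definition two_dimensional :: "'v set set \<Rightarrow> bool" where
  "two_dimensional K \<longleftrightarrow> (\<forall>F \<in> K. card F \<le> 3) \<and> triangles K \<noteq> {}"

text \<open>
  Points of the underlying space are given by barycentric coordinates; as \<open>K\<close> is finite, the
  product topology on \<open>'v \<Rightarrow> real\<close> induces the usual topology.
\<close>

definition underlying_space :: "'v set set \<Rightarrow> ('v \<Rightarrow> real) set" where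
  "underlying_space K =
    {t. (\<forall>v. 0 \<le> t v) \<and> {v. t v \<noteq> 0} \<in> K \<and> (\<Sum>v | t v \<noteq> 0. t v) = 1}"

definition triangulates :: "'v set set \<Rightarrow> 'a topology \<Rightarrow> bool" where
  "triangulates K S \<longleftrightarrow>
    abstract_complex K \<and> two_dimensional K \<and>
    top_of_set (underlying_space K) homeomorphic_space S"

definition combinatorially_isomorphic :: "'v set set \<Rightarrow> 'w set set \<Rightarrow> bool" where
  "combinatorially_isomorphic K L \<longleftrightarrow>
    (\<exists>f. bij_betw f (\<Union>K) (\<Union>L) \<and> (\<lambda>F. f ` F) ` K = L)"

text \<open>
  The triangulations of $N_h$ with exactly \<open>n\<close> vertices. Up to isomorphism, it is no restriction
  that the vertices are natural numbers.
\<close>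

definition triangulations_N :: "nat \<Rightarrow> nat \<Rightarrow> nat set set set" where
  "triangulations_N h n =
    {K. card (\<Union>K) = n \<and> (\<exists>S. nonorientable_surface h S \<and> triangulates K S)}"


section \<open>Polyhedral realizations of non-orientable surfaces\<close>

definition simplexwise_linear_map ::
  "'v set set \<Rightarrow> ('v \<Rightarrow> real ^ 3) \<Rightarrow> ('v \<Rightarrow> real) \<Rightarrow> real ^ 3" where
  "simplexwise_linear_map K \<psi> t = (\<Sum>v \<in> \<Union>K. t v *\<^sub>R \<psi> v)"

definition locally_injective_on :: "'a::topological_space set \<Rightarrow> ('a \<Rightarrow> 'b) \<Rightarrow> bool" where
  "locally_injective_on S \<phi> \<longleftrightarrow> (\<forall>x \<in> S. \<exists>U. open U \<and> x \<in> U \<and> inj_on \<phi> (S \<inter> U))"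

definition polyhedrally_realizable :: "'v set set \<Rightarrow> bool" where
  "polyhedrally_realizable K \<longleftrightarrow>
    (\<exists>\<psi>. locally_injective_on (underlying_space K) (simplexwise_linear_map K \<psi>))"


section \<open>Triple points\<close>

definition adjacent_triangles :: "'v set \<Rightarrow> 'v set \<Rightarrow> bool" where
  "adjacent_triangles A B \<longleftrightarrow> A \<noteq> B \<and> card (A \<inter> B) = 2"

text \<open>
  In a closed surface, two vertex-disjoint triangles have exactly six adjacent triangles in
  total; the condition asks that at most four of them have all their vertices in \<open>A \<union> B\<close>.
\<close>

definition pair_condition :: "'v set set \<Rightarrow> 'v set \<Rightarrow> 'v set \<Rightarrow> bool" where
  "pair_condition K A B \<longleftrightarrow>
    card {T \<in> triangles K. (adjacent_triangles T A \<or> adjacent_triangles T B) \<and> T \<subseteq> A \<union> B} \<le> 4"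

definition triple_points_infeasible :: "'v set set \<Rightarrow> bool" where
  "triple_points_infeasible K \<longleftrightarrow>
    \<not> (\<exists>A \<in> triangles K. \<exists>B \<in> triangles K. \<exists>C \<in> triangles K.
         A \<inter> B = {} \<and> A \<inter> C = {} \<and> B \<inter> C = {} \<and>
         pair_condition K A B \<and> pair_condition K A C \<and> pair_condition K B C)"

end

theory Submission
  imports Defs
begin

text \<open>
  The realizable triangulations come with integer coordinates; local injectivity is certified by a
  separating plane through the common face for each pair of triangles with a common vertex. All seven
  complexes are obtained by flips and removals of vertices of degree three from three six-vertex projective
  planes glued along triangles, and the six-vertex projective plane arises in the same way from a nine-vertex
  quotient of the octahedral sphere.

  Non-realizability is Banchoff's argument modulo 2. A locally injective map is perturbed into
  general position; if there are no triple points, the complement of the image has a colouring with two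
  colours that changes whenever a path crosses the surface transversally. Orient the triangles arbitrarily
  and let \<open>\<gamma>\<close> be the set of edges along which the orientations disagree. Following the colour on the
  positive side along a closed path that runs through \<open>\<gamma>\<close> once modulo 2, one sees that the number of
  piercings of triangles by edges in \<open>\<gamma>\<close> is congruent to the number of times the path crosses \<open>\<gamma>\<close>, which
  is the self-intersection number of \<open>\<gamma>\<close> and odd for \<open>N\<^sub>3\<close>. Following the colour of the doubly
  positive quadrant along the double curves, one sees that this number is even. A pair of disjoint
  triangles that intersect contains exactly two piercings, and an edge cannot pierce a triangle if it
  spans a triangle with one of its vertices; this gives the combinatorial condition on triple points.
\<close>

section \<open>Stellar subdivisions and flips\<close>

text \<open>Both directions meet in one linear condition, \<open>dependence_free\<close>: two
  triangles with a common vertex admit no nontrivial affine dependence that is positive only on the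
  first and negative only on the second. It is equivalent to local injectivity, separating planes
  certify it, and by compactness it survives small perturbations. Triple points are excluded
  combinatorially, so their exclusion applies to the perturbed map without further care.

  The detour over nine vertices has a reason: modulo the antipodal map all faces of the octahedron
  have the same vertex set, but its midpoint subdivision becomes a genuine complex whose barycentric
  coordinates have a closed piecewise linear form.

  The obstacle in the argument modulo 2 is that colours live off the surface while the relations
  between them concern flags on it. Colours are therefore sampled at finitely many points displaced
  by two small parameters, \<open>\<eta>\<close> along the surface and then \<open>e\<close> off it.
  No orientation theory is developed: the odd self-intersection number is read off an explicit
  closed walk of flags.\<close>

definition faces_of :: "'v set set \<Rightarrow> 'v set set" where
  "faces_of \<Phi> = {F. F \<noteq> {} \<and> (\<exists>T \<in> \<Phi>. F \<subseteq> T)}"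

text \<open>For a single vertex \<open>F = {v}\<close> this renames \<open>v\<close> to
  \<open>m\<close>; for an edge or a triangle it is the subdivision at the barycentre. All three
  cases occur among the moves.\<close>

definition stellar :: "'v set set \<Rightarrow> 'v set \<Rightarrow> 'v \<Rightarrow> 'v set set" where
  "stellar \<Phi> F m = {T \<in> \<Phi>. \<not> F \<subseteq> T} \<union> {insert m (T - {v}) | T v. T \<in> \<Phi> \<and> F \<subseteq> T \<and> v \<in> F}"

text \<open>The support of \<open>t\<close> varies with \<open>t\<close>; a sum over one fixed
  finite \<open>V\<close> is continuous in \<open>t\<close> and can be compared between different
  complexes.\<close>

lemma underlying_space_altdef:
  assumes "finite V" "\<Union>K \<subseteq> V"
  shows "underlying_space K =
    {t. (\<forall>v. 0 \<le> t v) \<and> {v. t v \<noteq> 0} \<in> K \<and> sum t V = 1}"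
proof -
  have "(\<Sum>v | t v \<noteq> 0. t v) = sum t V" if "{v. t v \<noteq> 0} \<in> K" for t :: "'a \<Rightarrow> real"
    using assms that by (intro sum.mono_neutral_left) auto
  then show ?thesis unfolding underlying_space_def by auto
qed

lemma Union_faces_of: "\<Union>(faces_of \<Phi>) = \<Union>\<Phi>"
  unfolding faces_of_def by auto

lemma underlying_space_faces_of:
  assumes "finite V" "\<Union>\<Phi> \<subseteq> V"
  shows "underlying_space (faces_of \<Phi>) =
    {t. (\<forall>v. 0 \<le> t v) \<and> (\<exists>T\<in>\<Phi>. {v. t v \<noteq> 0} \<subseteq> T) \<and> sum t V = 1}"
proof -
  have "{v. t v \<noteq> 0} \<noteq> {}" if "sum t V = 1" for t :: "'a \<Rightarrow> real"
    using that by (metis (mono_tags, lifting) empty_Collect_eq sum.neutral zero_neq_one)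
  then show ?thesis
    using assms by (subst underlying_space_altdef[OF assms(1)]) (auto simp: faces_of_def)
qed

lemma continuous_on_coordinate: "continuous_on S (\<lambda>t::'v \<Rightarrow> real. t v)"
  by (rule continuous_on_subset[OF continuous_on_product_coordinates]) simp

lemma continuous_on_Min_coordinates:
  assumes "finite F" "F \<noteq> {}"
  shows "continuous_on S (\<lambda>t::'v \<Rightarrow> real. Min (t ` F))"
  using assms
proof (induction F rule: finite_ne_induct)
  case (singleton x)
  then show ?case
    using continuous_on_coordinate by simp
next
  case (insert x F)
  have "(\<lambda>t::'v \<Rightarrow> real. Min (t ` insert x F)) = (\<lambda>t. min (t x) (Min (t ` F)))"
    using insert by auto
  then show ?case
    using insert by (auto intro!: continuous_intros intro: continuous_on_coordinate)
qed

text \<open>\<open>h\<close> distributes the weight of \<open>m\<close> equally over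
  \<open>F\<close>, which places \<open>m\<close> at the barycentre of \<open>F\<close>. The inverse
  \<open>g\<close> removes from all coordinates in \<open>F\<close> their minimum
  \<open>\<mu>\<close> and gives \<open>k * \<mu>\<close> to \<open>m\<close>. Both formulas are
  global, so continuity needs no pasting over simplices.\<close>

proposition stellar_homeomorphic:
  fixes \<Phi> :: "'v set set"
  assumes fin: "finite (\<Union>\<Phi>)" and F: "finite F" "F \<noteq> {}" and m: "m \<notin> \<Union>\<Phi>" "m \<notin> F"
  shows "top_of_set (underlying_space (faces_of (stellar \<Phi> F m))) homeomorphic_space
    top_of_set (underlying_space (faces_of \<Phi>))"
proof -
  define V where "V = insert m (\<Union>\<Phi> \<union> F)"
  have finV: "finite V" and subV: "\<Union>\<Phi> \<subseteq> V" "\<Union>(stellar \<Phi> F m) \<subseteq> V" "F \<subseteq> V" "m \<in> V"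
    using fin F unfolding V_def stellar_def by auto
  define X where "X = underlying_space (faces_of (stellar \<Phi> F m))"
  define Y where "Y = underlying_space (faces_of \<Phi>)"
  have X: "X = {t. (\<forall>v. 0 \<le> t v) \<and> (\<exists>T\<in>stellar \<Phi> F m. {v. t v \<noteq> 0} \<subseteq> T) \<and> sum t V = 1}"
    unfolding X_def using underlying_space_faces_of[OF finV subV(2)] .
  have Y: "Y = {t. (\<forall>v. 0 \<le> t v) \<and> (\<exists>T\<in>\<Phi>. {v. t v \<noteq> 0} \<subseteq> T) \<and> sum t V = 1}"
    unfolding Y_def using underlying_space_faces_of[OF finV subV(1)] .
  define k where "k = real (card F)"
  have k: "k > 0" using F by (simp add: k_def card_gt_0_iff)
  define h :: "('v \<Rightarrow> real) \<Rightarrow> 'v \<Rightarrow> real" where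
    "h t = (\<lambda>v. if v = m then 0 else if v \<in> F then t v + t m / k else t v)" for t
  define \<mu> :: "('v \<Rightarrow> real) \<Rightarrow> real" where "\<mu> t = Min (t ` F)" for t
  define g :: "('v \<Rightarrow> real) \<Rightarrow> 'v \<Rightarrow> real" where
    "g t = (\<lambda>v. if v = m then k * \<mu> t else if v \<in> F then t v - \<mu> t else t v)" for t
  have sumF: "(\<Sum>v\<in>V. if v \<in> F then c else 0) = k * c" for c :: real
    using finV subV by (simp add: sum.If_cases k_def Int_absorb1)
  have conth: "continuous_on X h"
    unfolding h_def
  proof (rule continuous_on_coordinatewise_then_product)
    fix v show "continuous_on X (\<lambda>t. if v = m then 0 else if v \<in> F then t v + t m / k else t v)"
      using k by (cases "v = m"; cases "v \<in> F")
        (simp_all add: continuous_on_add continuous_on_divide continuous_on_coordinate)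
  qed
  have contg: "continuous_on Y g"
    unfolding g_def \<mu>_def
  proof (rule continuous_on_coordinatewise_then_product)
    fix v show "continuous_on Y (\<lambda>t. if v = m then k * Min (t ` F) else if v \<in> F then t v - Min (t ` F) else t v)"
      using F by (cases "v = m"; cases "v \<in> F")
        (simp_all add: continuous_on_diff continuous_on_mult_left continuous_on_coordinate continuous_on_Min_coordinates)
  qed
  \<comment> \<open>A face of the subdivision omits a vertex of \<open>F\<close>; this makes the
    minimum of \<open>h t\<close> over \<open>F\<close> equal to \<open>t m / k\<close>, so that
    \<open>g\<close> undoes \<open>h\<close>.\<close>
  have Xm: "(\<exists>v\<in>F. t v = 0)" if t: "t \<in> X" for t
  proof -
    obtain T where T: "T \<in> stellar \<Phi> F m" "{v. t v \<noteq> 0} \<subseteq> T" using t unfolding X by auto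
    have "\<not> F \<subseteq> T" using T(1) m unfolding stellar_def by auto
    then show ?thesis using T(2) by auto
  qed
  have hX: "h t \<in> Y" if t: "t \<in> X" for t
  proof -
    from t[unfolded X] obtain T where T: "T \<in> stellar \<Phi> F m" "{v. t v \<noteq> 0} \<subseteq> T"
      and nn: "\<And>v. 0 \<le> t v" and s: "sum t V = 1" by auto
    have 1: "0 \<le> h t v" for v using nn k by (simp add: h_def)
    have "\<exists>T\<in>\<Phi>. {v. h t v \<noteq> 0} \<subseteq> T"
    proof (cases "T \<in> \<Phi>")
      case True
      then have "t m = 0" using T m by auto
      then have "{v. h t v \<noteq> 0} \<subseteq> T" using T by (auto simp: h_def split: if_splits)
      with True show ?thesis by blast
    next
      case False
      then obtain U v where U: "U \<in> \<Phi>" "F \<subseteq> U" "v \<in> F" "T = insert m (U - {v})"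
        using T(1) unfolding stellar_def by auto
      then have "{v. h t v \<noteq> 0} \<subseteq> U" using T by (auto simp: h_def split: if_splits)
      with U show ?thesis by blast
    qed
    moreover have "sum (h t) V = 1"
    proof -
      have "h t v = t v + (if v \<in> F then t m / k else 0) + (if v = m then - t m else 0)" for v
        using m by (simp add: h_def)
      then have "sum (h t) V = sum t V + k * (t m / k) + (- t m)"
        using finV subV by (simp add: sum.distrib sumF)
      then show ?thesis using s k by simp
    qed
    ultimately show ?thesis using 1 unfolding Y by auto
  qed
  have gY: "g t \<in> X" if t: "t \<in> Y" for t
  proof -
    from t[unfolded Y] obtain T where T: "T \<in> \<Phi>" "{v. t v \<noteq> 0} \<subseteq> T"
      and nn: "\<And>v. 0 \<le> t v" and s: "sum t V = 1" by auto
    have tm: "t m = 0" using T m by auto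
    have \<mu>: "\<mu> t \<ge> 0" "\<And>v. v \<in> F \<Longrightarrow> \<mu> t \<le> t v" using F nn by (auto simp: \<mu>_def)
    have "\<mu> t \<in> t ` F" unfolding \<mu>_def by (rule Min_in) (use F in simp_all)
    then obtain v where v': "\<mu> t = t v" "v \<in> F" by (rule imageE)
    then have v: "v \<in> F" "t v = \<mu> t" by simp_all
    have 1: "0 \<le> g t v" for v using nn k \<mu> by (simp add: g_def)
    have "\<exists>T\<in>stellar \<Phi> F m. {v. g t v \<noteq> 0} \<subseteq> T"
    proof (cases "F \<subseteq> T")
      case True
      then have "insert m (T - {v}) \<in> stellar \<Phi> F m" using T v unfolding stellar_def by auto
      moreover have "{v. g t v \<noteq> 0} \<subseteq> insert m (T - {v})"
        using T v True by (auto simp: g_def split: if_splits)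
      ultimately show ?thesis by blast
    next
      case False
      then obtain u where "u \<in> F" "t u = 0" using T by auto
      then have "\<mu> t = 0" using \<mu>(1) \<mu>(2)[of u] by simp
      then have "{v. g t v \<noteq> 0} \<subseteq> T" using T tm by (auto simp: g_def split: if_splits)
      moreover have "T \<in> stellar \<Phi> F m" using False T by (auto simp: stellar_def)
      ultimately show ?thesis by blast
    qed
    moreover have "sum (g t) V = 1"
    proof -
      have "g t v = t v + (if v \<in> F then - \<mu> t else 0) + (if v = m then k * \<mu> t else 0)" for v
        using m tm by (simp add: g_def)
      then have "sum (g t) V = (\<Sum>v\<in>V. t v + (if v \<in> F then - \<mu> t else 0) + (if v = m then k * \<mu> t else 0))"
        by (intro sum.cong) simp_all
      also have "\<dots> = sum t V + k * (- \<mu> t) + k * \<mu> t"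
        unfolding sum.distrib sumF using finV subV by simp
      finally have "sum (g t) V = sum t V + k * (- \<mu> t) + k * \<mu> t" .
      then show ?thesis using s by simp
    qed
    ultimately show ?thesis using 1 unfolding X by auto
  qed
  have gh: "g (h t) = t" if t: "t \<in> X" for t
  proof -
    obtain v where v: "v \<in> F" "t v = 0" using Xm[OF t] by auto
    have nn: "\<And>v. 0 \<le> t v" using t unfolding X by auto
    have "\<mu> (h t) = t m / k"
      unfolding \<mu>_def
    proof (rule Min_eqI)
      show "t m / k \<in> h t ` F" using v m by (intro image_eqI[of _ _ v]) (auto simp: h_def)
    qed (use F m nn in \<open>auto simp: h_def\<close>)
    then show ?thesis using k by (auto simp: g_def h_def)
  qed
  have hg: "h (g t) = t" if t: "t \<in> Y" for t
  proof -
    have "t m = 0" using t m unfolding Y by auto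
    then show ?thesis using k m by (auto simp: g_def h_def)
  qed
  have "homeomorphic_maps (top_of_set X) (top_of_set Y) h g"
    unfolding homeomorphic_maps_def
    using conth contg hX gY gh hg by auto
  then show ?thesis unfolding X_def Y_def homeomorphic_space_def by blast
qed

lemma stellar_common:
  fixes \<Phi> :: "'v set set"
  assumes fin: "finite (\<Union>\<Phi>)" "finite (\<Union>\<Phi>')" and F: "finite F" "F \<noteq> {}" "finite F'" "F' \<noteq> {}"
   and m: "m \<notin> \<Union>\<Phi> \<union> F" "m \<notin> \<Union>\<Phi>' \<union> F'" "stellar \<Phi> F m = stellar \<Phi>' F' m"
  shows "top_of_set (underlying_space (faces_of \<Phi>)) homeomorphic_space
    top_of_set (underlying_space (faces_of \<Phi>'))"
proof -
  have "top_of_set (underlying_space (faces_of (stellar \<Phi> F m))) homeomorphic_space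
      top_of_set (underlying_space (faces_of \<Phi>))"
    by (rule stellar_homeomorphic[OF fin(1) F(1,2)]) (use m in auto)
  moreover have "top_of_set (underlying_space (faces_of (stellar \<Phi>' F' m))) homeomorphic_space
      top_of_set (underlying_space (faces_of \<Phi>'))"
    by (rule stellar_homeomorphic[OF fin(2) F(3,4)]) (use m in auto)
  ultimately show ?thesis
    unfolding m(3) using homeomorphic_space_sym homeomorphic_space_trans by blast
qed

text \<open>Subdividing either diagonal of the quadrilateral at the same new point \<open>m\<close>
  gives the same four triangles, so both complexes share a subdivision. Infinitely many labels
  supply a fresh \<open>m\<close>; since \<open>cd\<close> lies in no old triangle, subdividing it
  affects only the two new ones.\<close>

proposition flip_homeomorphic:
  fixes \<Phi> :: "'v set set"
  assumes inf: "infinite (UNIV :: 'v set)" and fin: "finite (\<Union>\<Phi>)"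
    and d: "distinct [a,b,c,d]"
    and ab: "{T \<in> \<Phi>. {a,b} \<subseteq> T} = {{a,b,c},{a,b,d}}"
    and cd: "{T \<in> \<Phi>. {c,d} \<subseteq> T} = {}"
  shows "top_of_set (underlying_space (faces_of \<Phi>)) homeomorphic_space
    top_of_set (underlying_space (faces_of (\<Phi> - {{a,b,c},{a,b,d}} \<union> {{a,c,d},{b,c,d}})))"
proof -
  define \<Phi>' where "\<Phi>' = \<Phi> - {{a,b,c},{a,b,d}} \<union> {{a,c,d},{b,c,d}}"
  have in\<Phi>: "{a,b,c} \<in> \<Phi>" "{a,b,d} \<in> \<Phi>" using ab by blast+
  have ab': "T = {a,b,c} \<or> T = {a,b,d}" if "T \<in> \<Phi>" "{a,b} \<subseteq> T" for T using ab that by blast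
  have cd': "\<not> {c,d} \<subseteq> T" if "T \<in> \<Phi>" for T using cd that by blast
  have fin': "finite (\<Union>\<Phi>')" 
    using fin by (intro finite_subset[of "\<Union>\<Phi>'" "{a,b,c,d} \<union> \<Union>\<Phi>"]) (auto simp: \<Phi>'_def)
  have "finite ({a,b,c,d} \<union> \<Union>\<Phi> \<union> \<Union>\<Phi>')" using fin fin' by simp
  from ex_new_if_finite[OF inf this] obtain m where m: "m \<notin> {a,b,c,d} \<union> \<Union>\<Phi> \<union> \<Union>\<Phi>'" ..
  have 1: "stellar \<Phi> {a,b} m = {T\<in>\<Phi>. \<not> {a,b} \<subseteq> T} \<union> {insert m {b,c}, insert m {a,c}, insert m {b,d}, insert m {a,d}}"
    (is "_ = ?R1")
  proof -
    have eq: "{a,b,c} - {a} = {b,c}" "{a,b,c} - {b} = {a,c}" "{a,b,d} - {a} = {b,d}" "{a,b,d} - {b} = {a,d}"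
      using d by auto
    have "{insert m (T - {v}) | T v. T \<in> \<Phi> \<and> {a,b} \<subseteq> T \<and> v \<in> {a,b}} =
      (\<Union>T\<in>{T \<in> \<Phi>. {a,b} \<subseteq> T}. {insert m (T - {a}), insert m (T - {b})})" by blast
    also have "\<dots> = {insert m {b,c}, insert m {a,c}, insert m {b,d}, insert m {a,d}}"
      unfolding ab using eq by simp blast
    finally show ?thesis unfolding stellar_def by simp
  qed
  have 2: "stellar \<Phi>' {c,d} m = {T\<in>\<Phi>. \<not> {a,b} \<subseteq> T} \<union> {insert m {b,c}, insert m {a,c}, insert m {b,d}, insert m {a,d}}"
  proof -
    have eq: "{a,c,d} - {c} = {a,d}" "{a,c,d} - {d} = {a,c}" "{b,c,d} - {c} = {b,d}" "{b,c,d} - {d} = {b,c}"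
      using d by auto
    have cde: "{T \<in> \<Phi>'. {c,d} \<subseteq> T} = {{a,c,d},{b,c,d}}" using cd' unfolding \<Phi>'_def by blast
    moreover have "{insert m (T - {v}) | T v. T \<in> \<Phi>' \<and> {c,d} \<subseteq> T \<and> v \<in> {c,d}} =
      (\<Union>T\<in>{T \<in> \<Phi>'. {c,d} \<subseteq> T}. {insert m (T - {c}), insert m (T - {d})})" by blast
    ultimately have A: "{insert m (T - {v}) | T v. T \<in> \<Phi>' \<and> {c,d} \<subseteq> T \<and> v \<in> {c,d}} =
       {insert m {b,c}, insert m {a,c}, insert m {b,d}, insert m {a,d}}"
       unfolding cde using eq by simp blast
    have "{T \<in> \<Phi>'. \<not> {c,d} \<subseteq> T} = {T\<in>\<Phi>. \<not> {a,b} \<subseteq> T}"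
    proof (intro set_eqI iffI)
      fix T assume "T \<in> {T \<in> \<Phi>'. \<not> {c,d} \<subseteq> T}"
      then have "T \<in> \<Phi>" "T \<noteq> {a,b,c}" "T \<noteq> {a,b,d}" by (auto simp: \<Phi>'_def)
      then show "T \<in> {T\<in>\<Phi>. \<not> {a,b} \<subseteq> T}" using ab' by blast
    next
      fix T assume "T \<in> {T\<in>\<Phi>. \<not> {a,b} \<subseteq> T}"
      then show "T \<in> {T \<in> \<Phi>'. \<not> {c,d} \<subseteq> T}" using cd' by (auto simp: \<Phi>'_def)
    qed
    with A show ?thesis unfolding stellar_def by simp
  qed
  show ?thesis
    unfolding \<Phi>'_def[symmetric]
    by (rule stellar_common[OF fin fin', of "{a,b}" "{c,d}" m]) (use 1 2 m in auto)
qed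

section \<open>Connected sums along a common triangle\<close>

lemma Hausdorff_top_of_set: "Hausdorff_space (top_of_set (S :: ('v \<Rightarrow> 'a::metric_space) set))"
  by (rule Hausdorff_space_subtopology)
    (metis Hausdorff_space_euclidean Hausdorff_space_product_topology euclidean_product_topology)

lemma compact_underlying_space:
  fixes \<Phi> :: "'v set set"
  assumes "finite (\<Union>\<Phi>)"
  shows "compact (underlying_space (faces_of \<Phi>))"
proof -
  have fin\<Phi>: "finite \<Phi>" using assms by (rule finite_UnionD)
  have eq: "underlying_space (faces_of \<Phi>) =
    (\<Inter>v. {t. 0 \<le> t v}) \<inter> (\<Union>T\<in>\<Phi>. \<Inter>v\<in>-T. {t. t v = 0}) \<inter> {t. sum t (\<Union>\<Phi>) = 1}"
    unfolding underlying_space_faces_of[OF assms order_refl] by auto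
  have "closed {t::'v \<Rightarrow> real. 0 \<le> t v}" for v
    by (intro closed_Collect_le continuous_on_coordinate) auto
  moreover have "closed {t::'v \<Rightarrow> real. t v = 0}" for v
    by (intro closed_Collect_eq continuous_on_coordinate) auto
  moreover have "closed {t::'v \<Rightarrow> real. sum t (\<Union>\<Phi>) = 1}"
    by (intro closed_Collect_eq continuous_on_sum continuous_on_coordinate) auto
  ultimately have cl: "closed (underlying_space (faces_of \<Phi>))"
    unfolding eq using fin\<Phi> by (intro closed_Int closed_INT closed_UN) auto
  \<comment> \<open>Coordinates outside the vertex set vanish, so a product of compact intervals
    over all labels contains the space, and Tychonoff's theorem applies.\<close>
  define B where "B = (\<lambda>v. if v \<in> \<Union>\<Phi> then {0..1} else {0::real})"
  have "compactin (product_topology (\<lambda>_::'v. euclidean) UNIV) (PiE UNIV B)"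
    unfolding compactin_PiE by (simp add: B_def)
  then have comp: "compact (PiE UNIV B)"
    by (simp add: euclidean_product_topology flip: compactin_euclidean_iff)
  have "underlying_space (faces_of \<Phi>) \<subseteq> PiE UNIV B"
  proof
    fix t assume "t \<in> underlying_space (faces_of \<Phi>)"
    then obtain T where t: "\<And>v. 0 \<le> t v" "T \<in> \<Phi>" "{v. t v \<noteq> 0} \<subseteq> T" "sum t (\<Union>\<Phi>) = 1"
      unfolding underlying_space_faces_of[OF assms order_refl] by auto
    have "t v \<le> 1" if "v \<in> \<Union>\<Phi>" for v
      using member_le_sum[OF that, of t] t assms by auto
    moreover have "t v = 0" if "v \<notin> \<Union>\<Phi>" for v using that t by auto
    ultimately show "t \<in> PiE UNIV B" using t by (auto simp: B_def)
  qed
  then show ?thesis using comp cl by (metis compact_Int_closed inf.absorb2)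
qed

text \<open>The standard simplex in the plane is a convex body, hence a disc, and \<open>e\<close>
  lifts it to barycentric coordinates. Connected sums remove the image of the open disc, so this
  image must be known exactly: invariance of domain identifies it with the open triangle.\<close>

lemma disc_to_simplex:
  fixes a b c :: 'v
  assumes d: "distinct [a,b,c]"
  obtains f :: "real^2 \<Rightarrow> 'v \<Rightarrow> real" where
    "continuous_on (cball 0 1) f" "inj_on f (cball 0 1)"
    "f ` cball 0 1 = {t. (\<forall>v. 0 \<le> t v) \<and> {v. t v \<noteq> 0} \<subseteq> {a,b,c} \<and> sum t {a,b,c} = 1}"
    "f ` ball 0 1 = {t. (\<forall>v. 0 \<le> t v) \<and> {v. t v \<noteq> 0} = {a,b,c} \<and> sum t {a,b,c} = 1}"
proof -
  define T :: "(real^2) set" where "T = convex hull (insert 0 Basis)"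
  have B2: "(\<forall>i\<in>(Basis::(real^2) set). P i) \<longleftrightarrow> P (axis 1 1) \<and> P (axis 2 1)" for P
    by (auto simp: Basis_vec_def exhaust_2 forall_2)
  have S2: "sum ((\<bullet>) x) Basis = x$1 + x$2" for x :: "real^2"
  proof -
    have eq: "(Basis::(real^2) set) = {axis 1 1, axis 2 1}" 
      by (auto simp: Basis_vec_def) (metis (full_types) exhaust_2)
    show ?thesis unfolding eq by (simp add: inner_axis axis_eq_axis)
  qed
  have T: "T = {x. 0 \<le> x$1 \<and> 0 \<le> x$2 \<and> x$1 + x$2 \<le> 1}"
    unfolding T_def std_simplex by (auto simp: B2 S2 inner_axis)
  have iT: "interior T = {x. 0 < x$1 \<and> 0 < x$2 \<and> x$1 + x$2 < 1}"
    unfolding T_def interior_std_simplex by (auto simp: B2 S2 inner_axis)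
  have "vector [1/3,1/3] \<in> interior T" unfolding iT by simp
  then have ne: "interior T \<noteq> {}" by blast
  have "convex T" "compact T" unfolding T_def by (auto simp: finite_imp_compact_convex_hull)
  then have "T homeomorphic cball (0::real^2) 1"
    by (intro homeomorphic_convex_compact_cball ne) auto
  then obtain h h' where hom: "homeomorphism (cball (0::real^2) 1) T h h'"
    by (meson homeomorphic_def homeomorphic_sym)
  have hball: "h ` ball 0 1 = interior T"
  proof
    have "open (h ` ball 0 1)"
      using hom by (intro invariance_of_domain)
        (auto simp: homeomorphism_def intro: continuous_on_subset inj_on_inverseI[of _ h'])
    then show "h ` ball 0 1 \<subseteq> interior T"
      using hom by (intro interior_maximal) (auto simp: homeomorphism_def)
    have "open (h' ` interior T)"
      using hom interior_subset[of T] by (intro invariance_of_domain)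
        (auto simp: homeomorphism_def intro: continuous_on_subset intro!: inj_on_inverseI[of _ h])
    then have "h' ` interior T \<subseteq> interior (cball 0 1)"
      using hom interior_subset[of T] by (intro interior_maximal) (auto simp: homeomorphism_def)
    then have "h ` h' ` interior T \<subseteq> h ` ball 0 1" by auto
    moreover have "h ` h' ` interior T = interior T"
      using hom interior_subset[of T] by (force simp: homeomorphism_def image_image)
    ultimately show "interior T \<subseteq> h ` ball 0 1" by simp
  qed
  define e :: "real^2 \<Rightarrow> 'v \<Rightarrow> real" where
    "e x = (\<lambda>v. if v = a then x$1 else if v = b then x$2 else if v = c then 1 - x$1 - x$2 else 0)" for x
  define s :: "('v \<Rightarrow> real) \<Rightarrow> real^2" where "s t = vector [t a, t b]" for t
  have se: "s (e x) = x" for x using d by (auto simp: s_def e_def vec_eq_iff forall_2)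
  have es: "e (s t) = t" if "{v. t v \<noteq> 0} \<subseteq> {a,b,c}" "sum t {a,b,c} = 1" for t
    using that d by (auto simp: s_def e_def fun_eq_iff)
  have eT: "e ` T = {t. (\<forall>v. 0 \<le> t v) \<and> {v. t v \<noteq> 0} \<subseteq> {a,b,c} \<and> sum t {a,b,c} = 1}" (is "_ = ?R")
  proof
    show "e ` T \<subseteq> ?R" using d by (auto simp: e_def T split: if_splits)
    show "?R \<subseteq> e ` T"
    proof
      fix t assume t: "t \<in> ?R"
      then have "s t \<in> T" using d by (auto simp: s_def T) (metis add.assoc le_add_same_cancel1)
      moreover have "e (s t) = t" using t by (intro es) auto
      ultimately show "t \<in> e ` T" by (metis imageI)
    qed
  qed
  have eiT: "e ` interior T = {t. (\<forall>v. 0 \<le> t v) \<and> {v. t v \<noteq> 0} = {a,b,c} \<and> sum t {a,b,c} = 1}" (is "_ = ?R")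
  proof
    show "e ` interior T \<subseteq> ?R" using d by (auto simp: e_def iT split: if_splits)
    show "?R \<subseteq> e ` interior T"
    proof
      fix t assume t: "t \<in> ?R"
      then have "t a > 0" "t b > 0" "t c > 0" "t a + t b + t c = 1"
        using d by (auto simp: less_le)
      then have "s t \<in> interior T" by (auto simp: s_def iT)
      moreover have "e (s t) = t" using t by (intro es) auto
      ultimately show "t \<in> e ` interior T" by (metis imageI)
    qed
  qed
  have "continuous_on UNIV e"
  proof (unfold e_def, rule continuous_on_coordinatewise_then_product)
    fix v show "continuous_on UNIV (\<lambda>x::real^2. if v = a then x$1 else if v = b then x$2 else if v = c then 1 - x$1 - x$2 else 0)"
      by (cases "v = a"; cases "v = b"; cases "v = c") (auto intro!: continuous_intros)
  qed
  then have "continuous_on (cball 0 1) (e \<circ> h)"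
    using hom by (intro continuous_on_compose) (auto simp: homeomorphism_def intro: continuous_on_subset)
  moreover have "inj_on (e \<circ> h) (cball 0 1)"
    using hom by (intro inj_on_inverseI[of _ "h' \<circ> s"]) (simp add: se homeomorphism_def)
  moreover have "(e \<circ> h) ` cball 0 1 = e ` T" using hom by (auto simp: homeomorphism_def image_comp[symmetric])
  moreover have "(e \<circ> h) ` ball 0 1 = e ` interior T" using hball by (metis image_comp)
  ultimately show ?thesis using that[of "e \<circ> h"] eT eiT by simp
qed

text \<open>Every edge of \<open>F\<close> lies in another facet, so deleting the facet loses just
  the points with support exactly \<open>F\<close>; equal cardinalities prevent \<open>F\<close>
  from being contained in another facet.\<close>

lemma underlying_space_remove_facet:
  fixes \<Phi> :: "'v set set"
  assumes fin: "finite (\<Union>\<Phi>)" and c3: "\<And>T. T \<in> \<Phi> \<Longrightarrow> card T = card F" and F: "F \<in> \<Phi>"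
    and bd: "\<And>v. v \<in> F \<Longrightarrow> \<exists>T\<in>\<Phi> - {F}. F - {v} \<subseteq> T"
  shows "underlying_space (faces_of (\<Phi> - {F})) = underlying_space (faces_of \<Phi>) - {t. {v. t v \<noteq> 0} = F}"
proof -
  have *: "underlying_space (faces_of (\<Phi> - {F})) =
    {t. (\<forall>v. 0 \<le> t v) \<and> (\<exists>T\<in>\<Phi> - {F}. {v. t v \<noteq> 0} \<subseteq> T) \<and> sum t (\<Union>\<Phi>) = 1}"
    by (rule underlying_space_faces_of) (use fin in auto)
  have "(\<exists>T\<in>\<Phi> - {F}. G \<subseteq> T) \<longleftrightarrow> (\<exists>T\<in>\<Phi>. G \<subseteq> T) \<and> G \<noteq> F" for G
  proof
    assume "\<exists>T\<in>\<Phi> - {F}. G \<subseteq> T"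
    then obtain T where T: "T \<in> \<Phi>" "T \<noteq> F" "G \<subseteq> T" by auto
    have "finite T" using T fin by (meson Union_upper finite_subset)
    then show "(\<exists>T\<in>\<Phi>. G \<subseteq> T) \<and> G \<noteq> F" using T c3[of T] card_subset_eq by metis
  next
    assume *: "(\<exists>T\<in>\<Phi>. G \<subseteq> T) \<and> G \<noteq> F"
    then obtain T where T: "T \<in> \<Phi>" "G \<subseteq> T" by auto
    show "\<exists>T\<in>\<Phi> - {F}. G \<subseteq> T"
    proof (cases "T = F")
      case True
      then obtain v where "v \<in> F" "G \<subseteq> F - {v}" using T * by blast
      then obtain U where "U \<in> \<Phi> - {F}" "F - {v} \<subseteq> U" using bd[OF \<open>v \<in> F\<close>] by blast
      then show ?thesis using \<open>G \<subseteq> F - {v}\<close> by (intro bexI[of _ U]) auto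
    qed (use T in blast)
  qed
  then show ?thesis
    unfolding * underlying_space_faces_of[OF fin order_refl] by auto
qed

text \<open>Both summands contain the same triangle, so one disc \<open>f\<close> serves for both
  and the prescribed gluing identifies equal points. The quotient map is then \<open>snd\<close>,
  which forgets the tag.\<close>

proposition connected_sum_along_triangle:
  fixes \<Phi>1 \<Phi>2 :: "'v set set"
  assumes fin: "finite (\<Union>\<Phi>1)" "finite (\<Union>\<Phi>2)"
    and c3: "\<And>T. T \<in> \<Phi>1 \<Longrightarrow> card T = 3" "\<And>T. T \<in> \<Phi>2 \<Longrightarrow> card T = 3"
    and F: "F \<in> \<Phi>1" "F \<in> \<Phi>2" and int: "\<Union>\<Phi>1 \<inter> \<Union>\<Phi>2 = F"
    and bd: "\<And>v. v \<in> F \<Longrightarrow> \<exists>T\<in>\<Phi>1 - {F}. F - {v} \<subseteq> T" "\<And>v. v \<in> F \<Longrightarrow> \<exists>T\<in>\<Phi>2 - {F}. F - {v} \<subseteq> T"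
  shows "connected_sum (top_of_set (underlying_space (faces_of \<Phi>1)))
     (top_of_set (underlying_space (faces_of \<Phi>2)))
     (top_of_set (underlying_space (faces_of (\<Phi>1 \<union> \<Phi>2 - {F}))))"
proof -
  obtain a b c where abc: "F = {a,b,c}" "distinct [a,b,c]"
    using c3(1)[OF F(1)] by (auto simp: card_3_iff)
  obtain f :: "real^2 \<Rightarrow> 'v \<Rightarrow> real" where f: "continuous_on (cball 0 1) f" "inj_on f (cball 0 1)"
    and fc: "f ` cball 0 1 = {t. (\<forall>v. 0 \<le> t v) \<and> {v. t v \<noteq> 0} \<subseteq> {a,b,c} \<and> sum t {a,b,c} = 1}"
    and fb: "f ` ball 0 1 = {t. (\<forall>v. 0 \<le> t v) \<and> {v. t v \<noteq> 0} = {a,b,c} \<and> sum t {a,b,c} = 1}"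
    by (rule disc_to_simplex[OF abc(2)])
  define X where "X \<Phi> = underlying_space (faces_of \<Phi>)" for \<Phi> :: "'v set set"
  have Xeq: "X \<Phi> = {t. (\<forall>v. 0 \<le> t v) \<and> (\<exists>T\<in>\<Phi>. {v. t v \<noteq> 0} \<subseteq> T) \<and> sum t (\<Union>\<Phi>) = 1}"
    if "finite (\<Union>\<Phi>)" for \<Phi>
    unfolding X_def using underlying_space_faces_of[OF that order_refl] .
  have sumF: "sum t V = sum t F" if "{v. t v \<noteq> 0} \<subseteq> F" "F \<subseteq> V" "finite V" for t :: "'v \<Rightarrow> real" and V
    by (rule sum.mono_neutral_right) (use that in auto)
  have sub: "f ` cball 0 1 \<subseteq> X \<Phi>" and ball: "f ` ball 0 1 = X \<Phi> \<inter> {t. {v. t v \<noteq> 0} = F}"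
    if "finite (\<Union>\<Phi>)" "F \<in> \<Phi>" for \<Phi>
  proof -
    have FU: "F \<subseteq> \<Union>\<Phi>" using that by auto
    show "f ` cball 0 1 \<subseteq> X \<Phi>"
      unfolding fc abc(1)[symmetric] Xeq[OF that(1)] using that sumF[OF _ FU that(1)] by auto
    show "f ` ball 0 1 = X \<Phi> \<inter> {t. {v. t v \<noteq> 0} = F}"
      unfolding fb abc(1)[symmetric] Xeq[OF that(1)] using that sumF[OF _ FU that(1)] by auto
  qed
  have emb: "embedding_map (top_of_set (cball (0 :: real ^ 2) 1)) (top_of_set (X \<Phi>)) f"
    if "finite (\<Union>\<Phi>)" "F \<in> \<Phi>" for \<Phi>
    using f sub[OF that]
    by (intro continuous_imp_embedding_map) (auto simp: compact_space_subtopology Hausdorff_top_of_set)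
  have rem: "X \<Phi> - f ` ball 0 1 = X (\<Phi> - {F})"
    if "finite (\<Union>\<Phi>)" "F \<in> \<Phi>" "\<And>T. T \<in> \<Phi> \<Longrightarrow> card T = 3" "\<And>v. v \<in> F \<Longrightarrow> \<exists>T\<in>\<Phi> - {F}. F - {v} \<subseteq> T" for \<Phi>
    using underlying_space_remove_facet[of \<Phi> F] ball[OF that(1,2)] that unfolding X_def by auto
  have rem1: "X \<Phi>1 - f ` ball 0 1 = X (\<Phi>1 - {F})" and rem2: "X \<Phi>2 - f ` ball 0 1 = X (\<Phi>2 - {F})"
    using rem fin F c3 bd by blast+
  define P where "P = punctured_sum (top_of_set (X \<Phi>1)) f (top_of_set (X \<Phi>2)) f"
  have P: "P = sum_topology (\<lambda>b. if b then top_of_set (X (\<Phi>2 - {F})) else top_of_set (X (\<Phi>1 - {F}))) UNIV"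
  proof -
    have "X (\<Phi>1 - {F}) \<subseteq> X \<Phi>1" "X (\<Phi>2 - {F}) \<subseteq> X \<Phi>2" using rem1 rem2 by blast+
    then show ?thesis
      unfolding P_def punctured_sum_def using rem1 rem2
      by (intro arg_cong2[where f = sum_topology] ext) (auto simp: subtopology_subtopology Int_absorb1)
  qed
  have topP: "topspace P = {False} \<times> X (\<Phi>1 - {F}) \<union> {True} \<times> X (\<Phi>2 - {F})"
    unfolding P by (auto split: if_splits)
  define \<Psi> where "\<Psi> = \<Phi>1 \<union> \<Phi>2 - {F}"
  have fin\<Psi>: "finite (\<Union>\<Psi>)" "finite (\<Union>(\<Phi>1 - {F}))" "finite (\<Union>(\<Phi>2 - {F}))"
    using fin by (auto intro: finite_subset[of _ "\<Union>\<Phi>1 \<union> \<Union>\<Phi>2"] simp: \<Psi>_def)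
  have X\<Psi>: "X \<Psi> = X (\<Phi>1 - {F}) \<union> X (\<Phi>2 - {F})"
  proof -
    define V where "V = \<Union>\<Phi>1 \<union> \<Union>\<Phi>2"
    have "finite V" using fin by (simp add: V_def)
    have V: "X \<Phi> = {t. (\<forall>v. 0 \<le> t v) \<and> (\<exists>T\<in>\<Phi>. {v. t v \<noteq> 0} \<subseteq> T) \<and> sum t V = 1}"
      if "\<Union>\<Phi> \<subseteq> V" for \<Phi>
      unfolding X_def using underlying_space_faces_of[OF \<open>finite V\<close> that] .
    have "\<Union>\<Psi> \<subseteq> V" "\<Union>(\<Phi>1 - {F}) \<subseteq> V" "\<Union>(\<Phi>2 - {F}) \<subseteq> V" by (auto simp: V_def \<Psi>_def)
    note VV = this[THEN V]
    show ?thesis unfolding VV unfolding \<Psi>_def by auto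
  qed
  have cont: "continuous_map P (top_of_set (X \<Psi>)) snd"
  proof -
    have "continuous_map P euclidean snd"
      unfolding P continuous_map_def
    proof (intro conjI allI impI)
      fix U :: "('v \<Rightarrow> real) set" assume "openin euclidean U"
      then have "open U" by (simp only: open_openin)
      have "openin (top_of_set S) {x \<in> S. x \<in> U}" for S
      proof -
        have "{x \<in> S. x \<in> U} = S \<inter> U" by auto
        then show ?thesis using openin_open_Int[OF \<open>open U\<close>, of S] by simp
      qed
      then have *: "openin (top_of_set S) {x. x \<in> S \<and> x \<in> U}" for S by simp
      define Q where "Q = (\<lambda>b. if b then top_of_set (X (\<Phi>2 - {F})) else top_of_set (X (\<Phi>1 - {F})))"
      have "openin (sum_topology Q UNIV) {x \<in> topspace (sum_topology Q UNIV). snd x \<in> U}"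
        unfolding openin_sum_topology
      proof (intro conjI ballI)
        fix b
        show "openin (Q b) {x. (b, x) \<in> {x \<in> topspace (sum_topology Q UNIV). snd x \<in> U}}"
          using *[of "X (\<Phi>2 - {F})"] *[of "X (\<Phi>1 - {F})"] by (cases b) (simp_all add: Q_def)
      qed auto
      then show "openin (sum_topology (\<lambda>b. if b then top_of_set (X (\<Phi>2 - {F})) else top_of_set (X (\<Phi>1 - {F}))) UNIV)
          {x \<in> topspace (sum_topology (\<lambda>b. if b then top_of_set (X (\<Phi>2 - {F})) else top_of_set (X (\<Phi>1 - {F}))) UNIV).
            snd x \<in> U}" unfolding Q_def .
    qed auto
    moreover have "snd p \<in> X \<Psi>" if "p \<in> topspace P" for p
      using that unfolding topP X\<Psi> by (elim UnE SigmaE) simp_all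
    ultimately show ?thesis
      by (simp add: continuous_map_in_subtopology image_subset_iff Pi_iff)
  qed
  have compP: "compact_space P"
  proof -
    have "compactin (top_of_set (X (\<Phi>1 - {F}))) (X (\<Phi>1 - {F}))" "compactin (top_of_set (X (\<Phi>2 - {F}))) (X (\<Phi>2 - {F}))"
      using compact_underlying_space[OF fin\<Psi>(2)] compact_underlying_space[OF fin\<Psi>(3)]
      by (auto simp: compactin_subtopology X_def)
    moreover have "continuous_map (top_of_set (X (\<Phi>1 - {F}))) P (\<lambda>x. (False, x))"
      "continuous_map (top_of_set (X (\<Phi>2 - {F}))) P (\<lambda>x. (True, x))"
      unfolding P
      using continuous_map_component_injection[of False UNIV "\<lambda>b. if b then top_of_set (X (\<Phi>2 - {F})) else top_of_set (X (\<Phi>1 - {F}))"]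
        continuous_map_component_injection[of True UNIV "\<lambda>b. if b then top_of_set (X (\<Phi>2 - {F})) else top_of_set (X (\<Phi>1 - {F}))"]
      by simp_all
    ultimately have "compactin P ((\<lambda>x. (False, x)) ` X (\<Phi>1 - {F}) \<union> (\<lambda>x. (True, x)) ` X (\<Phi>2 - {F}))"
      by (intro compactin_Un image_compactin)
    moreover have "(\<lambda>x. (False, x)) ` X (\<Phi>1 - {F}) \<union> (\<lambda>x. (True, x)) ` X (\<Phi>2 - {F}) = topspace P"
      unfolding topP by auto
    ultimately show ?thesis by (simp add: compact_space_def)
  qed
  have quot: "quotient_map P (top_of_set (X \<Psi>)) snd"
    using cont compP by (intro continuous_imp_quotient_map)
     (auto simp: Hausdorff_top_of_set topP X\<Psi> image_Un)
  \<comment> \<open>A point of both summands is supported on common vertices, that is on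
    \<open>F\<close>, and so lies in the disc; being in the punctured parts it lies on the bounding
    circle.\<close>
  have sph: "{t. t \<in> X (\<Phi>1 - {F}) \<and> t \<in> X (\<Phi>2 - {F})} = f ` sphere 0 1"
  proof -
    have "f ` sphere 0 1 = f ` cball 0 1 - f ` ball 0 1"
      using inj_on_image_set_diff[OF f(2), of "cball 0 1" "ball 0 1"] by (simp add: cball_diff_eq_sphere)
    moreover have "X \<Phi>1 \<inter> X \<Phi>2 \<subseteq> f ` cball 0 1"
    proof
      fix t assume "t \<in> X \<Phi>1 \<inter> X \<Phi>2"
      then have t: "\<forall>v. 0 \<le> t v" "{v. t v \<noteq> 0} \<subseteq> \<Union>\<Phi>1" "{v. t v \<noteq> 0} \<subseteq> \<Union>\<Phi>2" "sum t (\<Union>\<Phi>1) = 1"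
        using Xeq fin by auto
      then have "{v. t v \<noteq> 0} \<subseteq> F" using t(2,3) int by (metis Int_subset_iff)
      moreover from this have "sum t F = 1" using sumF[of t "\<Union>\<Phi>1"] F fin t by auto
      ultimately show "t \<in> f ` cball 0 1" using t unfolding fc abc by auto
    qed
    moreover have "{t. t \<in> X1 - B \<and> t \<in> X2 - B} = A - B" if "A \<subseteq> X1" "A \<subseteq> X2" "X1 \<inter> X2 \<subseteq> A"
      for X1 X2 A B :: "('v \<Rightarrow> real) set" using that by blast
    ultimately show ?thesis
      using sub[OF fin(1) F(1)] sub[OF fin(2) F(2)] unfolding rem1[symmetric] rem2[symmetric] by simp
  qed
  have "snd p = snd p' \<longleftrightarrow> p = p' \<or> (\<exists>s \<in> sphere 0 1. {p, p'} = {(False, f s), (True, f s)})"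
    if p: "p \<in> topspace P" "p' \<in> topspace P" for p p'
  proof
    assume e: "snd p = snd p'"
    show "p = p' \<or> (\<exists>s \<in> sphere 0 1. {p, p'} = {(False, f s), (True, f s)})"
    proof (cases "fst p = fst p'")
      case True then show ?thesis using e by (simp add: prod_eq_iff)
    next
      case False
      obtain i x j y where pp: "p = (i,x)" "p' = (j,y)" by (metis surj_pair)
      then have ij: "x = y" "j = (\<not> i)" using e False by auto
      then have "{p,p'} = {(False, x), (True, x)}" using pp by (cases i) auto
      moreover have "x \<in> f ` sphere 0 1"
        unfolding sph[symmetric] using p topP pp ij by (cases i) auto
      ultimately show ?thesis by auto
    qed
  qed (auto simp: doubleton_eq_iff)
  then show ?thesis unfolding connected_sum_def
    using emb[OF fin(1) F(1)] emb[OF fin(2) F(2)] quot unfolding P_def X_def \<Psi>_def by blast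
qed

section \<open>Invariance of the surfaces under homeomorphism\<close>

lemma projective_plane_homeomorphic:
  assumes "projective_plane X" "X homeomorphic_space Y"
  shows "projective_plane Y"
proof -
  obtain q where q: "quotient_map (top_of_set (sphere (0 :: real ^ 3) 1)) X q"
    "\<And>x y. x \<in> sphere 0 1 \<Longrightarrow> y \<in> sphere 0 1 \<Longrightarrow> q x = q y \<longleftrightarrow> y = x \<or> y = - x"
    using assms(1) unfolding projective_plane_def by blast
  obtain h where h: "homeomorphic_map X Y h" using assms(2) homeomorphic_space by blast
  have inj: "inj_on h (topspace X)" using h by (simp add: homeomorphic_map_def)
  have "q x \<in> topspace X" if "x \<in> sphere 0 1" for x
    using quotient_imp_surjective_map[OF q(1)] that by auto
  then have "(h \<circ> q) x = (h \<circ> q) y \<longleftrightarrow> y = x \<or> y = - x" if "x \<in> sphere 0 1" "y \<in> sphere 0 1" for x y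
    using q(2)[OF that] that inj_onD[OF inj] by (metis comp_apply)
  moreover have "quotient_map (top_of_set (sphere (0 :: real ^ 3) 1)) Y (h \<circ> q)"
    using q(1) h by (meson homeomorphic_map_def quotient_map_compose)
  ultimately show ?thesis unfolding projective_plane_def by blast
qed

lemma connected_sum_homeomorphic:
  assumes "connected_sum X Y Z" "Z homeomorphic_space Z'"
  shows "connected_sum X Y Z'"
proof -
  obtain f g q where fg: "embedding_map (top_of_set (cball (0 :: real ^ 2) 1)) X f"
      "embedding_map (top_of_set (cball (0 :: real ^ 2) 1)) Y g"
     and q: "quotient_map (punctured_sum X f Y g) Z q"
      "\<forall>p \<in> topspace (punctured_sum X f Y g). \<forall>p' \<in> topspace (punctured_sum X f Y g).
         q p = q p' \<longleftrightarrow> p = p' \<or> (\<exists>s \<in> sphere 0 1. {p, p'} = {(False, f s), (True, g s)})"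
    using assms(1) unfolding connected_sum_def by (elim exE conjE) (rule that)
  obtain h where h: "homeomorphic_map Z Z' h" using assms(2) homeomorphic_space by blast
  have inj: "inj_on h (topspace Z)" using h by (simp add: homeomorphic_map_def)
  have "q x \<in> topspace Z" if "x \<in> topspace (punctured_sum X f Y g)" for x
    using quotient_imp_surjective_map[OF q(1)] that by auto
  then have "(h \<circ> q) p = (h \<circ> q) p' \<longleftrightarrow> p = p' \<or> (\<exists>s \<in> sphere 0 1. {p, p'} = {(False, f s), (True, g s)})"
    if "p \<in> topspace (punctured_sum X f Y g)" "p' \<in> topspace (punctured_sum X f Y g)" for p p'
    using q(2)[rule_format, OF that] that inj_onD[OF inj] by (metis comp_apply)
  moreover have "quotient_map (punctured_sum X f Y g) Z' (h \<circ> q)"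
    using q(1) h by (meson homeomorphic_map_def quotient_map_compose)
  ultimately show ?thesis unfolding connected_sum_def using fg by blast
qed

text \<open>Only the final space has to be transported, so a case distinction on the last
  construction step is enough.\<close>

lemma nonorientable_surface_homeomorphic:
  assumes "nonorientable_surface h X" "X homeomorphic_space Y"
  shows "nonorientable_surface h Y"
  using assms(1)
proof cases
  case base
  then show ?thesis
    using nonorientable_surface.base projective_plane_homeomorphic assms(2) by blast
next
  case (step h X Y)
  then show ?thesis
    using nonorientable_surface.step connected_sum_homeomorphic assms(2) by blast
qed

section \<open>A nine-vertex projective plane\<close>

text \<open>The four faces of the octahedron up to antipodes, each cut at its edge midpoints into
  three corners and a middle triangle, listed in this order. Some subdivision is necessary:
  otherwise all four faces would have the vertex set \<open>{7, 8, 9}\<close>.\<close>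

definition RP2_9 :: "nat set set" where
  "RP2_9 = {{1,3,7}, {1,5,8}, {3,5,9}, {1,3,5}, {1,4,7}, {1,6,8}, {4,6,9}, {1,4,6}, {2,3,7}, {2,6,8}, {3,6,9}, {2,3,6}, {2,4,7}, {2,5,8}, {4,5,9}, {2,4,5}}"

text \<open>A coordinate vector on all naturals with default value 0, so that supports and
  equalities reduce to nine entries.\<close>

definition nine :: "'a::zero \<Rightarrow> 'a \<Rightarrow> 'a \<Rightarrow> 'a \<Rightarrow> 'a \<Rightarrow> 'a \<Rightarrow> 'a \<Rightarrow> 'a \<Rightarrow> 'a \<Rightarrow> nat \<Rightarrow> 'a" where
  "nine a b c d e f g h i v =
    (if v = 1 then a else if v = 2 then b else if v = 3 then c else if v = 4 then d else if v = 5 then e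
     else if v = 6 then f else if v = 7 then g else if v = 8 then h else if v = 9 then i else 0)"

text \<open>
  For a point \<open>(x, y, z)\<close> of the octahedron surface \<open>\<bar>x\<bar> + \<bar>y\<bar> + \<bar>z\<bar> = 1\<close> these are the barycentric
  coordinates with respect to the subdivision of the octahedron at its edge midpoints, taken modulo the
  antipodal map: 7, 8, 9 are the octahedron vertices, and 1, 3, 5 (2, 4, 6) are the midpoints of the edges
  in the coordinate planes 12, 13, 23 on which the two coordinates have equal (opposite) signs.
\<close>

definition octa_coords :: "real \<Rightarrow> real \<Rightarrow> real \<Rightarrow> nat \<Rightarrow> real" where
  "octa_coords x y z = nine
    (max 0 (min (\<bar>x + y\<bar> - \<bar>x - y\<bar>) (1 - 2 * \<bar>z\<bar>))) (max 0 (min (\<bar>x - y\<bar> - \<bar>x + y\<bar>) (1 - 2 * \<bar>z\<bar>)))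
    (max 0 (min (\<bar>x + z\<bar> - \<bar>x - z\<bar>) (1 - 2 * \<bar>y\<bar>))) (max 0 (min (\<bar>x - z\<bar> - \<bar>x + z\<bar>) (1 - 2 * \<bar>y\<bar>)))
    (max 0 (min (\<bar>y + z\<bar> - \<bar>y - z\<bar>) (1 - 2 * \<bar>x\<bar>))) (max 0 (min (\<bar>y - z\<bar> - \<bar>y + z\<bar>) (1 - 2 * \<bar>x\<bar>)))
    (max 0 (2 * \<bar>x\<bar> - 1)) (max 0 (2 * \<bar>y\<bar> - 1)) (max 0 (2 * \<bar>z\<bar> - 1))"

lemma interval_1_9: "{1..9::nat} = {1,2,3,4,5,6,7,8,9}"
  by auto

lemma nine_simps [simp]:
  "nine a b c d e f g h i 1 = a" "nine a b c d e f g h i (Suc 0) = a" "nine a b c d e f g h i 2 = b"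
  "nine a b c d e f g h i 3 = c" "nine a b c d e f g h i 4 = d" "nine a b c d e f g h i 5 = e"
  "nine a b c d e f g h i 6 = f" "nine a b c d e f g h i 7 = g" "nine a b c d e f g h i 8 = h"
  "nine a b c d e f g h i 9 = i"
  by (simp_all add: nine_def)

lemma continuous_on_nine:
  fixes a :: "'a::topological_space \<Rightarrow> real"
  assumes "continuous_on S a" "continuous_on S b" "continuous_on S c" "continuous_on S d" "continuous_on S e"
    "continuous_on S f" "continuous_on S g" "continuous_on S h" "continuous_on S i"
  shows "continuous_on S (\<lambda>x. nine (a x) (b x) (c x) (d x) (e x) (f x) (g x) (h x) (i x) v)"
proof (cases "v \<in> {1,2,3,4,5,6,7,8,9}")
  case True
  then show ?thesis by (elim insertE) (simp_all add: assms)
qed (simp add: nine_def)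

lemma nine_nonneg:
  fixes a b c d e f g h i :: real
  assumes "0 \<le> a" "0 \<le> b" "0 \<le> c" "0 \<le> d" "0 \<le> e" "0 \<le> f" "0 \<le> g" "0 \<le> h" "0 \<le> i"
  shows "0 \<le> nine a b c d e f g h i v"
  using assms by (simp add: nine_def)

lemma sum_nine: "sum (nine a b c d e f g h i) {1..9} = a + b + c + d + e + f + g + h + (i :: real)"
  unfolding interval_1_9 by (simp add: nine_def)

lemma nine_support:
  assumes "1 \<notin> T \<Longrightarrow> a = 0" "2 \<notin> T \<Longrightarrow> b = 0" "3 \<notin> T \<Longrightarrow> c = 0" "4 \<notin> T \<Longrightarrow> d = 0"
      "5 \<notin> T \<Longrightarrow> e = 0" "6 \<notin> T \<Longrightarrow> f = 0" "7 \<notin> T \<Longrightarrow> g = 0" "8 \<notin> T \<Longrightarrow> h = 0" "9 \<notin> T \<Longrightarrow> i = 0"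
  shows "{v. nine a b c d e f g h i v \<noteq> 0} \<subseteq> T"
proof
  fix v assume "v \<in> {v. nine a b c d e f g h i v \<noteq> 0}"
  then show "v \<in> T" using assms unfolding nine_def mem_Collect_eq
    by (cases "v \<in> T") (auto split: if_splits)
qed

lemma nine_collapse:
  assumes "\<And>v. v \<notin> {1..9} \<Longrightarrow> t v = 0"
  shows "t = nine (t 1) (t 2) (t 3) (t 4) (t 5) (t 6) (t 7) (t 8) (t 9)"
proof
  fix v show "t v = nine (t 1) (t 2) (t 3) (t 4) (t 5) (t 6) (t 7) (t 8) (t 9) v"
    using assms[of v] unfolding interval_1_9 nine_def by simp
qed

text \<open>On the face \<open>x + y + z = 1\<close> of the positive octant, the weight of the
  midpoint of the edge \<open>xy\<close> is \<open>2 * y\<close> in the corner at \<open>x\<close>,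
  \<open>2 * x\<close> in the corner at \<open>y\<close>, \<open>1 - 2 * z\<close> in the middle
  triangle and 0 in the corner at \<open>z\<close>. One expression covers the four pieces.\<close>

definition midpoint_coord :: "real \<Rightarrow> real \<Rightarrow> real \<Rightarrow> real" where
  "midpoint_coord x y z = max 0 (min (2 * min x y) (1 - 2 * z))"

definition vertex_coord :: "real \<Rightarrow> real" where
  "vertex_coord x = max 0 (2 * x - 1)"

lemma continuous_on_octa_coords:
  assumes "continuous_on S f" "continuous_on S g" "continuous_on S h"
  shows "continuous_on S (\<lambda>x. octa_coords (f x) (g x) (h x) v)"
  unfolding octa_coords_def by (rule continuous_on_nine; intro continuous_intros assms)

text \<open>The difference of the absolute values of \<open>x + y\<close> and \<open>x - y\<close>
  is twice the smaller absolute value for equal signs, and the negative of that for opposite signs.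
  So in each octant one midpoint of each of the pairs 1/2, 3/4 and 5/6 drops out.\<close>

lemma octa_coords_signs:
  assumes "0 \<le> X" "0 \<le> Y" "0 \<le> Z"
  shows "octa_coords X Y Z = nine (midpoint_coord X Y Z) 0 (midpoint_coord X Z Y) 0 (midpoint_coord Y Z X) 0 (vertex_coord X) (vertex_coord Y) (vertex_coord Z)"
    "octa_coords X Y (-Z) = nine (midpoint_coord X Y Z) 0 0 (midpoint_coord X Z Y) 0 (midpoint_coord Y Z X) (vertex_coord X) (vertex_coord Y) (vertex_coord Z)"
    "octa_coords X (-Y) Z = nine 0 (midpoint_coord X Y Z) (midpoint_coord X Z Y) 0 0 (midpoint_coord Y Z X) (vertex_coord X) (vertex_coord Y) (vertex_coord Z)"
    "octa_coords (-X) Y Z = nine 0 (midpoint_coord X Y Z) 0 (midpoint_coord X Z Y) (midpoint_coord Y Z X) 0 (vertex_coord X) (vertex_coord Y) (vertex_coord Z)"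
proof -
  have 1: "\<bar>x + y\<bar> - \<bar>x - y\<bar> = 2 * min x y" "\<bar>x - y\<bar> - \<bar>x + y\<bar> = - 2 * min x y"
      "\<bar>- x + y\<bar> - \<bar>- x - y\<bar> = - 2 * min x y" "\<bar>- x - y\<bar> - \<bar>- x + y\<bar> = 2 * min x y"
    if "0 \<le> x" "0 \<le> y" for x y :: real
    using that by (auto simp: min_def abs_if)
  have 3: "2 * min x y = x + y - \<bar>x - y\<bar>" for x y :: real
    by (auto simp: min_def abs_if)
  have 2: "max 0 (min (- 2 * min x y) c) = 0" if "0 \<le> x" "0 \<le> y" for x y c :: real
    using that by (auto simp: max_def min_def)
  note [simp] = 1[OF assms(1,2)] 1[OF assms(1,3)] 1[OF assms(2,3)] 2[OF assms(1,2)] 2[OF assms(1,3)] 2[OF assms(2,3)]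
  show "octa_coords X Y Z = nine (midpoint_coord X Y Z) 0 (midpoint_coord X Z Y) 0 (midpoint_coord Y Z X) 0 (vertex_coord X) (vertex_coord Y) (vertex_coord Z)"
    "octa_coords X Y (-Z) = nine (midpoint_coord X Y Z) 0 0 (midpoint_coord X Z Y) 0 (midpoint_coord Y Z X) (vertex_coord X) (vertex_coord Y) (vertex_coord Z)"
    "octa_coords X (-Y) Z = nine 0 (midpoint_coord X Y Z) (midpoint_coord X Z Y) 0 0 (midpoint_coord Y Z X) (vertex_coord X) (vertex_coord Y) (vertex_coord Z)"
    "octa_coords (-X) Y Z = nine 0 (midpoint_coord X Y Z) 0 (midpoint_coord X Z Y) (midpoint_coord Y Z X) 0 (vertex_coord X) (vertex_coord Y) (vertex_coord Z)"
    using assms unfolding octa_coords_def midpoint_coord_def vertex_coord_def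
    by (simp_all del: mult_minus_left minus_mult_left)
      (simp_all add: 3[of X Y] 3[of X Z] 3[of Y Z] abs_minus_commute[of Z X] abs_minus_commute[of Z Y] abs_minus_commute[of Y X] add.commute)
qed

lemma octa_coords_minus: "octa_coords (- x) (- y) (- z) = octa_coords x y z"
proof -
  have "\<bar>- x - y\<bar> = \<bar>x + y\<bar>" "\<bar>- x + y\<bar> = \<bar>x - y\<bar>" for x y :: real by linarith+
  then show ?thesis unfolding octa_coords_def by simp
qed

text \<open>The antipodal map reduces the eight octants to the four with at most one negative
  sign.\<close>

lemma octa_coords_cases:
  obtains X Y Z where "0 \<le> X" "0 \<le> Y" "0 \<le> Z" "X = \<bar>x\<bar>" "Y = \<bar>y\<bar>" "Z = \<bar>z\<bar>"
    "octa_coords x y z \<in> {octa_coords X Y Z, octa_coords X Y (-Z), octa_coords X (-Y) Z, octa_coords (-X) Y Z}"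
proof
  have "x = \<bar>x\<bar> \<or> x = - \<bar>x\<bar>" "y = \<bar>y\<bar> \<or> y = - \<bar>y\<bar>" "z = \<bar>z\<bar> \<or> z = - \<bar>z\<bar>" by linarith+
  then show "octa_coords x y z \<in> {octa_coords \<bar>x\<bar> \<bar>y\<bar> \<bar>z\<bar>, octa_coords \<bar>x\<bar> \<bar>y\<bar> (-\<bar>z\<bar>),
      octa_coords \<bar>x\<bar> (-\<bar>y\<bar>) \<bar>z\<bar>, octa_coords (-\<bar>x\<bar>) \<bar>y\<bar> \<bar>z\<bar>}"
    using octa_coords_minus[of "\<bar>x\<bar>" "\<bar>y\<bar>" "\<bar>z\<bar>"] octa_coords_minus[of "\<bar>x\<bar>" "\<bar>y\<bar>" "-\<bar>z\<bar>"]
      octa_coords_minus[of "\<bar>x\<bar>" "-\<bar>y\<bar>" "\<bar>z\<bar>"] octa_coords_minus[of "-\<bar>x\<bar>" "\<bar>y\<bar>" "\<bar>z\<bar>"]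
    by (elim disjE) (metis insertCI minus_minus)+
qed auto

text \<open>A midpoint contributes half of its weight to each end of its edge, which recovers the
  point. The last claim lists the weights that vanish in the three corners, where one coordinate is
  at least 1/2, and in the middle triangle.\<close>

lemma midpoint_coords_cases:
  assumes "0 \<le> X" "0 \<le> Y" "0 \<le> Z" "X + Y + Z = 1"
  shows "X = vertex_coord X + (midpoint_coord X Y Z + midpoint_coord X Z Y) / 2"
    "Y = vertex_coord Y + (midpoint_coord X Y Z + midpoint_coord Y Z X) / 2"
    "Z = vertex_coord Z + (midpoint_coord X Z Y + midpoint_coord Y Z X) / 2"
    "vertex_coord Y = 0 \<and> vertex_coord Z = 0 \<and> midpoint_coord Y Z X = 0 \<or>
     vertex_coord X = 0 \<and> vertex_coord Z = 0 \<and> midpoint_coord X Z Y = 0 \<or>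
     vertex_coord X = 0 \<and> vertex_coord Y = 0 \<and> midpoint_coord X Y Z = 0 \<or>
     vertex_coord X = 0 \<and> vertex_coord Y = 0 \<and> vertex_coord Z = 0"
proof -
  have Z: "Z = 1 - X - Y" using assms by simp
  show "X = vertex_coord X + (midpoint_coord X Y Z + midpoint_coord X Z Y) / 2"
    "Y = vertex_coord Y + (midpoint_coord X Y Z + midpoint_coord Y Z X) / 2"
    "Z = vertex_coord Z + (midpoint_coord X Z Y + midpoint_coord Y Z X) / 2"
    using assms unfolding midpoint_coord_def vertex_coord_def max_def min_def Z by (auto simp: field_simps)
  show "vertex_coord Y = 0 \<and> vertex_coord Z = 0 \<and> midpoint_coord Y Z X = 0 \<or>
     vertex_coord X = 0 \<and> vertex_coord Z = 0 \<and> midpoint_coord X Z Y = 0 \<or>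
     vertex_coord X = 0 \<and> vertex_coord Y = 0 \<and> midpoint_coord X Y Z = 0 \<or>
     vertex_coord X = 0 \<and> vertex_coord Y = 0 \<and> vertex_coord Z = 0"
  proof -
    consider "X \<ge> 1/2" | "Y \<ge> 1/2" | "Z \<ge> 1/2" | "X \<le> 1/2" "Y \<le> 1/2" "Z \<le> 1/2" by linarith
    then show ?thesis
      by cases (use assms in \<open>simp_all add: midpoint_coord_def vertex_coord_def\<close>)
  qed
qed

lemma midpoint_coord_eqs:
  "2 * x = w \<Longrightarrow> 0 \<le> w \<Longrightarrow> x \<le> y \<Longrightarrow> w \<le> 1 - 2 * z \<Longrightarrow> midpoint_coord x y z = w"
  "2 * y = w \<Longrightarrow> 0 \<le> w \<Longrightarrow> y \<le> x \<Longrightarrow> w \<le> 1 - 2 * z \<Longrightarrow> midpoint_coord x y z = w"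
  "1 - 2 * z = w \<Longrightarrow> 0 \<le> w \<Longrightarrow> w \<le> 2 * x \<Longrightarrow> w \<le> 2 * y \<Longrightarrow> midpoint_coord x y z = w"
  "1 - 2 * z \<le> 0 \<Longrightarrow> midpoint_coord x y z = 0"
  unfolding midpoint_coord_def by (auto simp: min_absorb1 min_absorb2 max_absorb1 max_absorb2 min.coboundedI2)

lemma vertex_coord_eqs:
  "2 * x - 1 = w \<Longrightarrow> 0 \<le> w \<Longrightarrow> vertex_coord x = w"
  "2 * x \<le> 1 \<Longrightarrow> vertex_coord x = 0"
  unfolding vertex_coord_def by auto

text \<open>Converse of \<open>midpoint_coords_cases\<close>: the piecewise formulas return the
  weights from which a point was built. In each of the four pieces the chosen rule among
  \<open>midpoint_coord_eqs\<close> names the active branch of \<open>max\<close> and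
  \<open>min\<close>.\<close>

lemma midpoint_coords_eq:
  assumes "X = a + (p + r) / 2" "Y = b + (p + s) / 2" "Z = c + (r + s) / 2"
    and "0 \<le> a" "0 \<le> b" "0 \<le> c" "0 \<le> p" "0 \<le> r" "0 \<le> s"
    and "a + b + c + p + r + s = 1"
    and "b = 0 \<and> c = 0 \<and> s = 0 \<or> a = 0 \<and> c = 0 \<and> r = 0 \<or> a = 0 \<and> b = 0 \<and> p = 0 \<or> a = 0 \<and> b = 0 \<and> c = 0"
  shows "midpoint_coord X Y Z = p" "midpoint_coord X Z Y = r" "midpoint_coord Y Z X = s"
    "vertex_coord X = a" "vertex_coord Y = b" "vertex_coord Z = c"
proof -
  have "midpoint_coord X Y Z = p \<and> midpoint_coord X Z Y = r \<and> midpoint_coord Y Z X = s \<and>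
    vertex_coord X = a \<and> vertex_coord Y = b \<and> vertex_coord Z = c"
    using assms(11)
  proof (elim disjE conjE)
    assume z: "b = 0" "c = 0" "s = 0"
    then have e: "a = 1 - p - r" using assms(10) by simp
    have m0: "midpoint_coord X Y Z = p"
      by (rule midpoint_coord_eqs(2)) (use assms(1-9) z e in argo)+
    have m1: "midpoint_coord X Z Y = r"
      by (rule midpoint_coord_eqs(2)) (use assms(1-9) z e in argo)+
    have m2: "midpoint_coord Y Z X = 0"
      by (rule midpoint_coord_eqs(4)) (use assms(1-9) z e in argo)+
    have v0: "vertex_coord X = a"
      by (rule vertex_coord_eqs(1)) (use assms(1-9) z e in argo)+
    have v1: "vertex_coord Y = 0"
      by (rule vertex_coord_eqs(2)) (use assms(1-9) z e in argo)+
    have v2: "vertex_coord Z = 0"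
      by (rule vertex_coord_eqs(2)) (use assms(1-9) z e in argo)+
    show ?thesis using m0 m1 m2 v0 v1 v2 z by simp
  next
    assume z: "a = 0" "c = 0" "r = 0"
    then have e: "b = 1 - p - s" using assms(10) by simp
    have m0: "midpoint_coord X Y Z = p"
      by (rule midpoint_coord_eqs(1)) (use assms(1-9) z e in argo)+
    have m1: "midpoint_coord X Z Y = 0"
      by (rule midpoint_coord_eqs(4)) (use assms(1-9) z e in argo)+
    have m2: "midpoint_coord Y Z X = s"
      by (rule midpoint_coord_eqs(2)) (use assms(1-9) z e in argo)+
    have v0: "vertex_coord X = 0"
      by (rule vertex_coord_eqs(2)) (use assms(1-9) z e in argo)+
    have v1: "vertex_coord Y = b"
      by (rule vertex_coord_eqs(1)) (use assms(1-9) z e in argo)+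
    have v2: "vertex_coord Z = 0"
      by (rule vertex_coord_eqs(2)) (use assms(1-9) z e in argo)+
    show ?thesis using m0 m1 m2 v0 v1 v2 z by simp
  next
    assume z: "a = 0" "b = 0" "p = 0"
    then have e: "c = 1 - r - s" using assms(10) by simp
    have m0: "midpoint_coord X Y Z = 0"
      by (rule midpoint_coord_eqs(4)) (use assms(1-9) z e in argo)+
    have m1: "midpoint_coord X Z Y = r"
      by (rule midpoint_coord_eqs(1)) (use assms(1-9) z e in argo)+
    have m2: "midpoint_coord Y Z X = s"
      by (rule midpoint_coord_eqs(1)) (use assms(1-9) z e in argo)+
    have v0: "vertex_coord X = 0"
      by (rule vertex_coord_eqs(2)) (use assms(1-9) z e in argo)+
    have v1: "vertex_coord Y = 0"
      by (rule vertex_coord_eqs(2)) (use assms(1-9) z e in argo)+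
    have v2: "vertex_coord Z = c"
      by (rule vertex_coord_eqs(1)) (use assms(1-9) z e in argo)+
    show ?thesis using m0 m1 m2 v0 v1 v2 z by simp
  next
    assume z: "a = 0" "b = 0" "c = 0"
    then have e: "p = 1 - r - s" using assms(10) by simp
    have m0: "midpoint_coord X Y Z = p"
      by (rule midpoint_coord_eqs(3)) (use assms(1-9) z e in argo)+
    have m1: "midpoint_coord X Z Y = r"
      by (rule midpoint_coord_eqs(3)) (use assms(1-9) z e in argo)+
    have m2: "midpoint_coord Y Z X = s"
      by (rule midpoint_coord_eqs(3)) (use assms(1-9) z e in argo)+
    have v0: "vertex_coord X = 0"
      by (rule vertex_coord_eqs(2)) (use assms(1-9) z e in argo)+
    have v1: "vertex_coord Y = 0"
      by (rule vertex_coord_eqs(2)) (use assms(1-9) z e in argo)+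
    have v2: "vertex_coord Z = 0"
      by (rule vertex_coord_eqs(2)) (use assms(1-9) z e in argo)+
    show ?thesis using m0 m1 m2 v0 v1 v2 z by simp
  qed
  then show "midpoint_coord X Y Z = p" "midpoint_coord X Z Y = r" "midpoint_coord Y Z X = s"
    "vertex_coord X = a" "vertex_coord Y = b" "vertex_coord Z = c" by simp_all
qed

lemma octa_coords_sum:
  assumes "\<bar>x\<bar> + \<bar>y\<bar> + \<bar>z\<bar> = 1"
  shows "sum (octa_coords x y z) {1..9} = 1"
proof -
  obtain X Y Z where XYZ: "0 \<le> X" "0 \<le> Y" "0 \<le> Z" "X = \<bar>x\<bar>" "Y = \<bar>y\<bar>" "Z = \<bar>z\<bar>"
    "octa_coords x y z \<in> {octa_coords X Y Z, octa_coords X Y (-Z), octa_coords X (-Y) Z, octa_coords (-X) Y Z}"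
    by (rule octa_coords_cases)
  have s: "X + Y + Z = 1" using assms XYZ by simp
  have "vertex_coord X + vertex_coord Y + vertex_coord Z +
    midpoint_coord X Y Z + midpoint_coord X Z Y + midpoint_coord Y Z X = 1"
    using midpoint_coords_cases(1-3)[OF XYZ(1-3) s] s by argo
  then show ?thesis using XYZ(7) unfolding octa_coords_signs[OF XYZ(1-3)]
    by (elim insertE) (simp_all only: sum_nine, simp_all)
qed

lemma octa_coords_support:
  assumes "\<bar>x\<bar> + \<bar>y\<bar> + \<bar>z\<bar> = 1"
  shows "\<exists>T\<in>RP2_9. {v. octa_coords x y z v \<noteq> 0} \<subseteq> T"
proof -
  obtain X Y Z where XYZ: "0 \<le> X" "0 \<le> Y" "0 \<le> Z" "X = \<bar>x\<bar>" "Y = \<bar>y\<bar>" "Z = \<bar>z\<bar>"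
    "octa_coords x y z \<in> {octa_coords X Y Z, octa_coords X Y (-Z), octa_coords X (-Y) Z, octa_coords (-X) Y Z}"
    by (rule octa_coords_cases)
  have s: "X + Y + Z = 1" using assms XYZ by simp
  have sup: "\<exists>T\<in>RP2_9. {v. nine a b c d e f g h i v \<noteq> 0} \<subseteq> T"
    if "T \<in> RP2_9" "{v. nine a b c d e f g h i v \<noteq> 0} \<subseteq> T" for T and a b c d e f g h i :: real
    using that by blast
  show ?thesis
    using XYZ(7) midpoint_coords_cases(4)[OF XYZ(1-3) s] unfolding octa_coords_signs[OF XYZ(1-3)]
    apply (elim insertE disjE conjE)
    subgoal by (simp only:, rule sup[of "{1,3,7}"], simp add: RP2_9_def, rule nine_support, simp_all)
    subgoal by (simp only:, rule sup[of "{1,5,8}"], simp add: RP2_9_def, rule nine_support, simp_all)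
    subgoal by (simp only:, rule sup[of "{3,5,9}"], simp add: RP2_9_def, rule nine_support, simp_all)
    subgoal by (simp only:, rule sup[of "{1,3,5}"], simp add: RP2_9_def, rule nine_support, simp_all)
    subgoal by (simp only:, rule sup[of "{1,4,7}"], simp add: RP2_9_def, rule nine_support, simp_all)
    subgoal by (simp only:, rule sup[of "{1,6,8}"], simp add: RP2_9_def, rule nine_support, simp_all)
    subgoal by (simp only:, rule sup[of "{4,6,9}"], simp add: RP2_9_def, rule nine_support, simp_all)
    subgoal by (simp only:, rule sup[of "{1,4,6}"], simp add: RP2_9_def, rule nine_support, simp_all)
    subgoal by (simp only:, rule sup[of "{2,3,7}"], simp add: RP2_9_def, rule nine_support, simp_all)
    subgoal by (simp only:, rule sup[of "{2,6,8}"], simp add: RP2_9_def, rule nine_support, simp_all)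
    subgoal by (simp only:, rule sup[of "{3,6,9}"], simp add: RP2_9_def, rule nine_support, simp_all)
    subgoal by (simp only:, rule sup[of "{2,3,6}"], simp add: RP2_9_def, rule nine_support, simp_all)
    subgoal by (simp only:, rule sup[of "{2,4,7}"], simp add: RP2_9_def, rule nine_support, simp_all)
    subgoal by (simp only:, rule sup[of "{2,5,8}"], simp add: RP2_9_def, rule nine_support, simp_all)
    subgoal by (simp only:, rule sup[of "{4,5,9}"], simp add: RP2_9_def, rule nine_support, simp_all)
    subgoal by (simp only:, rule sup[of "{2,4,5}"], simp add: RP2_9_def, rule nine_support, simp_all)
    by simp_all
qed

text \<open>At most one of the two midpoints in each coordinate plane has positive weight, so adding
  both gives a formula independent of the octant.\<close>

lemma octa_coords_abs:
  assumes "\<bar>x\<bar> + \<bar>y\<bar> + \<bar>z\<bar> = 1"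
  defines "q \<equiv> octa_coords x y z"
  shows "\<bar>x\<bar> = q 7 + (q 1 + q 2 + q 3 + q 4) / 2"
    "\<bar>y\<bar> = q 8 + (q 1 + q 2 + q 5 + q 6) / 2"
    "\<bar>z\<bar> = q 9 + (q 3 + q 4 + q 5 + q 6) / 2"
proof -
  obtain X Y Z where XYZ: "0 \<le> X" "0 \<le> Y" "0 \<le> Z" "X = \<bar>x\<bar>" "Y = \<bar>y\<bar>" "Z = \<bar>z\<bar>"
    "q \<in> {octa_coords X Y Z, octa_coords X Y (-Z), octa_coords X (-Y) Z, octa_coords (-X) Y Z}"
    unfolding q_def by (rule octa_coords_cases)
  have s: "X + Y + Z = 1" using assms XYZ by simp
  note m = midpoint_coords_cases(1-3)[OF XYZ(1-3) s]
  have "X = q 7 + (q 1 + q 2 + q 3 + q 4) / 2 \<and> Y = q 8 + (q 1 + q 2 + q 5 + q 6) / 2 \<and>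
     Z = q 9 + (q 3 + q 4 + q 5 + q 6) / 2"
    using XYZ(7) m unfolding octa_coords_signs[OF XYZ(1-3)] by (elim insertE) simp_all
  then show "\<bar>x\<bar> = q 7 + (q 1 + q 2 + q 3 + q 4) / 2"
    "\<bar>y\<bar> = q 8 + (q 1 + q 2 + q 5 + q 6) / 2"
    "\<bar>z\<bar> = q 9 + (q 3 + q 4 + q 5 + q 6) / 2" using XYZ by simp_all
qed

text \<open>Absolute values are recovered by \<open>octa_coords_abs\<close>. The sign of a product
  of two coordinates is visible in a midpoint weight as soon as the third coordinate is below 1/2 in
  absolute value. If no coordinate vanishes, two of them are below 1/2, and the resulting two
  products fix all signs up to a common one.\<close>

lemma octa_coords_inj:
  assumes n: "\<bar>x\<bar> + \<bar>y\<bar> + \<bar>z\<bar> = 1" "\<bar>x'\<bar> + \<bar>y'\<bar> + \<bar>z'\<bar> = 1"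
    and q: "octa_coords x y z = octa_coords x' y' z'"
  shows "x' = x \<and> y' = y \<and> z' = z \<or> x' = - x \<and> y' = - y \<and> z' = - z"
proof -
  have abs: "\<bar>x\<bar> = \<bar>x'\<bar>" "\<bar>y\<bar> = \<bar>y'\<bar>" "\<bar>z\<bar> = \<bar>z'\<bar>"
    using octa_coords_abs[OF n(1)] octa_coords_abs[OF n(2)] q by simp_all
  have pos: "0 < max 0 (min (\<bar>a + b\<bar> - \<bar>a - b\<bar>) (1 - 2 * \<bar>c\<bar>)) \<longleftrightarrow> 0 < a * b" if "\<bar>c\<bar> < 1/2" for a b c :: real
  proof -
    have "0 < \<bar>a + b\<bar> - \<bar>a - b\<bar> \<longleftrightarrow> 0 < a * b" by (auto simp: abs_if zero_less_mult_iff)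
    then show ?thesis using that by (auto simp: less_max_iff_disj)
  qed
  have prod: "a' * b' = a * b" if "\<bar>a\<bar> = \<bar>a'\<bar>" "\<bar>b\<bar> = \<bar>b'\<bar>" "\<bar>c\<bar> = \<bar>c'\<bar>" "\<bar>c\<bar> < 1/2"
    "max 0 (min (\<bar>a + b\<bar> - \<bar>a - b\<bar>) (1 - 2 * \<bar>c\<bar>)) = max 0 (min (\<bar>a' + b'\<bar> - \<bar>a' - b'\<bar>) (1 - 2 * \<bar>c'\<bar>))"
    for a b c a' b' c' :: real
  proof -
    have "0 < a * b \<longleftrightarrow> 0 < a' * b'"
      using pos[OF that(4), of a b] pos[OF that(4)[unfolded that(3)], of a' b'] unfolding that(5) by blast
    moreover have "\<bar>a * b\<bar> = \<bar>a' * b'\<bar>" by (simp only: abs_mult that(1,2))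
    ultimately show ?thesis by linarith
  qed
  have Q: "octa_coords x y z v = octa_coords x' y' z' v" for v using q by simp
  have p12: "x' * y' = x * y" if "\<bar>z\<bar> < 1/2"
    using prod[OF abs(1,2,3) that] Q[of 1] unfolding octa_coords_def nine_simps by blast
  have p13: "x' * z' = x * z" if "\<bar>y\<bar> < 1/2"
    using prod[OF abs(1,3,2) that] Q[of 3] unfolding octa_coords_def nine_simps by blast
  have p23: "y' * z' = y * z" if "\<bar>x\<bar> < 1/2"
    using prod[OF abs(2,3,1) that] Q[of 5] unfolding octa_coords_def nine_simps by blast
  have two: "b' = b \<and> c' = c \<or> b' = - b \<and> c' = - c" if "b' * c' = b * c" "\<bar>b\<bar> = \<bar>b'\<bar>" "\<bar>c\<bar> = \<bar>c'\<bar>"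
    for b b' c c' :: real
    using that by (auto simp: abs_eq_iff)
  have three: "a' = a \<and> b' = b \<and> c' = c \<or> a' = - a \<and> b' = - b \<and> c' = - c"
    if "c \<noteq> 0" "a' * c' = a * c" "b' * c' = b * c" "\<bar>c\<bar> = \<bar>c'\<bar>" for a a' b b' c c' :: real
  proof -
    have "c' = c \<or> c' = - c" using that(4) by (auto simp: abs_eq_iff)
    then show ?thesis
    proof
      assume c: "c' = c"
      then have "a' = a" "b' = b" using that(1-3) by simp_all
      with c show ?thesis by blast
    next
      assume c: "c' = - c"
      then have "- a' * c = a * c" "- b' * c = b * c" using that(2,3) by simp_all
      then have "a' = - a" "b' = - b" using that(1) by (simp_all only: mult_cancel_right) auto
      with c show ?thesis by blast
    qed
  qed
  have z0: "a' = 0" if "a = 0" "\<bar>a\<bar> = \<bar>a'\<bar>" for a a' :: real using that by simp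
  consider "x = 0" | "y = 0" | "z = 0" | "x \<noteq> 0" "y \<noteq> 0" "z \<noteq> 0" by blast
  then show ?thesis
  proof cases
    case 1 then show ?thesis using two[OF p23 abs(2,3)] z0[OF 1 abs(1)] by auto
  next
    case 2 then show ?thesis using two[OF p13 abs(1,3)] z0[OF 2 abs(2)] by auto
  next
    case 3 then show ?thesis using two[OF p12 abs(1,2)] z0[OF 3 abs(3)] by auto
  next
    case 4
    then have "\<bar>x\<bar> > 0" "\<bar>y\<bar> > 0" "\<bar>z\<bar> > 0" by simp_all
    then consider "\<bar>x\<bar> < 1/2" "\<bar>y\<bar> < 1/2" | "\<bar>x\<bar> < 1/2" "\<bar>z\<bar> < 1/2" | "\<bar>y\<bar> < 1/2" "\<bar>z\<bar> < 1/2"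
      using n(1) by argo
    then show ?thesis
    proof cases
      case 1
      then show ?thesis using three[OF 4(3) p13 p23 abs(3)] by blast
    next
      case 2
      have "z' * y' = z * y" using p23[OF 2(1)] by (simp only: mult.commute)
      then show ?thesis using three[OF 4(2) p12[OF 2(2)] _ abs(2), of z' z] by blast
    next
      case 3
      have "y' * x' = y * x" "z' * x' = z * x" using p12[OF 3(2)] p13[OF 3(1)] by (simp_all only: mult.commute)
      then show ?thesis using three[OF 4(1) _ _ abs(1), of y' y z' z] by blast
    qed
  qed
qed

lemma octa_coords_surj:
  assumes t: "\<And>v. 0 \<le> t v" "T \<in> RP2_9" "{v. t v \<noteq> 0} \<subseteq> T" "sum t {1..9} = 1"
  shows "\<exists>x y z. \<bar>x\<bar> + \<bar>y\<bar> + \<bar>z\<bar> = 1 \<and> octa_coords x y z = t"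
proof -
  define X where "X = t 7 + (t 1 + t 2 + t 3 + t 4) / 2"
  define Y where "Y = t 8 + (t 1 + t 2 + t 5 + t 6) / 2"
  define Z where "Z = t 9 + (t 3 + t 4 + t 5 + t 6) / 2"
  have t0: "t v = 0" if "v \<notin> T" for v using t(3) that by auto
  have s: "t 1 + t 2 + t 3 + t 4 + t 5 + t 6 + t 7 + t 8 + t 9 = 1"
    using t(4) unfolding interval_1_9 by simp
  have "T \<subseteq> {1,2,3,4,5,6,7,8,9}" using t(2) unfolding RP2_9_def by auto
  then have "v \<notin> {1..9} \<Longrightarrow> t v = 0" for v using t0 unfolding interval_1_9 by blast
  note t9 = nine_collapse[OF this]
  have nn: "t 1 \<ge> 0" "t 2 \<ge> 0" "t 3 \<ge> 0" "t 4 \<ge> 0" "t 5 \<ge> 0" "t 6 \<ge> 0" "t 7 \<ge> 0" "t 8 \<ge> 0" "t 9 \<ge> 0"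
    using t(1) by simp_all
  have XYZ: "0 \<le> X" "0 \<le> Y" "0 \<le> Z" using nn unfolding X_def Y_def Z_def by simp_all
  have abs: "\<bar>X\<bar> + \<bar>Y\<bar> + \<bar>Z\<bar> = 1" using XYZ s unfolding X_def Y_def Z_def by (simp add: field_simps)
  \<comment> \<open>The facet determines the octant, by the choice within the pairs 1/2, 3/4 and
    5/6, and the piece of the face, by the vanishing of the remaining weights.\<close>
  have cases: "(t 2 = 0 \<and> t 4 = 0 \<and> t 6 = 0) \<and> (t 8 = 0 \<and> t 9 = 0 \<and> t 5 = 0 \<or> t 7 = 0 \<and> t 9 = 0 \<and> t 3 = 0 \<or> t 7 = 0 \<and> t 8 = 0 \<and> t 1 = 0 \<or> t 7 = 0 \<and> t 8 = 0 \<and> t 9 = 0) \<or>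
    (t 2 = 0 \<and> t 3 = 0 \<and> t 5 = 0) \<and> (t 8 = 0 \<and> t 9 = 0 \<and> t 6 = 0 \<or> t 7 = 0 \<and> t 9 = 0 \<and> t 4 = 0 \<or> t 7 = 0 \<and> t 8 = 0 \<and> t 1 = 0 \<or> t 7 = 0 \<and> t 8 = 0 \<and> t 9 = 0) \<or>
    (t 1 = 0 \<and> t 4 = 0 \<and> t 5 = 0) \<and> (t 8 = 0 \<and> t 9 = 0 \<and> t 6 = 0 \<or> t 7 = 0 \<and> t 9 = 0 \<and> t 3 = 0 \<or> t 7 = 0 \<and> t 8 = 0 \<and> t 2 = 0 \<or> t 7 = 0 \<and> t 8 = 0 \<and> t 9 = 0) \<or>
    (t 1 = 0 \<and> t 3 = 0 \<and> t 6 = 0) \<and> (t 8 = 0 \<and> t 9 = 0 \<and> t 5 = 0 \<or> t 7 = 0 \<and> t 9 = 0 \<and> t 4 = 0 \<or> t 7 = 0 \<and> t 8 = 0 \<and> t 2 = 0 \<or> t 7 = 0 \<and> t 8 = 0 \<and> t 9 = 0)"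
    using t(2) unfolding RP2_9_def
    by (elim insertE) (simp_all add: t0)
  have "octa_coords X Y Z = t \<or> octa_coords X Y (-Z) = t \<or> octa_coords X (-Y) Z = t \<or> octa_coords (-X) Y Z = t"
    using cases
  proof (elim disjE)
    assume "(t 2 = 0 \<and> t 4 = 0 \<and> t 6 = 0) \<and> (t 8 = 0 \<and> t 9 = 0 \<and> t 5 = 0 \<or> t 7 = 0 \<and> t 9 = 0 \<and> t 3 = 0 \<or> t 7 = 0 \<and> t 8 = 0 \<and> t 1 = 0 \<or> t 7 = 0 \<and> t 8 = 0 \<and> t 9 = 0)"
    then have z: "t 2 = 0 \<and> t 4 = 0 \<and> t 6 = 0" and alt: "t 8 = 0 \<and> t 9 = 0 \<and> t 5 = 0 \<or> t 7 = 0 \<and> t 9 = 0 \<and> t 3 = 0 \<or> t 7 = 0 \<and> t 8 = 0 \<and> t 1 = 0 \<or> t 7 = 0 \<and> t 8 = 0 \<and> t 9 = 0" by simp_all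
    have "X = t 7 + (t 1 + t 3) / 2" "Y = t 8 + (t 1 + t 5) / 2" "Z = t 9 + (t 3 + t 5) / 2"
      unfolding X_def Y_def Z_def using z by simp_all
    moreover have "t 7 + t 8 + t 9 + t 1 + t 3 + t 5 = 1" using s z by linarith
    moreover note alt
    ultimately have m: "midpoint_coord X Y Z = t 1" "midpoint_coord X Z Y = t 3" "midpoint_coord Y Z X = t 5"
        "vertex_coord X = t 7" "vertex_coord Y = t 8" "vertex_coord Z = t 9"
      using midpoint_coords_eq[of X "t 7" "t 1" "t 3" Y "t 8" "t 5" Z "t 9"] nn by simp_all
    have "octa_coords X Y Z = nine (t 1) (t 2) (t 3) (t 4) (t 5) (t 6) (t 7) (t 8) (t 9)"
      unfolding octa_coords_signs(1)[OF XYZ] m by (simp only: z)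
    also have "\<dots> = t" by (rule t9[symmetric])
    finally have "octa_coords X Y Z = t" .
    then show ?thesis by blast
  next
    assume "(t 2 = 0 \<and> t 3 = 0 \<and> t 5 = 0) \<and> (t 8 = 0 \<and> t 9 = 0 \<and> t 6 = 0 \<or> t 7 = 0 \<and> t 9 = 0 \<and> t 4 = 0 \<or> t 7 = 0 \<and> t 8 = 0 \<and> t 1 = 0 \<or> t 7 = 0 \<and> t 8 = 0 \<and> t 9 = 0)"
    then have z: "t 2 = 0 \<and> t 3 = 0 \<and> t 5 = 0" and alt: "t 8 = 0 \<and> t 9 = 0 \<and> t 6 = 0 \<or> t 7 = 0 \<and> t 9 = 0 \<and> t 4 = 0 \<or> t 7 = 0 \<and> t 8 = 0 \<and> t 1 = 0 \<or> t 7 = 0 \<and> t 8 = 0 \<and> t 9 = 0" by simp_all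
    have "X = t 7 + (t 1 + t 4) / 2" "Y = t 8 + (t 1 + t 6) / 2" "Z = t 9 + (t 4 + t 6) / 2"
      unfolding X_def Y_def Z_def using z by simp_all
    moreover have "t 7 + t 8 + t 9 + t 1 + t 4 + t 6 = 1" using s z by linarith
    moreover note alt
    ultimately have m: "midpoint_coord X Y Z = t 1" "midpoint_coord X Z Y = t 4" "midpoint_coord Y Z X = t 6"
        "vertex_coord X = t 7" "vertex_coord Y = t 8" "vertex_coord Z = t 9"
      using midpoint_coords_eq[of X "t 7" "t 1" "t 4" Y "t 8" "t 6" Z "t 9"] nn by simp_all
    have "octa_coords X Y (-Z) = nine (t 1) (t 2) (t 3) (t 4) (t 5) (t 6) (t 7) (t 8) (t 9)"
      unfolding octa_coords_signs(2)[OF XYZ] m by (simp only: z)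
    also have "\<dots> = t" by (rule t9[symmetric])
    finally have "octa_coords X Y (-Z) = t" .
    then show ?thesis by blast
  next
    assume "(t 1 = 0 \<and> t 4 = 0 \<and> t 5 = 0) \<and> (t 8 = 0 \<and> t 9 = 0 \<and> t 6 = 0 \<or> t 7 = 0 \<and> t 9 = 0 \<and> t 3 = 0 \<or> t 7 = 0 \<and> t 8 = 0 \<and> t 2 = 0 \<or> t 7 = 0 \<and> t 8 = 0 \<and> t 9 = 0)"
    then have z: "t 1 = 0 \<and> t 4 = 0 \<and> t 5 = 0" and alt: "t 8 = 0 \<and> t 9 = 0 \<and> t 6 = 0 \<or> t 7 = 0 \<and> t 9 = 0 \<and> t 3 = 0 \<or> t 7 = 0 \<and> t 8 = 0 \<and> t 2 = 0 \<or> t 7 = 0 \<and> t 8 = 0 \<and> t 9 = 0" by simp_all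
    have "X = t 7 + (t 2 + t 3) / 2" "Y = t 8 + (t 2 + t 6) / 2" "Z = t 9 + (t 3 + t 6) / 2"
      unfolding X_def Y_def Z_def using z by simp_all
    moreover have "t 7 + t 8 + t 9 + t 2 + t 3 + t 6 = 1" using s z by linarith
    moreover note alt
    ultimately have m: "midpoint_coord X Y Z = t 2" "midpoint_coord X Z Y = t 3" "midpoint_coord Y Z X = t 6"
        "vertex_coord X = t 7" "vertex_coord Y = t 8" "vertex_coord Z = t 9"
      using midpoint_coords_eq[of X "t 7" "t 2" "t 3" Y "t 8" "t 6" Z "t 9"] nn by simp_all
    have "octa_coords X (-Y) Z = nine (t 1) (t 2) (t 3) (t 4) (t 5) (t 6) (t 7) (t 8) (t 9)"
      unfolding octa_coords_signs(3)[OF XYZ] m by (simp only: z)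
    also have "\<dots> = t" by (rule t9[symmetric])
    finally have "octa_coords X (-Y) Z = t" .
    then show ?thesis by blast
  next
    assume "(t 1 = 0 \<and> t 3 = 0 \<and> t 6 = 0) \<and> (t 8 = 0 \<and> t 9 = 0 \<and> t 5 = 0 \<or> t 7 = 0 \<and> t 9 = 0 \<and> t 4 = 0 \<or> t 7 = 0 \<and> t 8 = 0 \<and> t 2 = 0 \<or> t 7 = 0 \<and> t 8 = 0 \<and> t 9 = 0)"
    then have z: "t 1 = 0 \<and> t 3 = 0 \<and> t 6 = 0" and alt: "t 8 = 0 \<and> t 9 = 0 \<and> t 5 = 0 \<or> t 7 = 0 \<and> t 9 = 0 \<and> t 4 = 0 \<or> t 7 = 0 \<and> t 8 = 0 \<and> t 2 = 0 \<or> t 7 = 0 \<and> t 8 = 0 \<and> t 9 = 0" by simp_all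
    have "X = t 7 + (t 2 + t 4) / 2" "Y = t 8 + (t 2 + t 5) / 2" "Z = t 9 + (t 4 + t 5) / 2"
      unfolding X_def Y_def Z_def using z by simp_all
    moreover have "t 7 + t 8 + t 9 + t 2 + t 4 + t 5 = 1" using s z by linarith
    moreover note alt
    ultimately have m: "midpoint_coord X Y Z = t 2" "midpoint_coord X Z Y = t 4" "midpoint_coord Y Z X = t 5"
        "vertex_coord X = t 7" "vertex_coord Y = t 8" "vertex_coord Z = t 9"
      using midpoint_coords_eq[of X "t 7" "t 2" "t 4" Y "t 8" "t 5" Z "t 9"] nn by simp_all
    have "octa_coords (-X) Y Z = nine (t 1) (t 2) (t 3) (t 4) (t 5) (t 6) (t 7) (t 8) (t 9)"
      unfolding octa_coords_signs(4)[OF XYZ] m by (simp only: z)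
    also have "\<dots> = t" by (rule t9[symmetric])
    finally have "octa_coords (-X) Y Z = t" .
    then show ?thesis by blast
  qed
  then show ?thesis using abs by (metis abs_minus_cancel)
qed

text \<open>The sphere is projected radially to the octahedron by dividing by the sum
  \<open>l\<close> of absolute values; on the octahedron \<open>octa_coords\<close> has exactly the
  antipodal pairs as fibres.\<close>

proposition projective_plane_RP2_9: "projective_plane (top_of_set (underlying_space (faces_of RP2_9)))"
proof -
  define X where "X = underlying_space (faces_of RP2_9)"
  have U: "\<Union>RP2_9 = {1..9}" unfolding RP2_9_def interval_1_9 by auto
  have X: "X = {t. (\<forall>v. 0 \<le> t v) \<and> (\<exists>T\<in>RP2_9. {v. t v \<noteq> 0} \<subseteq> T) \<and> sum t {1..9} = 1}"
    unfolding X_def by (rule underlying_space_faces_of) (auto simp: U)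
  define l where "l x = \<bar>x$1\<bar> + \<bar>x$2\<bar> + \<bar>x$3\<bar>" for x :: "real^3"
  have l0: "l x > 0" if "x \<noteq> 0" for x
    using that unfolding l_def vec_eq_iff forall_3 by (auto simp: less_le)
  have lscale: "l (c *\<^sub>R x) = \<bar>c\<bar> * l x" for c x by (simp add: l_def abs_mult algebra_simps)
  define q where "q x = octa_coords (x$1 / l x) (x$2 / l x) (x$3 / l x)" for x
  have n: "\<bar>x$1 / l x\<bar> + \<bar>x$2 / l x\<bar> + \<bar>x$3 / l x\<bar> = 1" if "x \<noteq> 0" for x
  proof -
    have "\<bar>x$1 / l x\<bar> + \<bar>x$2 / l x\<bar> + \<bar>x$3 / l x\<bar> = (\<bar>x$1\<bar> + \<bar>x$2\<bar> + \<bar>x$3\<bar>) / \<bar>l x\<bar>"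
      by (simp add: abs_divide add_divide_distrib)
    also have "\<dots> = l x / \<bar>l x\<bar>" by (simp only: l_def[symmetric])
    also have "\<dots> = 1" using l0[OF that] by simp
    finally show ?thesis .
  qed
  have s0: "x \<noteq> 0" if "x \<in> sphere 0 1" for x :: "real^3" using that by auto
  have nonneg: "0 \<le> octa_coords a b c v" for a b c v
    unfolding octa_coords_def by (rule nine_nonneg) simp_all
  have qX: "q x \<in> X" if "x \<in> sphere 0 1" for x
    unfolding X q_def using octa_coords_sum[OF n[OF s0[OF that]]] octa_coords_support[OF n[OF s0[OF that]]] nonneg by auto
  have surj: "q ` sphere 0 1 = X"
  proof
    show "X \<subseteq> q ` sphere 0 1"
    proof
      fix t assume "t \<in> X"
      then obtain x y z where xyz: "\<bar>x\<bar> + \<bar>y\<bar> + \<bar>z\<bar> = 1" "octa_coords x y z = t"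
        unfolding X using octa_coords_surj by blast
      define p :: "real^3" where "p = vector [x,y,z]"
      have lp: "l p = 1" using xyz by (simp add: l_def p_def)
      then have p0: "p \<noteq> 0" by (auto simp: l_def)
      define u where "u = (1 / norm p) *\<^sub>R p"
      have "l u = 1 / norm p" using lp by (simp add: u_def lscale)
      then have "q u = t" using p0 xyz by (simp add: q_def u_def p_def)
      moreover have "u \<in> sphere 0 1" using p0 by (simp add: u_def)
      ultimately show "t \<in> q ` sphere 0 1" by blast
    qed
  qed (use qX in blast)
  have fib: "q x = q y \<longleftrightarrow> y = x \<or> y = - x" if xy: "x \<in> sphere 0 1" "y \<in> sphere 0 1" for x y
  proof
    assume "q x = q y"
    then have *: "(1 / l y) *\<^sub>R y = (1 / l x) *\<^sub>R x \<or> (1 / l y) *\<^sub>R y = - ((1 / l x) *\<^sub>R x)"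
      using octa_coords_inj[OF n[OF s0[OF xy(1)]] n[OF s0[OF xy(2)]]] unfolding q_def vec_eq_iff forall_3 by simp
    have ly: "l x > 0" "l y > 0" using l0 s0 xy by auto
    \<comment> \<open>On the unit sphere the two norms are the reciprocals of \<open>l y\<close> and
      \<open>l x\<close>, so both points are scaled by the same factor.\<close>
    have "norm ((1 / l y) *\<^sub>R y) = norm ((1 / l x) *\<^sub>R x)" using * by (elim disjE) (simp_all only: norm_minus_cancel)
    then have "l x = l y" using ly xy by (simp add: field_simps)
    then show "y = x \<or> y = - x" using * ly by (auto simp flip: scaleR_minus_right)
  next
    assume "y = x \<or> y = - x"
    moreover have "q (- x) = q x"
    proof -
      have "l (- x) = l x" by (simp add: l_def)
      then show ?thesis using octa_coords_minus unfolding q_def by simp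
    qed
    ultimately show "q x = q y" by auto
  qed
  have cont: "continuous_on (sphere 0 1) q"
  proof (rule continuous_on_coordinatewise_then_product)
    fix v
    have nz: "\<bar>x$1\<bar> + \<bar>x$2\<bar> + \<bar>x$3\<bar> \<noteq> 0" if "x \<in> sphere 0 1" for x :: "real^3"
      using l0[OF s0[OF that]] unfolding l_def by simp
    have c: "continuous_on (sphere 0 1) (\<lambda>x. x$i / l x)" for i
      unfolding l_def using nz by (intro continuous_intros) auto
    have "continuous_on (sphere 0 1) (\<lambda>x. octa_coords (x$1 / l x) (x$2 / l x) (x$3 / l x) v)"
      by (intro continuous_on_octa_coords c)
    then show "continuous_on (sphere 0 1) (\<lambda>x. q x v)" unfolding q_def .
  qed
  have "quotient_map (top_of_set (sphere 0 1)) (top_of_set X) q"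
    by (rule continuous_imp_quotient_map)
      (use cont surj in \<open>auto simp: Hausdorff_top_of_set compact_space_subtopology\<close>)
  then show ?thesis unfolding projective_plane_def X_def[symmetric] using fib by blast
qed

section \<open>Facet lists and moves\<close>

definition facets :: "nat list list \<Rightarrow> nat set set" where
  "facets l = set ` set l"

text \<open>\<open>Flip a b c d\<close> exchanges the diagonal \<open>ab\<close> of a quadrilateral
  for \<open>cd\<close>; \<open>Unstar v a b c\<close> removes a vertex \<open>v\<close> of degree
  three with neighbours \<open>a\<close>, \<open>b\<close>, \<open>c\<close>. Triples are kept
  sorted so that equality of lists decides equality of triangles.\<close>

datatype move = Flip nat nat nat nat | Unstar nat nat nat nat | Rename nat nat

fun move_ok :: "move \<Rightarrow> nat list list \<Rightarrow> bool" where
  "move_ok (Flip a b c d) l \<longleftrightarrow> distinct [a,b,c,d] \<and> sort [a,b,c] \<in> set l \<and> sort [a,b,d] \<in> set l \<and>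
     (\<forall>t\<in>set l. a \<in> set t \<and> b \<in> set t \<longrightarrow> t = sort [a,b,c] \<or> t = sort [a,b,d]) \<and>
     (\<forall>t\<in>set l. \<not> (c \<in> set t \<and> d \<in> set t))"
| "move_ok (Unstar v a b c) l \<longleftrightarrow> distinct [v,a,b,c] \<and>
     sort [v,a,b] \<in> set l \<and> sort [v,a,c] \<in> set l \<and> sort [v,b,c] \<in> set l \<and>
     (\<forall>t\<in>set l. v \<in> set t \<longrightarrow> t = sort [v,a,b] \<or> t = sort [v,a,c] \<or> t = sort [v,b,c]) \<and>
     (\<forall>t\<in>set l. \<not> (a \<in> set t \<and> b \<in> set t \<and> c \<in> set t))"
| "move_ok (Rename v m) l \<longleftrightarrow> v \<noteq> m \<and> (\<forall>t\<in>set l. m \<notin> set t)"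

fun move_apply :: "move \<Rightarrow> nat list list \<Rightarrow> nat list list" where
  "move_apply (Flip a b c d) l =
     sort [a,c,d] # sort [b,c,d] # filter (\<lambda>t. \<not> (a \<in> set t \<and> b \<in> set t)) l"
| "move_apply (Unstar v a b c) l = sort [a,b,c] # filter (\<lambda>t. v \<notin> set t) l"
| "move_apply (Rename v m) l = map (\<lambda>t. sort (map (\<lambda>x. if x = v then m else x) t)) l"

fun moves_ok :: "move list \<Rightarrow> nat list list \<Rightarrow> bool" where
  "moves_ok [] l = True"
| "moves_ok (m # ms) l \<longleftrightarrow> move_ok m l \<and> moves_ok ms (move_apply m l)"

definition moves_apply :: "move list \<Rightarrow> nat list list \<Rightarrow> nat list list" where
  "moves_apply ms l = fold move_apply ms l"

definition space_of :: "nat list list \<Rightarrow> (nat \<Rightarrow> real) topology" where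
  "space_of l = top_of_set (underlying_space (faces_of (facets l)))"

lemma finite_Union_facets: "finite (\<Union>(facets l))"
  unfolding facets_def by simp

lemma Collect_image: "{T \<in> f ` A. P T} = f ` {t \<in> A. P (f t)}"
  by auto

lemma set_sort3: "set (sort [a,b,c]) = {a,b,c::nat}"
  by (simp only: set_sort list.set)

text \<open>A flip is settled by a common subdivision. Removing a vertex of degree three is read
  backwards, as starring the triangle that it leaves behind. Renaming is the stellar subdivision at
  a single vertex.\<close>

lemma move_homeomorphic:
  assumes "move_ok m l"
  shows "space_of l homeomorphic_space space_of (move_apply m l)"
proof (cases m)
  case (Flip a b c d)
  have ok: "distinct [a,b,c,d]" "sort [a,b,c] \<in> set l" "sort [a,b,d] \<in> set l"
    "\<And>t. t \<in> set l \<Longrightarrow> a \<in> set t \<Longrightarrow> b \<in> set t \<Longrightarrow> t = sort [a,b,c] \<or> t = sort [a,b,d]"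
    "\<And>t. t \<in> set l \<Longrightarrow> \<not> (c \<in> set t \<and> d \<in> set t)"
    using assms unfolding Flip move_ok.simps by blast+
  have mem: "{a,b,c} \<in> facets l" "{a,b,d} \<in> facets l"
    using imageI[OF ok(2), of set] imageI[OF ok(3), of set] unfolding facets_def set_sort3 by auto
  have ab: "T = {a,b,c} \<or> T = {a,b,d}" if T: "T \<in> facets l" "{a,b} \<subseteq> T" for T
  proof -
    obtain t where t: "t \<in> set l" "T = set t" using T unfolding facets_def by auto
    then show ?thesis using ok(4)[of t] T set_sort3 by (metis insert_subset)
  qed
  have eq: "facets (move_apply m l) = facets l - {{a,b,c},{a,b,d}} \<union> {{a,c,d},{b,c,d}}"
  proof -
    have "facets (move_apply m l) = insert {a,c,d} (insert {b,c,d} (set ` {t \<in> set l. \<not> (a \<in> set t \<and> b \<in> set t)}))"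
      by (simp only: Flip facets_def move_apply.simps list.set set_filter image_insert set_sort3)
    also have "set ` {t \<in> set l. \<not> (a \<in> set t \<and> b \<in> set t)} = {T \<in> facets l. \<not> {a,b} \<subseteq> T}"
      unfolding facets_def Collect_image by simp
    also have "{T \<in> facets l. \<not> {a,b} \<subseteq> T} = facets l - {{a,b,c},{a,b,d}}" using ab by blast
    finally show ?thesis by (simp only: Un_insert_right Un_empty_right)
  qed
  show ?thesis unfolding space_of_def eq
  proof (rule flip_homeomorphic[OF _ finite_Union_facets ok(1)])
    show "{T \<in> facets l. {a, b} \<subseteq> T} = {{a, b, c}, {a, b, d}}" using ab mem by blast
    show "{T \<in> facets l. {c, d} \<subseteq> T} = {}" using ok(5) unfolding facets_def by auto
  qed simp
next
  case (Unstar v a b c)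
  have ok: "distinct [v,a,b,c]" "sort [v,a,b] \<in> set l" "sort [v,a,c] \<in> set l" "sort [v,b,c] \<in> set l"
    "\<And>t. t \<in> set l \<Longrightarrow> v \<in> set t \<Longrightarrow> t = sort [v,a,b] \<or> t = sort [v,a,c] \<or> t = sort [v,b,c]"
    "\<And>t. t \<in> set l \<Longrightarrow> \<not> (a \<in> set t \<and> b \<in> set t \<and> c \<in> set t)"
    using assms unfolding Unstar move_ok.simps by blast+
  have mem: "{v,a,b} \<in> facets l" "{v,a,c} \<in> facets l" "{v,b,c} \<in> facets l"
    using imageI[OF ok(2), of set] imageI[OF ok(3), of set] imageI[OF ok(4), of set]
    unfolding facets_def set_sort3 by auto
  have v: "T = {v,a,b} \<or> T = {v,a,c} \<or> T = {v,b,c}" if T: "T \<in> facets l" "v \<in> T" for T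
  proof -
    obtain t where t: "t \<in> set l" "T = set t" using T unfolding facets_def by auto
    then show ?thesis using ok(5)[of t] T set_sort3 by metis
  qed
  have abc: "\<not> {a,b,c} \<subseteq> T" if "T \<in> facets l" for T
    using ok(6) that unfolding facets_def by auto
  define \<Psi> where "\<Psi> = facets (move_apply m l)"
  have \<Psi>: "\<Psi> = insert {a,b,c} {T \<in> facets l. v \<notin> T}"
  proof -
    have "\<Psi> = insert {a,b,c} (set ` {t \<in> set l. v \<notin> set t})"
      by (simp only: \<Psi>_def Unstar facets_def move_apply.simps list.set set_filter image_insert set_sort3)
    also have "set ` {t \<in> set l. v \<notin> set t} = {T \<in> facets l. v \<notin> T}"
      unfolding facets_def Collect_image ..
    finally show ?thesis .
  qed
  have "stellar \<Psi> {a,b,c} v = facets l"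
  proof -
    have 1: "{T \<in> \<Psi>. \<not> {a,b,c} \<subseteq> T} = {T \<in> facets l. v \<notin> T}" unfolding \<Psi> using abc by blast
    have 2: "{insert v (T - {x}) | T x. T \<in> \<Psi> \<and> {a,b,c} \<subseteq> T \<and> x \<in> {a,b,c}} =
       {{v,a,b},{v,a,c},{v,b,c}}"
    proof -
      have "{insert v (T - {x}) | T x. T \<in> \<Psi> \<and> {a,b,c} \<subseteq> T \<and> x \<in> {a,b,c}} =
        {insert v ({a,b,c} - {x}) | x. x \<in> {a,b,c}}" unfolding \<Psi> using abc by blast
      also have "\<dots> = {insert v ({a,b,c} - {a}), insert v ({a,b,c} - {b}), insert v ({a,b,c} - {c})}" by blast
      also have "\<dots> = {insert v {b,c}, insert v {a,c}, insert v {a,b}}"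
      proof -
        have "{a,b,c} - {a} = {b,c}" "{a,b,c} - {b} = {a,c}" "{a,b,c} - {c} = {a,b}" using ok(1) by auto
        then show ?thesis by simp
      qed
      finally show ?thesis by (simp only: insert_commute)
    qed
    have 3: "{T \<in> facets l. v \<in> T} = {{v,a,b},{v,a,c},{v,b,c}}" using v mem by blast
    have "stellar \<Psi> {a,b,c} v = {T \<in> facets l. v \<notin> T} \<union> {T \<in> facets l. v \<in> T}"
      unfolding stellar_def 1 2 3 ..
    also have "\<dots> = facets l" by blast
    finally show ?thesis .
  qed
  moreover have "finite (\<Union>\<Psi>)" unfolding \<Psi>_def by (rule finite_Union_facets)
  moreover have "v \<notin> \<Union>\<Psi>" "v \<notin> {a,b,c}" using ok(1) unfolding \<Psi> by auto
  ultimately show ?thesis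
    using stellar_homeomorphic[of \<Psi> "{a,b,c}" v] unfolding space_of_def \<Psi>_def by simp
next
  case (Rename v n)
  have ok: "v \<noteq> n" "\<And>t. t \<in> set l \<Longrightarrow> n \<notin> set t"
    using assms unfolding Rename move_ok.simps by blast+
  have img: "set (sort (map (\<lambda>x. if x = v then n else x) t)) = (if v \<in> set t then insert n (set t - {v}) else set t)" for t
    by auto
  have "facets (move_apply m l) = (\<lambda>T. if v \<in> T then insert n (T - {v}) else T) ` facets l"
    unfolding Rename facets_def move_apply.simps set_map image_image img ..
  also have "\<dots> = stellar (facets l) {v} n"
    unfolding stellar_def by auto
  finally have eq: "facets (move_apply m l) = stellar (facets l) {v} n" .
  have "n \<notin> \<Union>(facets l)" using ok(2) unfolding facets_def by auto
  then have "top_of_set (underlying_space (faces_of (stellar (facets l) {v} n))) homeomorphic_space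
      top_of_set (underlying_space (faces_of (facets l)))"
    by (intro stellar_homeomorphic finite_Union_facets) (use ok(1) in simp_all)
  then show ?thesis
    unfolding space_of_def eq using homeomorphic_space_sym by blast
qed

lemma moves_homeomorphic:
  assumes "moves_ok ms l"
  shows "space_of l homeomorphic_space space_of (moves_apply ms l)"
  using assms
proof (induction ms arbitrary: l)
  case Nil
  then show ?case by (simp add: moves_apply_def homeomorphic_space_refl)
next
  case (Cons m ms)
  then have "space_of l homeomorphic_space space_of (move_apply m l)"
    using move_homeomorphic by simp
  moreover have "space_of (move_apply m l) homeomorphic_space space_of (moves_apply ms (move_apply m l))"
    using Cons by simp
  ultimately show ?case unfolding moves_apply_def using homeomorphic_space_trans by fastforce
qed

fun glue_ok :: "nat list \<Rightarrow> nat list list \<Rightarrow> nat list list \<Rightarrow> bool" where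
  "glue_ok t l l' \<longleftrightarrow> t \<in> set l \<and> t \<in> set l' \<and> (\<forall>s\<in>set l \<union> set l'. length s = 3 \<and> distinct s) \<and>
     (\<forall>s\<in>set l. \<forall>s'\<in>set l'. \<forall>x\<in>set s. x \<in> set s' \<longrightarrow> x \<in> set t) \<and>
     (\<forall>x\<in>set t. (\<exists>s\<in>set l. set s \<noteq> set t \<and> (\<forall>y\<in>set t. y \<noteq> x \<longrightarrow> y \<in> set s)) \<and>
                (\<exists>s\<in>set l'. set s \<noteq> set t \<and> (\<forall>y\<in>set t. y \<noteq> x \<longrightarrow> y \<in> set s)))"

lemma glue_connected_sum:
  assumes "glue_ok t l l'"
  shows "connected_sum (space_of l) (space_of l')
    (space_of (filter (\<lambda>s. set s \<noteq> set t) (l @ l')))"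
proof -
  have g: "t \<in> set l" "t \<in> set l'" "\<forall>s\<in>set l \<union> set l'. length s = 3 \<and> distinct s"
     "\<forall>s\<in>set l. \<forall>s'\<in>set l'. \<forall>x\<in>set s. x \<in> set s' \<longrightarrow> x \<in> set t"
     "\<forall>x\<in>set t. (\<exists>s\<in>set l. set s \<noteq> set t \<and> (\<forall>y\<in>set t. y \<noteq> x \<longrightarrow> y \<in> set s)) \<and>
                (\<exists>s\<in>set l'. set s \<noteq> set t \<and> (\<forall>y\<in>set t. y \<noteq> x \<longrightarrow> y \<in> set s))"
    using assms[unfolded glue_ok.simps, THEN conjunct1]
      assms[unfolded glue_ok.simps, THEN conjunct2, THEN conjunct1]
      assms[unfolded glue_ok.simps, THEN conjunct2, THEN conjunct2, THEN conjunct1]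
      assms[unfolded glue_ok.simps, THEN conjunct2, THEN conjunct2, THEN conjunct2, THEN conjunct1]
      assms[unfolded glue_ok.simps, THEN conjunct2, THEN conjunct2, THEN conjunct2, THEN conjunct2]
    by blast+
  have eq: "facets (filter (\<lambda>s. set s \<noteq> set t) (l @ l')) = facets l \<union> facets l' - {set t}"
    unfolding facets_def by auto
  show ?thesis unfolding space_of_def eq
  proof (rule connected_sum_along_triangle[OF finite_Union_facets finite_Union_facets])
    show "card T = 3" if "T \<in> facets l" for T using that bspec[OF g(3)] distinct_card unfolding facets_def by (metis UnI1 imageE)
    show "card T = 3" if "T \<in> facets l'" for T using that bspec[OF g(3)] distinct_card unfolding facets_def by (metis UnI2 imageE)
    show "set t \<in> facets l" "set t \<in> facets l'" using g(1,2) unfolding facets_def by blast+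
    show "\<Union>(facets l) \<inter> \<Union>(facets l') = set t"
      proof
      show "\<Union>(facets l) \<inter> \<Union>(facets l') \<subseteq> set t" using g(4) unfolding facets_def by blast
      show "set t \<subseteq> \<Union>(facets l) \<inter> \<Union>(facets l')" using g(1,2) unfolding facets_def by blast
    qed
    show "\<exists>T\<in>facets l - {set t}. set t - {v} \<subseteq> T" if v: "v \<in> set t" for v
    proof -
      obtain s where "s \<in> set l" "set s \<noteq> set t" "\<forall>y\<in>set t. y \<noteq> v \<longrightarrow> y \<in> set s"
        using bspec[OF g(5) v, THEN conjunct1] by blast
      then show ?thesis unfolding facets_def by (intro bexI[of _ "set s"]) auto
    qed
    show "\<exists>T\<in>facets l' - {set t}. set t - {v} \<subseteq> T" if v: "v \<in> set t" for v
    proof -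
      obtain s where "s \<in> set l'" "set s \<noteq> set t" "\<forall>y\<in>set t. y \<noteq> v \<longrightarrow> y \<in> set s"
        using bspec[OF g(5) v, THEN conjunct2] by blast
      then show ?thesis unfolding facets_def by (intro bexI[of _ "set s"]) auto
    qed
  qed
qed

lemma nonorientable_surface_glue:
  assumes "nonorientable_surface h (space_of l)" "projective_plane (space_of l')" "glue_ok t l l'"
  shows "nonorientable_surface (Suc h) (space_of (filter (\<lambda>s. set s \<noteq> set t) (l @ l')))"
  using assms glue_connected_sum nonorientable_surface.step by blast

lemma nonorientable_surface_moves:
  assumes "nonorientable_surface h (space_of l)" "moves_ok ms l"
  shows "nonorientable_surface h (space_of (moves_apply ms l))"
  using assms moves_homeomorphic nonorientable_surface_homeomorphic by blast

lemma projective_plane_moves: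
  assumes "projective_plane (space_of l)" "moves_ok ms l"
  shows "projective_plane (space_of (moves_apply ms l))"
  using assms moves_homeomorphic projective_plane_homeomorphic by blast

lemma triangulations_N_facets:
  assumes "nonorientable_surface h (space_of l)" "l \<noteq> []"
    "\<And>t. t \<in> set l \<Longrightarrow> length t = 3 \<and> distinct t" "card (\<Union>(facets l)) = n"
  shows "faces_of (facets l) \<in> triangulations_N h n"
proof -
  define K where "K = faces_of (facets l)"
  have c: "finite T \<and> card T = 3" if "T \<in> facets l" for T
    using that assms(3) distinct_card unfolding facets_def by fastforce
  have "finite K"
    by (rule finite_subset[of _ "\<Union>(Pow ` facets l)"]) (use c in \<open>auto simp: K_def faces_of_def facets_def\<close>)
  moreover have "finite F \<and> F \<noteq> {}" if "F \<in> K" for F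
    using that c finite_subset unfolding K_def faces_of_def by blast
  moreover have "G \<in> K" if "F \<in> K" "G \<subseteq> F" "G \<noteq> {}" for F G
    using that unfolding K_def faces_of_def by blast
  ultimately have "abstract_complex K"
    unfolding abstract_complex_def by blast
  moreover have "two_dimensional K"
  proof -
    have "card F \<le> 3" if "F \<in> K" for F
      using that c card_mono unfolding K_def faces_of_def by fastforce
    moreover obtain t where t: "t \<in> set l" using assms(2) by (cases l) auto
    then have "set t \<in> K" "card (set t) = 3"
      using c[of "set t"] unfolding K_def faces_of_def facets_def by auto
    ultimately show ?thesis unfolding two_dimensional_def triangles_def by auto
  qed
  ultimately have "triangulates K (space_of l)"
    unfolding triangulates_def space_of_def K_def by (simp add: homeomorphic_space_refl)
  then show ?thesis
    using assms(1,4) unfolding triangulations_N_def K_def[symmetric]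
    by (auto simp: K_def Union_faces_of)
qed

section \<open>Local injectivity\<close>

text \<open>Such a \<open>d\<close> is, up to a factor, the difference of the barycentric
  coordinates of a point of \<open>S\<close> and a point of \<open>T\<close> with the same image.
  The condition thus says that equal images come from equal points. Being homogeneous in
  \<open>d\<close>, it can be tested arbitrarily close to a common vertex.\<close>

definition dependence_free :: "('v \<Rightarrow> real^3) \<Rightarrow> 'v set \<Rightarrow> 'v set \<Rightarrow> bool" where
  "dependence_free \<psi> S T \<longleftrightarrow>
    (\<forall>d. (\<forall>v. 0 < d v \<longrightarrow> v \<in> S) \<and> (\<forall>v. d v < 0 \<longrightarrow> v \<in> T) \<and>
         sum d (S \<union> T) = 0 \<and> (\<Sum>v\<in>S \<union> T. d v *\<^sub>R \<psi> v) = 0 \<longrightarrow> (\<forall>v. d v = 0))"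

lemma dependence_freeD:
  assumes "dependence_free \<psi> S T" "\<And>v. 0 < d v \<Longrightarrow> v \<in> S" "\<And>v. d v < 0 \<Longrightarrow> v \<in> T"
    "sum d (S \<union> T) = 0" "(\<Sum>v\<in>S \<union> T. d v *\<^sub>R \<psi> v) = 0"
  shows "d v = 0"
  using assms unfolding dependence_free_def by blast

text \<open>The open star of a vertex \<open>v\<close> serves as the neighbourhood: any two points
  of it lie in triangles through \<open>v\<close>, and if their images agree, their difference is a
  dependence of these triangles.\<close>

lemma dependence_free_imp_realizable:
  fixes \<Phi> :: "'v set set"
  assumes fin: "finite (\<Union>\<Phi>)"
    and free: "\<And>S T. S \<in> \<Phi> \<Longrightarrow> T \<in> \<Phi> \<Longrightarrow> S \<inter> T \<noteq> {} \<Longrightarrow> dependence_free \<psi> S T"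
  shows "polyhedrally_realizable (faces_of \<Phi>)"
  unfolding polyhedrally_realizable_def locally_injective_on_def
proof (intro exI[of _ \<psi>] ballI)
  fix x assume x: "x \<in> underlying_space (faces_of \<Phi>)"
  note us = underlying_space_faces_of[OF fin order_refl]
  have "sum x (\<Union>\<Phi>) = 1" "\<forall>v. 0 \<le> x v" using x unfolding us by auto
  then obtain v where v: "0 < x v" by (metis less_eq_real_def sum.neutral zero_neq_one)
  have "open {t::'v \<Rightarrow> real. 0 < t v}"
    by (intro open_Collect_less continuous_on_coordinate) auto
  moreover have "inj_on (simplexwise_linear_map (faces_of \<Phi>) \<psi>) (underlying_space (faces_of \<Phi>) \<inter> {t. 0 < t v})"
  proof (rule inj_onI)
    fix s t assume s: "s \<in> underlying_space (faces_of \<Phi>) \<inter> {t. 0 < t v}"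
      and t: "t \<in> underlying_space (faces_of \<Phi>) \<inter> {t. 0 < t v}"
      and eq: "simplexwise_linear_map (faces_of \<Phi>) \<psi> s = simplexwise_linear_map (faces_of \<Phi>) \<psi> t"
    obtain S where S: "S \<in> \<Phi>" "{v. s v \<noteq> 0} \<subseteq> S" "\<forall>v. 0 \<le> s v" "sum s (\<Union>\<Phi>) = 1" "0 < s v"
      using s unfolding us by auto
    obtain T where T: "T \<in> \<Phi>" "{v. t v \<noteq> 0} \<subseteq> T" "\<forall>v. 0 \<le> t v" "sum t (\<Union>\<Phi>) = 1" "0 < t v"
      using t unfolding us by auto
    define d where "d = (\<lambda>v. s v - t v)"
    have "v \<in> S" "v \<in> T" using S T by auto
    then have free': "dependence_free \<psi> S T" using free S(1) T(1) by blast
    have pos: "u \<in> S" if "0 < d u" for u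
    proof -
      have "s u \<noteq> 0" using that T(3)[rule_format, of u] by (simp add: d_def)
      then show ?thesis using S(2) by blast
    qed
    have neg: "u \<in> T" if "d u < 0" for u
    proof -
      have "t u \<noteq> 0" using that S(3)[rule_format, of u] by (simp add: d_def)
      then show ?thesis using T(2) by blast
    qed
    have z: "d u = 0" if "u \<notin> S \<union> T" for u
    proof -
      have "s u = 0" "t u = 0" using that S(2) T(2) by blast+
      then show ?thesis by (simp add: d_def)
    qed
    have "sum d (S \<union> T) = sum d (\<Union>\<Phi>)"
      using S(1) T(1) z by (intro sum.mono_neutral_left fin) auto
    also have "\<dots> = 0" using S(4) T(4) by (simp add: d_def sum_subtractf)
    finally have s0: "sum d (S \<union> T) = 0" .
    have "(\<Sum>v\<in>S \<union> T. d v *\<^sub>R \<psi> v) = (\<Sum>v\<in>\<Union>\<Phi>. d v *\<^sub>R \<psi> v)"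
      using S(1) T(1) z by (intro sum.mono_neutral_left fin) auto
    also have "\<dots> = 0"
      using eq unfolding simplexwise_linear_map_def Union_faces_of d_def scaleR_diff_left sum_subtractf
      by simp
    finally have "d u = 0" for u using dependence_freeD[OF free' pos neg s0] by blast
    then show "s = t" by (auto simp: d_def)
  qed
  ultimately show "\<exists>U. open U \<and> x \<in> U \<and> inj_on (simplexwise_linear_map (faces_of \<Phi>) \<psi>) (underlying_space (faces_of \<Phi>) \<inter> U)"
    using v by blast
qed

text \<open>A nontrivial dependence can be scaled down at a common vertex \<open>v\<close>: mix its
  positive part, and separately its negative part, into \<open>v\<close> with weight
  \<open>\<epsilon>\<close>. The two points differ, have equal images, and both tend to
  \<open>v\<close>.\<close>

lemma locally_injective_imp_dependence_free:
  fixes \<Phi> :: "'v set set"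
  assumes fin: "finite (\<Union>\<Phi>)"
    and inj: "locally_injective_on (underlying_space (faces_of \<Phi>)) (simplexwise_linear_map (faces_of \<Phi>) \<psi>)"
    and ST: "S \<in> \<Phi>" "T \<in> \<Phi>" "S \<inter> T \<noteq> {}"
  shows "dependence_free \<psi> S T"
  unfolding dependence_free_def
proof (intro allI impI, elim conjE, rule ccontr)
  fix d :: "'v \<Rightarrow> real" and u
  assume d: "\<forall>v. 0 < d v \<longrightarrow> v \<in> S" "\<forall>v. d v < 0 \<longrightarrow> v \<in> T" "sum d (S \<union> T) = 0"
    "(\<Sum>v\<in>S \<union> T. d v *\<^sub>R \<psi> v) = 0" and u: "d u \<noteq> 0"
  note us = underlying_space_faces_of[OF fin order_refl]
  define V where "V = \<Union>\<Phi>"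
  have finV: "finite V" and sub: "S \<union> T \<subseteq> V" using fin ST by (auto simp: V_def)
  obtain v where v: "v \<in> S" "v \<in> T" using ST(3) by auto
  have d0: "d w = 0" if "w \<notin> S \<union> T" for w using d(1,2) that by (metis UnCI linorder_neqE_linordered_idom)
  have sd: "sum d V = 0" using sum.mono_neutral_left[OF finV sub, of d] d0 d(3) by auto
  have sd\<psi>: "(\<Sum>v\<in>V. d v *\<^sub>R \<psi> v) = 0"
    using sum.mono_neutral_left[OF finV sub, of "\<lambda>v. d v *\<^sub>R \<psi> v"] d0 d(4) by auto
  define p where "p w = max (d w) 0" for w
  define n where "n w = max (- d w) 0" for w
  have pn: "p w - n w = d w" "0 \<le> p w" "0 \<le> n w" for w by (auto simp: p_def n_def)
  define M where "M = sum p V"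
  have Mn: "sum n V = M" using sd unfolding M_def pn(1)[symmetric] by (simp add: sum_subtractf)
  have "u \<in> V" using d0 u sub by blast
  have "M > 0"
  proof -
    have "p u > 0 \<or> n u > 0" using u by (auto simp: p_def n_def)
    then show ?thesis
      using sum_pos2[OF finV \<open>u \<in> V\<close>, of p] sum_pos2[OF finV \<open>u \<in> V\<close>, of n] pn Mn unfolding M_def by auto
  qed
  define mix where "mix f \<epsilon> = (\<lambda>w. (1 - \<epsilon>) * (if w = v then 1 else 0) + \<epsilon> / M * f w)" for f and \<epsilon> :: real
  have "v \<in> V" using v sub by auto
  have sum_mix: "sum (mix f \<epsilon>) V = 1" if "sum f V = M" for f \<epsilon>
  proof -
    have "(\<Sum>w\<in>V. \<epsilon> / M * f w) = \<epsilon>"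
      unfolding sum_distrib_left[symmetric] using that \<open>M > 0\<close> by simp
    moreover have "(\<Sum>w\<in>V. (1 - \<epsilon>) * (if w = v then 1 else 0)) = 1 - \<epsilon>"
      unfolding sum_distrib_left[symmetric] using finV \<open>v \<in> V\<close> by simp
    ultimately show ?thesis unfolding mix_def sum.distrib by simp
  qed
  have mixp: "mix p \<epsilon> \<in> underlying_space (faces_of \<Phi>)" and mixn: "mix n \<epsilon> \<in> underlying_space (faces_of \<Phi>)"
    if "0 \<le> \<epsilon>" "\<epsilon> \<le> 1" for \<epsilon>
  proof -
    have "{w. mix p \<epsilon> w \<noteq> 0} \<subseteq> S" "{w. mix n \<epsilon> w \<noteq> 0} \<subseteq> T"
      using v d(1,2) by (auto simp: mix_def p_def n_def max_def split: if_splits)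
    moreover have "0 \<le> mix p \<epsilon> w" "0 \<le> mix n \<epsilon> w" for w
      using that \<open>M > 0\<close> pn by (auto simp: mix_def)
    ultimately show "mix p \<epsilon> \<in> underlying_space (faces_of \<Phi>)" "mix n \<epsilon> \<in> underlying_space (faces_of \<Phi>)"
      unfolding us V_def[symmetric] using sum_mix[of p] sum_mix[of n] Mn M_def ST by auto
  qed
  have mix0: "mix f 0 = (\<lambda>w. if w = v then 1 else 0)" for f by (auto simp: mix_def)
  have "mix p 0 \<in> underlying_space (faces_of \<Phi>)" using mixp by simp
  then obtain U where U: "open U" "mix p 0 \<in> U"
    "inj_on (simplexwise_linear_map (faces_of \<Phi>) \<psi>) (underlying_space (faces_of \<Phi>) \<inter> U)"
    using inj unfolding locally_injective_on_def by blast
  have cont: "continuous_on UNIV (mix f)" for f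
    unfolding mix_def using \<open>M > 0\<close>
    by (intro continuous_on_coordinatewise_then_product continuous_intros) auto
  have "open (mix p -` U \<inter> mix n -` U)"
    using cont U(1) by (intro open_Int) (auto intro: open_vimage)
  moreover have "0 \<in> mix p -` U \<inter> mix n -` U" using U(2) mix0 by simp
  ultimately obtain \<delta> where \<delta>: "\<delta> > 0" "ball 0 \<delta> \<subseteq> mix p -` U \<inter> mix n -` U"
    using open_contains_ball by metis
  define \<epsilon> where "\<epsilon> = min (\<delta> / 2) 1"
  have \<epsilon>: "0 < \<epsilon>" "\<epsilon> \<le> 1" "\<epsilon> \<in> ball 0 \<delta>" using \<delta>(1) by (auto simp: \<epsilon>_def dist_real_def)
  have diff: "mix p \<epsilon> w - mix n \<epsilon> w = \<epsilon> / M * d w" for w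
    unfolding pn(1)[symmetric] by (simp add: mix_def algebra_simps)
  have "simplexwise_linear_map (faces_of \<Phi>) \<psi> (mix p \<epsilon>) - simplexwise_linear_map (faces_of \<Phi>) \<psi> (mix n \<epsilon>) =
    (\<Sum>w\<in>V. (mix p \<epsilon> w - mix n \<epsilon> w) *\<^sub>R \<psi> w)"
    unfolding simplexwise_linear_map_def Union_faces_of V_def by (simp add: scaleR_diff_left sum_subtractf)
  also have "\<dots> = (\<epsilon> / M) *\<^sub>R (\<Sum>w\<in>V. d w *\<^sub>R \<psi> w)"
    unfolding diff by (simp add: scaleR_sum_right)
  also have "\<dots> = 0" using sd\<psi> by simp
  finally have "simplexwise_linear_map (faces_of \<Phi>) \<psi> (mix p \<epsilon>) = simplexwise_linear_map (faces_of \<Phi>) \<psi> (mix n \<epsilon>)"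
    by simp
  moreover have "mix p \<epsilon> \<in> U" "mix n \<epsilon> \<in> U" using \<epsilon>(3) \<delta>(2) by blast+
  ultimately have "mix p \<epsilon> = mix n \<epsilon>"
    using inj_onD[OF U(3)] mixp[of \<epsilon>] mixn[of \<epsilon>] \<epsilon> by simp
  then show False using diff[of u] u \<epsilon> \<open>M > 0\<close> by simp
qed

section \<open>Separating planes with integer coefficients\<close>

type_synonym ivec = "int \<times> int \<times> int"

fun idot :: "ivec \<Rightarrow> ivec \<Rightarrow> int" where
  "idot (a, b, c) (x, y, z) = a * x + b * y + c * z"

definition realvec :: "ivec \<Rightarrow> real^3" where
  "realvec p = (case p of (x, y, z) \<Rightarrow> vector [of_int x, of_int y, of_int z])"

fun noncollinear :: "ivec \<Rightarrow> ivec \<Rightarrow> ivec \<Rightarrow> bool" where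
  "noncollinear (a1, a2, a3) (b1, b2, b3) (c1, c2, c3) \<longleftrightarrow>
    (b1 - a1) * (c2 - a2) \<noteq> (b2 - a2) * (c1 - a1) \<or>
    (b1 - a1) * (c3 - a3) \<noteq> (b3 - a3) * (c1 - a1) \<or>
    (b2 - a2) * (c3 - a3) \<noteq> (b3 - a3) * (c2 - a2)"

fun triangle_ok :: "(nat \<Rightarrow> ivec) \<Rightarrow> nat list \<Rightarrow> bool" where
  "triangle_ok \<psi> [a, b, c] \<longleftrightarrow> a \<noteq> b \<and> a \<noteq> c \<and> b \<noteq> c \<and> noncollinear (\<psi> a) (\<psi> b) (\<psi> c)"
| "triangle_ok \<psi> _ \<longleftrightarrow> False"

text \<open>The level \<open>k\<close> is read off at the first common vertex. Disjoint triangles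
  yield the empty list and pass, since only pairs with a common vertex have to be certified.\<close>

definition separates :: "(nat \<Rightarrow> ivec) \<Rightarrow> nat list \<Rightarrow> nat list \<Rightarrow> ivec \<Rightarrow> bool" where
  "separates \<psi> s t l \<longleftrightarrow>
    (case filter (\<lambda>x. x \<in> set t) s of [] \<Rightarrow> True
     | v # _ \<Rightarrow> (let k = idot l (\<psi> v) in
        (\<forall>x\<in>set s. if x \<in> set t then idot l (\<psi> x) = k else k < idot l (\<psi> x)) \<and>
        (\<forall>x\<in>set t. x \<in> set s \<or> idot l (\<psi> x) < k)))"

fun rows_ok :: "(nat \<Rightarrow> ivec) \<Rightarrow> nat list list \<Rightarrow> ivec list list \<Rightarrow> bool" where
  "rows_ok \<psi> [] rs \<longleftrightarrow> True"
| "rows_ok \<psi> (s # l) [] \<longleftrightarrow> False"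
| "rows_ok \<psi> (s # l) (r # rs) \<longleftrightarrow> triangle_ok \<psi> s \<and> list_all2 (separates \<psi> s) l r \<and> rows_ok \<psi> l rs"

lemma realvec_dot: "realvec (a, b, c) \<bullet> realvec p = of_int (idot (a, b, c) p)"
  by (cases p) (simp add: realvec_def inner_vec_def sum_3)

lemma rows_okD:
  assumes "rows_ok \<psi> l rs" "i < j" "j < length l"
  shows "\<exists>c. separates \<psi> (l ! i) (l ! j) c"
  using assms
proof (induction \<psi> l rs arbitrary: i j rule: rows_ok.induct)
  case (3 \<psi> s l r rs)
  show ?case
  proof (cases i)
    case 0
    then obtain j' where "j = Suc j'" "j' < length l" using 3 by (cases j) auto
    moreover from this have "separates \<psi> s (l ! j') (r ! j')"
      using 3 list_all2_nthD[of "separates \<psi> s" l r j'] by simp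
    ultimately have "\<exists>c. separates \<psi> ((s # l) ! i) ((s # l) ! j) c" using 0 by (intro exI[of _ "r ! j'"]) simp
    then show ?thesis .
  next
    case (Suc i')
    then obtain j' where "j = Suc j'" "i' < j'" "j' < length l" using 3 by (cases j) auto
    then show ?thesis using 3 Suc by auto
  qed
qed auto

lemma rows_ok_triangle: "rows_ok \<psi> l rs \<Longrightarrow> s \<in> set l \<Longrightarrow> triangle_ok \<psi> s"
  by (induction \<psi> l rs rule: rows_ok.induct) auto

lemma triangle_ok_free:
  assumes "triangle_ok \<psi> s" and d: "\<And>v. v \<notin> set s \<Longrightarrow> d v = 0" "sum d (set s) = 0"
    "(\<Sum>v\<in>set s. d v *\<^sub>R realvec (\<psi> v)) = 0"
  shows "d v = 0"
proof -
  obtain a b c where s: "s = [a, b, c]" using assms(1) by (cases "(\<psi>, s)" rule: triangle_ok.cases) auto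
  obtain a1 a2 a3 b1 b2 b3 c1 c2 c3 where abc: "\<psi> a = (a1, a2, a3)" "\<psi> b = (b1, b2, b3)" "\<psi> c = (c1, c2, c3)"
    by (metis prod_cases3)
  have ne: "a \<noteq> b" "a \<noteq> c" "b \<noteq> c" and nc: "noncollinear (\<psi> a) (\<psi> b) (\<psi> c)"
    using assms(1) unfolding s by auto
  have da: "d a = - d b - d c" using d(2) ne unfolding s by simp
  have "d a *\<^sub>R realvec (\<psi> a) + d b *\<^sub>R realvec (\<psi> b) + d c *\<^sub>R realvec (\<psi> c) = 0"
    using d(3) ne unfolding s by (simp add: add.assoc)
  then have "d a * a1 + d b * b1 + d c * c1 = 0" "d a * a2 + d b * b2 + d c * c2 = 0" "d a * a3 + d b * b3 + d c * c3 = 0"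
    unfolding abc realvec_def by (simp_all add: vec_eq_iff forall_3)
  then have e: "d b * (b1 - a1) + d c * (c1 - a1) = 0" "d b * (b2 - a2) + d c * (c2 - a2) = 0" "d b * (b3 - a3) + d c * (c3 - a3) = 0"
    unfolding da by (simp_all add: algebra_simps)
  \<comment> \<open>Each 2 by 2 minor of the two edge vectors annihilates both coefficients;
    noncollinearity makes one of the minors nonzero.\<close>
  have elim: "\<beta> * (u1 * w2 - u2 * w1) = 0 \<and> \<gamma> * (u1 * w2 - u2 * w1) = 0"
    if "\<beta> * u1 + \<gamma> * w1 = 0" "\<beta> * u2 + \<gamma> * w2 = 0" for \<beta> \<gamma> u1 u2 w1 w2 :: real
    using that by algebra
  have "(real_of_int ((b1 - a1) * (c2 - a2) - (b2 - a2) * (c1 - a1)) \<noteq> 0 \<or>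
    real_of_int ((b1 - a1) * (c3 - a3) - (b3 - a3) * (c1 - a1)) \<noteq> 0 \<or>
    real_of_int ((b2 - a2) * (c3 - a3) - (b3 - a3) * (c2 - a2)) \<noteq> 0)"
    using nc unfolding abc noncollinear.simps of_int_eq_0_iff by simp
  then have "d b = 0 \<and> d c = 0"
    using elim[OF e(1,2)] elim[OF e(1,3)] elim[OF e(2,3)] by (auto simp del: of_int_eq_0_iff)
  then show ?thesis using da d(1) unfolding s by (cases "v \<in> {a, b, c}") auto
qed

text \<open>Summing \<open>d\<close> against the functional minus its level gives zero although no
  term is negative. Hence \<open>d\<close> is supported on common vertices, and these belong to the
  nondegenerate triangle \<open>s\<close>.\<close>

lemma separates_free:
  assumes sep: "separates \<psi> s t l" and ok: "triangle_ok \<psi> s" and st: "set s \<inter> set t \<noteq> {}"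
    and d: "\<And>v. 0 < d v \<Longrightarrow> v \<in> set s" "\<And>v. d v < 0 \<Longrightarrow> v \<in> set t" "sum d (set s \<union> set t) = 0"
    "(\<Sum>v\<in>set s \<union> set t. d v *\<^sub>R realvec (\<psi> v)) = 0"
  shows "d v = 0"
proof -
  define V where "V = set s \<union> set t"
  obtain k where k: "\<And>x. x \<in> set s \<Longrightarrow> x \<in> set t \<Longrightarrow> idot l (\<psi> x) = k"
    "\<And>x. x \<in> set s \<Longrightarrow> x \<notin> set t \<Longrightarrow> idot l (\<psi> x) > k" "\<And>x. x \<notin> set s \<Longrightarrow> x \<in> set t \<Longrightarrow> idot l (\<psi> x) < k"
  proof (cases "filter (\<lambda>x. x \<in> set t) s")
    case Nil
    then show ?thesis using st by (auto simp: filter_empty_conv)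
  next
    case (Cons w ws)
    then show ?thesis using that[of "idot l (\<psi> w)"] sep unfolding separates_def Let_def by auto
  qed
  obtain l1 l2 l3 where l: "l = (l1, l2, l3)" by (metis prod_cases3)
  have "0 = realvec l \<bullet> (\<Sum>v\<in>V. d v *\<^sub>R realvec (\<psi> v))" using d(4) unfolding V_def by simp
  also have "\<dots> = (\<Sum>v\<in>V. d v * of_int (idot l (\<psi> v)))"
    unfolding l by (simp add: inner_sum_right realvec_dot)
  finally have "(\<Sum>v\<in>V. d v * of_int (idot l (\<psi> v))) - of_int k * sum d V = 0" using d(3) unfolding V_def by simp
  then have sum0: "(\<Sum>v\<in>V. d v * (of_int (idot l (\<psi> v)) - of_int k)) = 0"
    by (simp add: sum_distrib_left sum_subtractf algebra_simps)
  have nn: "0 \<le> d v * (of_int (idot l (\<psi> v)) - of_int k)" if "v \<in> V" for v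
  proof (cases "0 < d v")
    case True
    then have "v \<in> set s" using d(1) by blast
    then show ?thesis using True k(1,2)[of v] by (cases "v \<in> set t") auto
  next
    case False
    show ?thesis
    proof (cases "d v < 0")
      case True
      then have "v \<in> set t" using d(2) by blast
      then show ?thesis using True k(1,3)[of v] by (cases "v \<in> set s") (auto intro: mult_nonpos_nonpos)
    qed (use False in auto)
  qed
  have z: "d v * (of_int (idot l (\<psi> v)) - of_int k) = 0" if "v \<in> V" for v
    using sum_nonneg_eq_0_iff[of V "\<lambda>v. d v * (of_int (idot l (\<psi> v)) - of_int k)"] nn sum0 that
    unfolding V_def by auto
  have supp: "v \<in> set s \<inter> set t" if "d v \<noteq> 0" for v
  proof -
    have "v \<in> V" using d(1,2)[of v] that unfolding V_def by (metis UnCI linorder_neqE_linordered_idom)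
    then have "idot l (\<psi> v) = k" using z[of v] that by simp
    then show ?thesis using k(2,3)[of v] \<open>v \<in> V\<close> unfolding V_def by auto
  qed
  show ?thesis
  proof (rule triangle_ok_free[OF ok])
    show "d v = 0" if "v \<notin> set s" for v using supp[of v] that by blast
    show "sum d (set s) = 0"
    proof -
      have "sum d (set s) = sum d V"
        by (rule sum.mono_neutral_left) (use supp in \<open>auto simp: V_def\<close>)
      then show ?thesis using d(3) by (simp add: V_def)
    qed
    show "(\<Sum>v\<in>set s. d v *\<^sub>R realvec (\<psi> v)) = 0"
    proof -
      have "(\<Sum>v\<in>set s. d v *\<^sub>R realvec (\<psi> v)) = (\<Sum>v\<in>V. d v *\<^sub>R realvec (\<psi> v))"
        by (rule sum.mono_neutral_left) (use supp in \<open>auto simp: V_def\<close>)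
      then show ?thesis using d(4) by (simp add: V_def)
    qed
  qed
qed

lemma dependence_free_sym:
  assumes "dependence_free \<psi> S T"
  shows "dependence_free \<psi> T S"
  unfolding dependence_free_def
proof (intro allI impI, elim conjE)
  fix d :: "'a \<Rightarrow> real" and v
  assume d: "\<forall>v. 0 < d v \<longrightarrow> v \<in> T" "\<forall>v. d v < 0 \<longrightarrow> v \<in> S" "sum d (T \<union> S) = 0" "(\<Sum>v\<in>T \<union> S. d v *\<^sub>R \<psi> v) = 0"
  have "- d v = 0"
  proof (rule dependence_freeD[OF assms])
    show "sum (\<lambda>v. - d v) (S \<union> T) = 0" "(\<Sum>v\<in>S \<union> T. - d v *\<^sub>R \<psi> v) = 0"
      using d(3,4) by (simp_all only: sum_negf scaleR_minus_left Un_commute[of S T] neg_equal_0_iff_equal)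
  qed (use d(1,2) in simp_all)
  then show "d v = 0" by simp
qed

proposition rows_ok_realizable:
  assumes "rows_ok \<psi> l rs"
  shows "polyhedrally_realizable (faces_of (facets l))"
proof (rule dependence_free_imp_realizable[OF finite_Union_facets, where \<psi> = "\<lambda>v. realvec (\<psi> v)"])
  fix S T assume "S \<in> facets l" "T \<in> facets l" and ne: "S \<inter> T \<noteq> {}"
  then obtain i j where ij: "i < length l" "j < length l" "S = set (l ! i)" "T = set (l ! j)"
    unfolding facets_def by (metis imageE in_set_conv_nth)
  have tri: "triangle_ok \<psi> (l ! i)" if "i < length l" for i using rows_ok_triangle[OF assms] that by simp
  have lt: "dependence_free (\<lambda>v. realvec (\<psi> v)) (set (l ! i)) (set (l ! j))"
    if h: "i < j" "j < length l" "set (l ! i) \<inter> set (l ! j) \<noteq> {}" for i j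
  proof -
    obtain c where c: "separates \<psi> (l ! i) (l ! j) c" using rows_okD[OF assms h(1,2)] by blast
    have "i < length l" using h by simp
    from separates_free[OF c tri[OF this] h(3)] show ?thesis
      unfolding dependence_free_def by blast
  qed
  consider "i < j" | "j < i" | "i = j" by linarith
  then show "dependence_free (\<lambda>v. realvec (\<psi> v)) S T"
  proof cases
    case 1 then show ?thesis using lt ij ne by simp
  next
    case 2 then show ?thesis using dependence_free_sym[OF lt[of j i]] ij ne by (simp add: Int_commute)
  next
    case 3
    show ?thesis
      unfolding dependence_free_def ij 3 Un_absorb
    proof (intro allI impI, elim conjE)
      fix d :: "nat \<Rightarrow> real" and v
      assume d: "\<forall>v. 0 < d v \<longrightarrow> v \<in> set (l ! j)" "\<forall>v. d v < 0 \<longrightarrow> v \<in> set (l ! j)"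
        "sum d (set (l ! j)) = 0" "(\<Sum>v\<in>set (l ! j). d v *\<^sub>R realvec (\<psi> v)) = 0"
      have "d w = 0" if "w \<notin> set (l ! j)" for w using d(1,2) that by (meson linorder_neqE_linordered_idom)
      then show "d v = 0" using triangle_ok_free[OF tri[OF ij(2)] _ d(3,4)] by blast
    qed
  qed
qed

section \<open>Counting triangles through sorted lists\<close>

definition degree_in :: "'v set set \<Rightarrow> 'v \<Rightarrow> nat" where
  "degree_in K v = card {F \<in> K. card F = 3 \<and> v \<in> F}"

definition sorted_triples :: "nat list list \<Rightarrow> bool" where
  "sorted_triples l \<longleftrightarrow> distinct l \<and> (\<forall>t\<in>set l. length t = 3 \<and> distinct t \<and> sorted t)"

lemma triangles_faces_of_facets:
  assumes "sorted_triples l"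
  shows "{F \<in> faces_of (facets l). card F = 3} = facets l"
proof
  show "{F \<in> faces_of (facets l). card F = 3} \<subseteq> facets l"
  proof
    fix F assume F: "F \<in> {F \<in> faces_of (facets l). card F = 3}"
    then obtain t where t: "t \<in> set l" "F \<subseteq> set t" unfolding faces_of_def facets_def by auto
    then have "card (set t) = 3" using assms distinct_card unfolding sorted_triples_def by metis
    then have "F = set t" using F t card_subset_eq[of "set t" F] by simp
    then show "F \<in> facets l" using t unfolding facets_def by simp
  qed
  show "facets l \<subseteq> {F \<in> faces_of (facets l). card F = 3}"
  proof
    fix F assume "F \<in> facets l"
    then obtain t where t: "t \<in> set l" "F = set t" unfolding facets_def by auto
    then have "card F = 3" using assms distinct_card unfolding sorted_triples_def by metis
    moreover from this have "F \<noteq> {}" by auto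
    ultimately show "F \<in> {F \<in> faces_of (facets l). card F = 3}" using t unfolding faces_of_def facets_def by auto
  qed
qed

lemma card_facets_filter:
  assumes "sorted_triples l"
  shows "card {F \<in> facets l. P F} = length (filter (\<lambda>t. P (set t)) l)"
proof -
  have "inj_on set (set l)"
    using assms unfolding sorted_triples_def by (meson inj_onI sorted_distinct_set_unique)
  then have "card (set ` {t \<in> set l. P (set t)}) = card {t \<in> set l. P (set t)}"
    by (intro card_image) (rule inj_on_subset, auto)
  also have "\<dots> = card (set (filter (\<lambda>t. P (set t)) l))" by (simp only: set_filter)
  also have "\<dots> = length (filter (\<lambda>t. P (set t)) l)"
    using assms unfolding sorted_triples_def by (intro distinct_card) simp
  finally show ?thesis unfolding facets_def Collect_image .
qed

section \<open>Crossings of a segment with a cell\<close>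

text \<open>The parameters inside the cell form a compact interval from \<open>\<alpha>\<close> to
  \<open>\<beta>\<close>. Each of its ends is either an end of the segment or lies on exactly one
  wall, and no wall is met elsewhere, so the total is two. This serves twice: for a tetrahedron with
  its four faces, and for two triangles on the line common to their planes.\<close>

lemma segment_cell_crossings:
  fixes p q :: "'i \<Rightarrow> real"
  assumes fin: "finite I"
  defines "f \<equiv> \<lambda>i t. p i + t * (q i - p i)"
  assumes p0: "(\<forall>i\<in>I. 0 \<le> p i) \<Longrightarrow> (\<forall>i\<in>I. 0 < p i)" and q0: "(\<forall>i\<in>I. 0 \<le> q i) \<Longrightarrow> (\<forall>i\<in>I. 0 < q i)"
    and single: "\<And>t i j. 0 \<le> t \<Longrightarrow> t \<le> 1 \<Longrightarrow> \<forall>i\<in>I. 0 \<le> f i t \<Longrightarrow> i \<in> I \<Longrightarrow> j \<in> I \<Longrightarrow> f i t = 0 \<Longrightarrow> f j t = 0 \<Longrightarrow> i = j"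
  shows "card {i\<in>I. \<exists>t. 0 \<le> t \<and> t \<le> 1 \<and> f i t = 0 \<and> (\<forall>j\<in>I. 0 \<le> f j t)} +
     of_bool (\<forall>i\<in>I. 0 \<le> p i) + of_bool (\<forall>i\<in>I. 0 \<le> q i) =
     (if \<exists>t. 0 \<le> t \<and> t \<le> 1 \<and> (\<forall>i\<in>I. 0 \<le> f i t) then 2 else 0)"
proof -
  define J where "J = {t. 0 \<le> t \<and> t \<le> 1 \<and> (\<forall>j\<in>I. 0 \<le> f j t)}"
  define Z where "Z = {i\<in>I. \<exists>t. 0 \<le> t \<and> t \<le> 1 \<and> f i t = 0 \<and> (\<forall>j\<in>I. 0 \<le> f j t)}"
  have Z: "Z = {i\<in>I. \<exists>t\<in>J. f i t = 0}" unfolding Z_def J_def by auto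
  have f01: "f i 0 = p i" "f i 1 = q i" for i by (simp_all add: f_def)
  have mem0: "0 \<in> J \<longleftrightarrow> (\<forall>i\<in>I. 0 \<le> p i)" and mem1: "1 \<in> J \<longleftrightarrow> (\<forall>i\<in>I. 0 \<le> q i)"
    unfolding J_def by (simp_all add: f01)
  have contf: "continuous_on A (f i)" for A i unfolding f_def by (intro continuous_intros)
  show ?thesis
  proof (cases "J = {}")
    case True
    then have "Z = {}" "\<not> (\<forall>i\<in>I. 0 \<le> p i)" "\<not> (\<forall>i\<in>I. 0 \<le> q i)" using Z mem0 mem1 by auto
    then have "card Z = 0" "of_bool (\<forall>i\<in>I. 0 \<le> p i) = (0::nat)" "of_bool (\<forall>i\<in>I. 0 \<le> q i) = (0::nat)"
      by (simp_all only: card.empty of_bool_eq_0_iff simp_thms)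
    moreover have "\<not> (\<exists>t. 0 \<le> t \<and> t \<le> 1 \<and> (\<forall>i\<in>I. 0 \<le> f i t))" using True unfolding J_def by blast
    ultimately show ?thesis unfolding Z_def[symmetric] by (simp only: if_False add_0)
  next
    case False
    have "J = {0..1} \<inter> (\<Inter>j\<in>I. {t. 0 \<le> f j t})" unfolding J_def by auto
    moreover have "closed {t. 0 \<le> f j t}" for j
      by (intro closed_Collect_le contf continuous_intros)
    ultimately have compJ: "compact J" by (metis closed_INT compact_Int_closed compact_Icc)
    obtain \<alpha> where \<alpha>: "\<alpha> \<in> J" "\<And>t. t \<in> J \<Longrightarrow> \<alpha> \<le> t" using compact_attains_inf[OF compJ False] by blast
    obtain \<beta> where \<beta>: "\<beta> \<in> J" "\<And>t. t \<in> J \<Longrightarrow> t \<le> \<beta>" using compact_attains_sup[OF compJ False] by blast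
    have J01: "0 \<le> t" "t \<le> 1" if "t \<in> J" for t using that unfolding J_def by auto
    have nz: "t \<noteq> 0" "t \<noteq> 1" if "t \<in> J" "i \<in> I" "f i t = 0" for t i
    proof -
      show "t \<noteq> 0"
      proof
        assume "t = 0"
        then have "\<forall>i\<in>I. 0 < p i" using that p0 mem0 by blast
        then show False using that \<open>t = 0\<close> f01 by fastforce
      qed
      show "t \<noteq> 1"
      proof
        assume "t = 1"
        then have "\<forall>i\<in>I. 0 < q i" using that q0 mem1 by blast
        then show False using that \<open>t = 1\<close> f01 by fastforce
      qed
    qed
    have near: "\<exists>e>0. \<forall>s. \<bar>s - t\<bar> < e \<longrightarrow> (\<forall>j\<in>A. 0 < f j s)" if "A \<subseteq> I" "\<forall>j\<in>A. 0 < f j t" for A t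
    proof -
      have "eventually (\<lambda>s. \<forall>j\<in>A. 0 < f j s) (nhds t)"
      proof (intro eventually_ball_finite ballI)
        show "finite A" using fin that(1) finite_subset by blast
        fix j assume "j \<in> A"
        have "isCont (f j) t" unfolding f_def by (intro continuous_intros)
        then have "(f j \<longlongrightarrow> f j t) (nhds t)" by (simp add: isCont_def tendsto_at_iff_tendsto_nhds)
        then show "eventually (\<lambda>s. 0 < f j s) (nhds t)" using that \<open>j \<in> A\<close> by (auto dest: order_tendstoD)
      qed
      then show ?thesis unfolding eventually_nhds_metric dist_real_def by blast
    qed
    have ex\<alpha>: "\<exists>i\<in>I. f i \<alpha> = 0" if "\<alpha> \<noteq> 0"
    proof (rule ccontr)
      assume "\<not> ?thesis"
      then have "\<forall>j\<in>I. 0 < f j \<alpha>" using \<alpha>(1) unfolding J_def by (metis (mono_tags, lifting) mem_Collect_eq order_le_less)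
      then obtain e where e: "e > 0" "\<And>s. \<bar>s - \<alpha>\<bar> < e \<Longrightarrow> \<forall>j\<in>I. 0 < f j s" using near by blast
      define s where "s = \<alpha> - min (e / 2) \<alpha>"
      have "0 \<le> \<alpha>" "\<alpha> \<le> 1" using J01 \<alpha>(1) by auto
      then have s: "0 \<le> s" "s < \<alpha>" "\<bar>s - \<alpha>\<bar> < e" using that e(1) by (auto simp: s_def)
      then have "s \<in> J" unfolding J_def using e(2)[OF s(3)] \<open>\<alpha> \<le> 1\<close> by (auto intro: less_imp_le)
      then show False using \<alpha>(2) s by force
    qed
    have ex\<beta>: "\<exists>i\<in>I. f i \<beta> = 0" if "\<beta> \<noteq> 1"
    proof (rule ccontr)
      assume "\<not> ?thesis"
      then have "\<forall>j\<in>I. 0 < f j \<beta>" using \<beta>(1) unfolding J_def by (metis (mono_tags, lifting) mem_Collect_eq order_le_less)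
      then obtain e where e: "e > 0" "\<And>s. \<bar>s - \<beta>\<bar> < e \<Longrightarrow> \<forall>j\<in>I. 0 < f j s" using near by blast
      define s where "s = \<beta> + min (e / 2) (1 - \<beta>)"
      have "0 \<le> \<beta>" "\<beta> \<le> 1" using J01 \<beta>(1) by auto
      then have s: "s \<le> 1" "\<beta> < s" "\<bar>s - \<beta>\<bar> < e" using that e(1) by (auto simp: s_def)
      then have "s \<in> J" unfolding J_def using e(2)[OF s(3)] \<open>0 \<le> \<beta>\<close> by (auto intro: less_imp_le)
      then show False using \<beta>(2) s by force
    qed
    have uniq: "i = j" if "t \<in> J" "i \<in> I" "j \<in> I" "f i t = 0" "f j t = 0" for i j t
      using single[of t i j] that unfolding J_def by auto
    have aff: "f i s = f i t + (s - t) * (q i - p i)" for i s t by (simp add: f_def algebra_simps)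
    \<comment> \<open>A wall parallel to the segment would contain all of it; the other functions,
      positive at \<open>\<alpha>\<close>, would then allow the interval to be extended beyond
      \<open>\<alpha>\<close>.\<close>
    have slope: "q i - p i \<noteq> 0" if t: "t \<in> J" "i \<in> I" "f i t = 0" for t i
    proof
      assume z: "q i - p i = 0"
      then have "f i \<alpha> = 0" "f i \<beta> = 0" using aff[of i \<alpha> t] aff[of i \<beta> t] t(3) by simp_all
      have "\<alpha> \<noteq> 0" using nz[OF \<alpha>(1) t(2) \<open>f i \<alpha> = 0\<close>] by simp
      have pos: "\<forall>j\<in>I - {i}. 0 < f j \<alpha>"
        using uniq[OF \<alpha>(1) t(2) _ \<open>f i \<alpha> = 0\<close>] \<alpha>(1) unfolding J_def
        by (metis (mono_tags, lifting) DiffE insertI1 mem_Collect_eq order_le_less)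
      obtain e where e: "e > 0" "\<And>s. \<bar>s - \<alpha>\<bar> < e \<Longrightarrow> \<forall>j\<in>I - {i}. 0 < f j s" using near[OF _ pos] by blast
      define s where "s = \<alpha> - min (e / 2) \<alpha>"
      have "0 \<le> \<alpha>" "\<alpha> \<le> 1" using J01 \<alpha>(1) by auto
      then have s: "0 \<le> s" "s < \<alpha>" "\<bar>s - \<alpha>\<bar> < e" using \<open>\<alpha> \<noteq> 0\<close> e(1) by (auto simp: s_def)
      have "f i s = 0" using aff[of i s t] t(3) z by simp
      then have "0 \<le> f j s" if "j \<in> I" for j using e(2)[OF s(3)] that by (cases "j = i") (auto intro: less_imp_le)
      then have "s \<in> J" unfolding J_def using s \<open>\<alpha> \<le> 1\<close> by auto
      then show False using \<alpha>(2) s by force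
    qed
    have end\<alpha>: "t = \<alpha>" if "t \<in> J" "i \<in> I" "f i t = 0" "q i - p i > 0" for t i
    proof (rule ccontr)
      assume "t \<noteq> \<alpha>"
      then have "\<alpha> - t < 0" using \<alpha>(2) that(1) by force
      then have "f i \<alpha> < 0" using aff[of i \<alpha> t] that by (simp add: mult_neg_pos)
      then show False using \<alpha>(1) that(2) unfolding J_def by force
    qed
    have end\<beta>: "t = \<beta>" if "t \<in> J" "i \<in> I" "f i t = 0" "q i - p i < 0" for t i
    proof (rule ccontr)
      assume "t \<noteq> \<beta>"
      then have "\<beta> - t > 0" using \<beta>(2) that(1) by force
      then have "f i \<beta> < 0" using aff[of i \<beta> t] that by (simp add: mult_pos_neg)
      then show False using \<beta>(1) that(2) unfolding J_def by force
    qed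
    \<comment> \<open>A single touching point is impossible: only one function vanishes there, and
      moving in a direction in which it does not decrease stays inside the cell.\<close>
    have ab: "\<alpha> < \<beta>" if zero: "\<alpha> \<noteq> 0 \<or> \<beta> \<noteq> 1"
    proof (rule ccontr)
      assume "\<not> \<alpha> < \<beta>"
      then have eq: "\<alpha> = \<beta>" using \<alpha>(2)[OF \<beta>(1)] by simp
      have "\<exists>i\<in>I. f i \<alpha> = 0"
        using zero
      proof
        assume "\<alpha> \<noteq> 0"
        then show ?thesis by (rule ex\<alpha>)
      next
        assume "\<beta> \<noteq> 1"
        then show ?thesis unfolding eq by (rule ex\<beta>)
      qed
      then obtain i where i: "i \<in> I" "f i \<alpha> = 0" by blast
      have "\<alpha> \<noteq> 0" "\<alpha> \<noteq> 1" using nz[OF \<alpha>(1) i] by auto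
      then have \<alpha>01: "0 < \<alpha>" "\<alpha> < 1" using J01[OF \<alpha>(1)] by auto
      have pos: "\<forall>j\<in>I - {i}. 0 < f j \<alpha>"
        using uniq[OF \<alpha>(1) i(1) _ i(2)] \<alpha>(1) unfolding J_def
        by (metis (mono_tags, lifting) DiffE insertI1 mem_Collect_eq order_le_less)
      obtain e where e: "e > 0" "\<And>s. \<bar>s - \<alpha>\<bar> < e \<Longrightarrow> \<forall>j\<in>I - {i}. 0 < f j s" using near[OF _ pos] by blast
      define h where "h = min (e / 2) (min \<alpha> (1 - \<alpha>))"
      have h: "h > 0" "h < e" "h \<le> \<alpha>" "h \<le> 1 - \<alpha>" using e(1) \<alpha>01 by (auto simp: h_def)
      define s where "s = (if q i - p i > 0 then \<alpha> + h else \<alpha> - h)"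
      have s: "0 \<le> s" "s \<le> 1" "s \<noteq> \<alpha>" "\<bar>s - \<alpha>\<bar> < e" using h by (auto simp: s_def)
      have "0 \<le> (s - \<alpha>) * (q i - p i)" using h by (auto simp: s_def mult_nonneg_nonpos mult_nonneg_nonpos2 not_less mult_nonneg_nonneg mult_nonpos_nonpos)
      then have "0 \<le> f i s" using aff[of i s \<alpha>] i by simp
      then have "0 \<le> f j s" if "j \<in> I" for j using e(2)[OF s(4)] that by (cases "j = i") (auto intro: less_imp_le)
      then have "s \<in> J" unfolding J_def using s by auto
      then show False using \<alpha>(2)[of s] \<beta>(2)[of s] eq s(3) by force
    qed
    have cl: "\<exists>i. {i\<in>I. f i t = 0} = {i}" if "t \<in> J" "\<exists>i\<in>I. f i t = 0" for t
      using that uniq[OF that(1)] by blast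
    have Zsplit: "Z = {i\<in>I. f i \<alpha> = 0} \<union> {i\<in>I. f i \<beta> = 0}"
    proof
      show "Z \<subseteq> {i\<in>I. f i \<alpha> = 0} \<union> {i\<in>I. f i \<beta> = 0}"
      proof
        fix i assume "i \<in> Z"
        then obtain t where t: "i \<in> I" "t \<in> J" "f i t = 0" unfolding Z by auto
        then have "t = \<alpha> \<or> t = \<beta>" using slope[OF t(2,1,3)] end\<alpha>[OF t(2,1,3)] end\<beta>[OF t(2,1,3)] by linarith
        then show "i \<in> {i\<in>I. f i \<alpha> = 0} \<union> {i\<in>I. f i \<beta> = 0}" using t by auto
      qed
    qed (use Z \<alpha>(1) \<beta>(1) in auto)
    have A: "card {i\<in>I. f i \<alpha> = 0} = of_bool (\<alpha> \<noteq> 0)"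
    proof (cases "\<alpha> = 0")
      case True
      then have "{i\<in>I. f i \<alpha> = 0} = {}" using nz(1)[OF \<alpha>(1)] by auto
      then have "card {i\<in>I. f i \<alpha> = 0} = 0" by (simp only: card.empty)
      moreover have "of_bool (\<alpha> \<noteq> 0) = (0::nat)" using True by simp
      ultimately show ?thesis by linarith
    next
      case False
      then obtain i where "{i\<in>I. f i \<alpha> = 0} = {i}" using cl[OF \<alpha>(1) ex\<alpha>] by blast
      then show ?thesis using False by simp
    qed
    have B: "card {i\<in>I. f i \<beta> = 0} = of_bool (\<beta> \<noteq> 1)"
    proof (cases "\<beta> = 1")
      case True
      then have "{i\<in>I. f i \<beta> = 0} = {}" using nz(2)[OF \<beta>(1)] by auto
      then have "card {i\<in>I. f i \<beta> = 0} = 0" by (simp only: card.empty)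
      moreover have "of_bool (\<beta> \<noteq> 1) = (0::nat)" using True by simp
      ultimately show ?thesis by linarith
    next
      case False
      then obtain i where "{i\<in>I. f i \<beta> = 0} = {i}" using cl[OF \<beta>(1) ex\<beta>] by blast
      then show ?thesis using False by simp
    qed
    have disj: "{i\<in>I. f i \<alpha> = 0} \<inter> {i\<in>I. f i \<beta> = 0} = {}"
    proof (rule ccontr)
      assume "\<not> ?thesis"
      then obtain i where i: "i \<in> I" "f i \<alpha> = 0" "f i \<beta> = 0" by auto
      have "\<alpha> \<noteq> 0" using nz[OF \<alpha>(1) i(1,2)] by simp
      then have "\<alpha> < \<beta>" using ab by simp
      then show False using aff[of i \<beta> \<alpha>] i slope[OF \<alpha>(1) i(1,2)] by simp
    qed
    have "card Z = of_bool (\<alpha> \<noteq> 0) + of_bool (\<beta> \<noteq> 1)"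
      unfolding Zsplit using card_Un_disjoint[OF _ _ disj] fin A B by simp
    moreover have "\<exists>t. 0 \<le> t \<and> t \<le> 1 \<and> (\<forall>i\<in>I. 0 \<le> f i t)" using False unfolding J_def by blast
    moreover have "(\<forall>i\<in>I. 0 \<le> p i) \<longleftrightarrow> \<alpha> = 0" using mem0 \<alpha> J01 by force
    moreover have "(\<forall>i\<in>I. 0 \<le> q i) \<longleftrightarrow> \<beta> = 1" using mem1 \<beta> J01 by force
    ultimately show ?thesis unfolding Z_def[symmetric] by (cases "\<alpha> = 0"; cases "\<beta> = 1") auto
  qed
qed

section \<open>Determinants and barycentric coordinates in space\<close>

definition triple_product :: "real^3 \<Rightarrow> real^3 \<Rightarrow> real^3 \<Rightarrow> real" where
  "triple_product u v w = u$1 * (v$2 * w$3 - v$3 * w$2) - u$2 * (v$1 * w$3 - v$3 * w$1) + u$3 * (v$1 * w$2 - v$2 * w$1)"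

lemma triple_product_linear:
  "triple_product (u + u') v w = triple_product u v w + triple_product u' v w"
  "triple_product u (v + v') w = triple_product u v w + triple_product u v' w"
  "triple_product u v (w + w') = triple_product u v w + triple_product u v w'"
  "triple_product (u - u') v w = triple_product u v w - triple_product u' v w"
  "triple_product u (v - v') w = triple_product u v w - triple_product u v' w"
  "triple_product u v (w - w') = triple_product u v w - triple_product u v w'"
  "triple_product (c *\<^sub>R u) v w = c * triple_product u v w"
  "triple_product u (c *\<^sub>R v) w = c * triple_product u v w"
  "triple_product u v (c *\<^sub>R w) = c * triple_product u v w"
  "triple_product (- u) v w = - triple_product u v w"
  "triple_product u (- v) w = - triple_product u v w"
  "triple_product u v (- w) = - triple_product u v w"
  unfolding triple_product_def by (simp_all add: algebra_simps)

lemma triple_product_same [simp]: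
  "triple_product u u w = 0" "triple_product u w u = 0" "triple_product w u u = 0"
  unfolding triple_product_def by (simp_all add: algebra_simps)

lemma triple_product_swap:
  "triple_product v u w = - triple_product u v w"
  "triple_product u w v = - triple_product u v w"
  "triple_product w v u = - triple_product u v w"
  unfolding triple_product_def by (simp_all add: algebra_simps)

lemma triple_product_zero [simp]:
  "triple_product 0 v w = 0" "triple_product u 0 w = 0" "triple_product u v 0 = 0"
  unfolding triple_product_def by simp_all

text \<open>Cramer's rule without division. When the last determinant vanishes, it expresses a
  vector of a plane through two spanning ones.\<close>

lemma triple_product_cramer:
  "triple_product u v w *\<^sub>R x =
    triple_product x v w *\<^sub>R u + triple_product u x w *\<^sub>R v + triple_product u v x *\<^sub>R w"
  unfolding vec_eq_iff forall_3 triple_product_def by (simp add: algebra_simps)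

lemma barycentric_coordinates:
  fixes a :: "'i \<Rightarrow> real^3"
  assumes I: "I = {i0, i1, i2, i3}" "distinct [i0, i1, i2, i3]"
    and ne: "triple_product (a i1 - a i0) (a i2 - a i0) (a i3 - a i0) \<noteq> 0"
  shows "\<exists>b :: real^3 \<Rightarrow> 'i \<Rightarrow> real.
    (\<forall>x. (\<Sum>i\<in>I. b x i *\<^sub>R a i) = x) \<and> (\<forall>x. sum (b x) I = 1) \<and>
    (\<forall>x y t i. b (x + t *\<^sub>R (y - x)) i = b x i + t * (b y i - b x i)) \<and>
    (\<forall>c x i. sum c I = 1 \<longrightarrow> (\<Sum>i\<in>I. c i *\<^sub>R a i) = x \<longrightarrow> i \<in> I \<longrightarrow> c i = b x i)"
proof -
  define u v w where "u = a i1 - a i0" "v = a i2 - a i0" "w = a i3 - a i0"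
  define D where "D = triple_product u v w"
  have D: "D \<noteq> 0" using ne by (simp add: D_def u_v_w_def)
  define f1 f2 f3 where "f1 x = triple_product (x - a i0) v w / D" "f2 x = triple_product u (x - a i0) w / D"
    "f3 x = triple_product u v (x - a i0) / D" for x
  define b where "b x = (\<lambda>i. if i = i1 then f1 x else if i = i2 then f2 x else if i = i3 then f3 x
    else 1 - f1 x - f2 x - f3 x)" for x
  have bs: "b x i1 = f1 x" "b x i2 = f2 x" "b x i3 = f3 x" "b x i0 = 1 - f1 x - f2 x - f3 x" for x
    using I(2) by (auto simp: b_def)
  have dec: "x - a i0 = f1 x *\<^sub>R u + f2 x *\<^sub>R v + f3 x *\<^sub>R w" for x
  proof -
    have "D *\<^sub>R (x - a i0) = D *\<^sub>R (f1 x *\<^sub>R u + f2 x *\<^sub>R v + f3 x *\<^sub>R w)"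
      using triple_product_cramer[of u v w "x - a i0"] D
      unfolding D_def[symmetric] f1_f2_f3_def by (simp add: scaleR_add_right)
    then show ?thesis using D by simp
  qed
  have B1: "(\<Sum>i\<in>I. b x i *\<^sub>R a i) = x" for x
  proof -
    have "(\<Sum>i\<in>I. b x i *\<^sub>R a i) = a i0 + (f1 x *\<^sub>R u + f2 x *\<^sub>R v + f3 x *\<^sub>R w)"
      unfolding I(1) u_v_w_def using I(2) by (simp add: bs algebra_simps)
    then show ?thesis unfolding dec[symmetric] by simp
  qed
  have B2: "sum (b x) I = 1" for x unfolding I(1) using I(2) by (simp add: bs)
  have B3: "b (x + t *\<^sub>R (y - x)) i = b x i + t * (b y i - b x i)" for x y t i
  proof -
    have "x + t *\<^sub>R (y - x) - a i0 = (x - a i0) + t *\<^sub>R ((y - a i0) - (x - a i0))" by simp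
    then have "f1 (x + t *\<^sub>R (y - x)) = f1 x + t * (f1 y - f1 x)" "f2 (x + t *\<^sub>R (y - x)) = f2 x + t * (f2 y - f2 x)"
      "f3 (x + t *\<^sub>R (y - x)) = f3 x + t * (f3 y - f3 x)"
      unfolding f1_f2_f3_def using D by (simp_all only: triple_product_linear) (simp_all add: field_simps)
    then show ?thesis unfolding b_def by (simp add: algebra_simps)
  qed
  have B4: "c i = b x i" if c: "sum c I = 1" "(\<Sum>i\<in>I. c i *\<^sub>R a i) = x" "i \<in> I" for c x i
  proof -
    have c0: "c i0 = 1 - c i1 - c i2 - c i3" using c(1) I by simp
    have "x - a i0 = c i1 *\<^sub>R u + c i2 *\<^sub>R v + c i3 *\<^sub>R w"
    proof -
      have "c i0 *\<^sub>R a i0 + (c i1 *\<^sub>R a i0 + (c i2 *\<^sub>R a i0 + c i3 *\<^sub>R a i0)) = a i0"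
        unfolding scaleR_add_left[symmetric] using c0 by simp
      then show ?thesis
        unfolding c(2)[symmetric] I(1) u_v_w_def using I(2) by (simp add: algebra_simps)
    qed
    then have "f1 x = c i1" "f2 x = c i2" "f3 x = c i3"
      unfolding f1_f2_f3_def using D by (simp_all add: triple_product_linear D_def)
    then show ?thesis using c(3) c0 unfolding I(1) by (auto simp: bs)
  qed
  show ?thesis
    by (intro exI[of _ b] conjI allI impI B1 B2 B3 B4)
qed

section \<open>The mod 2 colouring of the complement\<close>

text \<open>Coefficients are indexed by vertices instead of points, which is the form in which
  dependences and barycentric coordinates are stated.\<close>

lemma convex_hull_image_finite:
  fixes a :: "'i \<Rightarrow> 'a::real_vector"
  assumes "finite I"
  shows "convex hull (a ` I) = {\<Sum>i\<in>I. c i *\<^sub>R a i | c. (\<forall>i\<in>I. 0 \<le> c i) \<and> sum c I = 1}"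
  using assms
proof -
  show ?thesis
  proof
    show "convex hull (a ` I) \<subseteq> {\<Sum>i\<in>I. c i *\<^sub>R a i | c. (\<forall>i\<in>I. 0 \<le> c i) \<and> sum c I = 1}"
    proof (rule hull_minimal)
      show "a ` I \<subseteq> {\<Sum>i\<in>I. c i *\<^sub>R a i | c. (\<forall>i\<in>I. 0 \<le> c i) \<and> sum c I = 1}"
      proof
        fix x assume "x \<in> a ` I"
        then obtain i where i: "i \<in> I" "x = a i" by auto
        have "x = (\<Sum>j\<in>I. (if j = i then 1 else 0) *\<^sub>R a j)"
          using i assms by (simp add: if_distrib[where f = "\<lambda>c. c *\<^sub>R _"] sum.delta cong: if_cong)
        moreover have "sum (\<lambda>j. if j = i then 1 else 0 :: real) I = 1" using i assms by simp
        ultimately show "x \<in> {\<Sum>i\<in>I. c i *\<^sub>R a i | c. (\<forall>i\<in>I. 0 \<le> c i) \<and> sum c I = 1}"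
          by (intro CollectI exI[of _ "\<lambda>j. if j = i then 1 else 0"]) simp
      qed
      show "convex {\<Sum>i\<in>I. c i *\<^sub>R a i | c. (\<forall>i\<in>I. 0 \<le> c i) \<and> sum c I = 1}"
      proof (rule convexI)
        fix x y and u v :: real
        assume uv: "0 \<le> u" "0 \<le> v" "u + v = 1"
          and "x \<in> {\<Sum>i\<in>I. c i *\<^sub>R a i | c. (\<forall>i\<in>I. 0 \<le> c i) \<and> sum c I = 1}"
            "y \<in> {\<Sum>i\<in>I. c i *\<^sub>R a i | c. (\<forall>i\<in>I. 0 \<le> c i) \<and> sum c I = 1}"
        then obtain c d where c: "x = (\<Sum>i\<in>I. c i *\<^sub>R a i)" "\<forall>i\<in>I. 0 \<le> c i" "sum c I = 1"
          and d: "y = (\<Sum>i\<in>I. d i *\<^sub>R a i)" "\<forall>i\<in>I. 0 \<le> d i" "sum d I = 1" by auto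
        have "u *\<^sub>R x + v *\<^sub>R y = (\<Sum>i\<in>I. (u * c i + v * d i) *\<^sub>R a i)"
          unfolding c d by (simp add: scaleR_sum_right scaleR_add_left sum.distrib)
        moreover have "\<forall>i\<in>I. 0 \<le> u * c i + v * d i" using uv c d by simp
        moreover have "(\<Sum>i\<in>I. u * c i + v * d i) = 1"
          unfolding sum.distrib sum_distrib_left[symmetric] using c d uv by simp
        ultimately show "u *\<^sub>R x + v *\<^sub>R y \<in> {\<Sum>i\<in>I. c i *\<^sub>R a i | c. (\<forall>i\<in>I. 0 \<le> c i) \<and> sum c I = 1}"
          by (intro CollectI exI[of _ "\<lambda>i. u * c i + v * d i"]) simp
      qed
    qed
    show "{\<Sum>i\<in>I. c i *\<^sub>R a i | c. (\<forall>i\<in>I. 0 \<le> c i) \<and> sum c I = 1} \<subseteq> convex hull (a ` I)"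
    proof
      fix x assume "x \<in> {\<Sum>i\<in>I. c i *\<^sub>R a i | c. (\<forall>i\<in>I. 0 \<le> c i) \<and> sum c I = 1}"
      then obtain c where c: "x = (\<Sum>i\<in>I. c i *\<^sub>R a i)" "\<forall>i\<in>I. 0 \<le> c i" "sum c I = 1" by auto
      show "x \<in> convex hull (a ` I)" unfolding c(1)
        by (rule convex_sum[OF assms convex_convex_hull c(3)]) (use c(2) in \<open>auto intro: hull_inc\<close>)
    qed
  qed
qed

lemma mem_hull_face:
  fixes a :: "'i \<Rightarrow> real^3"
  assumes fin: "finite I" and FI: "F \<subseteq> I"
    and b: "\<And>x. (\<Sum>i\<in>I. b x i *\<^sub>R a i) = x" "\<And>x. sum (b x) I = 1"
      "\<And>c x i. sum c I = 1 \<Longrightarrow> (\<Sum>i\<in>I. c i *\<^sub>R a i) = x \<Longrightarrow> i \<in> I \<Longrightarrow> c i = b x i"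
  shows "x \<in> convex hull (a ` F) \<longleftrightarrow> (\<forall>i\<in>I. 0 \<le> b x i) \<and> (\<forall>i\<in>I - F. b x i = 0)"
proof -
  have finF: "finite F" using fin FI finite_subset by blast
  show ?thesis
  proof
    assume "x \<in> convex hull (a ` F)"
    then obtain c where c: "x = (\<Sum>i\<in>F. c i *\<^sub>R a i)" "\<forall>i\<in>F. 0 \<le> c i" "sum c F = 1"
      unfolding convex_hull_image_finite[OF finF] by auto
    define c' where "c' i = (if i \<in> F then c i else 0)" for i
    have "sum c' I = sum c F"
      unfolding c'_def using fin FI by (simp add: sum.If_cases Int_absorb1)
    moreover have "(\<Sum>i\<in>I. c' i *\<^sub>R a i) = (\<Sum>i\<in>F. c i *\<^sub>R a i)"
      by (rule sum.mono_neutral_cong_right[OF fin FI]) (auto simp: c'_def)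
    ultimately have "c' i = b x i" if "i \<in> I" for i using b(3)[of c' x i] c that by simp
    then show "(\<forall>i\<in>I. 0 \<le> b x i) \<and> (\<forall>i\<in>I - F. b x i = 0)" using c(2) unfolding c'_def by (metis DiffE order_refl)
  next
    assume r: "(\<forall>i\<in>I. 0 \<le> b x i) \<and> (\<forall>i\<in>I - F. b x i = 0)"
    have "sum (b x) F = 1" using sum.mono_neutral_left[OF fin FI, of "b x"] r b(2)[of x] by simp
    moreover have "(\<Sum>i\<in>F. b x i *\<^sub>R a i) = x"
      using sum.mono_neutral_left[OF fin FI, of "\<lambda>i. b x i *\<^sub>R a i"] r b(1)[of x] by simp
    ultimately show "x \<in> convex hull (a ` F)"
      unfolding convex_hull_image_finite[OF finF] using r FI by (intro CollectI exI[of _ "b x"]) auto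
  qed
qed

text \<open>The case of \<open>segment_cell_crossings\<close> in which the walls are the zero sets
  of the four barycentric coordinates; a segment that misses the edges never meets two faces at the
  same point.\<close>

lemma tetrahedron_parity:
  fixes a :: "'i \<Rightarrow> real^3"
  assumes I: "I = {i0, i1, i2, i3}" "distinct [i0, i1, i2, i3]"
    and ne: "triple_product (a i1 - a i0) (a i2 - a i0) (a i3 - a i0) \<noteq> 0"
    and PQ: "\<And>i. i \<in> I \<Longrightarrow> P \<notin> convex hull (a ` (I - {i}))" "\<And>i. i \<in> I \<Longrightarrow> Q \<notin> convex hull (a ` (I - {i}))"
    and edge: "\<And>i j. i \<in> I \<Longrightarrow> j \<in> I \<Longrightarrow> i \<noteq> j \<Longrightarrow> closed_segment P Q \<inter> convex hull (a ` (I - {i, j})) = {}"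
  shows "even (card {i\<in>I. closed_segment P Q \<inter> convex hull (a ` (I - {i})) \<noteq> {}} +
     of_bool (P \<in> convex hull (a ` I)) + of_bool (Q \<in> convex hull (a ` I)))"
proof -
  obtain b :: "real^3 \<Rightarrow> 'i \<Rightarrow> real" where B:
    "\<forall>x. (\<Sum>i\<in>I. b x i *\<^sub>R a i) = x" "\<forall>x. sum (b x) I = 1"
    "\<forall>x y t i. b (x + t *\<^sub>R (y - x)) i = b x i + t * (b y i - b x i)"
    "\<forall>c x i. sum c I = 1 \<longrightarrow> (\<Sum>i\<in>I. c i *\<^sub>R a i) = x \<longrightarrow> i \<in> I \<longrightarrow> c i = b x i"
    using barycentric_coordinates[OF I ne] by (elim exE conjE) (rule that)
  have b: "(\<Sum>i\<in>I. b x i *\<^sub>R a i) = x" "sum (b x) I = 1" for x using B(1,2) by blast+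
  have aff: "b (x + t *\<^sub>R (y - x)) i = b x i + t * (b y i - b x i)" for x y t i using B(3) by blast
  have b': "c i = b x i" if "sum c I = 1" "(\<Sum>i\<in>I. c i *\<^sub>R a i) = x" "i \<in> I" for c x i
    using B(4) that by blast
  have fin: "finite I" using I by simp
  have mem: "x \<in> convex hull (a ` F) \<longleftrightarrow> (\<forall>i\<in>I. 0 \<le> b x i) \<and> (\<forall>i\<in>I - F. b x i = 0)" if "F \<subseteq> I" for x F
    by (rule mem_hull_face[where b = b, OF fin that]) (fact b b')+
  have all: "x \<in> convex hull (a ` I) \<longleftrightarrow> (\<forall>i\<in>I. 0 \<le> b x i)" for x using mem[of I x] by simp
  have face: "x \<in> convex hull (a ` (I - {i})) \<longleftrightarrow> (\<forall>i\<in>I. 0 \<le> b x i) \<and> b x i = 0" if "i \<in> I" for x i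
    using mem[of "I - {i}" x] that by (simp add: double_diff)
  have seg: "closed_segment P Q = {P + t *\<^sub>R (Q - P) | t. 0 \<le> t \<and> t \<le> 1}"
    unfolding closed_segment_def by (auto simp: algebra_simps)
  have 1: "\<forall>i\<in>I. 0 < b P i" if "\<forall>i\<in>I. 0 \<le> b P i"
    using that PQ(1) face by (metis order_le_less)
  have 2: "\<forall>i\<in>I. 0 < b Q i" if "\<forall>i\<in>I. 0 \<le> b Q i"
    using that PQ(2) face by (metis order_le_less)
  have 3: "i = j" if t: "0 \<le> t" "t \<le> 1" "\<forall>i\<in>I. 0 \<le> b P i + t * (b Q i - b P i)" "i \<in> I" "j \<in> I"
    "b P i + t * (b Q i - b P i) = 0" "b P j + t * (b Q j - b P j) = 0" for t i j
  proof (rule ccontr)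
    assume "i \<noteq> j"
    define x where "x = P + t *\<^sub>R (Q - P)"
    have "x \<in> closed_segment P Q" unfolding seg x_def using t by blast
    moreover have "\<forall>i\<in>I. 0 \<le> b x i" "b x i = 0" "b x j = 0" using t unfolding x_def aff by auto
    then have "x \<in> convex hull (a ` (I - {i, j}))" using mem[of "I - {i, j}" x] by auto
    ultimately show False using edge[OF t(4,5) \<open>i \<noteq> j\<close>] by blast
  qed
  have "closed_segment P Q \<inter> convex hull (a ` (I - {i})) \<noteq> {} \<longleftrightarrow>
      (\<exists>t. 0 \<le> t \<and> t \<le> 1 \<and> b P i + t * (b Q i - b P i) = 0 \<and> (\<forall>j\<in>I. 0 \<le> b P j + t * (b Q j - b P j)))"
    if "i \<in> I" for i
  proof -
    have *: "closed_segment P Q \<inter> H \<noteq> {} \<longleftrightarrow> (\<exists>t. 0 \<le> t \<and> t \<le> 1 \<and> P + t *\<^sub>R (Q - P) \<in> H)" for H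
      unfolding seg by blast
    show ?thesis unfolding * face[OF that] aff by (simp only: conj_ac)
  qed
  then have "{i\<in>I. closed_segment P Q \<inter> convex hull (a ` (I - {i})) \<noteq> {}} =
    {i\<in>I. \<exists>t. 0 \<le> t \<and> t \<le> 1 \<and> b P i + t * (b Q i - b P i) = 0 \<and> (\<forall>j\<in>I. 0 \<le> b P j + t * (b Q j - b P j))}"
    by blast
  then show ?thesis
    unfolding all using segment_cell_crossings[OF fin 1 2 3] by (simp split: if_splits)
qed

section \<open>Apices in general position\<close>

lemma affine_hull_3_negligible:
  fixes x y z :: "real^3"
  shows "negligible (affine hull {x, y, z})"
proof -
  have "dim {y - x, z - x} \<le> card {y - x, z - x}" by (rule dim_le_card') simp
  also have "\<dots> \<le> 2" by (simp add: card_insert_if)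
  finally have "dim {y - x, z - x} < DIM(real^3)" by simp
  then obtain n where n: "n \<noteq> 0" "span {y - x, z - x} \<subseteq> {v. n \<bullet> v = 0}"
    using lowdim_subset_hyperplane by blast
  have "n \<bullet> (y - x) = 0" "n \<bullet> (z - x) = 0" using n(2) span_superset[of "{y - x, z - x}"] by auto
  then have "{x, y, z} \<subseteq> {v. n \<bullet> v = n \<bullet> x}" by (auto simp: inner_diff_right)
  then have "affine hull {x, y, z} \<subseteq> {v. n \<bullet> v = n \<bullet> x}"
    by (intro hull_minimal affine_hyperplane)
  then show ?thesis using negligible_hyperplane[of n "n \<bullet> x"] n(1) negligible_subset by blast
qed

text \<open>The planes, lines and points spanned by finitely many points form a null set.\<close>

lemma generic_point:
  fixes W :: "(real^3) set"
  assumes "finite W"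
  obtains c where "\<And>x y z. x \<in> W \<Longrightarrow> y \<in> W \<Longrightarrow> z \<in> W \<Longrightarrow> c \<notin> affine hull {x, y, z}"
proof -
  have "negligible (\<Union>x\<in>W. \<Union>y\<in>W. \<Union>z\<in>W. affine hull {x, y, z})"
    using assms by (intro negligible_Union finite_imageI ballI) (auto intro!: negligible_Union affine_hull_3_negligible)
  then have "(\<Union>x\<in>W. \<Union>y\<in>W. \<Union>z\<in>W. affine hull {x, y, z}) \<noteq> UNIV"
    using non_negligible_UNIV by metis
  then obtain c where "c \<notin> (\<Union>x\<in>W. \<Union>y\<in>W. \<Union>z\<in>W. affine hull {x, y, z})" by blast
  then show ?thesis using that[of c] by blast
qed

text \<open>By Cramer's rule a vanishing determinant would place \<open>o'\<close> in the plane of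
  \<open>a\<close>, \<open>b\<close>, \<open>c\<close>; the auxiliary \<open>v\<close> witnesses
  that these three are not collinear.\<close>

lemma triple_product_eq_0_iff_affine:
  fixes o' a b c :: "real^3"
  assumes "o' \<notin> affine hull {a, b, c}" "triple_product (b - a) (c - a) v \<noteq> 0"
  shows "triple_product (a - o') (b - o') (c - o') \<noteq> 0"
proof
  assume z: "triple_product (a - o') (b - o') (c - o') = 0"
  define p where "p = o' - a"
  have "a - o' = - p" "b - o' = (b - a) - p" "c - o' = (c - a) - p" by (simp_all add: p_def)
  with z have "triple_product (b - a) (c - a) p = 0"
    by (simp add: triple_product_linear triple_product_swap[of _ p] triple_product_swap(2)[of _ p])
      (simp add: triple_product_def algebra_simps)
  then have *: "triple_product (b - a) (c - a) v *\<^sub>R p =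
      triple_product p (c - a) v *\<^sub>R (b - a) + triple_product (b - a) p v *\<^sub>R (c - a)"
    using triple_product_cramer[of "b - a" "c - a" v p] by simp
  have "p = (triple_product p (c - a) v / triple_product (b - a) (c - a) v) *\<^sub>R (b - a) +
       (triple_product (b - a) p v / triple_product (b - a) (c - a) v) *\<^sub>R (c - a)" (is "_ = ?s *\<^sub>R _ + ?t *\<^sub>R _")
  proof -
    have "p = (1 / triple_product (b - a) (c - a) v) *\<^sub>R (triple_product (b - a) (c - a) v *\<^sub>R p)"
      using assms(2) by simp
    then show ?thesis unfolding * by (simp add: scaleR_add_right)
  qed
  then have "o' = (1 - ?s - ?t) *\<^sub>R a + ?s *\<^sub>R b + ?t *\<^sub>R c"
    unfolding p_def by (simp add: algebra_simps)
  then have "o' \<in> affine hull {a, b, c}" unfolding affine_hull_3 by force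
  then show False using assms(1) by blast
qed

text \<open>A point of the cone off its base has positive weight at the apex, so the equation can be
  solved for the apex. For a generic apex this excludes points from cones over edges.\<close>

lemma apex_not_in_hull:
  fixes o' :: "'a::real_vector"
  assumes "finite W" "p \<in> convex hull (insert o' W)" "p \<notin> convex hull W"
  shows "o' \<in> affine hull (insert p W)"
proof (cases "W = {}")
  case True
  then show ?thesis using assms(2) by (simp add: hull_inc)
next
  case False
  then obtain u v y where uv: "0 \<le> u" "0 \<le> v" "u + v = 1" "y \<in> convex hull W" "p = u *\<^sub>R o' + v *\<^sub>R y"
    using assms(2) unfolding convex_hull_insert[OF False] by auto
  have "u \<noteq> 0" using uv assms(3) by auto
  have "o' = (1 / u) *\<^sub>R p + (- v / u) *\<^sub>R y"
    using uv(5) \<open>u \<noteq> 0\<close> by (simp add: field_simps scaleR_add_right)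
  moreover have "1 / u + (- v / u) = 1" using uv(3) \<open>u \<noteq> 0\<close> by (simp add: field_simps)
  moreover have "p \<in> affine hull (insert p W)" by (simp add: hull_inc)
  moreover have "y \<in> affine hull (insert p W)"
    using uv(4) convex_hull_subset_affine_hull[of W] hull_mono[of W "insert p W" affine] by blast
  ultimately show ?thesis
    using mem_affine[OF affine_affine_hull, of p "insert p W" y "1 / u" "- v / u"] by simp
qed

lemma card_filter_sum: "finite A \<Longrightarrow> card {i\<in>A. P i} = (\<Sum>i\<in>A. of_bool (P i))"
  by (simp only: card_eq_sum sum.inter_filter of_bool_def)

text \<open>
  The colour of a point is the parity of the number of tetrahedra \<open>o * \<sigma>\<close> containing it, for a
  generic apex \<open>o\<close>: the side faces \<open>o * e\<close> cancel because every edge lies in an even number of triangles.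
\<close>

theorem mod_2_colouring:
  fixes \<psi> :: "'v \<Rightarrow> real^3" and \<Delta> :: "'v set set"
  assumes fin: "finite \<Delta>" "finite S" and c3: "\<And>\<sigma>. \<sigma> \<in> \<Delta> \<Longrightarrow> card \<sigma> = 3"
    and closed: "\<And>e. card e = 2 \<Longrightarrow> even (card {\<sigma>\<in>\<Delta>. e \<subseteq> \<sigma>})"
    and nondeg: "\<And>a b c. {a, b, c} \<in> \<Delta> \<Longrightarrow> distinct [a, b, c] \<Longrightarrow> \<exists>v. triple_product (\<psi> b - \<psi> a) (\<psi> c - \<psi> a) v \<noteq> 0"
  obtains w :: "real^3 \<Rightarrow> bool" where
    "\<And>P Q. P \<in> S \<Longrightarrow> Q \<in> S \<Longrightarrow>
       (\<And>\<sigma>. \<sigma> \<in> \<Delta> \<Longrightarrow> P \<notin> convex hull (\<psi> ` \<sigma>) \<and> Q \<notin> convex hull (\<psi> ` \<sigma>)) \<Longrightarrow>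
       (\<And>\<sigma> e. \<sigma> \<in> \<Delta> \<Longrightarrow> e \<subseteq> \<sigma> \<Longrightarrow> card e = 2 \<Longrightarrow> closed_segment P Q \<inter> convex hull (\<psi> ` e) = {}) \<Longrightarrow>
       w P = w Q \<longleftrightarrow> even (card {\<sigma>\<in>\<Delta>. closed_segment P Q \<inter> convex hull (\<psi> ` \<sigma>) \<noteq> {}})"
proof -
  define V where "V = \<Union>\<Delta>"
  have fin\<sigma>: "finite \<sigma>" if "\<sigma> \<in> \<Delta>" for \<sigma> using c3[OF that] card.infinite by fastforce
  have finV: "finite V" unfolding V_def using fin fin\<sigma> by blast
  \<comment> \<open>The apex is generic with respect to \<open>S\<close> as well. This is where
    finiteness of \<open>S\<close> enters, and why colours are compared only at points of
    \<open>S\<close>.\<close>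
  obtain o' where o': "\<And>x y z. x \<in> S \<union> \<psi> ` V \<Longrightarrow> y \<in> S \<union> \<psi> ` V \<Longrightarrow> z \<in> S \<union> \<psi> ` V \<Longrightarrow> o' \<notin> affine hull {x, y, z}"
  proof -
    have "finite (S \<union> \<psi> ` V)" using fin finV by simp
    from generic_point[OF this] show ?thesis using that by blast
  qed
  define w where "w P = odd (\<Sum>\<sigma>\<in>\<Delta>. of_bool (P \<in> convex hull (insert o' (\<psi> ` \<sigma>))) :: nat)" for P
  define E where "E \<sigma> = {e. e \<subseteq> \<sigma> \<and> card e = 2}" for \<sigma> :: "'v set"
  \<comment> \<open>Parity for the tetrahedron with apex \<open>o'\<close> over
    \<open>\<sigma>\<close>: its faces are \<open>\<sigma>\<close> and the cones over the three
    edges of \<open>\<sigma>\<close>.\<close>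
  have main: "even (of_bool (closed_segment P Q \<inter> convex hull (\<psi> ` \<sigma>) \<noteq> {}) +
      (\<Sum>e\<in>E \<sigma>. of_bool (closed_segment P Q \<inter> convex hull (insert o' (\<psi> ` e)) \<noteq> {})) +
      of_bool (P \<in> convex hull (insert o' (\<psi> ` \<sigma>))) + of_bool (Q \<in> convex hull (insert o' (\<psi> ` \<sigma>))) :: nat)"
    if \<sigma>: "\<sigma> \<in> \<Delta>" and PQS: "P \<in> S" "Q \<in> S"
      and off: "\<And>\<sigma>. \<sigma> \<in> \<Delta> \<Longrightarrow> P \<notin> convex hull (\<psi> ` \<sigma>) \<and> Q \<notin> convex hull (\<psi> ` \<sigma>)"
      and edges: "\<And>\<sigma> e. \<sigma> \<in> \<Delta> \<Longrightarrow> e \<subseteq> \<sigma> \<Longrightarrow> card e = 2 \<Longrightarrow> closed_segment P Q \<inter> convex hull (\<psi> ` e) = {}" for P Q \<sigma>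
  proof -
    obtain x y z where xyz: "\<sigma> = {x, y, z}" "distinct [x, y, z]" using c3[OF \<sigma>] by (auto simp: card_3_iff)
    have "\<sigma> \<subseteq> V" using \<sigma> unfolding V_def by (rule Union_upper)
    then have inV: "x \<in> V" "y \<in> V" "z \<in> V" using xyz(1) by simp_all
    have c2: "card (\<sigma> - {s}) = 2" if "s \<in> \<sigma>" for s using c3[OF \<sigma>] fin\<sigma>[OF \<sigma>] that by simp
    \<comment> \<open>The apex receives the index \<open>None\<close>, which keeps it apart from all
      vertices.\<close>
    define a where "a = case_option o' \<psi>"
    define I where "I = {None, Some x, Some y, Some z}"
    have aF: "a ` insert None (Some ` F) = insert o' (\<psi> ` F)" "a ` Some ` F = \<psi> ` F" for F
      unfolding a_def by (auto simp: image_image)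
    have I': "I = insert None (Some ` \<sigma>)" unfolding I_def xyz by simp
    obtain v where v: "triple_product (\<psi> y - \<psi> x) (\<psi> z - \<psi> x) v \<noteq> 0" using nondeg \<sigma> xyz by metis
    have tp: "triple_product (a (Some x) - a None) (a (Some y) - a None) (a (Some z) - a None) \<noteq> 0"
      using triple_product_eq_0_iff_affine[OF o' v] inV unfolding a_def by simp
    have oe: "p \<notin> convex hull (insert o' (\<psi> ` e))"
      if h: "p \<in> {P, Q}" "e \<subseteq> \<sigma>" "card e = 2" for p e
    proof
      assume p: "p \<in> convex hull (insert o' (\<psi> ` e))"
      obtain s t where st: "e = {s, t}" using h(3) by (auto simp: card_2_iff)
      have "p \<notin> convex hull (\<psi> ` e)"
        using off[OF \<sigma>] h(1) hull_mono[OF image_mono[OF h(2)], of convex \<psi>] by blast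
      then have "o' \<in> affine hull (insert p (\<psi> ` e))" using apex_not_in_hull[of "\<psi> ` e" p o'] p st by simp
      then show False using o'[of p "\<psi> s" "\<psi> t"] h st PQS \<sigma> V_def by auto
    qed
    \<comment> \<open>Meeting an edge at the apex would place the apex in the plane of
      \<open>P\<close>, \<open>Q\<close> and a vertex.\<close>
    have ov: "closed_segment P Q \<inter> convex hull (insert o' (\<psi> ` {s})) = {}" if s: "s \<in> \<sigma>" for s
    proof (rule ccontr)
      assume "\<not> ?thesis"
      then obtain p where p: "p \<in> closed_segment P Q" "p \<in> convex hull (insert o' (\<psi> ` {s}))" by blast
      have "\<sigma> - {s} \<noteq> {}" using c2[OF s] by (metis card.empty zero_neq_numeral)
      then obtain r where "r \<in> \<sigma>" "r \<noteq> s" by blast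
      then obtain e where e: "s \<in> e" "e \<subseteq> \<sigma>" "card e = 2" using s c2[of r] by (intro that[of "\<sigma> - {r}"]) auto
      have "\<psi> s \<in> convex hull (\<psi> ` e)" using e(1) by (simp add: hull_inc)
      then have "p \<noteq> \<psi> s" using edges[OF \<sigma> e(2,3)] p(1) by blast
      then have "o' \<in> affine hull (insert p (\<psi> ` {s}))" using apex_not_in_hull[of "\<psi> ` {s}" p o'] p(2) by simp
      moreover have "insert p (\<psi> ` {s}) \<subseteq> affine hull {P, Q, \<psi> s}"
      proof -
        have "p \<in> affine hull {P, Q}"
          using p(1) unfolding segment_convex_hull using convex_hull_subset_affine_hull by blast
        then have "p \<in> affine hull {P, Q, \<psi> s}" using hull_mono[of "{P, Q}" "{P, Q, \<psi> s}" affine] by blast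
        then show ?thesis by (simp add: hull_inc)
      qed
      then have "affine hull (insert p (\<psi> ` {s})) \<subseteq> affine hull {P, Q, \<psi> s}"
        by (intro hull_minimal affine_affine_hull)
      ultimately show False using o'[of P Q "\<psi> s"] PQS s \<sigma> V_def by auto
    qed
    have par: "even (card {i\<in>I. closed_segment P Q \<inter> convex hull (a ` (I - {i})) \<noteq> {}} +
      of_bool (P \<in> convex hull (a ` I)) + of_bool (Q \<in> convex hull (a ` I)))"
    proof (rule tetrahedron_parity[OF I_def _ tp])
      show "distinct [None, Some x, Some y, Some z]" using xyz(2) by simp
      have D: "I - {None} = Some ` \<sigma>" "I - {Some s} = insert None (Some ` (\<sigma> - {s}))" for s
        unfolding I' by auto
      show "P \<notin> convex hull (a ` (I - {i}))" if "i \<in> I" for i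
      proof (cases i)
        case None then show ?thesis using off[OF \<sigma>] D aF by simp
      next
        case (Some s)
        then have "s \<in> \<sigma>" using that I' by auto
        then show ?thesis unfolding Some D aF using oe[of P "\<sigma> - {s}"] c2 by auto
      qed
      show "Q \<notin> convex hull (a ` (I - {i}))" if "i \<in> I" for i
      proof (cases i)
        case None then show ?thesis using off[OF \<sigma>] D aF by simp
      next
        case (Some s)
        then have "s \<in> \<sigma>" using that I' by auto
        then show ?thesis unfolding Some D aF using oe[of Q "\<sigma> - {s}"] c2 by auto
      qed
      have D2: "closed_segment P Q \<inter> convex hull (a ` (I - {None, Some s})) = {}" if "s \<in> \<sigma>" for s
      proof -
        have "I - {None, Some s} = Some ` (\<sigma> - {s})" unfolding I' by auto
        then show ?thesis using edges[OF \<sigma> _ c2[OF that]] aF by simp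
      qed
      show "closed_segment P Q \<inter> convex hull (a ` (I - {i, j})) = {}" if ij: "i \<in> I" "j \<in> I" "i \<noteq> j" for i j
      proof (cases i)
        case None
        then obtain s where "j = Some s" "s \<in> \<sigma>" using ij I' by auto
        then show ?thesis using D2 None by simp
      next
        case (Some s)
        then have s: "s \<in> \<sigma>" using ij I' by auto
        show ?thesis
        proof (cases j)
          case None
          then show ?thesis using D2[OF s] Some by (simp add: insert_commute)
        next
          case (Some t)
          then have t: "t \<in> \<sigma>" "s \<noteq> t" using ij I' \<open>i = Some s\<close> by auto
          then have "card (\<sigma> - {s, t}) = 1" using c3[OF \<sigma>] fin\<sigma>[OF \<sigma>] s by (simp add: card_Diff_subset)
          then obtain r where r: "\<sigma> - {s, t} = {r}" by (auto simp: card_1_singleton_iff)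
          have "I - {i, j} = insert None (Some ` {r})" unfolding r[symmetric] I' Some \<open>i = Some s\<close> by auto
          then show ?thesis using ov[of r] r aF by (metis DiffE insertI1)
        qed
      qed
    qed
    have "card {i\<in>I. closed_segment P Q \<inter> convex hull (a ` (I - {i})) \<noteq> {}} =
      of_bool (closed_segment P Q \<inter> convex hull (\<psi> ` \<sigma>) \<noteq> {}) +
      (\<Sum>e\<in>E \<sigma>. of_bool (closed_segment P Q \<inter> convex hull (insert o' (\<psi> ` e)) \<noteq> {}))"
    proof -
      have "card {i\<in>I. closed_segment P Q \<inter> convex hull (a ` (I - {i})) \<noteq> {}} =
        (\<Sum>i\<in>I. of_bool (closed_segment P Q \<inter> convex hull (a ` (I - {i})) \<noteq> {}))"
        by (rule card_filter_sum) (simp add: I_def)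
      also have "\<dots> = of_bool (closed_segment P Q \<inter> convex hull (a ` (I - {None})) \<noteq> {}) +
        (\<Sum>i\<in>Some ` \<sigma>. of_bool (closed_segment P Q \<inter> convex hull (a ` (I - {i})) \<noteq> {}))"
        unfolding I' using fin\<sigma>[OF \<sigma>] by (subst sum.insert) auto
      also have "I - {None} = Some ` \<sigma>" unfolding I' by auto
      also have "(\<Sum>i\<in>Some ` \<sigma>. of_bool (closed_segment P Q \<inter> convex hull (a ` (I - {i})) \<noteq> {}) :: nat) =
        (\<Sum>s\<in>\<sigma>. of_bool (closed_segment P Q \<inter> convex hull (insert o' (\<psi> ` (\<sigma> - {s}))) \<noteq> {}))"
      proof -
        have "I - {Some s} = insert None (Some ` (\<sigma> - {s}))" for s unfolding I' by auto
        then show ?thesis by (simp only: sum.reindex inj_Some inj_on_subset[OF inj_Some subset_UNIV] comp_def aF)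
      qed
      also have "\<dots> = (\<Sum>e\<in>E \<sigma>. of_bool (closed_segment P Q \<inter> convex hull (insert o' (\<psi> ` e)) \<noteq> {}))"
      proof (rule sum.reindex_bij_betw)
        have "E \<sigma> = (\<lambda>s. \<sigma> - {s}) ` \<sigma>"
        proof
          show "(\<lambda>s. \<sigma> - {s}) ` \<sigma> \<subseteq> E \<sigma>" using c3[OF \<sigma>] fin\<sigma>[OF \<sigma>] by (auto simp: E_def)
          show "E \<sigma> \<subseteq> (\<lambda>s. \<sigma> - {s}) ` \<sigma>"
          proof
            fix e assume "e \<in> E \<sigma>"
            then have e: "e \<subseteq> \<sigma>" "card e = 2" by (auto simp: E_def)
            then have "card (\<sigma> - e) = 1" using c3[OF \<sigma>] fin\<sigma>[OF \<sigma>] by (simp add: card_Diff_subset finite_subset)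
            then obtain s where "\<sigma> - e = {s}" by (auto simp: card_1_singleton_iff)
            then have "e = \<sigma> - {s}" "s \<in> \<sigma>" using e(1) by auto
            then show "e \<in> (\<lambda>s. \<sigma> - {s}) ` \<sigma>" by blast
          qed
        qed
        then show "bij_betw (\<lambda>s. \<sigma> - {s}) \<sigma> (E \<sigma>)" by (auto simp: bij_betw_def inj_on_def)
      qed
      finally show ?thesis unfolding aF .
    qed
    then show ?thesis using par unfolding I' aF by (simp only: add.assoc)
  qed
  show ?thesis
  proof (rule that[of w])
    fix P Q
    assume PQ: "P \<in> S" "Q \<in> S"
      and off: "\<And>\<sigma>. \<sigma> \<in> \<Delta> \<Longrightarrow> P \<notin> convex hull (\<psi> ` \<sigma>) \<and> Q \<notin> convex hull (\<psi> ` \<sigma>)"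
      and edges: "\<And>\<sigma> e. \<sigma> \<in> \<Delta> \<Longrightarrow> e \<subseteq> \<sigma> \<Longrightarrow> card e = 2 \<Longrightarrow> closed_segment P Q \<inter> convex hull (\<psi> ` e) = {}"
    define H where "H e \<longleftrightarrow> closed_segment P Q \<inter> convex hull (insert o' (\<psi> ` e)) \<noteq> {}" for e
    define EE where "EE = {e. e \<subseteq> V \<and> card e = 2}"
    have finEE: "finite EE" unfolding EE_def using finV by simp
    have "(\<Sum>\<sigma>\<in>\<Delta>. \<Sum>e\<in>E \<sigma>. of_bool (H e) :: nat) = (\<Sum>\<sigma>\<in>\<Delta>. \<Sum>e\<in>EE. if e \<subseteq> \<sigma> then of_bool (H e) else 0)"
    proof (rule sum.cong[OF refl])
      fix \<sigma> assume "\<sigma> \<in> \<Delta>"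
      then have "E \<sigma> = EE \<inter> {e. e \<subseteq> \<sigma>}" by (auto simp: E_def EE_def V_def)
      then show "(\<Sum>e\<in>E \<sigma>. of_bool (H e) :: nat) = (\<Sum>e\<in>EE. if e \<subseteq> \<sigma> then of_bool (H e) else 0)"
        by (simp only: sum.inter_restrict[OF finEE] mem_Collect_eq)
    qed
    \<comment> \<open>Exchanging the sums counts the cone over an edge once for every triangle at
      that edge, hence an even number of times.\<close>
    also have "\<dots> = (\<Sum>e\<in>EE. \<Sum>\<sigma>\<in>\<Delta>. if e \<subseteq> \<sigma> then of_bool (H e) else 0)" by (rule sum.swap)
    also have "\<dots> = (\<Sum>e\<in>EE. card {\<sigma>\<in>\<Delta>. e \<subseteq> \<sigma>} * of_bool (H e))"
      using fin(1) by (intro sum.cong refl) (simp add: sum.If_cases Int_def)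
    finally have 1: "even (\<Sum>\<sigma>\<in>\<Delta>. \<Sum>e\<in>E \<sigma>. of_bool (H e) :: nat)"
      using closed by (auto simp: EE_def intro!: dvd_sum)
    have 2: "even (\<Sum>\<sigma>\<in>\<Delta>. of_bool (closed_segment P Q \<inter> convex hull (\<psi> ` \<sigma>) \<noteq> {}) +
      (\<Sum>e\<in>E \<sigma>. of_bool (H e)) +
      of_bool (P \<in> convex hull (insert o' (\<psi> ` \<sigma>))) + of_bool (Q \<in> convex hull (insert o' (\<psi> ` \<sigma>))) :: nat)"
      unfolding H_def by (intro dvd_sum main PQ off edges)
    have 3: "(\<Sum>\<sigma>\<in>\<Delta>. of_bool (closed_segment P Q \<inter> convex hull (\<psi> ` \<sigma>) \<noteq> {}) :: nat) =
      card {\<sigma>\<in>\<Delta>. closed_segment P Q \<inter> convex hull (\<psi> ` \<sigma>) \<noteq> {}}"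
      by (rule card_filter_sum[OF fin(1), symmetric])
    have parity: "(odd p = odd q) = even c" if "even x" "even (c + x + p + q)" for x c p q :: nat
      using that by presburger
    show "w P = w Q \<longleftrightarrow> even (card {\<sigma>\<in>\<Delta>. closed_segment P Q \<inter> convex hull (\<psi> ` \<sigma>) \<noteq> {}})"
      unfolding w_def by (rule parity[OF 1 2[unfolded sum.distrib 3]])
  qed
qed

section \<open>Closed surfaces in general position\<close>

text \<open>The limit segment has a positive distance from the closed set, and nearby ends give a
  uniformly nearby segment.\<close>

lemma segment_avoid_eventually:
  fixes f g :: "'t \<Rightarrow> 'a::euclidean_space"
  assumes "(f \<longlongrightarrow> x) F" "(g \<longlongrightarrow> y) F" "closed H" "closed_segment x y \<inter> H = {}"
  shows "eventually (\<lambda>t. closed_segment (f t) (g t) \<inter> H = {}) F"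
proof -
  obtain d where d: "d > 0" "\<And>p q. p \<in> closed_segment x y \<Longrightarrow> q \<in> H \<Longrightarrow> d \<le> dist p q"
    using separate_compact_closed[OF compact_segment assms(3,4)] by blast
  have "eventually (\<lambda>t. dist (f t) x < d \<and> dist (g t) y < d) F"
    using tendstoD[OF assms(1) d(1)] tendstoD[OF assms(2) d(1)] by eventually_elim simp
  then show ?thesis
  proof eventually_elim
    case (elim t)
    show ?case
    proof (rule ccontr)
      assume "\<not> ?case"
      then obtain p where p: "p \<in> closed_segment (f t) (g t)" "p \<in> H" by blast
      then obtain u where u: "0 \<le> u" "u \<le> 1" "p = (1 - u) *\<^sub>R f t + u *\<^sub>R g t" unfolding closed_segment_def by auto
      define q where "q = (1 - u) *\<^sub>R x + u *\<^sub>R y"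
      have "q \<in> closed_segment x y" unfolding q_def closed_segment_def using u by blast
      then have "d \<le> dist q p" using d(2) p(2) by blast
      also have "dist q p = norm ((1 - u) *\<^sub>R (x - f t) + u *\<^sub>R (y - g t))"
        unfolding dist_norm q_def u(3) by (simp add: algebra_simps)
      also have "\<dots> \<le> (1 - u) * norm (x - f t) + u * norm (y - g t)"
        using u norm_triangle_ineq[of "(1 - u) *\<^sub>R (x - f t)" "u *\<^sub>R (y - g t)"] by simp
      also have "\<dots> < d"
      proof (cases "u = 0")
        case True then show ?thesis using elim by (simp add: dist_norm norm_minus_commute)
      next
        case False
        have "(1 - u) * norm (x - f t) \<le> (1 - u) * d"
          using elim u by (intro mult_left_mono) (auto simp: dist_norm norm_minus_commute)
        moreover have "u * norm (y - g t) < u * d"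
          using elim u False by (intro mult_strict_left_mono) (auto simp: dist_norm norm_minus_commute)
        ultimately show ?thesis by (simp add: algebra_simps)
      qed
      finally show False by simp
    qed
  qed
qed

text \<open>\<open>gp\<close> forbids four coplanar vertices, which makes disjoint triangles
  intersect transversally; \<open>free\<close> is local injectivity. The value 0 in
  \<open>closed2\<close> covers pairs of vertices that span no edge.\<close>

locale generic_surface =
  fixes \<psi> :: "nat \<Rightarrow> real^3" and \<Delta> :: "nat set set"
  assumes fin\<Delta>: "finite \<Delta>" and c3: "\<And>\<sigma>. \<sigma> \<in> \<Delta> \<Longrightarrow> card \<sigma> = 3"
    and closed2: "\<And>e. card e = 2 \<Longrightarrow> card {\<sigma>\<in>\<Delta>. e \<subseteq> \<sigma>} \<in> {0, 2}"
    and gp: "\<And>a b c d. distinct [a, b, c, d] \<Longrightarrow> {a, b, c, d} \<subseteq> \<Union>\<Delta> \<Longrightarrow>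
      triple_product (\<psi> b - \<psi> a) (\<psi> c - \<psi> a) (\<psi> d - \<psi> a) \<noteq> 0"
    and free: "\<And>\<sigma> \<tau>. \<sigma> \<in> \<Delta> \<Longrightarrow> \<tau> \<in> \<Delta> \<Longrightarrow> \<sigma> \<inter> \<tau> \<noteq> {} \<Longrightarrow> dependence_free \<psi> \<sigma> \<tau>"
begin

definition H :: "nat set \<Rightarrow> (real^3) set" where "H F = convex hull (\<psi> ` F)"

lemma fin\<sigma>: "\<sigma> \<in> \<Delta> \<Longrightarrow> finite \<sigma>"
  using c3 card.infinite by fastforce

lemma closed_H: "finite F \<Longrightarrow> closed (H F)"
  unfolding H_def by (simp add: finite_imp_compact_convex_hull compact_imp_closed)

lemma H_mono: "F \<subseteq> G \<Longrightarrow> H F \<subseteq> H G"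
  unfolding H_def by (simp add: hull_mono image_mono)

lemma H_empty [simp]: "H {} = {}" unfolding H_def by simp

text \<open>Two barycentric representations of one point differ by a dependence, hence agree and
  live on \<open>F \<inter> G\<close>. Triangles with a common vertex therefore meet in space just
  as they do in the complex.\<close>

lemma H_Int:
  assumes "\<sigma> \<in> \<Delta>" "\<tau> \<in> \<Delta>" "\<sigma> \<inter> \<tau> \<noteq> {}" "F \<subseteq> \<sigma>" "G \<subseteq> \<tau>"
  shows "H F \<inter> H G = H (F \<inter> G)"
proof
  show "H (F \<inter> G) \<subseteq> H F \<inter> H G" using H_mono[of "F \<inter> G" F] H_mono[of "F \<inter> G" G] by blast
  show "H F \<inter> H G \<subseteq> H (F \<inter> G)"
  proof
    fix x assume x: "x \<in> H F \<inter> H G"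
    have fin: "finite F" "finite G" "finite (\<sigma> \<union> \<tau>)"
      using finite_subset[OF assms(4) fin\<sigma>[OF assms(1)]] finite_subset[OF assms(5) fin\<sigma>[OF assms(2)]]
        fin\<sigma>[OF assms(1)] fin\<sigma>[OF assms(2)] by simp_all
    obtain s where s: "x = (\<Sum>i\<in>F. s i *\<^sub>R \<psi> i)" "\<forall>i\<in>F. 0 \<le> s i" "sum s F = 1"
      using x unfolding H_def convex_hull_image_finite[OF fin(1)] by auto
    obtain t where t: "x = (\<Sum>i\<in>G. t i *\<^sub>R \<psi> i)" "\<forall>i\<in>G. 0 \<le> t i" "sum t G = 1"
      using x unfolding H_def convex_hull_image_finite[OF fin(2)] by auto
    define s' t' where "s' i = (if i \<in> F then s i else 0)" "t' i = (if i \<in> G then t i else 0)" for i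
    have ext: "sum s' (\<sigma> \<union> \<tau>) = 1" "sum t' (\<sigma> \<union> \<tau>) = 1"
      "(\<Sum>i\<in>\<sigma> \<union> \<tau>. s' i *\<^sub>R \<psi> i) = x" "(\<Sum>i\<in>\<sigma> \<union> \<tau>. t' i *\<^sub>R \<psi> i) = x"
    proof -
      show "sum s' (\<sigma> \<union> \<tau>) = 1" unfolding s(3)[symmetric]
        by (rule sum.mono_neutral_cong_right) (use fin assms in \<open>auto simp: s'_t'_def\<close>)
      show "sum t' (\<sigma> \<union> \<tau>) = 1" unfolding t(3)[symmetric]
        by (rule sum.mono_neutral_cong_right) (use fin assms in \<open>auto simp: s'_t'_def\<close>)
      show "(\<Sum>i\<in>\<sigma> \<union> \<tau>. s' i *\<^sub>R \<psi> i) = x" unfolding s(1)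
        by (rule sum.mono_neutral_cong_right) (use fin assms in \<open>auto simp: s'_t'_def\<close>)
      show "(\<Sum>i\<in>\<sigma> \<union> \<tau>. t' i *\<^sub>R \<psi> i) = x" unfolding t(1)
        by (rule sum.mono_neutral_cong_right) (use fin assms in \<open>auto simp: s'_t'_def\<close>)
    qed
    have nn: "0 \<le> s' i" "0 \<le> t' i" for i using s t by (auto simp: s'_t'_def)
    have "s' i - t' i = 0" for i
    proof (rule dependence_freeD[OF free[OF assms(1-3)]])
      fix v assume "0 < s' v - t' v"
      then have "s' v \<noteq> 0" using nn(2)[of v] by auto
      then show "v \<in> \<sigma>" using assms(4) by (auto simp: s'_t'_def split: if_splits)
    next
      fix v assume "s' v - t' v < 0"
      then have "t' v \<noteq> 0" using nn(1)[of v] by auto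
      then show "v \<in> \<tau>" using assms(5) by (auto simp: s'_t'_def split: if_splits)
    next
      show "(\<Sum>v\<in>\<sigma> \<union> \<tau>. s' v - t' v) = 0" using ext by (simp add: sum_subtractf)
      show "(\<Sum>v\<in>\<sigma> \<union> \<tau>. (s' v - t' v) *\<^sub>R \<psi> v) = 0" using ext by (simp add: sum_subtractf scaleR_diff_left)
    qed
    then have eq: "s' i = t' i" for i by simp
    have "sum s' (F \<inter> G) = sum s F"
      by (rule sum.mono_neutral_cong_left) (use fin eq in \<open>auto simp: s'_t'_def\<close>, use eq in \<open>metis s'_t'_def\<close>)
    moreover have "(\<Sum>i\<in>F \<inter> G. s' i *\<^sub>R \<psi> i) = (\<Sum>i\<in>F. s i *\<^sub>R \<psi> i)"
      by (rule sum.mono_neutral_cong_left) (use fin eq in \<open>auto simp: s'_t'_def\<close>, use eq in \<open>metis s'_t'_def\<close>)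
    ultimately show "x \<in> H (F \<inter> G)"
      unfolding H_def convex_hull_image_finite[OF finite_Int[OF disjI1[OF fin(1)]]]
      using s nn by (intro CollectI exI[of _ s']) simp
  qed
qed

text \<open>
  \<open>gam a b c d x\<close> is the barycentric coordinate of \<open>x\<close> belonging to \<open>d\<close> with respect to the
  tetrahedron \<open>a b c d\<close>.
\<close>

definition gam :: "nat \<Rightarrow> nat \<Rightarrow> nat \<Rightarrow> nat \<Rightarrow> real^3 \<Rightarrow> real" where
  "gam a b c d x = triple_product (\<psi> b - \<psi> a) (\<psi> c - \<psi> a) (x - \<psi> a) /
    triple_product (\<psi> b - \<psi> a) (\<psi> c - \<psi> a) (\<psi> d - \<psi> a)"

definition gen4 :: "nat \<Rightarrow> nat \<Rightarrow> nat \<Rightarrow> nat \<Rightarrow> bool" where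
  "gen4 a b c d \<longleftrightarrow> distinct [a, b, c, d] \<and> {a, b, c, d} \<subseteq> \<Union>\<Delta>"

lemma gam_vertex:
  assumes "gen4 a b c d"
  shows "gam a b c d (\<psi> a) = 0" "gam a b c d (\<psi> b) = 0" "gam a b c d (\<psi> c) = 0" "gam a b c d (\<psi> d) = 1"
  using gp[of a b c d] assms unfolding gam_def gen4_def by auto

lemma gam_affine: "gam a b c d (x + t *\<^sub>R (y - x)) = gam a b c d x + t * (gam a b c d y - gam a b c d x)"
proof -
  have "x + t *\<^sub>R (y - x) - \<psi> a = (x - \<psi> a) + t *\<^sub>R ((y - \<psi> a) - (x - \<psi> a))" by simp
  then show ?thesis unfolding gam_def
    by (simp only: triple_product_linear) (simp add: field_simps add_divide_distrib diff_divide_distrib)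
qed

text \<open>The linear part of \<open>gam\<close>, for displacement vectors.\<close>

definition gaml :: "nat \<Rightarrow> nat \<Rightarrow> nat \<Rightarrow> nat \<Rightarrow> real^3 \<Rightarrow> real" where
  "gaml a b c d u = triple_product (\<psi> b - \<psi> a) (\<psi> c - \<psi> a) u /
    triple_product (\<psi> b - \<psi> a) (\<psi> c - \<psi> a) (\<psi> d - \<psi> a)"

lemma gam_add: "gam a b c d (x + u) = gam a b c d x + gaml a b c d u"
proof -
  have "x + u - \<psi> a = (x - \<psi> a) + u" by simp
  then show ?thesis unfolding gam_def gaml_def by (simp only: triple_product_linear add_divide_distrib)
qed

lemma gaml_linear:
  "gaml a b c d (u + u') = gaml a b c d u + gaml a b c d u'"
  "gaml a b c d (u - u') = gaml a b c d u - gaml a b c d u'"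
  "gaml a b c d (t *\<^sub>R u) = t * gaml a b c d u" "gaml a b c d (- u) = - gaml a b c d u"
  unfolding gaml_def
  by (simp_all only: triple_product_linear(3,6,9,12) add_divide_distrib diff_divide_distrib
      times_divide_eq_right minus_divide_left)

lemma gaml_diff: "gaml a b c d (x - y) = gam a b c d x - gam a b c d y"
  using gam_add[of a b c d y "x - y"] by simp

lemma gam_comb:
  assumes "finite I" "sum u I = 1"
  shows "gam a b c d (\<Sum>i\<in>I. u i *\<^sub>R p i) = (\<Sum>i\<in>I. u i * gam a b c d (p i))"
proof -
  have tp: "triple_product v w (\<Sum>i\<in>I. u i *\<^sub>R q i) = (\<Sum>i\<in>I. u i * triple_product v w (q i))" for v w q
    using assms(1) by (induction I rule: finite_induct) (simp_all add: triple_product_linear)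
  have "(\<Sum>i\<in>I. u i *\<^sub>R p i) - \<psi> a = (\<Sum>i\<in>I. u i *\<^sub>R (p i - \<psi> a))"
    using assms by (simp add: scaleR_diff_right sum_subtractf flip: scaleR_sum_left)
  then show ?thesis unfolding gam_def tp by (simp add: tp sum_divide_distrib)
qed

lemma continuous_gam: "isCont (gam a b c d) x"
  unfolding gam_def triple_product_def divide_inverse by (intro continuous_intros)

lemma tendsto_gam: "(f \<longlongrightarrow> x) F \<Longrightarrow> ((\<lambda>t. gam a b c d (f t)) \<longlongrightarrow> gam a b c d x) F"
  using continuous_gam isCont_tendsto_compose by blast

lemma gen4_perm:
  assumes "gen4 a b c d"
  shows "gen4 b c d a" "gen4 a c d b" "gen4 a b d c" "gen4 a c b d"
  using assms unfolding gen4_def by auto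

lemma gam_bary:
  assumes g: "gen4 a b c d"
  shows "gam b c d a x *\<^sub>R \<psi> a + gam a c d b x *\<^sub>R \<psi> b + gam a b d c x *\<^sub>R \<psi> c + gam a b c d x *\<^sub>R \<psi> d = x"
    "gam b c d a x + gam a c d b x + gam a b d c x + gam a b c d x = 1"
proof -
  have I: "{a, b, c, d} = {a, b, c, d}" and d: "distinct [a, b, c, d]" using g by (auto simp: gen4_def)
  have nd: "triple_product (\<psi> b - \<psi> a) (\<psi> c - \<psi> a) (\<psi> d - \<psi> a) \<noteq> 0"
    using gp[of a b c d] g unfolding gen4_def by blast
  obtain B :: "real^3 \<Rightarrow> nat \<Rightarrow> real" where B: "\<forall>x. (\<Sum>i\<in>{a, b, c, d}. B x i *\<^sub>R \<psi> i) = x" "\<forall>x. sum (B x) {a, b, c, d} = 1"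
    using barycentric_coordinates[OF I d nd] by (elim exE conjE) (rule that)
  have e: "gam p q r s x = (\<Sum>i\<in>{a, b, c, d}. B x i * gam p q r s (\<psi> i))" for p q r s
    using gam_comb[of "{a, b, c, d}" "B x" p q r s \<psi>] B by simp
  have "gam b c d a x = B x a" "gam a c d b x = B x b" "gam a b d c x = B x c" "gam a b c d x = B x d"
    unfolding e using d gam_vertex[OF gen4_perm(1)[OF g]] gam_vertex[OF gen4_perm(2)[OF g]]
      gam_vertex[OF gen4_perm(3)[OF g]] gam_vertex[OF g] by simp_all
  moreover have "(\<Sum>i\<in>{a, b, c, d}. B x i *\<^sub>R \<psi> i) = B x a *\<^sub>R \<psi> a + B x b *\<^sub>R \<psi> b + B x c *\<^sub>R \<psi> c + B x d *\<^sub>R \<psi> d"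
    "sum (B x) {a, b, c, d} = B x a + B x b + B x c + B x d"
    using d by (simp_all add: add.assoc)
  ultimately show "gam b c d a x *\<^sub>R \<psi> a + gam a c d b x *\<^sub>R \<psi> b + gam a b d c x *\<^sub>R \<psi> c + gam a b c d x *\<^sub>R \<psi> d = x"
    "gam b c d a x + gam a c d b x + gam a b d c x + gam a b c d x = 1" using B by simp_all
qed

text \<open>The triangle is described in the frame of a tetrahedron over it; the coordinate of the
  auxiliary vertex \<open>d\<close> vanishes on its plane.\<close>

lemma mem_H3:
  assumes g: "gen4 a b c d"
  shows "x \<in> H {a, b, c} \<longleftrightarrow> gam a b c d x = 0 \<and> 0 \<le> gam b c d a x \<and> 0 \<le> gam a c d b x \<and> 0 \<le> gam a b d c x"
proof
  assume "x \<in> H {a, b, c}"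
  then obtain u v w where uvw: "0 \<le> u" "0 \<le> v" "0 \<le> w" "u + v + w = 1" "x = u *\<^sub>R \<psi> a + v *\<^sub>R \<psi> b + w *\<^sub>R \<psi> c"
    unfolding H_def by (auto simp: convex_hull_3)
  define f where "f = (\<lambda>i. if i = a then u else if i = b then v else w)"
  have d: "distinct [a, b, c, d]" using g by (auto simp: gen4_def)
  have f: "sum f {a, b, c} = 1" "(\<Sum>i\<in>{a, b, c}. f i *\<^sub>R \<psi> i) = x" using d uvw by (auto simp: f_def add.assoc)
  have e: "gam p q r s x = u * gam p q r s (\<psi> a) + v * gam p q r s (\<psi> b) + w * gam p q r s (\<psi> c)" for p q r s
    using gam_comb[of "{a, b, c}" f p q r s \<psi>] f d by (simp add: f_def add.assoc)
  show "gam a b c d x = 0 \<and> 0 \<le> gam b c d a x \<and> 0 \<le> gam a c d b x \<and> 0 \<le> gam a b d c x"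
    unfolding e using gam_vertex[OF gen4_perm(1)[OF g]] gam_vertex[OF gen4_perm(2)[OF g]]
      gam_vertex[OF gen4_perm(3)[OF g]] gam_vertex[OF g] uvw by simp
next
  assume h: "gam a b c d x = 0 \<and> 0 \<le> gam b c d a x \<and> 0 \<le> gam a c d b x \<and> 0 \<le> gam a b d c x"
  then have "x = gam b c d a x *\<^sub>R \<psi> a + gam a c d b x *\<^sub>R \<psi> b + gam a b d c x *\<^sub>R \<psi> c"
    "gam b c d a x + gam a c d b x + gam a b d c x = 1"
    using gam_bary[OF g, of x] by simp_all
  then show "x \<in> H {a, b, c}" unfolding H_def using h by (auto simp: convex_hull_3)
qed

lemma H2_points: "x \<in> H {a, b} \<longleftrightarrow> (\<exists>t. 0 \<le> t \<and> t \<le> 1 \<and> x = \<psi> a + t *\<^sub>R (\<psi> b - \<psi> a))"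
  unfolding H_def image_insert image_empty segment_convex_hull[symmetric] closed_segment_def
  by (auto simp: algebra_simps)

text \<open>The coordinates belonging to \<open>c\<close> and \<open>d\<close> vanish on
  \<open>ab\<close>, but add up to 1 on \<open>cd\<close>.\<close>

lemma edges_disjoint:
  assumes g: "gen4 a b c d"
  shows "H {a, b} \<inter> H {c, d} = {}"
proof (rule ccontr)
  assume "\<not> ?thesis"
  then obtain x where "x \<in> H {a, b}" "x \<in> H {c, d}" by blast
  then obtain s t where x: "x = \<psi> a + s *\<^sub>R (\<psi> b - \<psi> a)" "x = \<psi> c + t *\<^sub>R (\<psi> d - \<psi> c)"
    unfolding H2_points by blast
  have "gam a b c d x = 0" unfolding x(1) gam_affine using gam_vertex[OF g] by simp
  moreover have "gam a b c d x = t" unfolding x(2) gam_affine using gam_vertex[OF g] by simp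
  moreover have "gam a b d c x = 0" unfolding x(1) gam_affine using gam_vertex[OF gen4_perm(3)[OF g]] by simp
  moreover have "gam a b d c x = 1 - t" unfolding x(2) gam_affine using gam_vertex[OF gen4_perm(3)[OF g]] by simp
  ultimately show False by simp
qed

lemma vertex_not_in_H3:
  assumes g: "gen4 a b c d"
  shows "\<psi> d \<notin> H {a, b, c}"
  using gam_vertex[OF g] unfolding mem_H3[OF g] by simp

lemma H2_comb:
  assumes "0 \<le> u" "0 \<le> w" "u + w = 1"
  shows "u *\<^sub>R \<psi> a + w *\<^sub>R \<psi> b \<in> H {a, b}"
  using assms by (auto simp: H_def convex_hull_2)

lemma mem_H2_face:
  assumes g: "gen4 a b c d"
  shows "x \<in> H {b, c} \<longleftrightarrow> x \<in> H {a, b, c} \<and> gam b c d a x = 0"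
proof
  assume x: "x \<in> H {b, c}"
  then obtain t where t: "x = \<psi> b + t *\<^sub>R (\<psi> c - \<psi> b)" unfolding H2_points by blast
  have "gam b c d a x = 0" unfolding t gam_affine using gam_vertex[OF gen4_perm(1)[OF g]] by simp
  moreover have "x \<in> H {a, b, c}" using x H_mono[of "{b, c}" "{a, b, c}"] by blast
  ultimately show "x \<in> H {a, b, c} \<and> gam b c d a x = 0" by simp
next
  assume h: "x \<in> H {a, b, c} \<and> gam b c d a x = 0"
  have "x = gam a c d b x *\<^sub>R \<psi> b + gam a b d c x *\<^sub>R \<psi> c" "gam a c d b x + gam a b d c x = 1"
    using gam_bary[OF g, of x] h unfolding mem_H3[OF g] by simp_all
  moreover have "gam a c d b x *\<^sub>R \<psi> b + gam a b d c x *\<^sub>R \<psi> c \<in> H {b, c}"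
    using h calculation(2) unfolding mem_H3[OF g] by (intro H2_comb) auto
  ultimately show "x \<in> H {b, c}" by simp
qed

text \<open>Edges without common vertices do not meet and no vertex lies in a triangle that omits
  it, so a piercing point is interior to both the edge and the triangle.\<close>

lemma pierce_strict:
  assumes d: "distinct [v, a, x, y, z]" and V: "{v, a, x, y, z} \<subseteq> \<Union>\<Delta>"
    and p: "p \<in> H {v, a}" "p \<in> H {x, y, z}"
  shows "0 < gam y z v x p" "0 < gam x z v y p" "0 < gam x y v z p"
    "\<exists>t. 0 < t \<and> t < 1 \<and> p = \<psi> v + t *\<^sub>R (\<psi> a - \<psi> v)"
proof -
  have g: "gen4 x y z v" "gen4 x y z a" using d V by (auto simp: gen4_def)
  have g': "gen4 y x z v" "gen4 z x y v" using d V by (auto simp: gen4_def)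
  note m = p(2)[unfolded mem_H3[OF g(1)]]
  have "p \<notin> H {y, z}" "p \<notin> H {x, z}" "p \<notin> H {x, y}"
    using edges_disjoint[of v a y z] edges_disjoint[of v a x z] edges_disjoint[of v a x y] d V p(1) by (auto simp: gen4_def)
  moreover have "{y, x, z} = {x, y, z}" "{z, x, y} = {x, y, z}" by auto
  ultimately have "gam y z v x p \<noteq> 0" "gam x z v y p \<noteq> 0" "gam x y v z p \<noteq> 0"
    using p(2) mem_H2_face[OF g(1), of p] mem_H2_face[OF g'(1), of p] mem_H2_face[OF g'(2), of p] by auto
  then show "0 < gam y z v x p" "0 < gam x z v y p" "0 < gam x y v z p" using m by linarith+
  obtain t where t: "0 \<le> t" "t \<le> 1" "p = \<psi> v + t *\<^sub>R (\<psi> a - \<psi> v)" using p(1) unfolding H2_points by blast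
  have "t \<noteq> 0" using vertex_not_in_H3[OF g(1)] p(2) t by auto
  moreover have "t \<noteq> 1" using vertex_not_in_H3[OF g(2)] p(2) t by auto
  ultimately show "\<exists>t. 0 < t \<and> t < 1 \<and> p = \<psi> v + t *\<^sub>R (\<psi> a - \<psi> v)" using t by (metis order_le_less)
qed

end

section \<open>The segment in which two disjoint triangles intersect\<close>

context generic_surface begin

lemma gen4I:
  assumes "\<sigma> \<in> \<Delta>" "\<tau> \<in> \<Delta>" "{a, b, c, d} \<subseteq> \<sigma> \<union> \<tau>" "distinct [a, b, c, d]"
  shows "gen4 a b c d"
  using assms unfolding gen4_def by auto

text \<open>Two edges of \<open>\<sigma>\<close> meet only in their common vertex, and this lies in
  no disjoint triangle.\<close>

lemma two_edges_vertex:
  assumes \<sigma>: "\<sigma> \<in> \<Delta>" and \<tau>: "\<tau> \<in> \<Delta>" and dis: "\<sigma> \<inter> \<tau> = {}" and ij: "i \<in> \<sigma>" "j \<in> \<sigma>" "i \<noteq> j"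
    and x: "x \<in> H (\<sigma> - {i})" "x \<in> H (\<sigma> - {j})"
  shows "x \<notin> H \<tau>"
proof -
  obtain l where l: "\<sigma> - {i, j} = {l}"
  proof (rule card_1_singletonE)
    show "card (\<sigma> - {i, j}) = 1" using c3[OF \<sigma>] ij by (subst card_Diff_subset) auto
  qed
  have "(\<sigma> - {i}) \<inter> (\<sigma> - {j}) = {l}" using l by auto
  moreover have "H (\<sigma> - {i}) \<inter> H (\<sigma> - {j}) = H ((\<sigma> - {i}) \<inter> (\<sigma> - {j}))"
    by (rule H_Int[OF \<sigma> \<sigma>]) (use ij in auto)
  ultimately have "x \<in> H {l}" using x by auto
  then have xl: "x = \<psi> l" by (simp add: H_def)
  obtain d e f where t: "\<tau> = {d, e, f}" "distinct [d, e, f]" using c3[OF \<tau>] by (auto simp: card_3_iff)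
  have "l \<in> \<sigma>" using l by blast
  then have "l \<notin> \<tau>" using dis by blast
  then have "distinct [d, e, f, l]" using t by auto
  moreover have "{d, e, f, l} \<subseteq> \<sigma> \<union> \<tau>" using t(1) \<open>l \<in> \<sigma>\<close> by blast
  ultimately have "gen4 d e f l" by (intro gen4I[OF \<sigma> \<tau>])
  then show ?thesis unfolding xl t by (rule vertex_not_in_H3)
qed

lemma two_edges_cross:
  assumes \<sigma>: "\<sigma> \<in> \<Delta>" and \<tau>: "\<tau> \<in> \<Delta>" and dis: "\<sigma> \<inter> \<tau> = {}" and ij: "i \<in> \<sigma>" "j \<in> \<tau>"
  shows "H (\<sigma> - {i}) \<inter> H (\<tau> - {j}) = {}"
proof -
  have "card (\<sigma> - {i}) = 2" "card (\<tau> - {j}) = 2" using c3 \<sigma> \<tau> fin\<sigma> ij by simp_all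
  then obtain a b c d where e: "\<sigma> - {i} = {a, b}" "a \<noteq> b" "\<tau> - {j} = {c, d}" "c \<noteq> d"
    by (auto simp: card_2_iff)
  have "{a, b} \<subseteq> \<sigma>" "{c, d} \<subseteq> \<tau>" using e by blast+
  then have "gen4 a b c d" using e(2,4) dis by (intro gen4I[OF \<sigma> \<tau>]) auto
  then show ?thesis unfolding e by (rule edges_disjoint)
qed

text \<open>On the line common to both planes the six barycentric coordinates of the two triangles
  act as the walls of a cell. A long segment of this line has both ends outside, so
  \<open>segment_cell_crossings\<close> leaves exactly two walls. A wall met inside the cell is an
  edge of one triangle that pierces the other.\<close>

proposition pair_two_piercings:
  assumes \<sigma>: "\<sigma> \<in> \<Delta>" and \<tau>: "\<tau> \<in> \<Delta>" and dis: "\<sigma> \<inter> \<tau> = {}" and ne: "H \<sigma> \<inter> H \<tau> \<noteq> {}"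
  shows "card {i\<in>\<sigma>. H (\<sigma> - {i}) \<inter> H \<tau> \<noteq> {}} + card {i\<in>\<tau>. H \<sigma> \<inter> H (\<tau> - {i}) \<noteq> {}} = 2"
proof -
  obtain a b c where s: "\<sigma> = {a, b, c}" "distinct [a, b, c]" using c3[OF \<sigma>] by (auto simp: card_3_iff)
  obtain d e f where t: "\<tau> = {d, e, f}" "distinct [d, e, f]" using c3[OF \<tau>] by (auto simp: card_3_iff)
  have dd: "distinct [a, b, c, d, e, f]" using s t dis by auto
  have g: "gen4 a b c d" "gen4 b a c d" "gen4 c a b d" "gen4 d e f a" "gen4 e d f a" "gen4 f d e a"
    using dd s(1) t(1) by (auto intro!: gen4I[OF \<sigma> \<tau>])
  define I where "I = {a, b, c, d, e, f}"
  \<comment> \<open>For each vertex the opposite edge, completed by a vertex of the other triangle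
    to a coordinate frame.\<close>
  define Fs :: "nat \<Rightarrow> nat \<times> nat \<times> nat" where "Fs = (\<lambda>i. if i = a then (b, c, d) else if i = b then (a, c, d) else if i = c then (a, b, d)
    else if i = d then (e, f, a) else if i = e then (d, f, a) else (d, e, a))"
  define gg where "gg i = (case Fs i of (p, q, r) \<Rightarrow> gam p q r i)" for i
  define k where "k i u = (case Fs i of (p, q, r) \<Rightarrow> gaml p q r i u)" for i u
  have ggs: "gg a = gam b c d a" "gg b = gam a c d b" "gg c = gam a b d c" "gg d = gam e f a d" "gg e = gam d f a e" "gg f = gam d e a f"
    and ks: "k a = gaml b c d a" "k b = gaml a c d b" "k c = gaml a b d c"
    using dd by (auto simp: gg_def k_def Fs_def)
  have gadd: "gg i (x + u) = gg i x + k i u" for i x u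
    unfolding gg_def k_def by (simp add: gam_add split: prod.split)
  have klin: "k i (s *\<^sub>R u) = s * k i u" for i s u
    unfolding k_def by (simp add: gaml_linear split: prod.split)
  have m\<sigma>: "x \<in> H \<sigma> \<longleftrightarrow> gam a b c d x = 0 \<and> 0 \<le> gg a x \<and> 0 \<le> gg b x \<and> 0 \<le> gg c x" for x
    unfolding s ggs by (rule mem_H3[OF g(1)])
  have m\<tau>: "x \<in> H \<tau> \<longleftrightarrow> gam d e f a x = 0 \<and> 0 \<le> gg d x \<and> 0 \<le> gg e x \<and> 0 \<le> gg f x" for x
    unfolding t ggs by (rule mem_H3[OF g(4)])
  have face\<sigma>: "x \<in> H (\<sigma> - {i}) \<longleftrightarrow> x \<in> H \<sigma> \<and> gg i x = 0" if "i \<in> \<sigma>" for x i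
  proof -
    have e: "{a, b, c} - {a} = {b, c}" "{a, b, c} - {b} = {a, c}" "{a, b, c} - {c} = {a, b}"
      "{b, a, c} = {a, b, c}" "{c, a, b} = {a, b, c}" using s(2) by auto
    have "x \<in> H ({a, b, c} - {a}) \<longleftrightarrow> x \<in> H {a, b, c} \<and> gg a x = 0" unfolding e(1) ggs(1) by (rule mem_H2_face[OF g(1)])
    moreover have "x \<in> H ({a, b, c} - {b}) \<longleftrightarrow> x \<in> H {a, b, c} \<and> gg b x = 0" unfolding e(2) ggs(2) using mem_H2_face[OF g(2)] unfolding e(4) .
    moreover have "x \<in> H ({a, b, c} - {c}) \<longleftrightarrow> x \<in> H {a, b, c} \<and> gg c x = 0" unfolding e(3) ggs(3) using mem_H2_face[OF g(3)] unfolding e(5) .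
    ultimately show ?thesis using that unfolding s(1) by (elim insertE emptyE; simp only:)
  qed
  have face\<tau>: "x \<in> H (\<tau> - {i}) \<longleftrightarrow> x \<in> H \<tau> \<and> gg i x = 0" if "i \<in> \<tau>" for x i
  proof -
    have h: "{d, e, f} - {d} = {e, f}" "{d, e, f} - {e} = {d, f}" "{d, e, f} - {f} = {d, e}"
      "{e, d, f} = {d, e, f}" "{f, d, e} = {d, e, f}" using t(2) by auto
    have "x \<in> H ({d, e, f} - {d}) \<longleftrightarrow> x \<in> H {d, e, f} \<and> gg d x = 0" unfolding h(1) ggs(4) by (rule mem_H2_face[OF g(4)])
    moreover have "x \<in> H ({d, e, f} - {e}) \<longleftrightarrow> x \<in> H {d, e, f} \<and> gg e x = 0" unfolding h(2) ggs(5) using mem_H2_face[OF g(5)] unfolding h(4) .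
    moreover have "x \<in> H ({d, e, f} - {f}) \<longleftrightarrow> x \<in> H {d, e, f} \<and> gg f x = 0" unfolding h(3) ggs(6) using mem_H2_face[OF g(6)] unfolding h(5) .
    ultimately show ?thesis using that unfolding t(1) by (elim insertE emptyE; simp only:)
  qed
  obtain x0 where x0: "x0 \<in> H \<sigma>" "x0 \<in> H \<tau>" using ne by blast
  define u1 u2 where "u1 = \<psi> b - \<psi> a" "u2 = \<psi> c - \<psi> a"
  define \<nu> where "\<nu> u = triple_product (\<psi> e - \<psi> d) (\<psi> f - \<psi> d) u" for u
  define D where "D = triple_product (\<psi> e - \<psi> d) (\<psi> f - \<psi> d) (\<psi> a - \<psi> d)"
  define D' where "D' = triple_product u1 u2 (\<psi> d - \<psi> a)"
  have D: "D \<noteq> 0" "D' \<noteq> 0"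
    using g(1,4) gp[of d e f a] gp[of a b c d] unfolding D_def D'_def u1_u2_def gen4_def by auto
  have \<nu>g: "gaml d e f a u = \<nu> u / D" "gaml a b c d u = triple_product u1 u2 u / D'" for u
    unfolding gaml_def \<nu>_def D_def D'_def u1_u2_def by simp_all
  define n1 n2 where "n1 = \<nu> u1" "n2 = \<nu> u2"
  have \<nu>lin: "\<nu> (p *\<^sub>R u1 + q *\<^sub>R u2) = p * n1 + q * n2" for p q
    unfolding n1_n2_def \<nu>_def by (simp only: triple_product_linear)
  have span: "\<exists>p q. w = p *\<^sub>R u1 + q *\<^sub>R u2" if "gaml a b c d w = 0" for w
  proof -
    have "triple_product u1 u2 w = 0" using that D unfolding \<nu>g by simp
    then have *: "D' *\<^sub>R w = triple_product w u2 (\<psi> d - \<psi> a) *\<^sub>R u1 + triple_product u1 w (\<psi> d - \<psi> a) *\<^sub>R u2"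
      unfolding D'_def using triple_product_cramer[of u1 u2 "\<psi> d - \<psi> a" w] by simp
    have "w = (1 / D') *\<^sub>R (D' *\<^sub>R w)" using D by simp
    also have "\<dots> = (triple_product w u2 (\<psi> d - \<psi> a) / D') *\<^sub>R u1 + (triple_product u1 w (\<psi> d - \<psi> a) / D') *\<^sub>R u2"
      unfolding * by (simp add: scaleR_add_right)
    finally show ?thesis by blast
  qed
  \<comment> \<open>Parallel planes would coincide because of \<open>x0\<close>, and
    \<open>\<psi> a\<close> would lie in the plane of \<open>\<tau>\<close>, against general
    position.\<close>
  have n0: "n1 \<noteq> 0 \<or> n2 \<noteq> 0"
  proof (rule ccontr)
    assume n: "\<not> ?thesis"
    have "gaml a b c d (x0 - \<psi> a) = 0" using x0(1) gam_vertex[OF g(1)] unfolding gaml_diff m\<sigma> by simp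
    then obtain p q where "x0 - \<psi> a = p *\<^sub>R u1 + q *\<^sub>R u2" using span by blast
    then have "\<nu> (x0 - \<psi> a) = 0" using \<nu>lin[of p q] n by simp
    then have "gaml d e f a (x0 - \<psi> a) = 0" unfolding \<nu>g by simp
    then show False using x0(2) gam_vertex[OF g(4)] unfolding gaml_diff m\<tau> by simp
  qed
  \<comment> \<open>The solution of \<open>p * n1 + q * n2 = 0\<close>: a direction common to both
    planes.\<close>
  define r where "r = (- n2) *\<^sub>R u1 + n1 *\<^sub>R u2"
  have r0: "gaml d e f a r = 0" "gaml a b c d r = 0"
  proof -
    show "gaml d e f a r = 0" unfolding \<nu>g r_def \<nu>lin by simp
    show "gaml a b c d r = 0" unfolding \<nu>g r_def by (simp add: triple_product_linear)
  qed
  have kr: "k b r = - n2" "k c r = n1" "k a r = n2 - n1"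
  proof -
    note gv = gam_vertex[OF gen4_perm(1)[OF g(1)]] gam_vertex[OF gen4_perm(2)[OF g(1)]] gam_vertex[OF gen4_perm(3)[OF g(1)]]
    show "k b r = - n2" "k c r = n1" "k a r = n2 - n1"
      unfolding ks r_def u1_u2_def gaml_linear(1,3) gaml_diff by (simp_all add: gv)
  qed
  \<comment> \<open>The changes of the three coordinates of \<open>\<sigma>\<close> along
    \<open>r\<close> add up to zero without all vanishing, so one of them increases and another
    decreases.\<close>
  obtain i1 where i1: "i1 \<in> \<sigma>" "k i1 r > 0"
  proof -
    have "k a r > 0 \<or> k b r > 0 \<or> k c r > 0" unfolding kr using n0 by linarith
    then show ?thesis using that s(1) by blast
  qed
  obtain i2 where i2: "i2 \<in> \<sigma>" "k i2 r < 0"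
  proof -
    have "k a r < 0 \<or> k b r < 0 \<or> k c r < 0" unfolding kr using n0 by linarith
    then show ?thesis using that s(1) by blast
  qed
  have nn0: "0 \<le> gg i x0" if "i \<in> \<sigma>" for i using x0(1) that unfolding m\<sigma> unfolding s(1) by auto
  \<comment> \<open>Far enough for the coordinate of \<open>i1\<close> to be negative at
    \<open>P\<close> and that of \<open>i2\<close> at \<open>Q\<close>; the summand 1 makes both
    strict.\<close>
  define T where "T = gg i1 x0 / k i1 r + gg i2 x0 / (- k i2 r) + 1"
  have q12: "0 \<le> gg i1 x0 / k i1 r" "0 \<le> gg i2 x0 / (- k i2 r)" using nn0 i1 i2 by (simp_all add: divide_nonneg_neg)
  then have T0: "T > 0" "gg i1 x0 / k i1 r < T" "gg i2 x0 / (- k i2 r) < T" unfolding T_def by linarith+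
  have Tk: "gg i1 x0 < T * k i1 r" "gg i2 x0 < - T * k i2 r"
    using T0 i1 i2 by (simp_all add: pos_divide_less_eq minus_divide_right[symmetric] neg_less_divide_eq field_simps)
  define P Q where "P = x0 + (- T) *\<^sub>R r" "Q = x0 + T *\<^sub>R r"
  have seg: "P + l *\<^sub>R (Q - P) = x0 + (T * (2 * l - 1)) *\<^sub>R r" for l
    unfolding P_Q_def vec_eq_iff by (simp add: algebra_simps)
  have aff: "gg i P + l * (gg i Q - gg i P) = gg i (P + l *\<^sub>R (Q - P))" for i l
    unfolding gg_def by (simp add: gam_affine split: prod.split)
  have gx: "gg i (x0 + l *\<^sub>R r) = gg i x0 + l * k i r" for i l unfolding gadd klin ..
  have plane: "gam a b c d (x0 + l *\<^sub>R r) = 0" "gam d e f a (x0 + l *\<^sub>R r) = 0" for l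
    using x0 r0 unfolding gam_add gaml_linear(3) m\<sigma> m\<tau> by simp_all
  have Iall: "(\<forall>i\<in>I. 0 \<le> gg i (x0 + l *\<^sub>R r)) \<longleftrightarrow> x0 + l *\<^sub>R r \<in> H \<sigma> \<inter> H \<tau>" for l
    unfolding I_def Int_iff m\<sigma> m\<tau> using plane[of l] by auto
  have J: "x \<in> H \<sigma> \<inter> H \<tau> \<Longrightarrow> \<exists>l. 0 \<le> l \<and> l \<le> 1 \<and> x = P + l *\<^sub>R (Q - P)" for x
  proof -
    assume x: "x \<in> H \<sigma> \<inter> H \<tau>"
    have "gaml a b c d (x - x0) = 0" "gaml d e f a (x - x0) = 0"
      using x x0 unfolding gaml_diff m\<sigma> m\<tau> Int_iff by simp_all
    then obtain p q where pq: "x - x0 = p *\<^sub>R u1 + q *\<^sub>R u2" "p * n1 + q * n2 = 0"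
      using span[of "x - x0"] \<nu>lin D unfolding \<nu>g(1) by (metis divide_eq_0_iff)
    obtain l where l: "p = - n2 * l" "q = n1 * l"
    proof (cases "n1 = 0")
      case True
      then have "n2 \<noteq> 0" "q = 0" using n0 pq(2) by auto
      then show ?thesis using that[of "- p / n2"] True by simp
    next
      case False
      then have "p = - n2 * (q / n1)" using pq(2) by (simp add: field_simps)
      then show ?thesis using that[of "q / n1"] False by simp
    qed
    have xl: "x = x0 + l *\<^sub>R r" using pq(1) unfolding l r_def by (simp add: algebra_simps)
    have "0 \<le> gg i1 x" "0 \<le> gg i2 x" using x i1(1) i2(1) unfolding m\<sigma> Int_iff unfolding s(1) by auto
    then have b: "0 \<le> gg i1 x0 + l * k i1 r" "0 \<le> gg i2 x0 + l * k i2 r" unfolding xl gx .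
    have "0 < (l + T) * k i1 r" using b(1) Tk(1) by (simp add: algebra_simps)
    then have "0 < l + T" using i1(2) by (simp add: zero_less_mult_iff)
    have "0 < (l - T) * k i2 r" using b(2) Tk(2) by (simp add: algebra_simps)
    then have "l - T < 0" using i2(2) by (simp add: zero_less_mult_iff)
    have "T * (2 * ((l + T) / (2 * T)) - 1) = l" using T0(1) by (simp add: field_simps)
    then have "x = P + ((l + T) / (2 * T)) *\<^sub>R (Q - P)" unfolding seg xl by simp
    moreover have "0 \<le> (l + T) / (2 * T)" "(l + T) / (2 * T) \<le> 1"
      using T0(1) \<open>0 < l + T\<close> \<open>l - T < 0\<close> by simp_all
    ultimately show ?thesis by blast
  qed
  have IJ: "(\<forall>i\<in>I. 0 \<le> gg i (P + l *\<^sub>R (Q - P))) \<longleftrightarrow> P + l *\<^sub>R (Q - P) \<in> H \<sigma> \<inter> H \<tau>" for l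
    unfolding seg by (rule Iall)
  have I: "I = \<sigma> \<union> \<tau>" unfolding I_def s t by auto
  have "i1 \<in> I" "i2 \<in> I" using i1 i2 I by auto
  have "gg i1 P < 0" unfolding P_Q_def(1) gx using Tk by simp
  then have nP: "\<not> (\<forall>i\<in>I. 0 \<le> gg i P)" using \<open>i1 \<in> I\<close> by force
  have "gg i2 Q < 0" unfolding P_Q_def(2) gx using Tk by simp
  then have nQ: "\<not> (\<forall>i\<in>I. 0 \<le> gg i Q)" using \<open>i2 \<in> I\<close> by force
  have zero: "gg i x = 0 \<longleftrightarrow> x \<in> H (\<sigma> - {i}) \<inter> H \<tau> \<and> i \<in> \<sigma> \<or> x \<in> H \<sigma> \<inter> H (\<tau> - {i}) \<and> i \<in> \<tau>"
    if "x \<in> H \<sigma> \<inter> H \<tau>" "i \<in> I" for x i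
    using that face\<sigma>[of i x] face\<tau>[of i x] unfolding I by blast
  have single: "i = j" if x: "x \<in> H \<sigma> \<inter> H \<tau>" and ij: "i \<in> I" "j \<in> I" "gg i x = 0" "gg j x = 0" for x i j
  proof (rule ccontr)
    assume "i \<noteq> j"
    have zi: "i \<in> \<sigma> \<and> x \<in> H (\<sigma> - {i}) \<or> i \<in> \<tau> \<and> x \<in> H (\<tau> - {i})" using zero[OF x ij(1)] ij(3) by blast
    have zj: "j \<in> \<sigma> \<and> x \<in> H (\<sigma> - {j}) \<or> j \<in> \<tau> \<and> x \<in> H (\<tau> - {j})" using zero[OF x ij(2)] ij(4) by blast
    have dis': "\<tau> \<inter> \<sigma> = {}" using dis by blast
    from zi zj show False
      using two_edges_vertex[OF \<sigma> \<tau> dis _ _ \<open>i \<noteq> j\<close>, of x] two_edges_vertex[OF \<tau> \<sigma> dis' _ _ \<open>i \<noteq> j\<close>, of x]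
        two_edges_cross[OF \<sigma> \<tau> dis, of i j] two_edges_cross[OF \<sigma> \<tau> dis, of j i] x by blast
  qed
  have "card {i\<in>I. \<exists>l. 0 \<le> l \<and> l \<le> 1 \<and> gg i P + l * (gg i Q - gg i P) = 0 \<and> (\<forall>j\<in>I. 0 \<le> gg j P + l * (gg j Q - gg j P))} +
     of_bool (\<forall>i\<in>I. 0 \<le> gg i P) + of_bool (\<forall>i\<in>I. 0 \<le> gg i Q) =
     (if \<exists>l. 0 \<le> l \<and> l \<le> 1 \<and> (\<forall>i\<in>I. 0 \<le> gg i P + l * (gg i Q - gg i P)) then 2 else 0)"
  proof (rule segment_cell_crossings)
    show "finite I" by (simp add: I_def)
    show "i = j" if "\<forall>i\<in>I. 0 \<le> gg i P + l * (gg i Q - gg i P)" "i \<in> I" "j \<in> I"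
      "gg i P + l * (gg i Q - gg i P) = 0" "gg j P + l * (gg j Q - gg j P) = 0" for l i j
      using single[OF _ that(2,3)] that(1,4,5) unfolding aff IJ by blast
  qed (use nP nQ in blast)+
  moreover have "\<exists>l. 0 \<le> l \<and> l \<le> 1 \<and> (\<forall>i\<in>I. 0 \<le> gg i P + l * (gg i Q - gg i P))"
    unfolding aff IJ using J[of x0] x0 by (metis IntI)
  ultimately have "card {i\<in>I. \<exists>l. 0 \<le> l \<and> l \<le> 1 \<and> gg i P + l * (gg i Q - gg i P) = 0 \<and> (\<forall>j\<in>I. 0 \<le> gg j P + l * (gg j Q - gg j P))} = 2"
    using nP nQ by (simp only: of_bool_eq if_True add_0_right)
  also have "{i\<in>I. \<exists>l. 0 \<le> l \<and> l \<le> 1 \<and> gg i P + l * (gg i Q - gg i P) = 0 \<and> (\<forall>j\<in>I. 0 \<le> gg j P + l * (gg j Q - gg j P))} =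
    {i\<in>\<sigma>. H (\<sigma> - {i}) \<inter> H \<tau> \<noteq> {}} \<union> {i\<in>\<tau>. H \<sigma> \<inter> H (\<tau> - {i}) \<noteq> {}}" (is "?L = ?R")
  proof
    show "?L \<subseteq> ?R"
    proof
      fix i assume "i \<in> ?L"
      then obtain l where l: "i \<in> I" "gg i (P + l *\<^sub>R (Q - P)) = 0" "P + l *\<^sub>R (Q - P) \<in> H \<sigma> \<inter> H \<tau>"
        unfolding aff IJ by blast
      then show "i \<in> ?R" using zero[OF l(3,1)] by blast
    qed
    show "?R \<subseteq> ?L"
    proof
      fix i assume i: "i \<in> ?R"
      then have iI: "i \<in> I" unfolding I by blast
      obtain x where x: "x \<in> H \<sigma> \<inter> H \<tau>" "gg i x = 0"
        using i face\<sigma>[of i] face\<tau>[of i] by blast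
      obtain l where "0 \<le> l" "l \<le> 1" "x = P + l *\<^sub>R (Q - P)" using J[OF x(1)] by blast
      then show "i \<in> ?L" using x iI unfolding aff IJ by blast
    qed
  qed
  also have "card \<dots> = card {i\<in>\<sigma>. H (\<sigma> - {i}) \<inter> H \<tau> \<noteq> {}} + card {i\<in>\<tau>. H \<sigma> \<inter> H (\<tau> - {i}) \<noteq> {}}"
    by (rule card_Un_disjoint) (use fin\<sigma>[OF \<sigma>] fin\<sigma>[OF \<tau>] dis in auto)
  finally show ?thesis .
qed

end

section \<open>Segments running close to an edge\<close>

context generic_surface begin

text \<open>The hypotheses under which the colouring compares \<open>x\<close> with
  \<open>y\<close>, together with the outcome: \<open>b\<close> tells whether the two colours
  agree.\<close>

definition joined :: "bool \<Rightarrow> real^3 \<Rightarrow> real^3 \<Rightarrow> bool" where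
  "joined b x y \<longleftrightarrow> (\<forall>\<rho>\<in>\<Delta>. x \<notin> H \<rho> \<and> y \<notin> H \<rho>) \<and>
    (\<forall>\<rho>\<in>\<Delta>. \<forall>e. e \<subseteq> \<rho> \<longrightarrow> card e = 2 \<longrightarrow> closed_segment x y \<inter> H e = {}) \<and>
    even (card {\<rho>\<in>\<Delta>. closed_segment x y \<inter> H \<rho> \<noteq> {}}) = b"

lemma joinedI:
  assumes "D \<subseteq> \<Delta>" "\<And>\<rho>. \<rho> \<in> \<Delta> \<Longrightarrow> \<rho> \<notin> D \<Longrightarrow> closed_segment x y \<inter> H \<rho> = {}"
    "\<And>\<rho>. \<rho> \<in> D \<Longrightarrow> closed_segment x y \<inter> H \<rho> \<noteq> {} \<and> x \<notin> H \<rho> \<and> y \<notin> H \<rho>"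
    "\<And>\<rho> e. \<rho> \<in> D \<Longrightarrow> e \<subseteq> \<rho> \<Longrightarrow> card e = 2 \<Longrightarrow> closed_segment x y \<inter> H e = {}"
  shows "joined (even (card D)) x y"
proof -
  have "{\<rho>\<in>\<Delta>. closed_segment x y \<inter> H \<rho> \<noteq> {}} = D" using assms by blast
  moreover have "x \<notin> H \<rho> \<and> y \<notin> H \<rho>" if "\<rho> \<in> \<Delta>" for \<rho>
    using assms(2)[OF that] assms(3)[of \<rho>] by (cases "\<rho> \<in> D") auto
  moreover have "closed_segment x y \<inter> H e = {}" if "\<rho> \<in> \<Delta>" "e \<subseteq> \<rho>" "card e = 2" for \<rho> e
    using assms(2)[OF that(1)] assms(4)[OF _ that(2,3)] H_mono[OF that(2)] by (cases "\<rho> \<in> D") blast+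
  ultimately show ?thesis unfolding joined_def by simp
qed

lemma joinedI_empty:
  assumes "\<And>\<rho>. \<rho> \<in> \<Delta> \<Longrightarrow> closed_segment x y \<inter> H \<rho> = {}"
  shows "joined True x y"
  using joinedI[of "{}" x y] assms by simp

lemma edge_of_triangle:
  assumes "e \<subseteq> {a, b, c}" "card e = 2"
  shows "e = {b, c} \<or> e = {a, c} \<or> e = {a, b}"
proof -
  obtain x y where "e = {x, y}" "x \<noteq> y" using assms(2) by (auto simp: card_2_iff)
  then show ?thesis using assms(1) by auto
qed

lemma strict_edge:
  assumes g: "gen4 a b c d" and x: "0 < gam b c d a x" "0 < gam a c d b x" "0 < gam a b d c x"
    and e: "e \<subseteq> {a, b, c}" "card e = 2"
  shows "x \<notin> H e"
proof -
  have g': "gen4 b a c d" "gen4 c a b d" using g by (auto simp: gen4_def)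
  show ?thesis using edge_of_triangle[OF e] x mem_H2_face[OF g, of x] mem_H2_face[OF g'(1), of x] mem_H2_face[OF g'(2), of x] by auto
qed

lemma mem_segment: "x \<in> closed_segment p q \<longleftrightarrow> (\<exists>l. 0 \<le> l \<and> l \<le> 1 \<and> x = p + l *\<^sub>R (q - p))"
  unfolding closed_segment_def by (auto simp: algebra_simps)

text \<open>A transversal crossing in the interior of a triangle is stable: the crossing parameter
  \<open>L\<close> depends continuously on the ends of the segment.\<close>

lemma crossing_persists:
  assumes g: "gen4 x y z w" and f: "(f \<longlongrightarrow> z1) F" "(g \<longlongrightarrow> z2) F"
    and h: "0 < gam x y z w z1" "gam x y z w z2 < 0"
    and p: "p = z1 + l *\<^sub>R (z2 - z1)" "gam x y z w p = 0"
      "0 < gam y z w x p" "0 < gam x z w y p" "0 < gam x y w z p"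
  shows "eventually (\<lambda>t. closed_segment (f t) (g t) \<inter> H {x, y, z} \<noteq> {}) F"
proof -
  let ?h = "gam x y z w"
  define L where "L t = ?h (f t) / (?h (f t) - ?h (g t))" for t
  define r where "r t = f t + L t *\<^sub>R (g t - f t)" for t
  have "?h z1 + l * (?h z2 - ?h z1) = 0" using p(2) unfolding p(1) gam_affine .
  then have l: "l = ?h z1 / (?h z1 - ?h z2)" using h by (simp add: field_simps)
  have "(L \<longlongrightarrow> l) F" unfolding L_def l using h by (intro tendsto_intros tendsto_gam f) auto
  then have r: "(r \<longlongrightarrow> p) F" unfolding r_def p(1) by (intro tendsto_intros f)
  have "eventually (\<lambda>t. 0 < ?h (f t)) F" "eventually (\<lambda>t. ?h (g t) < 0) F"
    using order_tendstoD[OF tendsto_gam[OF f(1)]] order_tendstoD[OF tendsto_gam[OF f(2)]] h by blast+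
  moreover have "eventually (\<lambda>t. 0 < gam y z w x (r t)) F" "eventually (\<lambda>t. 0 < gam x z w y (r t)) F"
    "eventually (\<lambda>t. 0 < gam x y w z (r t)) F"
    using order_tendstoD[OF tendsto_gam[OF r]] p(3-5) by blast+
  ultimately show ?thesis
  proof eventually_elim
    case (elim t)
    have "?h (r t) = ?h (f t) + L t * (?h (g t) - ?h (f t))" unfolding r_def gam_affine ..
    also have "\<dots> = 0" unfolding L_def using elim by (simp add: field_simps)
    finally have "r t \<in> H {x, y, z}" unfolding mem_H3[OF g] using elim by simp
    moreover have "0 \<le> L t" "L t \<le> 1" using elim by (simp_all add: L_def)
    then have "r t \<in> closed_segment (f t) (g t)" unfolding mem_segment r_def by blast
    ultimately show ?case by blast
  qed
qed

text \<open>The order of the third vertices matters: \<open>b\<close> belongs to the flag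
  \<open>(v, a, b)\<close> under consideration, and \<open>c\<close> lies across its edge.\<close>

definition wedge :: "nat \<Rightarrow> nat \<Rightarrow> nat \<Rightarrow> nat \<Rightarrow> bool" where
  "wedge v a b c \<longleftrightarrow> {v, a, b} \<in> \<Delta> \<and> {v, a, c} \<in> \<Delta> \<and> distinct [v, a, b, c] \<and>
    (\<forall>\<rho>\<in>\<Delta>. v \<in> \<rho> \<longrightarrow> a \<in> \<rho> \<longrightarrow> \<rho> = {v, a, b} \<or> \<rho> = {v, a, c})"

lemma wedge_sym: "wedge v a b c \<Longrightarrow> wedge v a c b" "wedge v a b c \<Longrightarrow> wedge a v b c"
  unfolding wedge_def by (auto simp: insert_commute)

lemma wedgeD:
  assumes "wedge v a b c"
  shows "{v, a, b} \<in> \<Delta>" "{v, a, c} \<in> \<Delta>" "distinct [v, a, b, c]"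
    "\<And>\<rho>. \<rho> \<in> \<Delta> \<Longrightarrow> v \<in> \<rho> \<Longrightarrow> a \<in> \<rho> \<Longrightarrow> \<rho> = {v, a, b} \<or> \<rho> = {v, a, c}"
  using assms unfolding wedge_def by blast+

lemma wedge_gen4:
  assumes "wedge v a b c"
  shows "gen4 v a b c"
  unfolding gen4_def using wedgeD(3)[OF assms] Union_upper[OF wedgeD(1)[OF assms]] Union_upper[OF wedgeD(2)[OF assms]]
  by (simp only: insert_subset)

lemma wedge_exists:
  assumes "{v, a, b} \<in> \<Delta>"
  obtains c where "wedge v a b c"
proof -
  have d: "distinct [v, a, b]" using c3[OF assms] by (auto simp: card_insert_if split: if_splits)
  have "{v, a, b} \<in> {\<sigma>\<in>\<Delta>. {v, a} \<subseteq> \<sigma>}" using assms by simp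
  moreover have "finite {\<sigma>\<in>\<Delta>. {v, a} \<subseteq> \<sigma>}" using fin\<Delta> by simp
  ultimately have "card {\<sigma>\<in>\<Delta>. {v, a} \<subseteq> \<sigma>} \<noteq> 0" by auto
  then have c2: "card {\<sigma>\<in>\<Delta>. {v, a} \<subseteq> \<sigma>} = 2" using closed2[of "{v, a}"] d by auto
  define T where "T = {\<sigma>\<in>\<Delta>. {v, a} \<subseteq> \<sigma>}"
  have "card (T - {{v, a, b}}) = 1" using c2 assms unfolding T_def[symmetric] by (subst card_Diff_singleton) (auto simp: T_def)
  then obtain \<sigma>' where "T - {{v, a, b}} = {\<sigma>'}" by (rule card_1_singletonE)
  then have s: "{\<sigma>\<in>\<Delta>. {v, a} \<subseteq> \<sigma>} = {{v, a, b}, \<sigma>'}" "\<sigma>' \<noteq> {v, a, b}" using assms unfolding T_def by blast+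
  then have s': "\<sigma>' \<in> \<Delta>" "v \<in> \<sigma>'" "a \<in> \<sigma>'" by blast+
  have "card (\<sigma>' - {v, a}) = 1" using c3[OF s'(1)] s'(2,3) d by (subst card_Diff_subset) auto
  then obtain c where c: "\<sigma>' - {v, a} = {c}" by (auto simp: card_1_singleton_iff)
  then have sc: "\<sigma>' = {v, a, c}" using s' by blast
  have "c \<noteq> v" "c \<noteq> a" "c \<noteq> b" using c s(2) sc by blast+
  then have dd: "distinct [v, a, b, c]" using d by simp
  have "\<rho> = {v, a, b} \<or> \<rho> = {v, a, c}" if "\<rho> \<in> \<Delta>" "v \<in> \<rho>" "a \<in> \<rho>" for \<rho>
    using s(1) that unfolding sc by blast
  then have "wedge v a b c" unfolding wedge_def using assms s'(1) sc dd by blast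
  then show ?thesis by (rule that)
qed

definition ep :: "nat \<Rightarrow> nat \<Rightarrow> real \<Rightarrow> real^3" where "ep v a t = \<psi> v + t *\<^sub>R (\<psi> a - \<psi> v)"

text \<open>
  The direction \<open>mm v a b c\<close> points from the edge \<open>va\<close> into the wedge between the triangles \<open>vab\<close> and \<open>vac\<close>;
  unlike \<open>(b - v) + (c - v)\<close> it is symmetric in \<open>v\<close> and \<open>a\<close>.
\<close>

definition mm :: "nat \<Rightarrow> nat \<Rightarrow> nat \<Rightarrow> nat \<Rightarrow> real^3" where "mm v a b c = \<psi> b + \<psi> c - \<psi> v - \<psi> a"

lemma ep_sym: "ep v a (1 - t) = ep a v t"
  unfolding ep_def by (simp add: algebra_simps)

lemma mm_sym: "mm v a c b = mm v a b c" "mm a v b c = mm v a b c"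
  unfolding mm_def by (simp_all add: algebra_simps)

lemma ep_in: "0 \<le> t \<Longrightarrow> t \<le> 1 \<Longrightarrow> ep v a t \<in> H {v, a}"
  unfolding H2_points ep_def by blast

text \<open>In the frame \<open>v\<close>, \<open>a\<close>, \<open>b\<close>, \<open>c\<close> the
  vector \<open>mm\<close> has coordinate 1 at both \<open>b\<close> and \<open>c\<close>. Small
  positive multiples of it enter the wedge, negative ones leave it, and both are off the planes of
  the two triangles.\<close>

lemma wedge_gam:
  assumes w: "wedge v a b c"
  shows "gam v a b c (ep v a t + e *\<^sub>R mm v a b c) = e" "gam v a c b (ep v a t + e *\<^sub>R mm v a b c) = e"
    "gam v a b c (ep v a t) = 0" "gam v a c b (ep v a t) = 0" "gam v b c a (ep v a t) = t" "gam a b c v (ep v a t) = 1 - t"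
proof -
  note g = wedge_gen4[OF w]
  note gv = gam_vertex[OF g] gam_vertex[OF gen4_perm(1)[OF g]] gam_vertex[OF gen4_perm(2)[OF g]] gam_vertex[OF gen4_perm(3)[OF g]]
  show z: "gam v a b c (ep v a t) = 0" "gam v a c b (ep v a t) = 0" "gam v b c a (ep v a t) = t" "gam a b c v (ep v a t) = 1 - t"
    unfolding ep_def gam_affine by (simp_all add: gv)
  have mm: "mm v a b c = (\<psi> b - \<psi> v) + (\<psi> c - \<psi> a)" unfolding mm_def by simp
  have "gaml v a b c (mm v a b c) = 1" "gaml v a c b (mm v a b c) = 1"
    unfolding mm gaml_linear(1) gaml_diff by (simp_all add: gv)
  then show "gam v a b c (ep v a t + e *\<^sub>R mm v a b c) = e" "gam v a c b (ep v a t + e *\<^sub>R mm v a b c) = e"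
    unfolding gam_add gaml_linear(3) z(1,2) by simp_all
qed

lemma wedge_mem:
  assumes w: "wedge v a b c"
  shows "x \<in> H {v, a, b} \<Longrightarrow> gam v a b c x = 0 \<and> 0 \<le> gam v a c b x"
    "x \<in> H {v, a, c} \<Longrightarrow> gam v a c b x = 0 \<and> 0 \<le> gam v a b c x"
  using mem_H3[OF wedge_gen4[OF w], of x] mem_H3[OF gen4_perm(3)[OF wedge_gen4[OF w]], of x] by simp_all

text \<open>A triangle other than the two at the edge contains at most one of its endpoints, and by
  \<open>H_Int\<close> meets the edge only there.\<close>

lemma ep_not_in:
  assumes w: "wedge v a b c" and t: "0 < t" "t < 1" and \<rho>: "\<rho> \<in> \<Delta>" "\<rho> \<noteq> {v, a, b}" "\<rho> \<noteq> {v, a, c}" "v \<in> \<rho> \<or> a \<in> \<rho>"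
  shows "ep v a t \<notin> H \<rho>"
proof
  assume x: "ep v a t \<in> H \<rho>"
  have s: "{v, a, b} \<in> \<Delta>" by (rule wedgeD(1)[OF w])
  have "ep v a t \<in> H {v, a} \<inter> H \<rho>" using x t ep_in by auto
  also have "\<dots> = H ({v, a} \<inter> \<rho>)" by (rule H_Int[OF s \<rho>(1)]) (use \<rho>(4) in auto)
  finally have y: "ep v a t \<in> H ({v, a} \<inter> \<rho>)" .
  have "\<not> (v \<in> \<rho> \<and> a \<in> \<rho>)" using w \<rho> unfolding wedge_def by blast
  then have "{v, a} \<inter> \<rho> = {v} \<or> {v, a} \<inter> \<rho> = {a}" using \<rho>(4) by blast
  then have "ep v a t = ep v a 0 \<or> ep v a t = ep v a 1" using y by (auto simp: H_def ep_def)
  then show False using wedge_gam(5)[OF w] t by (metis less_irrefl)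
qed

lemma at_right_tendsto:
  "((\<lambda>e. x + e *\<^sub>R (u :: real^3)) \<longlongrightarrow> x) (at_right 0)" "((\<lambda>e. x + (e * s) *\<^sub>R (u :: real^3)) \<longlongrightarrow> x) (at_right 0)"
  "((\<lambda>e. x - e *\<^sub>R (u :: real^3)) \<longlongrightarrow> x) (at_right 0)"
  by (rule tendsto_eq_intros refl | simp)+

lemma eventually_lt_at_right: "0 < d \<Longrightarrow> eventually (\<lambda>e. e < d) (at_right (0::real))"
  by (rule order_tendstoD(2)[OF tendsto_ident_at])

lemma eventually_others:
  assumes "\<And>\<rho>. \<rho> \<in> \<Delta> \<Longrightarrow> P \<rho> \<Longrightarrow> closed_segment x y \<inter> H \<rho> = {}"
    and f: "(f \<longlongrightarrow> x) F" "(g \<longlongrightarrow> y) F"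
  shows "eventually (\<lambda>e. \<forall>\<rho>\<in>{\<rho>\<in>\<Delta>. P \<rho>}. closed_segment (f e) (g e) \<inter> H \<rho> = {}) F"
  using fin\<Delta> assms(1) by (intro eventually_ball_finite ballI segment_avoid_eventually[OF f] closed_H fin\<sigma>) auto

text \<open>The inside and the outside of the wedge have different colours. The direct segment
  between them runs through the edge, where the colouring says nothing. Hence the intermediate point
  displaced by \<open>\<psi> b - \<psi> c\<close>: it is reached from outside without a crossing and
  from inside by crossing \<open>vab\<close> once.\<close>

lemma edge_sides:
  assumes w: "wedge v a b c" and t: "0 < t" "t < 1"
    and z: "\<And>\<rho>. \<rho> \<in> \<Delta> \<Longrightarrow> \<rho> \<noteq> {v, a, b} \<Longrightarrow> \<rho> \<noteq> {v, a, c} \<Longrightarrow> ep v a t \<notin> H \<rho>"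
  shows "eventually (\<lambda>e. joined True (ep v a t + (- e) *\<^sub>R mm v a b c) (ep v a t + e *\<^sub>R (\<psi> b - \<psi> c)) \<and>
     joined False (ep v a t + e *\<^sub>R mm v a b c) (ep v a t + e *\<^sub>R (\<psi> b - \<psi> c))) (at_right 0)"
proof -
  let ?z = "ep v a t" and ?m = "mm v a b c" and ?k = "\<psi> b - \<psi> c"
  let ?P = "\<lambda>\<rho>. \<rho> \<noteq> {v, a, b} \<and> \<rho> \<noteq> {v, a, c}"
  note g = wedge_gen4[OF w] and W = wedge_gam[OF w]
  note gv = gam_vertex[OF g] gam_vertex[OF gen4_perm(1)[OF g]] gam_vertex[OF gen4_perm(2)[OF g]] gam_vertex[OF gen4_perm(3)[OF g]]
  have K: "gam v a b c (?z + e *\<^sub>R ?k) = - e" "gam v a c b (?z + e *\<^sub>R ?k) = e" for e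
    unfolding gam_add gaml_linear(3) gaml_diff by (simp_all add: W gv)
  have "b \<notin> {v, a, c}" using wedgeD(3)[OF w] by simp
  then have sd: "{v, a, b} \<in> \<Delta>" "{v, a, b} \<noteq> {v, a, c}" using wedgeD(1)[OF w] by blast+
  have z': "closed_segment ?z ?z \<inter> H \<rho> = {}" if "\<rho> \<in> \<Delta>" "?P \<rho>" for \<rho> using z that by simp
  have m': "((\<lambda>e. ?z + (- e) *\<^sub>R ?m) \<longlongrightarrow> ?z) (at_right 0)" using at_right_tendsto(3) by simp
  have "eventually (\<lambda>e. \<forall>\<rho>\<in>{\<rho>\<in>\<Delta>. ?P \<rho>}. closed_segment (?z + (- e) *\<^sub>R ?m) (?z + e *\<^sub>R ?k) \<inter> H \<rho> = {}) (at_right 0)"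
    using z' m' at_right_tendsto(1) by (rule eventually_others)
  moreover have "eventually (\<lambda>e. \<forall>\<rho>\<in>{\<rho>\<in>\<Delta>. ?P \<rho>}. closed_segment (?z + e *\<^sub>R ?m) (?z + e *\<^sub>R ?k) \<inter> H \<rho> = {}) (at_right 0)"
    using z' at_right_tendsto(1) at_right_tendsto(1) by (rule eventually_others)
  moreover have "eventually (\<lambda>e. 0 < e \<and> e < t \<and> e < 1 - t) (at_right (0::real))"
    using t by (intro eventually_conj eventually_at_right_less eventually_lt_at_right) auto
  ultimately show ?thesis
  proof eventually_elim
    case (elim e)
    then have e: "0 < e" "e < t" "e < 1 - t" by auto
    show ?case
    proof
      show "joined True (?z + (- e) *\<^sub>R ?m) (?z + e *\<^sub>R ?k)"
      proof (rule joinedI_empty)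
        fix \<rho> assume \<rho>: "\<rho> \<in> \<Delta>"
        have "x \<notin> H {v, a, b}" "x \<notin> H {v, a, c}" if x: "x \<in> closed_segment (?z + (- e) *\<^sub>R ?m) (?z + e *\<^sub>R ?k)" for x
        proof -
          obtain l where l: "x = (?z + (- e) *\<^sub>R ?m) + l *\<^sub>R ((?z + e *\<^sub>R ?k) - (?z + (- e) *\<^sub>R ?m))" using x unfolding mem_segment by blast
          have "gam v a b c x = - e" unfolding l gam_affine W K by simp
          then show "x \<notin> H {v, a, b}" "x \<notin> H {v, a, c}" using wedge_mem[OF w, of x] e by auto
        qed
        then show "closed_segment (?z + (- e) *\<^sub>R ?m) (?z + e *\<^sub>R ?k) \<inter> H \<rho> = {}" using elim(1) \<rho> by blast
      qed
      have seg: "gam v a c b x = e \<and> (\<exists>l. 0 \<le> l \<and> l \<le> 1 \<and> gam v a b c x = e - 2 * l * e \<and> x = ?z + e *\<^sub>R ?m + l *\<^sub>R ((?z + e *\<^sub>R ?k) - (?z + e *\<^sub>R ?m)))"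
        if x: "x \<in> closed_segment (?z + e *\<^sub>R ?m) (?z + e *\<^sub>R ?k)" for x
      proof -
        obtain l where l: "0 \<le> l" "l \<le> 1" "x = (?z + e *\<^sub>R ?m) + l *\<^sub>R ((?z + e *\<^sub>R ?k) - (?z + e *\<^sub>R ?m))" using x unfolding mem_segment by blast
        have "gam v a c b x = e" "gam v a b c x = e - 2 * l * e" unfolding l(3) gam_affine W K by simp_all
        then show ?thesis using l by blast
      qed
      \<comment> \<open>The midpoint of the segment, where the coordinate of \<open>c\<close>
        changes sign; it is interior to the triangle \<open>vab\<close>.\<close>
      define r where "r = ?z + e *\<^sub>R (\<psi> b - (1/2) *\<^sub>R \<psi> v - (1/2) *\<^sub>R \<psi> a)"
      have r: "r = ?z + e *\<^sub>R ?m + (1/2) *\<^sub>R ((?z + e *\<^sub>R ?k) - (?z + e *\<^sub>R ?m))"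
        unfolding r_def mm_def vec_eq_iff by (simp add: algebra_simps)
      have "r = ?z + e *\<^sub>R ((1/2) *\<^sub>R (\<psi> b - \<psi> v) + (1/2) *\<^sub>R (\<psi> b - \<psi> a))"
        unfolding r_def vec_eq_iff by (simp add: algebra_simps)
      note rr = this
      have rc: "gam v a b c r = 0" "gam v a c b r = e" "gam v b c a r = t - e / 2" "gam a b c v r = 1 - t - e / 2"
        unfolding rr gam_add gaml_linear(1,3) gaml_diff by (simp_all add: W gv)
      have rH: "r \<in> H {v, a, b}" unfolding mem_H3[OF g] rc using e by simp
      have rs: "r \<in> closed_segment (?z + e *\<^sub>R ?m) (?z + e *\<^sub>R ?k)" unfolding mem_segment r by (rule exI[of _ "1/2"]) simp
      have "joined (even (card {{v, a, b}})) (?z + e *\<^sub>R ?m) (?z + e *\<^sub>R ?k)"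
      proof (rule joinedI)
        show "{{v, a, b}} \<subseteq> \<Delta>" using sd by simp
        show "closed_segment (?z + e *\<^sub>R ?m) (?z + e *\<^sub>R ?k) \<inter> H \<rho> = {}" if \<rho>: "\<rho> \<in> \<Delta>" "\<rho> \<notin> {{v, a, b}}" for \<rho>
        proof (cases "\<rho> = {v, a, c}")
          case True
          show ?thesis unfolding True using seg wedge_mem(2)[OF w] e by (metis disjoint_iff less_irrefl)
        next
          case False
          then show ?thesis using elim(2) \<rho> by blast
        qed
        show "closed_segment (?z + e *\<^sub>R ?m) (?z + e *\<^sub>R ?k) \<inter> H \<rho> \<noteq> {} \<and> ?z + e *\<^sub>R ?m \<notin> H \<rho> \<and> ?z + e *\<^sub>R ?k \<notin> H \<rho>" if "\<rho> \<in> {{v, a, b}}" for \<rho>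
        proof -
          have "\<rho> = {v, a, b}" using that by simp
          moreover have "?z + e *\<^sub>R ?m \<notin> H {v, a, b}" "?z + e *\<^sub>R ?k \<notin> H {v, a, b}"
            using wedge_mem(1)[OF w] W(1)[of t e] K(1)[of e] e by force+
          ultimately show ?thesis using rH rs by blast
        qed
        show "closed_segment (?z + e *\<^sub>R ?m) (?z + e *\<^sub>R ?k) \<inter> H f = {}" if f: "\<rho> \<in> {{v, a, b}}" "f \<subseteq> \<rho>" "card f = 2" for \<rho> f
        proof (rule ccontr)
          assume "\<not> ?thesis"
          then obtain x where x: "x \<in> closed_segment (?z + e *\<^sub>R ?m) (?z + e *\<^sub>R ?k)" "x \<in> H f" by blast
          have fs: "f \<subseteq> {v, a, b}" using f by simp
          have "gam v a b c x = 0" using wedge_mem(1)[OF w] x(2) H_mono[OF fs] by blast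
          moreover obtain l where l: "gam v a b c x = e - 2 * l * e" "x = ?z + e *\<^sub>R ?m + l *\<^sub>R ((?z + e *\<^sub>R ?k) - (?z + e *\<^sub>R ?m))"
            using seg[OF x(1)] by blast
          ultimately have "l = 1/2" using e by simp
          then have "x = r" using l(2) unfolding r by simp
          then show False using strict_edge[OF g _ _ _ fs f(3), of x] x(2) rc e by simp
        qed
      qed
      then show "joined False (?z + e *\<^sub>R ?m) (?z + e *\<^sub>R ?k)" by simp
    qed
  qed
qed

text \<open>\<open>s\<close> selects the side of the edge. For \<open>s = 1\<close> the coordinates
  of \<open>b\<close> and \<open>c\<close> both stay positive along the segment; for
  \<open>s = - 1\<close> that of \<open>c\<close> stays negative. Either way the two triangles at
  the edge are missed, and the others are missed because the limit segment misses them.\<close>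

lemma lift_off_edge:
  assumes w: "wedge v a b c" and s: "s = 1 \<or> s = - 1"
    and Q: "(Q \<longlongrightarrow> q) (at_right 0)" "eventually (\<lambda>e. 0 < s * gam v a b c (Q e) \<and> 0 < gam v a c b (Q e)) (at_right 0)"
    and z: "\<And>\<rho>. \<rho> \<in> \<Delta> \<Longrightarrow> \<rho> \<noteq> {v, a, b} \<Longrightarrow> \<rho> \<noteq> {v, a, c} \<Longrightarrow> closed_segment (ep v a t) q \<inter> H \<rho> = {}"
  shows "eventually (\<lambda>e. joined True (ep v a t + (e * s) *\<^sub>R mm v a b c) (Q e)) (at_right 0)"
proof -
  let ?z = "ep v a t" and ?m = "mm v a b c"
  let ?P = "\<lambda>\<rho>. \<rho> \<noteq> {v, a, b} \<and> \<rho> \<noteq> {v, a, c}"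
  note W = wedge_gam[OF w]
  have "eventually (\<lambda>e. \<forall>\<rho>\<in>{\<rho>\<in>\<Delta>. ?P \<rho>}. closed_segment (?z + (e * s) *\<^sub>R ?m) (Q e) \<inter> H \<rho> = {}) (at_right 0)"
    using z at_right_tendsto(2) Q(1) by (intro eventually_others) auto
  moreover have "eventually (\<lambda>e. 0 < e) (at_right (0::real))" by (rule eventually_at_right_less)
  ultimately show ?thesis using Q(2)
  proof eventually_elim
    case (elim e)
    show ?case
    proof (rule joinedI_empty)
      fix \<rho> assume \<rho>: "\<rho> \<in> \<Delta>"
      have "x \<notin> H {v, a, b}" "x \<notin> H {v, a, c}" if x: "x \<in> closed_segment (?z + (e * s) *\<^sub>R ?m) (Q e)" for x
      proof -
        obtain l where l: "0 \<le> l" "l \<le> 1" "x = (?z + (e * s) *\<^sub>R ?m) + l *\<^sub>R (Q e - (?z + (e * s) *\<^sub>R ?m))" using x unfolding mem_segment by blast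
        have 1: "gam v a b c x = (1 - l) * (e * s) + l * gam v a b c (Q e)"
          unfolding l(3) gam_affine W by (simp add: algebra_simps)
        have 2: "gam v a c b x = (1 - l) * (e * s) + l * gam v a c b (Q e)"
          unfolding l(3) gam_affine W by (simp add: algebra_simps)
        have c1: "0 < (1 - l) * e + l * y" if "0 < y" for y
          using l(1,2) elim(2) that by (cases "l = 0") (auto intro: add_nonneg_pos)
        have ss: "s * s = 1" using s by auto
        have "s * gam v a b c x = (1 - l) * e * (s * s) + l * (s * gam v a b c (Q e))" unfolding 1 by (simp add: algebra_simps)
        then have p1: "0 < s * gam v a b c x" using c1 elim(3) ss by simp
        then show "x \<notin> H {v, a, b}" using wedge_mem(1)[OF w, of x] by auto
        show "x \<notin> H {v, a, c}"
        proof (cases "s = 1")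
          case True
          then have "0 < gam v a c b x" unfolding 2 using c1 elim(3) by simp
          then show ?thesis using wedge_mem(2)[OF w, of x] by auto
        next
          case False
          then show ?thesis using wedge_mem(2)[OF w, of x] p1 s by auto
        qed
      qed
      then show "closed_segment (?z + (e * s) *\<^sub>R ?m) (Q e) \<inter> H \<rho> = {}" using elim(1) \<rho> by blast
    qed
  qed
qed

definition pierced :: "nat \<Rightarrow> nat \<Rightarrow> nat set set" where
  "pierced v a = {\<tau>\<in>\<Delta>. v \<notin> \<tau> \<and> a \<notin> \<tau> \<and> H {v, a} \<inter> H \<tau> \<noteq> {}}"

text \<open>A segment parallel to the edge and slightly off it meets exactly the triangles that the
  edge pierces, since both crossing and avoiding persist under a small shift. The parts of the edge
  within \<open>\<eta>\<close> of its ends contain no piercing and can be left out.\<close>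

lemma edge_walk:
  assumes w: "wedge v a b c" and s: "s \<noteq> 0" and \<eta>: "0 < \<eta>" "\<eta> < 1 / 2"
    and near: "\<And>\<tau>. \<tau> \<in> \<Delta> \<Longrightarrow> v \<notin> \<tau> \<Longrightarrow> closed_segment (\<psi> v) (ep v a \<eta>) \<inter> H \<tau> = {}"
      "\<And>\<tau>. \<tau> \<in> \<Delta> \<Longrightarrow> a \<notin> \<tau> \<Longrightarrow> closed_segment (\<psi> a) (ep a v \<eta>) \<inter> H \<tau> = {}"
  shows "eventually (\<lambda>e. joined (even (card (pierced v a)))
    (ep v a \<eta> + (e * s) *\<^sub>R mm v a b c) (ep a v \<eta> + (e * s) *\<^sub>R mm v a b c)) (at_right 0)"
proof -
  let ?z1 = "ep v a \<eta>" and ?z2 = "ep a v \<eta>" and ?m = "mm v a b c"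
  let ?x1 = "\<lambda>e. ?z1 + (e * s) *\<^sub>R ?m" and ?x2 = "\<lambda>e. ?z2 + (e * s) *\<^sub>R ?m"
  note W = wedge_gam[OF w]
  have lim: "(?x1 \<longlongrightarrow> ?z1) (at_right 0)" "(?x2 \<longlongrightarrow> ?z2) (at_right 0)" by (rule at_right_tendsto)+
  have seg: "\<exists>t. \<eta> \<le> t \<and> t \<le> 1 - \<eta> \<and> x = ep v a t + u" if x: "x \<in> closed_segment (?z1 + u) (?z2 + u)" for x u
  proof -
    obtain l where l: "0 \<le> l" "l \<le> 1" "x = (?z1 + u) + l *\<^sub>R ((?z2 + u) - (?z1 + u))" using x unfolding mem_segment by blast
    have "x = ep v a (\<eta> + l * (1 - 2 * \<eta>)) + u" unfolding l(3) ep_def vec_eq_iff by (simp add: algebra_simps)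
    moreover have "l * (1 - 2 * \<eta>) \<le> 1 * (1 - 2 * \<eta>)" "0 \<le> l * (1 - 2 * \<eta>)" using l \<eta> by (auto intro!: mult_right_mono)
    ultimately show ?thesis by (intro exI[of _ "\<eta> + l * (1 - 2 * \<eta>)"]) auto
  qed
  have ps: "pierced v a \<subseteq> \<Delta>" by (auto simp: pierced_def)
  have fp: "finite (pierced v a)" using fin\<Delta> ps finite_subset by blast
  have 1: "eventually (\<lambda>e. \<forall>\<rho>\<in>{\<rho>\<in>\<Delta>. \<rho> \<noteq> {v, a, b} \<and> \<rho> \<noteq> {v, a, c} \<and> \<rho> \<notin> pierced v a}. closed_segment (?x1 e) (?x2 e) \<inter> H \<rho> = {}) (at_right 0)"
  proof (rule eventually_others[OF _ lim])
    fix \<rho> assume \<rho>: "\<rho> \<in> \<Delta>" "\<rho> \<noteq> {v, a, b} \<and> \<rho> \<noteq> {v, a, c} \<and> \<rho> \<notin> pierced v a"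
    show "closed_segment ?z1 ?z2 \<inter> H \<rho> = {}"
    proof (rule ccontr)
      assume "\<not> ?thesis"
      then obtain x where x: "x \<in> closed_segment ?z1 ?z2" "x \<in> H \<rho>" by blast
      then obtain t where t: "\<eta> \<le> t" "t \<le> 1 - \<eta>" "x = ep v a t" using seg[of x 0] by auto
      show False
      proof (cases "v \<in> \<rho> \<or> a \<in> \<rho>")
        case True
        then show False using ep_not_in[OF w _ _ \<rho>(1), of t] \<rho>(2) x(2) t \<eta> by simp
      next
        case False
        then show False using \<rho> x(2) t \<eta> ep_in[of t v a] unfolding pierced_def by auto
      qed
    qed
  qed
  have 2: "eventually (\<lambda>e. \<forall>\<rho>\<in>pierced v a. closed_segment (?x1 e) (?x2 e) \<inter> H \<rho> \<noteq> {} \<and> ?x1 e \<notin> H \<rho> \<and> ?x2 e \<notin> H \<rho> \<and>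
     (\<forall>f\<in>{f. f \<subseteq> \<rho> \<and> card f = 2}. closed_segment (?x1 e) (?x2 e) \<inter> H f = {})) (at_right 0)"
  proof (rule eventually_ball_finite[OF fp], rule ballI)
    fix \<rho> assume \<rho>: "\<rho> \<in> pierced v a"
    then have \<rho>': "\<rho> \<in> \<Delta>" "v \<notin> \<rho>" "a \<notin> \<rho>" by (auto simp: pierced_def)
    obtain x y z where r: "\<rho> = {x, y, z}" "distinct [x, y, z]" using c3[OF \<rho>'(1)] by (auto simp: card_3_iff)
    have vab: "{v, a, b} \<in> \<Delta>" "v \<noteq> a" using wedgeD(1,3)[OF w] by simp_all
    have "v \<in> \<Union>\<Delta>" "a \<in> \<Union>\<Delta>" "{x, y, z} \<subseteq> \<Union>\<Delta>" using vab(1) \<rho>'(1) unfolding r(1) by blast+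
    then have dV: "distinct [v, a, x, y, z]" "{v, a, x, y, z} \<subseteq> \<Union>\<Delta>"
      using vab(2) \<rho>'(2,3) r(2) unfolding r(1) by simp_all
    obtain p where p: "p \<in> H {v, a}" "p \<in> H {x, y, z}" using \<rho> r by (auto simp: pierced_def)
    note ps = pierce_strict[OF dV p]
    obtain t where t: "0 < t" "t < 1" "p = ep v a t" using ps(4) unfolding ep_def by blast
    have g: "gen4 x y z v" using dV by (auto simp: gen4_def)
    have t1: "\<eta> < t"
    proof (rule ccontr)
      assume "\<not> ?thesis"
      then have "p \<in> closed_segment (\<psi> v) ?z1" unfolding mem_segment t(3) ep_def using t \<eta>
        by (intro exI[of _ "t / \<eta>"]) auto
      then show False using near(1)[OF \<rho>'(1,2)] p(2) r(1) by blast
    qed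
    have t2: "t < 1 - \<eta>"
    proof (rule ccontr)
      assume "\<not> ?thesis"
      moreover have "p = ep a v (1 - t)" using ep_sym[of a v t] t(3) by simp
      ultimately have "p \<in> closed_segment (\<psi> a) ?z2" unfolding mem_segment ep_def using t \<eta>
        by (intro exI[of _ "(1 - t) / \<eta>"]) auto
      then show False using near(2)[OF \<rho>'(1,3)] p(2) r(1) by blast
    qed
    let ?h = "gam x y z v"
    have hl: "?h (ep v a l) = 1 + l * (?h (\<psi> a) - 1)" for l unfolding ep_def gam_affine using gam_vertex[OF g] by simp
    have p0: "?h p = 0" using p(2) mem_H3[OF g] by simp
    then have k: "?h (\<psi> a) - 1 = - 1 / t" using hl[of t] t by (simp add: field_simps)
    have h1: "0 < ?h ?z1" unfolding hl k using t1 t by (simp add: field_simps)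
    have h2: "?h ?z2 < 0" unfolding ep_sym[of v a \<eta>, symmetric] hl k using t2 t by (simp add: field_simps)
    have pl: "p = ?z1 + ((t - \<eta>) / (1 - 2 * \<eta>)) *\<^sub>R (?z2 - ?z1)"
    proof -
      have "?z2 - ?z1 = (1 - 2 * \<eta>) *\<^sub>R (\<psi> a - \<psi> v)" unfolding ep_def vec_eq_iff by (simp add: algebra_simps)
      then have "((t - \<eta>) / (1 - 2 * \<eta>)) *\<^sub>R (?z2 - ?z1) = (t - \<eta>) *\<^sub>R (\<psi> a - \<psi> v)" using \<eta> by simp
      then show ?thesis unfolding t(3) by (simp add: ep_def scaleR_diff_left)
    qed
    have "eventually (\<lambda>e. closed_segment (?x1 e) (?x2 e) \<inter> H \<rho> \<noteq> {}) (at_right 0)"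
      unfolding r(1) by (rule crossing_persists[OF g lim h1 h2 pl p0 ps(1-3)])
    moreover have "eventually (\<lambda>e. closed_segment (?x1 e) (?x1 e) \<inter> H \<rho> = {}) (at_right 0)"
      using near(1)[OF \<rho>'(1,2)] by (intro segment_avoid_eventually[OF lim(1) lim(1)] closed_H fin\<sigma> \<rho>'(1)) auto
    moreover have "eventually (\<lambda>e. closed_segment (?x2 e) (?x2 e) \<inter> H \<rho> = {}) (at_right 0)"
      using near(2)[OF \<rho>'(1,3)] by (intro segment_avoid_eventually[OF lim(2) lim(2)] closed_H fin\<sigma> \<rho>'(1)) auto
    moreover have "eventually (\<lambda>e. \<forall>f\<in>{f. f \<subseteq> \<rho> \<and> card f = 2}. closed_segment (?x1 e) (?x2 e) \<inter> H f = {}) (at_right 0)"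
    proof (rule eventually_ball_finite)
      show "finite {f. f \<subseteq> \<rho> \<and> card f = 2}" using fin\<sigma>[OF \<rho>'(1)] by simp
      show "\<forall>f\<in>{f. f \<subseteq> \<rho> \<and> card f = 2}. eventually (\<lambda>e. closed_segment (?x1 e) (?x2 e) \<inter> H f = {}) (at_right 0)"
      proof (intro ballI segment_avoid_eventually[OF lim])
        fix f assume f: "f \<in> {f. f \<subseteq> \<rho> \<and> card f = 2}"
        then obtain q1 q2 where q: "f = {q1, q2}" "q1 \<noteq> q2" by (auto simp: card_2_iff)
        show "closed (H f)" using q by (simp add: closed_H)
        have "gen4 v a q1 q2" using q f dV r by (auto simp: gen4_def)
        then have "H {v, a} \<inter> H f = {}" unfolding q(1) by (rule edges_disjoint)
        moreover have "closed_segment ?z1 ?z2 \<subseteq> H {v, a}" using seg[of _ 0] ep_in \<eta> by fastforce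
        ultimately show "closed_segment ?z1 ?z2 \<inter> H f = {}" by blast
      qed
    qed
    ultimately show "eventually (\<lambda>e. closed_segment (?x1 e) (?x2 e) \<inter> H \<rho> \<noteq> {} \<and> ?x1 e \<notin> H \<rho> \<and> ?x2 e \<notin> H \<rho> \<and>
     (\<forall>f\<in>{f. f \<subseteq> \<rho> \<and> card f = 2}. closed_segment (?x1 e) (?x2 e) \<inter> H f = {})) (at_right 0)"
      by eventually_elim auto
  qed
  have "eventually (\<lambda>e. 0 < e) (at_right (0::real))" by (rule eventually_at_right_less)
  with 1 2 show ?thesis
  proof eventually_elim
    case (elim e)
    have own: "x \<notin> H {v, a, b}" "x \<notin> H {v, a, c}" if x: "x \<in> closed_segment (?x1 e) (?x2 e)" for x
    proof -
      obtain t where "x = ep v a t + (e * s) *\<^sub>R ?m" using seg[OF x] by blast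
      then have "gam v a b c x \<noteq> 0" "gam v a c b x \<noteq> 0" using W(1,2)[of t "e * s"] s elim(3) by simp_all
      then show "x \<notin> H {v, a, b}" "x \<notin> H {v, a, c}" using wedge_mem[OF w, of x] by auto
    qed
    show ?case
    proof (rule joinedI[OF ps])
      fix \<rho> assume "\<rho> \<in> \<Delta>" "\<rho> \<notin> pierced v a"
      then show "closed_segment (?x1 e) (?x2 e) \<inter> H \<rho> = {}" using elim(1) own by blast
    qed (use elim(2) in blast)+
  qed
qed

end

section \<open>Colours near the surface\<close>

context generic_surface begin

lemma face_segment:
  assumes \<sigma>: "\<sigma> \<in> \<Delta>" and d: "d \<in> \<Union>\<Delta>" "d \<notin> \<sigma>" and i: "i \<in> \<sigma>"
    and x: "x \<in> H \<sigma>" "y \<in> H \<sigma>" "x \<notin> H (\<sigma> - {i})" and l: "0 \<le> l" "l < 1"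
  shows "x + l *\<^sub>R (y - x) \<notin> H (\<sigma> - {i})"
proof -
  have "card (\<sigma> - {i}) = 2" using c3[OF \<sigma>] i by simp
  then obtain b c where bc: "\<sigma> - {i} = {b, c}" "b \<noteq> c" by (auto simp: card_2_iff)
  then have s: "\<sigma> = {i, b, c}" "i \<notin> {b, c}" using i by blast+
  have "{i, b, c} \<subseteq> \<Union>\<Delta>" using \<sigma> unfolding s(1) by blast
  then have g: "gen4 i b c d" unfolding gen4_def using d s(2) bc(2) unfolding s(1) by auto
  have "0 < gam b c d i x" using x(1,3) unfolding bc unfolding s(1) mem_H2_face[OF g] using mem_H3[OF g, of x] by force
  moreover have "0 \<le> gam b c d i y" using x(2) unfolding s(1) mem_H3[OF g] by simp
  ultimately have "0 < (1 - l) * gam b c d i x + l * gam b c d i y" using l by (intro add_pos_nonneg) auto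
  then have "gam b c d i (x + l *\<^sub>R (y - x)) \<noteq> 0" unfolding gam_affine by (simp add: algebra_simps)
  then show ?thesis unfolding bc(1) mem_H2_face[OF g] by blast
qed

lemma segment_in_H: "x \<in> H \<sigma> \<Longrightarrow> y \<in> H \<sigma> \<Longrightarrow> 0 \<le> l \<Longrightarrow> l \<le> 1 \<Longrightarrow> x + l *\<^sub>R (y - x) \<in> H \<sigma>"
  using closed_segment_subset[of x "H \<sigma>" y] mem_segment[of _ x y] unfolding H_def by (auto simp: convex_convex_hull)

lemma vertex_not_in:
  assumes "v \<in> \<Union>\<Delta>" "\<rho> \<in> \<Delta>" "v \<notin> \<rho>"
  shows "\<psi> v \<notin> H \<rho>"
proof -
  obtain x y z where r: "\<rho> = {x, y, z}" "distinct [x, y, z]" using c3[OF assms(2)] by (auto simp: card_3_iff)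
  have "{x, y, z} \<subseteq> \<Union>\<Delta>" using assms(2) unfolding r(1) by blast
  then have "gen4 x y z v" unfolding gen4_def using assms(1,3) r by auto
  then show ?thesis unfolding r(1) by (rule vertex_not_in_H3)
qed

lemma wedge_unique: "wedge v a b c \<Longrightarrow> wedge v a b c' \<Longrightarrow> c = c'"
proof -
  assume w: "wedge v a b c" "wedge v a b c'"
  have "{v, a, c'} = {v, a, b} \<or> {v, a, c'} = {v, a, c}"
    using wedgeD(4)[OF w(1) wedgeD(2)[OF w(2)]] by blast
  moreover have "c' \<notin> {v, a, b}" using wedgeD(3)[OF w(2)] by simp
  ultimately have "c' \<in> {v, a, c}" by blast
  then show "c = c'" using \<open>c' \<notin> {v, a, b}\<close> by blast
qed

text \<open>A colouring is available for finitely many points at a time, so all comparisons to be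
  used together are collected in one finite set \<open>J\<close>.\<close>

lemma mod_2_colours:
  assumes "finite J" "\<And>b x y. (b, x, y) \<in> J \<Longrightarrow> joined b x y"
  obtains w :: "real^3 \<Rightarrow> bool" where "\<And>b x y. (b, x, y) \<in> J \<Longrightarrow> (w x = w y) = b"
proof -
  let ?S = "(fst \<circ> snd) ` J \<union> (snd \<circ> snd) ` J"
  have nd: "\<exists>v. triple_product (\<psi> b - \<psi> a) (\<psi> c - \<psi> a) v \<noteq> 0" if abc: "{a, b, c} \<in> \<Delta>" "distinct [a, b, c]" for a b c
  proof -
    obtain d where "wedge a b c d" using wedge_exists[OF abc(1)] .
    then show ?thesis using gp[of a b c d] wedge_gen4[of a b c d] unfolding gen4_def by blast
  qed
  have ev: "even (card {\<sigma>\<in>\<Delta>. e \<subseteq> \<sigma>})" if "card e = 2" for e using closed2[OF that] by auto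
  have finS: "finite ?S" using assms(1) by simp
  show ?thesis
  proof (rule mod_2_colouring[OF fin\<Delta> finS c3 ev nd])
    fix w :: "real^3 \<Rightarrow> bool"
    assume w: "\<And>P Q. P \<in> ?S \<Longrightarrow> Q \<in> ?S \<Longrightarrow>
       (\<And>\<sigma>. \<sigma> \<in> \<Delta> \<Longrightarrow> P \<notin> convex hull (\<psi> ` \<sigma>) \<and> Q \<notin> convex hull (\<psi> ` \<sigma>)) \<Longrightarrow>
       (\<And>\<sigma> e. \<sigma> \<in> \<Delta> \<Longrightarrow> e \<subseteq> \<sigma> \<Longrightarrow> card e = 2 \<Longrightarrow> closed_segment P Q \<inter> convex hull (\<psi> ` e) = {}) \<Longrightarrow>
       w P = w Q \<longleftrightarrow> even (card {\<sigma>\<in>\<Delta>. closed_segment P Q \<inter> convex hull (\<psi> ` \<sigma>) \<noteq> {}})"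
    show ?thesis
    proof (rule that[of w])
    fix b x y assume j: "(b, x, y) \<in> J"
    then have S: "x \<in> ?S" "y \<in> ?S" by force+
    have J: "joined b x y" by (rule assms(2)[OF j])
    have "w x = w y \<longleftrightarrow> even (card {\<sigma>\<in>\<Delta>. closed_segment x y \<inter> H \<sigma> \<noteq> {}})"
      unfolding H_def by (rule w[OF S]) (use J in \<open>auto simp: joined_def H_def\<close>)
    then show "(w x = w y) = b" using J unfolding joined_def by simp
    qed
  qed
qed

end

text \<open>\<open>or v a b\<close> says that \<open>v\<close>, \<open>a\<close>, \<open>b\<close>
  is the positive cyclic order of their triangle. The triangles are oriented one by one; coherence
  across an edge is the quantity to be measured.\<close>

locale oriented_surface = generic_surface +
  fixes or :: "nat \<Rightarrow> nat \<Rightarrow> nat \<Rightarrow> bool"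
  assumes or_cyc: "\<And>v a b. {v, a, b} \<in> \<Delta> \<Longrightarrow> or a b v = or v a b"
    and or_swap: "\<And>v a b. {v, a, b} \<in> \<Delta> \<Longrightarrow> or v b a = (\<not> or v a b)"
    and notriple: "\<And>\<rho> \<sigma> \<tau>. \<rho> \<in> \<Delta> \<Longrightarrow> \<sigma> \<in> \<Delta> \<Longrightarrow> \<tau> \<in> \<Delta> \<Longrightarrow> \<rho> \<inter> \<sigma> = {} \<Longrightarrow> \<rho> \<inter> \<tau> = {} \<Longrightarrow> \<sigma> \<inter> \<tau> = {} \<Longrightarrow>
      H \<rho> \<inter> H \<sigma> \<inter> H \<tau> = {}"
begin

definition side :: "nat \<Rightarrow> nat \<Rightarrow> nat \<Rightarrow> real^3 \<Rightarrow> real" where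
  "side v a b x = (if or v a b then 1 else - 1) * triple_product (\<psi> a - \<psi> v) (\<psi> b - \<psi> v) (x - \<psi> v)"

definition sidel :: "nat \<Rightarrow> nat \<Rightarrow> nat \<Rightarrow> real^3 \<Rightarrow> real" where
  "sidel v a b u = (if or v a b then 1 else - 1) * triple_product (\<psi> a - \<psi> v) (\<psi> b - \<psi> v) u"

lemma side_add: "side v a b (x + u) = side v a b x + sidel v a b u"
proof -
  have "x + u - \<psi> v = (x - \<psi> v) + u" by simp
  then show ?thesis unfolding side_def sidel_def by (simp only: triple_product_linear distrib_left)
qed

lemma sidel_linear: "sidel v a b (u + u') = sidel v a b u + sidel v a b u'" "sidel v a b (t *\<^sub>R u) = t * sidel v a b u"
  unfolding sidel_def by (simp_all add: triple_product_linear distrib_left)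

lemma sidel_diff: "sidel v a b (x - y) = side v a b x - side v a b y"
  using side_add[of v a b y "x - y"] by simp

lemma side_affine: "side v a b (x + t *\<^sub>R (y - x)) = side v a b x + t * (side v a b y - side v a b x)"
  unfolding side_add sidel_linear sidel_diff ..

lemma side_vertex: "side v a b (\<psi> v) = 0" "side v a b (\<psi> a) = 0" "side v a b (\<psi> b) = 0"
  unfolding side_def by simp_all

lemma side_perm:
  assumes "{v, a, b} \<in> \<Delta>"
  shows "side a b v x = side v a b x" "side v b a x = side v a b x"
proof -
  have "triple_product (\<psi> b - \<psi> a) (\<psi> v - \<psi> a) (x - \<psi> a) = triple_product (\<psi> a - \<psi> v) (\<psi> b - \<psi> v) (x - \<psi> v)"
    unfolding triple_product_def by (simp add: algebra_simps)
  then show "side a b v x = side v a b x" unfolding side_def or_cyc[OF assms] by simp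
  show "side v b a x = side v a b x" unfolding side_def or_swap[OF assms] triple_product_swap(1)[of "\<psi> b - \<psi> v"] by simp
qed

lemma side_perms:
  assumes d: "{v, a, b} \<in> \<Delta>" and e: "{v, a, b} = {v', a', b'}"
  shows "side v' a' b' = side v a b"
proof
  fix x
  have d3: "distinct [v, a, b]" "distinct [v', a', b']" using c3[OF d] c3[OF d] unfolding e by (auto simp: card_insert_if split: if_splits) (use c3[OF d] in \<open>auto simp: card_insert_if split: if_splits\<close>)
  have s: "{a, b, v} \<in> \<Delta>" "{b, v, a} \<in> \<Delta>" "{v, b, a} \<in> \<Delta>" "{b, a, v} \<in> \<Delta>" "{a, v, b} \<in> \<Delta>"
    using d by (simp_all add: insert_commute)
  note p = side_perm(1)[OF d, of x] side_perm(2)[OF d, of x] side_perm(1)[OF s(1), of x] side_perm(1)[OF s(3), of x] side_perm(1)[OF s(4), of x]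
  have "(v', a', b') \<in> {(v, a, b), (a, b, v), (b, v, a), (v, b, a), (b, a, v), (a, v, b)}"
  proof -
    have "v' \<in> {v, a, b}" "a' \<in> {v, a, b}" "b' \<in> {v, a, b}" unfolding e by simp_all
    then show ?thesis using d3 by auto
  qed
  then show "side v' a' b' x = side v a b x" using p by auto
qed

lemma side_hull:
  assumes "x \<in> H {v, a, b}"
  shows "side v a b x = 0"
proof -
  obtain u1 u2 u3 where u: "u1 + u2 + u3 = 1" "x = u1 *\<^sub>R \<psi> v + u2 *\<^sub>R \<psi> a + u3 *\<^sub>R \<psi> b"
    using assms unfolding H_def by (auto simp: convex_hull_3)
  have "u1 = 1 - u2 - u3" using u(1) by simp
  then have "x = \<psi> v + (u2 *\<^sub>R (\<psi> a - \<psi> v) + u3 *\<^sub>R (\<psi> b - \<psi> v))" unfolding u(2) \<open>u1 = 1 - u2 - u3\<close> by (simp add: algebra_simps)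
  then show ?thesis by (simp only: side_add sidel_linear sidel_diff side_vertex) simp
qed

lemma side_gam:
  assumes g: "gen4 v a b c"
  shows "side v a b x = gam v a b c x * side v a b (\<psi> c)" "side v a b (\<psi> c) \<noteq> 0"
  using gp[of v a b c] g unfolding side_def gam_def gen4_def by auto

text \<open>The side of \<open>vab\<close> on which its neighbour lies. Multiplied by
  \<open>mm\<close>, this sign displaces the edge to the positive side of
  \<open>vab\<close>.\<close>

definition sg :: "nat \<Rightarrow> nat \<Rightarrow> nat \<Rightarrow> nat \<Rightarrow> real" where "sg v a b c = sgn (side v a b (\<psi> c))"

lemma sg_cases: "wedge v a b c \<Longrightarrow> sg v a b c = 1 \<or> sg v a b c = - 1"
  using side_gam(2)[OF wedge_gen4] unfolding sg_def sgn_if by auto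

lemma sg_pos:
  assumes w: "wedge v a b c"
  shows "0 < sg v a b c * gam v a b c x \<longleftrightarrow> 0 < side v a b x"
proof (cases "0 < side v a b (\<psi> c)")
  case True
  then show ?thesis unfolding sg_def side_gam(1)[OF wedge_gen4[OF w], of x] by (simp add: zero_less_mult_iff)
next
  case False
  then have "side v a b (\<psi> c) < 0" using side_gam(2)[OF wedge_gen4[OF w]] by simp
  then show ?thesis unfolding sg_def side_gam(1)[OF wedge_gen4[OF w], of x] by (simp add: zero_less_mult_iff)
qed

text \<open>The triangles at \<open>va\<close> are coherently oriented just if
  \<open>or v a b\<close> and \<open>or v a c\<close> differ. Exchanging \<open>b\<close> and
  \<open>c\<close> changes the sign of the determinant, so for coherent orientations the wedge lies
  on the positive sides of both triangles or of neither.\<close>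

lemma sg_flip:
  assumes w: "wedge v a b c"
  shows "sg v a c b = (if or v a b \<noteq> or v a c then sg v a b c else - sg v a b c)"
  unfolding sg_def side_def triple_product_swap(2)[of "\<psi> a - \<psi> v" "\<psi> c - \<psi> v"] by (auto simp: sgn_minus)

lemma sg_rev: "wedge v a b c \<Longrightarrow> sg a v b c = sg v a b c"
  unfolding sg_def using side_perms[OF wedgeD(1), of v a b c a v b] by (simp add: insert_commute)

definition pos :: "nat set \<Rightarrow> real^3 \<Rightarrow> bool" where
  "pos \<sigma> x \<longleftrightarrow> (\<exists>v a b. \<sigma> = {v, a, b} \<and> 0 < side v a b x)"

lemma pos_iff: "{v, a, b} \<in> \<Delta> \<Longrightarrow> pos {v, a, b} x \<longleftrightarrow> 0 < side v a b x"
  unfolding pos_def using side_perms by metis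

lemma pos_segment:
  assumes "\<sigma> \<in> \<Delta>" "pos \<sigma> x" "pos \<sigma> y"
  shows "closed_segment x y \<inter> H \<sigma> = {}"
proof (rule ccontr)
  assume "\<not> ?thesis"
  then obtain q where q: "q \<in> closed_segment x y" "q \<in> H \<sigma>" by blast
  obtain v a b where s: "\<sigma> = {v, a, b}" using c3[OF assms(1)] by (auto simp: card_3_iff)
  have sd: "0 < side v a b x" "0 < side v a b y" using assms unfolding s by (simp_all add: pos_iff)
  obtain l where l: "0 \<le> l" "l \<le> 1" "q = x + l *\<^sub>R (y - x)" using q(1) unfolding mem_segment by blast
  have "side v a b q = (1 - l) * side v a b x + l * side v a b y" unfolding l(3) side_affine by (simp add: algebra_simps)
  also have "\<dots> > 0" using l sd by (cases "l = 0") (auto intro: add_nonneg_pos)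
  finally show False using side_hull q(2) unfolding s by simp
qed

text \<open>\<open>m\<close> is interior to both triangles, and \<open>d\<close> points into the
  quadrant on their positive sides: a base point for the colour of that quadrant.\<close>

definition good :: "nat set \<Rightarrow> nat set \<Rightarrow> real^3 \<Rightarrow> real^3 \<Rightarrow> bool" where
  "good \<sigma> \<tau> m d \<longleftrightarrow> m \<in> H \<sigma> \<inter> H \<tau> \<and> (\<forall>i\<in>\<sigma>. m \<notin> H (\<sigma> - {i})) \<and> (\<forall>i\<in>\<tau>. m \<notin> H (\<tau> - {i})) \<and>
    (\<forall>h>0. pos \<sigma> (m + h *\<^sub>R d) \<and> pos \<tau> (m + h *\<^sub>R d))"

lemma good_sym: "good \<sigma> \<tau> m d \<longleftrightarrow> good \<tau> \<sigma> m d"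
  unfolding good_def by auto

lemma piercing:
  assumes w: "wedge v a b c" and \<tau>: "\<tau> \<in> pierced v a"
  shows "\<tau> \<in> \<Delta>" "{v, a, b} \<inter> \<tau> = {} \<or> b \<in> \<tau>" "v \<notin> \<tau>" "a \<notin> \<tau>" "\<exists>p. p \<in> H {v, a} \<inter> H \<tau>"
  using \<tau> unfolding pierced_def by auto

lemma pierced_disjoint:
  assumes w: "wedge v a b c" and \<tau>: "\<tau> \<in> pierced v a"
  shows "{v, a, b} \<inter> \<tau> = {}"
proof (rule ccontr)
  assume ne: "\<not> ?thesis"
  note t = piercing[OF w \<tau>]
  obtain p where p: "p \<in> H {v, a}" "p \<in> H \<tau>" using t(5) by blast
  have "H {v, a} \<inter> H \<tau> = H ({v, a} \<inter> \<tau>)" by (rule H_Int[OF wedgeD(1)[OF w] t(1) ne]) auto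
  moreover have "{v, a} \<inter> \<tau> = {}" using t by auto
  ultimately show False using p by auto
qed

text \<open>The double segment runs from the piercing point \<open>p\<close> on \<open>va\<close> to
  a second piercing point \<open>q\<close>, and its midpoint is interior to both triangles. A
  direction positive for both exists because \<open>va\<close> is not parallel to the plane of
  \<open>\<tau>\<close>.\<close>

lemma good_exists:
  assumes w: "wedge v a b c" and \<tau>: "\<tau> \<in> pierced v a"
  shows "\<exists>m d. good {v, a, b} \<tau> m d"
proof -
  let ?\<sigma> = "{v, a, b}"
  note t = piercing[OF w \<tau>] and dis = pierced_disjoint[OF w \<tau>] and \<sigma> = wedgeD(1)[OF w] and g = wedge_gen4[OF w]
  have dab: "v \<noteq> a" "v \<noteq> b" "a \<noteq> b" using wedgeD(3)[OF w] by auto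
  have eb: "?\<sigma> - {b} = {v, a}" using dab by auto
  obtain p where p: "p \<in> H {v, a}" "p \<in> H \<tau>" using t(5) by blast
  have p\<sigma>: "p \<in> H ?\<sigma>" using p(1) H_mono[of "{v, a}" ?\<sigma>] by blast
  \<comment> \<open>Only one of the two piercings can belong to the edge \<open>va\<close>, which is
    opposite to \<open>b\<close>; the other one yields \<open>q\<close>.\<close>
  have "card {i\<in>?\<sigma>. H (?\<sigma> - {i}) \<inter> H \<tau> \<noteq> {}} + card {i\<in>\<tau>. H ?\<sigma> \<inter> H (\<tau> - {i}) \<noteq> {}} = 2"
    using p p\<sigma> by (intro pair_two_piercings[OF \<sigma> t(1) dis]) blast
  moreover have "card {i\<in>?\<sigma>. H (?\<sigma> - {i}) \<inter> H \<tau> \<noteq> {}} \<le> 1" if "{i\<in>?\<sigma>. H (?\<sigma> - {i}) \<inter> H \<tau> \<noteq> {}} \<subseteq> {b}"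
    using card_mono[OF _ that] by simp
  moreover have "card {i\<in>\<tau>. H ?\<sigma> \<inter> H (\<tau> - {i}) \<noteq> {}} = 0" if "{i\<in>\<tau>. H ?\<sigma> \<inter> H (\<tau> - {i}) \<noteq> {}} = {}"
    using that by (simp only: card.empty)
  ultimately have "\<not> {i\<in>?\<sigma>. H (?\<sigma> - {i}) \<inter> H \<tau> \<noteq> {}} \<subseteq> {b} \<or> {i\<in>\<tau>. H ?\<sigma> \<inter> H (\<tau> - {i}) \<noteq> {}} \<noteq> {}"
    by linarith
  then consider i where "i \<in> ?\<sigma>" "i \<noteq> b" "H (?\<sigma> - {i}) \<inter> H \<tau> \<noteq> {}" | i where "i \<in> \<tau>" "H ?\<sigma> \<inter> H (\<tau> - {i}) \<noteq> {}"
    by blast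
  then obtain q where q: "q \<in> H ?\<sigma>" "q \<in> H \<tau>" "q \<notin> H (?\<sigma> - {b})"
  proof cases
    case (1 i)
    then obtain q where q: "q \<in> H (?\<sigma> - {i})" "q \<in> H \<tau>" by blast
    have "q \<notin> H (?\<sigma> - {b})" using two_edges_vertex[OF \<sigma> t(1) dis 1(1) _ 1(2), of q] q by blast
    moreover have "q \<in> H ?\<sigma>" using q(1) H_mono[of "?\<sigma> - {i}" ?\<sigma>] by blast
    ultimately show ?thesis using that q(2) by blast
  next
    case (2 i)
    then obtain q where q: "q \<in> H ?\<sigma>" "q \<in> H (\<tau> - {i})" by blast
    have "q \<notin> H (?\<sigma> - {b})" using two_edges_cross[OF \<sigma> t(1) dis _ 2(1), of b] q by blast
    moreover have "q \<in> H \<tau>" using q(2) H_mono[of "\<tau> - {i}" \<tau>] by blast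
    ultimately show ?thesis using that q(1) by blast
  qed
  define m where "m = p + (1/2) *\<^sub>R (q - p)"
  have m': "m = q + (1/2) *\<^sub>R (p - q)" unfolding m_def vec_eq_iff by (simp add: field_simps)
  have m1: "m \<in> H ?\<sigma>" "m \<in> H \<tau>" unfolding m_def using p p\<sigma> q by (auto intro: segment_in_H)
  obtain d0 where d0: "d0 \<in> \<tau>" using c3[OF t(1)] by fastforce
  have out: "d0 \<in> \<Union>\<Delta>" "d0 \<notin> ?\<sigma>" "v \<in> \<Union>\<Delta>" using d0 t(1) dis \<sigma> by blast+
  have m2: "m \<notin> H (?\<sigma> - {i})" if i: "i \<in> ?\<sigma>" for i
  proof (cases "i = b")
    case True
    show ?thesis unfolding m' True by (rule face_segment[OF \<sigma> out(1,2) _ q(1) p\<sigma> q(3)]) auto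
  next
    case False
    have "p \<notin> H (?\<sigma> - {i})" using two_edges_vertex[OF \<sigma> t(1) dis i _ False, of p] p unfolding eb by blast
    then show ?thesis unfolding m_def by (intro face_segment[OF \<sigma> out(1,2) i p\<sigma> q(1)]) auto
  qed
  have m3: "m \<notin> H (\<tau> - {i})" if i: "i \<in> \<tau>" for i
  proof -
    have "p \<notin> H (\<tau> - {i})" using two_edges_cross[OF \<sigma> t(1) dis _ i, of b] p(1) unfolding eb by blast
    then show ?thesis unfolding m_def by (intro face_segment[OF t(1) out(3) t(3) i p(2) q(2)]) auto
  qed
  obtain x y z where r: "\<tau> = {x, y, z}" "distinct [x, y, z]" using c3[OF t(1)] by (auto simp: card_3_iff)
  have rd: "{x, y, z} \<in> \<Delta>" using t(1) r by simp
  have "{x, y, z} \<subseteq> \<Union>\<Delta>" using rd by blast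
  then have gv: "gen4 x y z v" unfolding gen4_def using out(3) t(3) r by auto
  obtain s where "p = \<psi> v + s *\<^sub>R (\<psi> a - \<psi> v)" using p(1) unfolding H2_points by blast
  then have "side x y z p = side x y z (\<psi> v) + s * sidel x y z (\<psi> a - \<psi> v)" by (simp add: side_add sidel_linear)
  then have la: "sidel x y z (\<psi> a - \<psi> v) \<noteq> 0" using side_hull p(2) side_gam(2)[OF gv] unfolding r(1) by force
  \<comment> \<open>Motion along \<open>va\<close> does not change the side of \<open>vab\<close>,
    so \<open>k2\<close> makes the first derivative a square; then \<open>k1\<close> normalises the
    second one to 1.\<close>
  define k2 where "k2 = side v a b (\<psi> c)"
  define k1 where "k1 = (1 - k2 * sidel x y z (\<psi> c - \<psi> v)) / sidel x y z (\<psi> a - \<psi> v)"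
  define d where "d = k1 *\<^sub>R (\<psi> a - \<psi> v) + k2 *\<^sub>R (\<psi> c - \<psi> v)"
  have "sidel v a b d = k2 * k2" unfolding d_def sidel_linear sidel_diff side_vertex k2_def by simp
  then have ds: "0 < sidel v a b d" using side_gam(2)[OF g] not_real_square_gt_zero[of k2] unfolding k2_def by metis
  have dt: "sidel x y z d = 1" unfolding d_def sidel_linear k1_def using la by simp
  have "pos ?\<sigma> (m + h *\<^sub>R d) \<and> pos \<tau> (m + h *\<^sub>R d)" if "0 < h" for h
    using that ds dt side_hull[OF m1(1)] side_hull[of m x y z] m1(2) unfolding pos_iff[OF \<sigma>] r(1) pos_iff[OF rd] side_add sidel_linear by simp
  then have "good ?\<sigma> \<tau> m d" unfolding good_def using m1 m2 m3 by blast
  then show ?thesis by blast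
qed

text \<open>A triangle disjoint from \<open>vab\<close> and \<open>\<tau>\<close> would produce a
  triple point. One that has a vertex in common with them meets them only in a common face, while
  the segment from \<open>p\<close> to \<open>m\<close> touches their boundaries only at
  \<open>p\<close>, on the edge \<open>va\<close>.\<close>

lemma piercing_segment:
  assumes w: "wedge v a b c" and \<tau>: "\<tau> \<in> pierced v a" and p: "p \<in> H {v, a}" "p \<in> H \<tau>" and m: "good {v, a, b} \<tau> m d"
    and \<rho>: "\<rho> \<in> \<Delta>" "\<rho> \<noteq> {v, a, b}" "\<rho> \<noteq> {v, a, c}" "\<rho> \<noteq> \<tau>"
  shows "closed_segment p m \<inter> H \<rho> = {}"
proof (rule ccontr)
  let ?\<sigma> = "{v, a, b}"
  note t = piercing[OF w \<tau>] and dis = pierced_disjoint[OF w \<tau>] and \<sigma> = wedgeD(1)[OF w]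
  assume "\<not> ?thesis"
  then obtain q where q: "q \<in> closed_segment p m" "q \<in> H \<rho>" by blast
  obtain l where l: "0 \<le> l" "l \<le> 1" "q = p + l *\<^sub>R (m - p)" using q(1) unfolding mem_segment by blast
  have dab: "v \<noteq> a" "v \<noteq> b" "a \<noteq> b" using wedgeD(3)[OF w] by auto
  have eb: "?\<sigma> - {b} = {v, a}" using dab by auto
  have p\<sigma>: "p \<in> H ?\<sigma>" using p(1) H_mono[of "{v, a}" ?\<sigma>] by blast
  have mm: "m \<in> H ?\<sigma>" "m \<in> H \<tau>" using m unfolding good_def by auto
  have qq: "q \<in> H ?\<sigma>" "q \<in> H \<tau>" unfolding l(3) using p p\<sigma> mm l by (auto intro: segment_in_H)
  obtain d0 where d0: "d0 \<in> \<tau>" using c3[OF t(1)] by fastforce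
  have out: "d0 \<in> \<Union>\<Delta>" "d0 \<notin> ?\<sigma>" "v \<in> \<Union>\<Delta>" using d0 t(1) dis \<sigma> by blast+
  have q1: "q \<notin> H (?\<sigma> - {i})" if i: "i \<in> {v, a}" for i
  proof (cases "l = 1")
    case True
    have "q = m" unfolding l(3) True by simp
    then show ?thesis using m i unfolding good_def by blast
  next
    case False
    have ib: "i \<noteq> b" "i \<in> ?\<sigma>" using i dab by auto
    have "p \<notin> H (?\<sigma> - {i})" using two_edges_vertex[OF \<sigma> t(1) dis ib(2) _ ib(1), of p] p unfolding eb by blast
    then show ?thesis unfolding l(3) using l False by (intro face_segment[OF \<sigma> out(1,2) ib(2) p\<sigma> mm(1)]) auto
  qed
  have q2: "q \<notin> H (\<tau> - {i})" if i: "i \<in> \<tau>" for i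
  proof (cases "l = 1")
    case True
    have "q = m" unfolding l(3) True by simp
    then show ?thesis using m i unfolding good_def by blast
  next
    case False
    have "p \<notin> H (\<tau> - {i})" using two_edges_cross[OF \<sigma> t(1) dis _ i, of b] p(1) unfolding eb by blast
    then show ?thesis unfolding l(3) using l False by (intro face_segment[OF t(1) out(3) t(3) i p(2) mm(2)]) auto
  qed
  have "\<rho> \<inter> ?\<sigma> \<noteq> {} \<or> \<rho> \<inter> \<tau> \<noteq> {}" using notriple[OF \<rho>(1) \<sigma> t(1) _ _ dis] q(2) qq by blast
  then show False
  proof
    assume ne: "\<rho> \<inter> ?\<sigma> \<noteq> {}"
    have "H \<rho> \<inter> H ?\<sigma> = H (\<rho> \<inter> ?\<sigma>)" by (rule H_Int[OF \<rho>(1) \<sigma> ne]) auto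
    then have qi: "q \<in> H (\<rho> \<inter> ?\<sigma>)" using q(2) qq(1) by blast
    have "i \<in> \<rho>" if "i \<in> {v, a}" for i
    proof (rule ccontr)
      assume "i \<notin> \<rho>"
      then have "\<rho> \<inter> ?\<sigma> \<subseteq> ?\<sigma> - {i}" by blast
      then show False using H_mono qi q1[OF that] by blast
    qed
    then show False using wedgeD(4)[OF w \<rho>(1)] \<rho>(2,3) by blast
  next
    assume ne: "\<rho> \<inter> \<tau> \<noteq> {}"
    have "H \<rho> \<inter> H \<tau> = H (\<rho> \<inter> \<tau>)" by (rule H_Int[OF \<rho>(1) t(1) ne]) auto
    then have qi: "q \<in> H (\<rho> \<inter> \<tau>)" using q(2) qq(2) by blast
    have "i \<in> \<rho>" if "i \<in> \<tau>" for i
    proof (rule ccontr)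
      assume "i \<notin> \<rho>"
      then have "\<rho> \<inter> \<tau> \<subseteq> \<tau> - {i}" by blast
      then show False using H_mono qi q2[OF that] by blast
    qed
    then have "\<tau> \<subseteq> \<rho>" by blast
    then have "\<tau> = \<rho>" using c3[OF t(1)] c3[OF \<rho>(1)] fin\<sigma>[OF \<rho>(1)] by (metis card_subset_eq)
    then show False using \<rho>(4) by simp
  qed
qed

end

context oriented_surface begin

text \<open>
  \<open>W v a b\<close> is the colour near the vertex \<open>v\<close> and near the edge \<open>va\<close>, on the positive side of the triangle
  \<open>vab\<close>; \<open>C {\<sigma>, \<tau>}\<close> is the colour near the double segment of \<open>\<sigma>\<close> and \<open>\<tau>\<close>, in the quadrant on the positive
  sides of both.
\<close>

theorem colours:
  obtains W :: "nat \<Rightarrow> nat \<Rightarrow> nat \<Rightarrow> bool" and C :: "nat set set \<Rightarrow> bool" where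
    "\<And>v a b. {v, a, b} \<in> \<Delta> \<Longrightarrow> (W v a b = W a v b) = even (card (pierced v a))"
    "\<And>v a b. {v, a, b} \<in> \<Delta> \<Longrightarrow> W v a b = W v b a"
    "\<And>v a b c. wedge v a b c \<Longrightarrow> (W v a b = W v a c) = (or v a b \<noteq> or v a c)"
    "\<And>v a b c \<tau>. wedge v a b c \<Longrightarrow> \<tau> \<in> pierced v a \<Longrightarrow>
      (C {{v, a, b}, \<tau>} = C {{v, a, c}, \<tau>}) = (or v a b \<noteq> or v a c)"
proof -
  define opp where "opp v a b = (SOME c. wedge v a b c)" for v a b
  have opp: "wedge v a b (opp v a b)" if "{v, a, b} \<in> \<Delta>" for v a b
    unfolding opp_def using wedge_exists[OF that] by (metis someI)
  have oppeq: "opp v a b = c" if "wedge v a b c" for v a b c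
    using wedge_unique[OF opp[OF wedgeD(1)[OF that]] that] .
  define Fl where "Fl = {(v, a, b). {v, a, b} \<in> \<Delta>}"
  define FlP where "FlP = {(v, a, b, \<tau>). {v, a, b} \<in> \<Delta> \<and> \<tau> \<in> pierced v a}"
  have "finite (\<Union>\<Delta>)" using fin\<Delta> fin\<sigma> by blast
  moreover have "Fl \<subseteq> \<Union>\<Delta> \<times> \<Union>\<Delta> \<times> \<Union>\<Delta>" unfolding Fl_def by blast
  moreover have "FlP \<subseteq> \<Union>\<Delta> \<times> \<Union>\<Delta> \<times> \<Union>\<Delta> \<times> \<Delta>" unfolding FlP_def pierced_def by blast
  ultimately have finFl: "finite Fl" "finite FlP" using fin\<Delta> by (meson finite_SigmaI finite_subset)+

  \<comment> \<open>The parameter of the piercing point on the edge.\<close>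
  define tt where "tt v a \<tau> = (SOME t. 0 < t \<and> t < 1 \<and> ep v a t \<in> H \<tau>)" for v a \<tau>
  have tt: "0 < tt v a \<tau> \<and> tt v a \<tau> < 1 \<and> ep v a (tt v a \<tau>) \<in> H \<tau>" if vab: "{v, a, b} \<in> \<Delta>" and \<tau>: "\<tau> \<in> pierced v a" for v a b \<tau>
  proof -
    have w: "wedge v a b (opp v a b)" by (rule opp[OF vab])
    note t = piercing[OF w \<tau>]
    obtain p where p: "p \<in> H {v, a}" "p \<in> H \<tau>" using t(5) by blast
    obtain x y z where r: "\<tau> = {x, y, z}" "distinct [x, y, z]" using c3[OF t(1)] by (auto simp: card_3_iff)
    have "v \<in> \<Union>\<Delta>" "a \<in> \<Union>\<Delta>" "{x, y, z} \<subseteq> \<Union>\<Delta>" using vab t(1) unfolding r(1) by blast+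
    then have dV: "distinct [v, a, x, y, z]" "{v, a, x, y, z} \<subseteq> \<Union>\<Delta>"
      using wedgeD(3)[OF w] t(3,4) r(2) unfolding r(1) by simp_all
    show ?thesis unfolding tt_def
      by (rule someI_ex) (use pierce_strict(4)[OF dV p(1)] p(2) in \<open>auto simp: ep_def r(1)\<close>)
  qed
  \<comment> \<open>The piercing point lies on \<open>\<tau>\<close> itself; \<open>kk\<close> is a
    speed along the edge that leads from it to the positive side of \<open>\<tau>\<close>.\<close>
  define kk where "kk v a \<tau> = (SOME k. \<forall>h>0. pos \<tau> (ep v a (tt v a \<tau> + k * h)))" for v a \<tau>
  have kk: "\<forall>h>0. pos \<tau> (ep v a (tt v a \<tau> + kk v a \<tau> * h))" if vab: "{v, a, b} \<in> \<Delta>" and \<tau>: "\<tau> \<in> pierced v a" for v a b \<tau>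
  proof -
    have w: "wedge v a b (opp v a b)" by (rule opp[OF vab])
    note t = piercing[OF w \<tau>] and tt' = tt[OF vab \<tau>]
    obtain x y z where r: "\<tau> = {x, y, z}" "distinct [x, y, z]" using c3[OF t(1)] by (auto simp: card_3_iff)
    have rd: "{x, y, z} \<in> \<Delta>" using t(1) r by simp
    have "v \<in> \<Union>\<Delta>" "{x, y, z} \<subseteq> \<Union>\<Delta>" using vab rd by blast+
    then have gv: "gen4 x y z v" unfolding gen4_def using t(3) r by auto
    let ?l = "sidel x y z (\<psi> a - \<psi> v)"
    have e: "side x y z (ep v a s) = side x y z (\<psi> v) + s * ?l" for s unfolding ep_def side_add sidel_linear ..
    have z: "side x y z (\<psi> v) + tt v a \<tau> * ?l = 0" using side_hull[of "ep v a (tt v a \<tau>)" x y z] tt' unfolding e r(1) by simp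
    then have l0: "?l \<noteq> 0" using side_gam(2)[OF gv] by auto
    have "pos \<tau> (ep v a (tt v a \<tau> + ?l * h))" if "0 < h" for h
    proof -
      have "side x y z (ep v a (tt v a \<tau> + ?l * h)) = (side x y z (\<psi> v) + tt v a \<tau> * ?l) + (?l * ?l) * h"
        unfolding e by (simp add: algebra_simps)
      also have "\<dots> > 0" unfolding z using mult_pos_pos[OF _ that, of "?l * ?l"] l0 not_real_square_gt_zero[of ?l] by (metis add_0)
      finally show ?thesis using pos_iff[OF rd] r(1) by simp
    qed
    then show ?thesis unfolding kk_def by (intro someI_ex[of "\<lambda>k. \<forall>h>0. pos \<tau> (ep v a (tt v a \<tau> + k * h))"]) blast
  qed
  \<comment> \<open>Chosen for the unordered pair, so that the colour of the quadrant has one base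
    point whichever of the two triangles contains the piercing edge.\<close>
  define ff where "ff P = (SOME md. \<exists>\<sigma> \<tau>. P = {\<sigma>, \<tau>} \<and> good \<sigma> \<tau> (fst md) (snd md))" for P
  have ff: "good {v, a, b} \<tau> (fst (ff {{v, a, b}, \<tau>})) (snd (ff {{v, a, b}, \<tau>}))" if vab: "{v, a, b} \<in> \<Delta>" and \<tau>: "\<tau> \<in> pierced v a" for v a b \<tau>
  proof -
    obtain m d where "good {v, a, b} \<tau> m d" using good_exists[OF opp[OF vab] \<tau>] by blast
    then have "\<exists>\<sigma> \<tau>'. {{v, a, b}, \<tau>} = {\<sigma>, \<tau>'} \<and> good \<sigma> \<tau>' (fst (m, d)) (snd (m, d))" unfolding fst_conv snd_conv by blast
    then have ex: "\<exists>md. \<exists>\<sigma> \<tau>'. {{v, a, b}, \<tau>} = {\<sigma>, \<tau>'} \<and> good \<sigma> \<tau>' (fst md) (snd md)" by (rule exI)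
    have "\<exists>\<sigma> \<tau>'. {{v, a, b}, \<tau>} = {\<sigma>, \<tau>'} \<and> good \<sigma> \<tau>' (fst (ff {{v, a, b}, \<tau>})) (snd (ff {{v, a, b}, \<tau>}))"
      using someI_ex[OF ex] unfolding ff_def .
    then obtain \<sigma> \<tau>' where st: "{{v, a, b}, \<tau>} = {\<sigma>, \<tau>'}" "good \<sigma> \<tau>' (fst (ff {{v, a, b}, \<tau>})) (snd (ff {{v, a, b}, \<tau>}))"
      by (elim exE conjE) (rule that)
    then have "{v, a, b} = \<sigma> \<and> \<tau> = \<tau>' \<or> {v, a, b} = \<tau>' \<and> \<tau> = \<sigma>" unfolding doubleton_eq_iff by blast
    then show ?thesis using st(2) good_sym by blast
  qed

  have lim0: "((\<lambda>\<eta>. ep v a \<eta>) \<longlongrightarrow> \<psi> v) (at_right 0)" for v a unfolding ep_def by (rule at_right_tendsto)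
  \<comment> \<open>First demand on \<open>\<eta>\<close>: close to \<open>v\<close> only triangles
    at \<open>v\<close> are present.\<close>
  have A: "eventually (\<lambda>\<eta>. \<forall>(v, a, b)\<in>Fl. (\<forall>\<rho>\<in>{\<rho>\<in>\<Delta>. v \<notin> \<rho>}. closed_segment (ep v a \<eta>) (ep v a \<eta> + \<eta> *\<^sub>R (\<psi> b - \<psi> v)) \<inter> H \<rho> = {}) \<and>
      (\<forall>\<rho>\<in>{\<rho>\<in>\<Delta>. v \<notin> \<rho>}. closed_segment (\<psi> v) (ep v a \<eta>) \<inter> H \<rho> = {})) (at_right 0)"
  proof (rule eventually_ball_finite[OF finFl(1)], clarify)
    fix v a b assume "(v, a, b) \<in> Fl"
    then have v: "v \<in> \<Union>\<Delta>" unfolding Fl_def by blast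
    have z: "closed_segment (\<psi> v) (\<psi> v) \<inter> H \<rho> = {}" if "\<rho> \<in> \<Delta>" "v \<notin> \<rho>" for \<rho> using vertex_not_in[OF v that] by simp
    have "((\<lambda>\<eta>. ep v a \<eta> + \<eta> *\<^sub>R (\<psi> b - \<psi> v)) \<longlongrightarrow> \<psi> v + 0 *\<^sub>R (\<psi> b - \<psi> v)) (at_right 0)" by (intro tendsto_intros lim0)
    then have l2: "((\<lambda>\<eta>. ep v a \<eta> + \<eta> *\<^sub>R (\<psi> b - \<psi> v)) \<longlongrightarrow> \<psi> v) (at_right 0)" by simp
    show "eventually (\<lambda>\<eta>. (\<forall>\<rho>\<in>{\<rho>\<in>\<Delta>. v \<notin> \<rho>}. closed_segment (ep v a \<eta>) (ep v a \<eta> + \<eta> *\<^sub>R (\<psi> b - \<psi> v)) \<inter> H \<rho> = {}) \<and>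
      (\<forall>\<rho>\<in>{\<rho>\<in>\<Delta>. v \<notin> \<rho>}. closed_segment (\<psi> v) (ep v a \<eta>) \<inter> H \<rho> = {})) (at_right 0)"
      by (intro eventually_conj; rule eventually_others[OF z]; (rule lim0 l2 tendsto_const)?)
  qed
  \<comment> \<open>Second demand on \<open>\<eta>\<close>: from the shifted edge point the base
    point of the double segment is seen without meeting triangles other than the two at the edge and
    \<open>\<tau>\<close>.\<close>
  have B: "eventually (\<lambda>\<eta>. \<forall>(v, a, b, \<tau>)\<in>FlP. (\<forall>\<rho>\<in>{\<rho>\<in>\<Delta>. \<rho> \<noteq> {v, a, b} \<and> \<rho> \<noteq> {v, a, opp v a b} \<and> \<rho> \<noteq> \<tau>}.
        closed_segment (ep v a (tt v a \<tau> + kk v a \<tau> * \<eta>)) (fst (ff {{v, a, b}, \<tau>}) + \<eta> *\<^sub>R snd (ff {{v, a, b}, \<tau>})) \<inter> H \<rho> = {}) \<and>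
      0 < tt v a \<tau> + kk v a \<tau> * \<eta> \<and> tt v a \<tau> + kk v a \<tau> * \<eta> < 1 \<and>
      0 < gam v a (opp v a b) b (fst (ff {{v, a, b}, \<tau>}) + \<eta> *\<^sub>R snd (ff {{v, a, b}, \<tau>}))) (at_right 0)"
  proof (rule eventually_ball_finite[OF finFl(2)], clarify)
    fix v a b \<tau> assume "(v, a, b, \<tau>) \<in> FlP"
    then have vab: "{v, a, b} \<in> \<Delta>" and \<tau>: "\<tau> \<in> pierced v a" unfolding FlP_def by auto
    let ?c = "opp v a b" and ?m = "fst (ff {{v, a, b}, \<tau>})" and ?d = "snd (ff {{v, a, b}, \<tau>})" and ?t = "tt v a \<tau>" and ?k = "kk v a \<tau>"
    note w = opp[OF vab] and t = tt[OF vab \<tau>] and gd = ff[OF vab \<tau>]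
    have g: "gen4 b v a ?c" using gen4_perm(1)[OF gen4_perm(1)[OF gen4_perm(3)[OF wedge_gen4[OF w]]]] gen4_perm(1)[OF wedge_gen4[OF w]] wedge_gen4[OF w] by (auto simp: gen4_def)
    have pH: "ep v a ?t \<in> H {v, a}" using t by (intro ep_in) auto
    have l1: "((\<lambda>\<eta>. ?t + ?k * \<eta>) \<longlongrightarrow> ?t) (at_right 0)" by (rule tendsto_eq_intros refl | simp)+
    have "((\<lambda>\<eta>. ep v a (?t + ?k * \<eta>)) \<longlongrightarrow> \<psi> v + ?t *\<^sub>R (\<psi> a - \<psi> v)) (at_right 0)" unfolding ep_def by (intro tendsto_intros l1)
    then have l2: "((\<lambda>\<eta>. ep v a (?t + ?k * \<eta>)) \<longlongrightarrow> ep v a ?t) (at_right 0)" unfolding ep_def .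
    have l3: "((\<lambda>\<eta>. ?m + \<eta> *\<^sub>R ?d) \<longlongrightarrow> ?m) (at_right 0)" by (rule at_right_tendsto)
    have e: "closed_segment (ep v a ?t) ?m \<inter> H \<rho> = {}" if "\<rho> \<in> \<Delta>" "\<rho> \<noteq> {v, a, b} \<and> \<rho> \<noteq> {v, a, ?c} \<and> \<rho> \<noteq> \<tau>" for \<rho>
      using piercing_segment[OF w \<tau> pH _ gd that(1)] t that(2) by blast
    have mb: "{b, v, a} = {v, a, b}" "{v, a, b} - {b} = {v, a}" using wedgeD(3)[OF w] by auto
    have m: "?m \<in> H {v, a, b}" "?m \<notin> H ({v, a, b} - {b})" using gd unfolding good_def by blast+
    have "0 < gam v a ?c b ?m"
      using m mem_H2_face[OF g, of ?m] mem_H3[OF g, of ?m] unfolding mb by force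
    then have "eventually (\<lambda>\<eta>. 0 < gam v a ?c b (?m + \<eta> *\<^sub>R ?d)) (at_right 0)"
      using order_tendstoD(1)[OF tendsto_gam[OF l3]] by blast
    moreover have "eventually (\<lambda>\<eta>. 0 < ?t + ?k * \<eta>) (at_right 0)" "eventually (\<lambda>\<eta>. ?t + ?k * \<eta> < 1) (at_right 0)"
      using order_tendstoD[OF l1] t by blast+
    moreover have "eventually (\<lambda>\<eta>. \<forall>\<rho>\<in>{\<rho>\<in>\<Delta>. \<rho> \<noteq> {v, a, b} \<and> \<rho> \<noteq> {v, a, ?c} \<and> \<rho> \<noteq> \<tau>}.
        closed_segment (ep v a (?t + ?k * \<eta>)) (?m + \<eta> *\<^sub>R ?d) \<inter> H \<rho> = {}) (at_right 0)"
      by (rule eventually_others[OF e l2 l3])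
    ultimately show "eventually (\<lambda>\<eta>. (\<forall>\<rho>\<in>{\<rho>\<in>\<Delta>. \<rho> \<noteq> {v, a, b} \<and> \<rho> \<noteq> {v, a, ?c} \<and> \<rho> \<noteq> \<tau>}.
        closed_segment (ep v a (?t + ?k * \<eta>)) (?m + \<eta> *\<^sub>R ?d) \<inter> H \<rho> = {}) \<and>
      0 < ?t + ?k * \<eta> \<and> ?t + ?k * \<eta> < 1 \<and> 0 < gam v a ?c b (?m + \<eta> *\<^sub>R ?d)) (at_right 0)"
      by eventually_elim blast
  qed
  have "eventually (\<lambda>\<eta>. 0 < \<eta> \<and> \<eta> < 1 / 3) (at_right (0::real))"
    by (intro eventually_conj eventually_at_right_less eventually_lt_at_right) auto
  with A B have "eventually (\<lambda>\<eta>. 0 < \<eta> \<and> \<eta> < 1 / 3 \<and> (\<forall>(v, a, b)\<in>Fl. (\<forall>\<rho>\<in>{\<rho>\<in>\<Delta>. v \<notin> \<rho>}. closed_segment (ep v a \<eta>) (ep v a \<eta> + \<eta> *\<^sub>R (\<psi> b - \<psi> v)) \<inter> H \<rho> = {}) \<and>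
      (\<forall>\<rho>\<in>{\<rho>\<in>\<Delta>. v \<notin> \<rho>}. closed_segment (\<psi> v) (ep v a \<eta>) \<inter> H \<rho> = {})) \<and>
     (\<forall>(v, a, b, \<tau>)\<in>FlP. (\<forall>\<rho>\<in>{\<rho>\<in>\<Delta>. \<rho> \<noteq> {v, a, b} \<and> \<rho> \<noteq> {v, a, opp v a b} \<and> \<rho> \<noteq> \<tau>}.
        closed_segment (ep v a (tt v a \<tau> + kk v a \<tau> * \<eta>)) (fst (ff {{v, a, b}, \<tau>}) + \<eta> *\<^sub>R snd (ff {{v, a, b}, \<tau>})) \<inter> H \<rho> = {}) \<and>
      0 < tt v a \<tau> + kk v a \<tau> * \<eta> \<and> tt v a \<tau> + kk v a \<tau> * \<eta> < 1 \<and>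
      0 < gam v a (opp v a b) b (fst (ff {{v, a, b}, \<tau>}) + \<eta> *\<^sub>R snd (ff {{v, a, b}, \<tau>})))) (at_right 0)"
    by eventually_elim blast
  then obtain \<eta> where \<eta>: "0 < \<eta>" "\<eta> < 1 / 3"
    and A: "\<And>v a b \<rho>. {v, a, b} \<in> \<Delta> \<Longrightarrow> \<rho> \<in> \<Delta> \<Longrightarrow> v \<notin> \<rho> \<Longrightarrow> closed_segment (ep v a \<eta>) (ep v a \<eta> + \<eta> *\<^sub>R (\<psi> b - \<psi> v)) \<inter> H \<rho> = {}"
      "\<And>v a b \<rho>. {v, a, b} \<in> \<Delta> \<Longrightarrow> \<rho> \<in> \<Delta> \<Longrightarrow> v \<notin> \<rho> \<Longrightarrow> closed_segment (\<psi> v) (ep v a \<eta>) \<inter> H \<rho> = {}"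
    and B: "\<And>v a b \<tau> \<rho>. {v, a, b} \<in> \<Delta> \<Longrightarrow> \<tau> \<in> pierced v a \<Longrightarrow> \<rho> \<in> \<Delta> \<Longrightarrow> \<rho> \<noteq> {v, a, b} \<Longrightarrow> \<rho> \<noteq> {v, a, opp v a b} \<Longrightarrow> \<rho> \<noteq> \<tau> \<Longrightarrow>
        closed_segment (ep v a (tt v a \<tau> + kk v a \<tau> * \<eta>)) (fst (ff {{v, a, b}, \<tau>}) + \<eta> *\<^sub>R snd (ff {{v, a, b}, \<tau>})) \<inter> H \<rho> = {}"
      "\<And>v a b \<tau>. {v, a, b} \<in> \<Delta> \<Longrightarrow> \<tau> \<in> pierced v a \<Longrightarrow> 0 < tt v a \<tau> + kk v a \<tau> * \<eta> \<and> tt v a \<tau> + kk v a \<tau> * \<eta> < 1 \<and>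
      0 < gam v a (opp v a b) b (fst (ff {{v, a, b}, \<tau>}) + \<eta> *\<^sub>R snd (ff {{v, a, b}, \<tau>}))"
    by (drule_tac eventually_happens) (auto simp: Fl_def FlP_def)

  \<comment> \<open>\<open>W\<close> is evaluated at the points \<open>Pt\<close> and
    \<open>C\<close> at the points \<open>QC\<close>. \<open>Y\<close> lies inside the triangle and
    is symmetric in \<open>a\<close> and \<open>b\<close>; lifted to \<open>Q\<close> it links the
    two flags at a corner. \<open>K\<close> and \<open>KC\<close> are the intermediate points of
    \<open>edge_sides\<close>.\<close>
  define Z where "Z v a = ep v a \<eta>" for v a
  define M where "M v a b = mm v a b (opp v a b)" for v a b
  define s where "s v a b = sg v a b (opp v a b)" for v a b
  define Pt where "Pt e v a b = Z v a + (e * s v a b) *\<^sub>R M v a b" for e v a b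
  define Y where "Y v a b = Z v a + \<eta> *\<^sub>R (\<psi> b - \<psi> v)" for v a b
  define Q where "Q e v a b = Y v a b + (e * s v a b) *\<^sub>R (\<psi> (opp v a b) - \<psi> v)" for e v a b
  define K where "K e v a b = Z v a + e *\<^sub>R (\<psi> b - \<psi> (opp v a b))" for e v a b
  define ZC where "ZC v a \<tau> = ep v a (tt v a \<tau> + kk v a \<tau> * \<eta>)" for v a \<tau>
  define KC where "KC e v a b \<tau> = ZC v a \<tau> + e *\<^sub>R (\<psi> b - \<psi> (opp v a b))" for e v a b \<tau>
  define QC where "QC P = fst (ff P) + \<eta> *\<^sub>R snd (ff P)" for P
  \<comment> \<open>The comparisons with their expected outcome: moving along an edge, turning a
    corner at \<open>v\<close>, and changing from one side of an edge to the other.\<close>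
  define L1 where "L1 e = (\<lambda>(v, a, b). [(even (card (pierced v a)), Pt e v a b, Pt e a v b), (True, Pt e v a b, Q e v a b),
    (True, Pt e v b a, Q e v a b), (True, Z v a + (- e) *\<^sub>R M v a b, K e v a b), (False, Z v a + e *\<^sub>R M v a b, K e v a b)])" for e
  define L2 where "L2 e = (\<lambda>(v, a, b, \<tau>). [(True, ZC v a \<tau> + (e * s v a b) *\<^sub>R M v a b, QC {{v, a, b}, \<tau>}),
    (True, ZC v a \<tau> + (- e) *\<^sub>R M v a b, KC e v a b \<tau>), (False, ZC v a \<tau> + e *\<^sub>R M v a b, KC e v a b \<tau>)])" for e

  have opp_rev: "opp a v b = opp v a b" if "{v, a, b} \<in> \<Delta>" for v a b
    using oppeq[OF wedge_sym(2)[OF opp[OF that]]] .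
  have E1: "eventually (\<lambda>e. \<forall>f\<in>Fl. \<forall>j\<in>set (L1 e f). case j of (b, x, y) \<Rightarrow> joined b x y) (at_right 0)"
  proof (rule eventually_ball_finite[OF finFl(1)], clarify)
    fix v a b assume "(v, a, b) \<in> Fl"
    then have vab: "{v, a, b} \<in> \<Delta>" by (simp add: Fl_def)
    have avb: "{a, v, b} \<in> \<Delta>" "{v, b, a} \<in> \<Delta>" using vab by (simp_all add: insert_commute)
    let ?c = "opp v a b"
    note w = opp[OF vab] and w2 = opp[OF avb(2)]
    have s0: "s v a b = 1 \<or> s v a b = - 1" "s v b a = 1 \<or> s v b a = - 1" unfolding s_def using sg_cases[OF w] sg_cases[OF w2] by blast+
    have rev: "s a v b = s v a b" "M a v b = M v a b" unfolding s_def M_def opp_rev[OF vab] using sg_rev[OF w] mm_sym by simp_all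
    have "eventually (\<lambda>e. joined (even (card (pierced v a))) (ep v a \<eta> + (e * s v a b) *\<^sub>R mm v a b ?c) (ep a v \<eta> + (e * s v a b) *\<^sub>R mm v a b ?c)) (at_right 0)"
      using s0(1) \<eta> A(2)[OF vab] A(2)[OF avb(1)] by (intro edge_walk[OF w]) auto
    then have 1: "eventually (\<lambda>e. joined (even (card (pierced v a))) (Pt e v a b) (Pt e a v b)) (at_right 0)"
      unfolding Pt_def Z_def rev M_def[of v a b] .
    have own: "ep v a \<eta> + l *\<^sub>R (Y v a b - ep v a \<eta>) \<in> H {v, a, b} \<and> ep v a \<eta> + l *\<^sub>R (Y v a b - ep v a \<eta>) \<notin> H {v, b}" if l: "0 \<le> l" "l \<le> 1" for l
    proof -
      note g = wedge_gen4[OF w]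
      note gv = gam_vertex[OF g] gam_vertex[OF gen4_perm(1)[OF g]] gam_vertex[OF gen4_perm(2)[OF g]] gam_vertex[OF gen4_perm(3)[OF g]]
      have Y: "Y v a b - ep v a \<eta> = \<eta> *\<^sub>R (\<psi> b - \<psi> v)" unfolding Y_def Z_def by simp
      have "l * \<eta> \<le> \<eta>" "0 \<le> l * \<eta>" using l \<eta> by (simp_all add: mult_left_le_one_le)
      then have "\<eta> + l * \<eta> \<le> 1" "0 \<le> l * \<eta>" using \<eta> by linarith+
      then have in': "ep v a \<eta> + l *\<^sub>R (Y v a b - ep v a \<eta>) \<in> H {v, a, b}"
        unfolding Y mem_H3[OF g] gam_add gaml_linear(3) gaml_diff using \<eta> by (simp add: gv wedge_gam[OF w])
      have co: "gam v b ?c a (ep v a \<eta> + l *\<^sub>R (Y v a b - ep v a \<eta>)) = \<eta>"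
        unfolding Y gam_add gaml_linear(3) gaml_diff by (simp add: gv wedge_gam[OF w])
      have "gam v b ?c a x = 0" if x: "x \<in> H {v, b}" for x
      proof -
        obtain t where "x = \<psi> v + t *\<^sub>R (\<psi> b - \<psi> v)" using x unfolding H2_points by blast
        then show ?thesis by (simp add: gam_affine gv)
      qed
      then show ?thesis using in' co \<eta> by force
    qed
    \<comment> \<open>Triangles at \<open>v\<close> that do not contain \<open>a\<close> meet
      \<open>vab\<close> at most in the edge \<open>vb\<close>, and this segment stays off that
      edge.\<close>
    have zY: "closed_segment (ep v a \<eta>) (Y v a b) \<inter> H \<rho> = {}" if \<rho>: "\<rho> \<in> \<Delta>" "\<rho> \<noteq> {v, a, b}" "\<rho> \<noteq> {v, a, c}" and wc: "wedge v a b c" for \<rho> c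
    proof (cases "v \<in> \<rho>")
      case False
      then show ?thesis using A(1)[OF vab \<rho>(1)] unfolding Y_def Z_def by blast
    next
      case True
      then have an: "a \<notin> \<rho>" using wedgeD(4)[OF wc \<rho>(1)] \<rho> by blast
      have "H \<rho> \<inter> H {v, a, b} = H (\<rho> \<inter> {v, a, b})" by (rule H_Int[OF \<rho>(1) vab]) (use True in auto)
      also have "\<dots> \<subseteq> H {v, b}" by (rule H_mono) (use an in blast)
      finally have sub: "H \<rho> \<inter> H {v, a, b} \<subseteq> H {v, b}" .
      show ?thesis
      proof (rule ccontr)
        assume "\<not> ?thesis"
        then obtain x where x: "x \<in> closed_segment (ep v a \<eta>) (Y v a b)" "x \<in> H \<rho>" by blast
        then obtain l where "0 \<le> l" "l \<le> 1" "x = ep v a \<eta> + l *\<^sub>R (Y v a b - ep v a \<eta>)" unfolding mem_segment by blast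
        then show False using own[of l] x(2) sub by blast
      qed
    qed
    have zY2: "closed_segment (ep v b \<eta>) (Y v a b) \<inter> H \<rho> = {}" if \<rho>: "\<rho> \<in> \<Delta>" "\<rho> \<noteq> {v, b, a}" "\<rho> \<noteq> {v, b, c}" and wc: "wedge v b a c" for \<rho> c
    proof (cases "v \<in> \<rho>")
      case False
      have "Y v a b = ep v b \<eta> + \<eta> *\<^sub>R (\<psi> a - \<psi> v)" unfolding Y_def Z_def ep_def by simp
      then show ?thesis using A(1)[OF avb(2) \<rho>(1) False] by simp
    next
      case True
      then have bn: "b \<notin> \<rho>" using wedgeD(4)[OF wc \<rho>(1)] \<rho> by blast
      have "H \<rho> \<inter> H {v, a, b} = H (\<rho> \<inter> {v, a, b})" by (rule H_Int[OF \<rho>(1) vab]) (use True in auto)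
      also have "\<dots> \<subseteq> H {v, a}" by (rule H_mono) (use bn in blast)
      finally have sub: "H \<rho> \<inter> H {v, a, b} \<subseteq> H {v, a}" .
      show ?thesis
      proof (rule ccontr)
        assume "\<not> ?thesis"
        then obtain x where x: "x \<in> closed_segment (ep v b \<eta>) (Y v a b)" "x \<in> H \<rho>" by blast
        then obtain l where l: "0 \<le> l" "l \<le> 1" "x = ep v b \<eta> + l *\<^sub>R (Y v a b - ep v b \<eta>)" unfolding mem_segment by blast
        note g = wedge_gen4[OF w]
        note gv = gam_vertex[OF g] gam_vertex[OF gen4_perm(1)[OF g]] gam_vertex[OF gen4_perm(2)[OF g]] gam_vertex[OF gen4_perm(3)[OF g]]
        have x': "x = \<psi> v + (\<eta> *\<^sub>R (\<psi> b - \<psi> v) + (l * \<eta>) *\<^sub>R (\<psi> a - \<psi> v))" unfolding l(3) Y_def Z_def ep_def by (simp add: algebra_simps)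
        have "l * \<eta> \<le> \<eta>" "0 \<le> l * \<eta>" using l \<eta> by (simp_all add: mult_left_le_one_le)
        then have "\<eta> + l * \<eta> \<le> 1" "0 \<le> l * \<eta>" using \<eta> by linarith+
        then have in': "x \<in> H {v, a, b}"
          unfolding x' mem_H3[OF g] gam_add gaml_linear(1,3) gaml_diff using \<eta> by (simp add: gv)
        have co: "gam v a ?c b x = \<eta>"
          unfolding x' gam_add gaml_linear(1,3) gaml_diff by (simp add: gv)
        have "x \<in> H {v, a}" using in' x(2) sub by blast
        then obtain t where "x = \<psi> v + t *\<^sub>R (\<psi> a - \<psi> v)" unfolding H2_points by blast
        then have "gam v a ?c b x = 0" by (simp add: gam_affine gv)
        then show False using co \<eta> by simp
      qed
    qed
    have limQ: "((\<lambda>e. Q e v a b) \<longlongrightarrow> Y v a b) (at_right 0)" unfolding Q_def by (rule at_right_tendsto)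
    \<comment> \<open>\<open>Y\<close> lies in the plane of the triangle, so only the displacement
      towards the neighbour contributes, with its sign corrected by \<open>s\<close>.\<close>
    have sdQ: "0 < side v a b (Q e v a b)" if "0 < e" for e
    proof -
      have sY: "side v a b (Y v a b) = 0" unfolding Y_def Z_def ep_def side_add sidel_linear sidel_diff side_vertex by simp
      have "side v a b (Q e v a b) = e * (s v a b * side v a b (\<psi> ?c))"
        unfolding Q_def side_add sidel_linear sidel_diff side_vertex sY by simp
      also have "s v a b * side v a b (\<psi> ?c) = \<bar>side v a b (\<psi> ?c)\<bar>" unfolding s_def sg_def by (simp add: abs_sgn mult.commute)
      finally show ?thesis using that side_gam(2)[OF wedge_gen4[OF w]] by simp
    qed
    have gY: "gam v a ?c b (Y v a b) = \<eta>" "gam v b (opp v b a) a (Y v a b) = \<eta>"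
    proof -
      note g = wedge_gen4[OF w] and g2 = wedge_gen4[OF w2]
      have Y': "Y v a b = \<psi> v + (\<eta> *\<^sub>R (\<psi> a - \<psi> v) + \<eta> *\<^sub>R (\<psi> b - \<psi> v))" unfolding Y_def Z_def ep_def by simp
      show "gam v a ?c b (Y v a b) = \<eta>" "gam v b (opp v b a) a (Y v a b) = \<eta>"
        unfolding Y' gam_add gaml_linear(1,3) gaml_diff by (simp_all add: gam_vertex[OF gen4_perm(3)[OF g]] gam_vertex[OF gen4_perm(3)[OF g2]])
    qed
    have p1: "eventually (\<lambda>e. 0 < gam v a ?c b (Q e v a b)) (at_right 0)" "eventually (\<lambda>e. 0 < gam v b (opp v b a) a (Q e v a b)) (at_right 0)"
      using order_tendstoD(1)[OF tendsto_gam[OF limQ]] gY \<eta> by simp_all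
    have sQ: "eventually (\<lambda>e. 0 < side v a b (Q e v a b)) (at_right 0)"
      using eventually_at_right_less[of "0::real"] by eventually_elim (rule sdQ)
    have c1: "eventually (\<lambda>e. 0 < s v a b * gam v a b ?c (Q e v a b) \<and> 0 < gam v a ?c b (Q e v a b)) (at_right 0)"
      using sQ p1(1) by eventually_elim (simp add: s_def sg_pos[OF w])
    have c2: "eventually (\<lambda>e. 0 < s v b a * gam v b a (opp v b a) (Q e v a b) \<and> 0 < gam v b (opp v b a) a (Q e v a b)) (at_right 0)"
      using sQ p1(2) by eventually_elim (simp add: s_def sg_pos[OF w2] side_perm(2)[OF vab])
    have 2: "eventually (\<lambda>e. joined True (Pt e v a b) (Q e v a b)) (at_right 0)"
      unfolding Pt_def Z_def M_def by (rule lift_off_edge[OF w s0(1) limQ c1 zY[OF _ _ _ w]])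
    have 3: "eventually (\<lambda>e. joined True (Pt e v b a) (Q e v a b)) (at_right 0)"
      unfolding Pt_def Z_def M_def by (rule lift_off_edge[OF w2 s0(2) limQ c2 zY2[OF _ _ _ w2]])
    have "ep v a \<eta> \<notin> H \<rho>" if "\<rho> \<in> \<Delta>" "\<rho> \<noteq> {v, a, b}" "\<rho> \<noteq> {v, a, ?c}" for \<rho>
      using zY[OF that w] by auto
    then have 4: "eventually (\<lambda>e. joined True (Z v a + (- e) *\<^sub>R M v a b) (K e v a b) \<and> joined False (Z v a + e *\<^sub>R M v a b) (K e v a b)) (at_right 0)"
      unfolding Z_def M_def K_def using \<eta> by (intro edge_sides[OF w]) auto
    from 1 2 3 4 show "eventually (\<lambda>e. \<forall>j\<in>set (L1 e (v, a, b)). case j of (b, x, y) \<Rightarrow> joined b x y) (at_right 0)"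
      by eventually_elim (simp add: L1_def)
  qed
  have E2: "eventually (\<lambda>e. \<forall>f\<in>FlP. \<forall>j\<in>set (L2 e f). case j of (b, x, y) \<Rightarrow> joined b x y) (at_right 0)"
  proof (rule eventually_ball_finite[OF finFl(2)], clarify)
    fix v a b \<tau> assume "(v, a, b, \<tau>) \<in> FlP"
    then have vab: "{v, a, b} \<in> \<Delta>" and \<tau>: "\<tau> \<in> pierced v a" by (simp_all add: FlP_def)
    let ?c = "opp v a b" and ?Q = "QC {{v, a, b}, \<tau>}"
    note w = opp[OF vab]
    have \<tau>d: "\<tau> \<in> \<Delta>" using \<tau> by (simp add: pierced_def)
    have gd: "pos {v, a, b} ?Q" "pos \<tau> ?Q" using ff[OF vab \<tau>] \<eta> unfolding good_def QC_def by blast+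
    have zt: "pos \<tau> (ZC v a \<tau>)" using kk[OF vab \<tau>] \<eta> unfolding ZC_def by blast
    \<comment> \<open>\<open>\<tau>\<close> itself is missed because both ends lie on its positive
      side.\<close>
    have z: "closed_segment (ZC v a \<tau>) ?Q \<inter> H \<rho> = {}" if \<rho>: "\<rho> \<in> \<Delta>" "\<rho> \<noteq> {v, a, b}" "\<rho> \<noteq> {v, a, ?c}" for \<rho>
      using B(1)[OF vab \<tau> \<rho>] pos_segment[OF \<tau>d zt gd(2)] unfolding ZC_def QC_def by blast
    have s0: "s v a b = 1 \<or> s v a b = - 1" unfolding s_def by (rule sg_cases[OF w])
    have "0 < s v a b * gam v a b ?c ?Q \<and> 0 < gam v a ?c b ?Q"
      using gd(1) B(2)[OF vab \<tau>] unfolding pos_iff[OF vab] s_def sg_pos[OF w] QC_def by simp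
    then have 1: "eventually (\<lambda>e. joined True (ZC v a \<tau> + (e * s v a b) *\<^sub>R M v a b) ?Q) (at_right 0)"
      unfolding ZC_def M_def using z unfolding ZC_def by (intro lift_off_edge[OF w s0 tendsto_const]) auto
    have "ep v a (tt v a \<tau> + kk v a \<tau> * \<eta>) \<notin> H \<rho>" if "\<rho> \<in> \<Delta>" "\<rho> \<noteq> {v, a, b}" "\<rho> \<noteq> {v, a, ?c}" for \<rho>
      using z[OF that] unfolding ZC_def by auto
    then have "eventually (\<lambda>e. joined True (ZC v a \<tau> + (- e) *\<^sub>R M v a b) (KC e v a b \<tau>) \<and> joined False (ZC v a \<tau> + e *\<^sub>R M v a b) (KC e v a b \<tau>)) (at_right 0)"
      unfolding ZC_def M_def KC_def using B(2)[OF vab \<tau>] by (intro edge_sides[OF w]) auto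
    with 1 show "eventually (\<lambda>e. \<forall>j\<in>set (L2 e (v, a, b, \<tau>)). case j of (b, x, y) \<Rightarrow> joined b x y) (at_right 0)"
      by eventually_elim (simp add: L2_def)
  qed
  from E1 E2 have "eventually (\<lambda>e. (\<forall>f\<in>Fl. \<forall>j\<in>set (L1 e f). case j of (b, x, y) \<Rightarrow> joined b x y) \<and> (\<forall>f\<in>FlP. \<forall>j\<in>set (L2 e f). case j of (b, x, y) \<Rightarrow> joined b x y)) (at_right 0)"
    by eventually_elim blast
  \<comment> \<open>All comparisons hold for the same \<open>e\<close>, which depends on the
    \<open>\<eta>\<close> fixed before.\<close>
  then obtain e :: real where e: "\<forall>f\<in>Fl. \<forall>j\<in>set (L1 e f). case j of (b, x, y) \<Rightarrow> joined b x y" "\<forall>f\<in>FlP. \<forall>j\<in>set (L2 e f). case j of (b, x, y) \<Rightarrow> joined b x y"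
    by (drule_tac eventually_happens) auto
  define J where "J = (\<Union>f\<in>Fl. set (L1 e f)) \<union> (\<Union>f\<in>FlP. set (L2 e f))"
  have finJ: "finite J" unfolding J_def using finFl by simp
  have jJ: "joined b x y" if "(b, x, y) \<in> J" for b x y
  proof -
    have "\<forall>j\<in>J. case j of (b, x, y) \<Rightarrow> joined b x y" using e unfolding J_def by blast
    from bspec[OF this that] show ?thesis by simp
  qed
  show ?thesis
  proof (rule mod_2_colours[OF finJ jJ])
    fix w :: "real^3 \<Rightarrow> bool"
    assume w: "\<And>b x y. (b, x, y) \<in> J \<Longrightarrow> (w x = w y) = b"
  have w1: "(w x = w y) = b" if "{v, a, b'} \<in> \<Delta>" "(b, x, y) \<in> set (L1 e (v, a, b'))" for b x y v a b'
    by (rule w) (use that in \<open>auto simp: J_def Fl_def\<close>)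
  have w2: "(w x = w y) = b" if "{v, a, b'} \<in> \<Delta>" "\<tau> \<in> pierced v a" "(b, x, y) \<in> set (L2 e (v, a, b', \<tau>))" for b x y v a b' \<tau>
    by (rule w) (use that in \<open>auto simp: J_def FlP_def\<close>)
  \<comment> \<open>Both flags at an edge use the same \<open>M\<close>. For coherently oriented
    triangles the signs agree and the two sample points coincide; otherwise these points lie on
    opposite sides of the edge.\<close>
  have flip: "M v a c = M v a b" "s v a c = (if or v a b \<noteq> or v a c then s v a b else - s v a b)" "s v a b = 1 \<or> s v a b = - 1"
    if wc: "wedge v a b c" for v a b c
    unfolding M_def s_def oppeq[OF wc] oppeq[OF wedge_sym(1)[OF wc]]
    using mm_sym(1) sg_flip[OF wc] sg_cases[OF wc] by blast+
  show ?thesis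
  proof (rule that[of "\<lambda>v a b. w (Pt e v a b)" "\<lambda>P. w (QC P)"])
    fix v a b assume vab: "{v, a, b} \<in> \<Delta>"
    show "(w (Pt e v a b) = w (Pt e a v b)) = even (card (pierced v a))"
      by (rule w1[OF vab]) (simp add: L1_def)
    have "(w (Pt e v a b) = w (Q e v a b)) = True" "(w (Pt e v b a) = w (Q e v a b)) = True"
      by (rule w1[OF vab], simp add: L1_def)+
    then show "w (Pt e v a b) = w (Pt e v b a)" by simp
  next
    fix v a b c assume wc: "wedge v a b c"
    note fl = flip[OF wc]
    have "(w (Z v a + (- e) *\<^sub>R M v a b) = w (K e v a b)) = True" "(w (Z v a + e *\<^sub>R M v a b) = w (K e v a b)) = False"
      by (rule w1[OF wedgeD(1)[OF wc]], simp add: L1_def)+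
    then have ne: "w (Z v a + e *\<^sub>R M v a b) \<noteq> w (Z v a + (- e) *\<^sub>R M v a b)" by auto
    show "(w (Pt e v a b) = w (Pt e v a c)) = (or v a b \<noteq> or v a c)"
    proof (cases "or v a b \<noteq> or v a c")
      case True
      then show ?thesis unfolding Pt_def fl(1,2) by simp
    next
      case False
      then show ?thesis unfolding Pt_def fl(1,2) using fl(3) ne by auto
    qed
    fix \<tau> assume \<tau>: "\<tau> \<in> pierced v a"
    have "(w (ZC v a \<tau> + (- e) *\<^sub>R M v a b) = w (KC e v a b \<tau>)) = True" "(w (ZC v a \<tau> + e *\<^sub>R M v a b) = w (KC e v a b \<tau>)) = False"
      by (rule w2[OF wedgeD(1)[OF wc] \<tau>], simp add: L2_def)+
    then have ne: "w (ZC v a \<tau> + e *\<^sub>R M v a b) \<noteq> w (ZC v a \<tau> + (- e) *\<^sub>R M v a b)" by auto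
    have q: "(w (ZC v a \<tau> + (e * s v a b) *\<^sub>R M v a b) = w (QC {{v, a, b}, \<tau>})) = True"
      by (rule w2[OF wedgeD(1)[OF wc] \<tau>]) (simp add: L2_def)
    have q': "(w (ZC v a \<tau> + (e * s v a c) *\<^sub>R M v a c) = w (QC {{v, a, c}, \<tau>})) = True"
      by (rule w2[OF wedgeD(2)[OF wc] \<tau>]) (simp add: L2_def)
    show "(w (QC {{v, a, b}, \<tau>}) = w (QC {{v, a, c}, \<tau>})) = (or v a b \<noteq> or v a c)"
    proof (cases "or v a b \<noteq> or v a c")
      case True
      then show ?thesis using q q' unfolding fl(1,2) by simp
    next
      case False
      then show ?thesis using q q' unfolding fl(1,2) using fl(3) ne by auto
    qed
  qed
  qed
qed

end

section \<open>Orientations and walks of flags\<close>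

text \<open>Moving along the edge, turning the corner within the triangle, and crossing the edge;
  these match the three relations for the colours of flags.\<close>

fun flag_step :: "nat set set \<Rightarrow> nat \<times> nat \<times> nat \<Rightarrow> nat \<times> nat \<times> nat \<Rightarrow> bool" where
  "flag_step \<Delta> (v, a, b) (v', a', b') \<longleftrightarrow> {v, a, b} \<in> \<Delta> \<and> {v', a', b'} \<in> \<Delta> \<and>
    (v' = a \<and> a' = v \<and> b' = b \<or> v' = v \<and> a' = b \<and> b' = a \<or> v' = v \<and> a' = a \<and> b' \<noteq> b)"

fun flag_walk :: "nat set set \<Rightarrow> (nat \<times> nat \<times> nat) list \<Rightarrow> bool" where
  "flag_walk \<Delta> (f # g # fs) \<longleftrightarrow> flag_step \<Delta> f g \<and> flag_walk \<Delta> (g # fs)"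
| "flag_walk \<Delta> _ \<longleftrightarrow> True"

text \<open>Only steps along an edge contribute. The smaller vertex is recorded first, so that
  traversals in both directions are counted together.\<close>

fun step_edges :: "nat \<times> nat \<times> nat \<Rightarrow> nat \<times> nat \<times> nat \<Rightarrow> (nat \<times> nat) list" where
  "step_edges (v, a, b) (v', a', b') = (if v' = a then [(min v a, max v a)] else [])"

fun walk_edges :: "(nat \<times> nat \<times> nat) list \<Rightarrow> (nat \<times> nat) list" where
  "walk_edges (f # g # fs) = step_edges f g @ walk_edges (g # fs)"
| "walk_edges _ = []"

text \<open>Crossings of edges along which the orientations disagree; these are the crossings that
  change the colour of the flag.\<close>

fun step_twists :: "(nat \<Rightarrow> nat \<Rightarrow> nat \<Rightarrow> bool) \<Rightarrow> nat \<times> nat \<times> nat \<Rightarrow> nat \<times> nat \<times> nat \<Rightarrow> nat" where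
  "step_twists r (v, a, b) (v', a', b') = (if v' = v \<and> a' = a \<and> r v a b = r v a b' then 1 else 0)"

fun walk_twists :: "(nat \<Rightarrow> nat \<Rightarrow> nat \<Rightarrow> bool) \<Rightarrow> (nat \<times> nat \<times> nat) list \<Rightarrow> nat" where
  "walk_twists r (f # g # fs) = step_twists r f g + walk_twists r (g # fs)"
| "walk_twists r _ = 0"

lemma even_symmetric_sum:
  fixes h :: "'a \<Rightarrow> 'a \<Rightarrow> nat"
  assumes "finite A" "\<And>x y. h x y = h y x" "\<And>x. x \<in> A \<Longrightarrow> h x x = 0"
  shows "even (\<Sum>x\<in>A. \<Sum>y\<in>A. h x y)"
  using assms(1,3)
proof (induction A rule: finite_induct)
  case (insert a A)
  have "(\<Sum>x\<in>insert a A. \<Sum>y\<in>insert a A. h x y) = h a a + (\<Sum>y\<in>A. h a y) + (\<Sum>x\<in>A. h x a) + (\<Sum>x\<in>A. \<Sum>y\<in>A. h x y)"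
    using insert.hyps by (simp add: sum.distrib)
  moreover have "(\<Sum>x\<in>A. h x a) = (\<Sum>y\<in>A. h a y)" using assms(2) by simp
  ultimately show ?case using insert by simp
qed simp

section \<open>Piercings by the edges along which orientations disagree\<close>

context oriented_surface begin

definition pierce :: "nat set \<Rightarrow> nat set set" where
  "pierce e = {\<tau>\<in>\<Delta>. e \<inter> \<tau> = {} \<and> H e \<inter> H \<tau> \<noteq> {}}"

lemma pierced_eq: "pierced v a = pierce {v, a}"
  unfolding pierced_def pierce_def by auto

definition edges :: "nat set set" where "edges = {e. card e = 2 \<and> (\<exists>\<sigma>\<in>\<Delta>. e \<subseteq> \<sigma>)}"

text \<open>Equal values of \<open>or\<close> at an edge mean that both triangles induce the same
  direction on it, whereas coherent neighbours induce opposite directions.\<close>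

definition twisted :: "nat set set" where
  "twisted = {e. \<exists>v a b c. wedge v a b c \<and> e = {v, a} \<and> or v a b = or v a c}"

lemma finite_edges: "finite edges"
proof (rule finite_subset)
  show "edges \<subseteq> Pow (\<Union>\<Delta>)" unfolding edges_def by blast
  show "finite (Pow (\<Union>\<Delta>))" using fin\<Delta> fin\<sigma> by blast
qed

lemma edge_wedge:
  assumes "e \<in> edges"
  obtains v a b c where "wedge v a b c" "e = {v, a}" "v < a"
proof -
  obtain \<sigma> where s: "\<sigma> \<in> \<Delta>" "e \<subseteq> \<sigma>" "card e = 2" using assms unfolding edges_def by blast
  obtain x y where xy: "e = {x, y}" "x \<noteq> y" using s(3) by (auto simp: card_2_iff)
  define v a where "v = min x y" "a = max x y"
  have va: "e = {v, a}" "v < a" using xy unfolding v_a_def by (auto simp: min_def max_def)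
  have "card (\<sigma> - e) = 1" using s c3[OF s(1)] by (subst card_Diff_subset) (auto intro: finite_subset[OF _ fin\<sigma>])
  then obtain b where "\<sigma> - e = {b}" by (rule card_1_singletonE)
  then have "\<sigma> = {v, a, b}" using s(2) unfolding va by blast
  then obtain c where "wedge v a b c" using wedge_exists s(1) by blast
  then show ?thesis using that va by blast
qed

lemma or_rev: "{v, a, b} \<in> \<Delta> \<Longrightarrow> or a v b = (\<not> or v a b)"
  using or_cyc[of v a b] or_swap[of v a b] or_cyc[of a v b] or_swap[of a b v] by (metis insert_commute)

lemma twisted_iff:
  assumes w: "wedge v a b c"
  shows "{v, a} \<in> twisted \<longleftrightarrow> or v a b = or v a c"
proof
  assume "{v, a} \<in> twisted"
  then obtain v' a' b' c' where w': "wedge v' a' b' c'" "{v, a} = {v', a'}" "or v' a' b' = or v' a' c'"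
    unfolding twisted_def by blast
  have *: "or v a x = or v a y" if x: "wedge v a x y" "or v a b' = or v a c'" "x = b" "{b', c'} = {b, c}" for x y
  proof -
    have "y = c" using wedge_unique[OF w] x by blast
    then show ?thesis using x by (metis doubleton_eq_iff)
  qed
  have eq: "{b', c'} = {b, c}" if "wedge v a b' c'"
  proof -
    have "{v, a, b'} = {v, a, b} \<or> {v, a, b'} = {v, a, c}" using wedgeD(4)[OF w wedgeD(1)[OF that]] by blast
    moreover have "b' \<notin> {v, a}" using wedgeD(3)[OF that] by simp
    ultimately have "b' = b \<or> b' = c" by blast
    then show ?thesis using wedge_unique[OF w] wedge_unique[OF wedge_sym(1)[OF w]] that by blast
  qed
  show "or v a b = or v a c"
  proof (cases "v' = v")
    case True
    then have "a' = a" using w'(2) by (metis doubleton_eq_iff)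
    then show ?thesis using *[OF w] eq w' True by simp
  next
    case False
    then have va: "v' = a" "a' = v" using w'(2) by (metis doubleton_eq_iff)+
    have w2: "wedge v a b' c'" using wedge_sym(2)[OF w'(1)] unfolding va .
    have "or v a b' = or v a c'" using w'(3) or_rev[OF wedgeD(1)[OF w2]] or_rev[OF wedgeD(2)[OF w2]] unfolding va by simp
    then show ?thesis using *[OF w] eq[OF w2] by simp
  qed
next
  assume "or v a b = or v a c"
  then show "{v, a} \<in> twisted" unfolding twisted_def using w by blast
qed

text \<open>The colours \<open>c\<close> are summed over all edges \<open>e\<close>, triangles
  \<open>\<sigma>\<close> at \<open>e\<close>, and triangles \<open>\<tau>\<close> pierced by
  \<open>e\<close>. For fixed \<open>e\<close> and \<open>\<tau>\<close> the two colours differ just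
  if \<open>e\<close> is twisted, so modulo 2 the sum counts piercings by twisted edges. For a fixed
  pair of triangles there are two piercings with the same colour, so the sum is even.\<close>

lemma twisted_pierce_even:
  fixes C :: "nat set set \<Rightarrow> bool"
  assumes C: "\<And>v a b c \<tau>. wedge v a b c \<Longrightarrow> \<tau> \<in> pierced v a \<Longrightarrow>
      (C {{v, a, b}, \<tau>} = C {{v, a, c}, \<tau>}) = (or v a b \<noteq> or v a c)"
  shows "even (\<Sum>e\<in>edges. of_bool (e \<in> twisted) * card (pierce e))"
proof -
  define c :: "nat set \<Rightarrow> nat set \<Rightarrow> nat" where "c \<sigma> \<tau> = of_bool (C {\<sigma>, \<tau>})" for \<sigma> \<tau>
  define q :: "nat set \<Rightarrow> nat set \<Rightarrow> nat set \<Rightarrow> nat" where "q e \<sigma> \<tau> = of_bool (e \<subseteq> \<sigma> \<and> \<tau> \<in> pierce e)" for e \<sigma> \<tau>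
  define n where "n \<sigma> \<tau> = (\<Sum>e\<in>edges. q e \<sigma> \<tau>)" for \<sigma> \<tau>
  have csym: "c \<sigma> \<tau> = c \<tau> \<sigma>" for \<sigma> \<tau> unfolding c_def by (simp add: insert_commute)
  have fp: "finite (pierce e)" "pierce e \<subseteq> \<Delta>" for e unfolding pierce_def using fin\<Delta> by auto
  have 1: "even ((\<Sum>\<sigma>\<in>\<Delta>. \<Sum>\<tau>\<in>\<Delta>. q e \<sigma> \<tau> * c \<sigma> \<tau>) + of_bool (e \<in> twisted) * card (pierce e))" if e: "e \<in> edges" for e
  proof -
    obtain v a b d where w: "wedge v a b d" and ev: "e = {v, a}" using edge_wedge[OF e] by metis
    have ne: "{v, a, b} \<noteq> {v, a, d}" using wedgeD(3)[OF w] by (metis distinct_length_2_or_more insertE insertI1 insert_commute singletonD)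
    have inner: "(\<Sum>\<tau>\<in>\<Delta>. q e \<sigma> \<tau> * c \<sigma> \<tau>) = (if e \<subseteq> \<sigma> then \<Sum>\<tau>\<in>pierce e. c \<sigma> \<tau> else 0)" for \<sigma>
    proof (cases "e \<subseteq> \<sigma>")
      case True
      have "(\<Sum>\<tau>\<in>\<Delta>. q e \<sigma> \<tau> * c \<sigma> \<tau>) = (\<Sum>\<tau>\<in>pierce e. c \<sigma> \<tau>)"
        by (rule sum.mono_neutral_cong_right[OF fin\<Delta> fp(2)]) (use True in \<open>auto simp: q_def\<close>)
      then show ?thesis using True by simp
    qed (simp add: q_def)
    have "(\<Sum>\<sigma>\<in>\<Delta>. \<Sum>\<tau>\<in>\<Delta>. q e \<sigma> \<tau> * c \<sigma> \<tau>) = (\<Sum>\<sigma>\<in>{{v, a, b}, {v, a, d}}. \<Sum>\<tau>\<in>pierce e. c \<sigma> \<tau>)"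
      unfolding inner
      by (rule sum.mono_neutral_cong_right[OF fin\<Delta>]) (use wedgeD(1,2,4)[OF w] in \<open>auto simp: ev\<close>)
    also have "\<dots> = (\<Sum>\<tau>\<in>pierce e. c {v, a, b} \<tau> + c {v, a, d} \<tau>)" using ne by (simp add: sum.distrib)
    finally have "(\<Sum>\<sigma>\<in>\<Delta>. \<Sum>\<tau>\<in>\<Delta>. q e \<sigma> \<tau> * c \<sigma> \<tau>) + of_bool (e \<in> twisted) * card (pierce e) =
      (\<Sum>\<tau>\<in>pierce e. c {v, a, b} \<tau> + c {v, a, d} \<tau> + of_bool (e \<in> twisted))" by (simp add: sum.distrib)
    moreover have "even (\<Sum>\<tau>\<in>pierce e. c {v, a, b} \<tau> + c {v, a, d} \<tau> + of_bool (e \<in> twisted))"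
    proof (rule dvd_sum)
      fix \<tau> assume "\<tau> \<in> pierce e"
      then have "(C {{v, a, b}, \<tau>} = C {{v, a, d}, \<tau>}) = (e \<notin> twisted)"
        using C[OF w] twisted_iff[OF w] unfolding ev pierced_eq by blast
      then show "even (c {v, a, b} \<tau> + c {v, a, d} \<tau> + of_bool (e \<in> twisted))" unfolding c_def by auto
    qed
    ultimately show ?thesis by simp
  qed
  \<comment> \<open>Edges of \<open>\<sigma>\<close> correspond to their opposite vertices;
    triangles with a common vertex contribute nothing, by \<open>H_Int\<close>.\<close>
  have 2: "n \<sigma> \<tau> = (if \<sigma> \<inter> \<tau> = {} then card {i\<in>\<sigma>. H (\<sigma> - {i}) \<inter> H \<tau> \<noteq> {}} else 0)" if \<sigma>: "\<sigma> \<in> \<Delta>" and \<tau>: "\<tau> \<in> \<Delta>" for \<sigma> \<tau>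
  proof -
    have n: "n \<sigma> \<tau> = card {e\<in>edges. e \<subseteq> \<sigma> \<and> \<tau> \<in> pierce e}"
      unfolding n_def q_def using finite_edges by (simp add: Int_def conj_commute)
    show ?thesis
    proof (cases "\<sigma> \<inter> \<tau> = {}")
      case True
      have "{e\<in>edges. e \<subseteq> \<sigma> \<and> \<tau> \<in> pierce e} = (\<lambda>i. \<sigma> - {i}) ` {i\<in>\<sigma>. H (\<sigma> - {i}) \<inter> H \<tau> \<noteq> {}}" (is "?L = ?R")
      proof
        show "?L \<subseteq> ?R"
        proof
          fix e assume e: "e \<in> ?L"
          then have "card (\<sigma> - e) = 1" using c3[OF \<sigma>] unfolding edges_def by (subst card_Diff_subset) (auto intro: finite_subset[OF _ fin\<sigma>[OF \<sigma>]])
          then obtain i where "\<sigma> - e = {i}" by (rule card_1_singletonE)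
          then have "i \<in> \<sigma>" "e = \<sigma> - {i}" using e by auto
          then show "e \<in> ?R" using e unfolding pierce_def by auto
        qed
        show "?R \<subseteq> ?L"
        proof
          fix e assume "e \<in> ?R"
          then obtain i where i: "i \<in> \<sigma>" "e = \<sigma> - {i}" "H e \<inter> H \<tau> \<noteq> {}" by blast
          have "card e = 2" using i c3[OF \<sigma>] by simp
          then show "e \<in> ?L" unfolding edges_def pierce_def using i \<sigma> \<tau> True by blast
        qed
      qed
      moreover have "inj_on (\<lambda>i. \<sigma> - {i}) {i\<in>\<sigma>. H (\<sigma> - {i}) \<inter> H \<tau> \<noteq> {}}" by (auto simp: inj_on_def)
      ultimately show ?thesis unfolding n using True by (simp add: card_image)
    next
      case False
      have "\<tau> \<notin> pierce e" if "e \<subseteq> \<sigma>" for e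
      proof
        assume p: "\<tau> \<in> pierce e"
        have "H e \<inter> H \<tau> = H (e \<inter> \<tau>)" by (rule H_Int[OF \<sigma> \<tau> False that order_refl])
        then show False using p unfolding pierce_def by auto
      qed
      then have "{e\<in>edges. e \<subseteq> \<sigma> \<and> \<tau> \<in> pierce e} = {}" by blast
      then show ?thesis unfolding n using False by (simp only: card.empty if_False)
    qed
  qed
  define h :: "nat set \<Rightarrow> nat set \<Rightarrow> nat" where "h \<sigma> \<tau> = of_bool (\<sigma> \<inter> \<tau> = {} \<and> H \<sigma> \<inter> H \<tau> \<noteq> {}) * c \<sigma> \<tau>" for \<sigma> \<tau>
  \<comment> \<open>An intersecting pair has two piercings in total, distributed in some way over
    the two orders of the pair.\<close>
  have 3: "(n \<sigma> \<tau> + n \<tau> \<sigma>) * c \<sigma> \<tau> = 2 * h \<sigma> \<tau>" if \<sigma>: "\<sigma> \<in> \<Delta>" and \<tau>: "\<tau> \<in> \<Delta>" for \<sigma> \<tau>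
  proof (cases "\<sigma> \<inter> \<tau> = {} \<and> H \<sigma> \<inter> H \<tau> \<noteq> {}")
    case True
    have "{i\<in>\<tau>. H \<sigma> \<inter> H (\<tau> - {i}) \<noteq> {}} = {i\<in>\<tau>. H (\<tau> - {i}) \<inter> H \<sigma> \<noteq> {}}" by blast
    then have "n \<sigma> \<tau> + n \<tau> \<sigma> = 2"
      using pair_two_piercings[OF \<sigma> \<tau>] True unfolding 2[OF \<sigma> \<tau>] 2[OF \<tau> \<sigma>] by (simp add: Int_commute)
    then show ?thesis unfolding h_def using True by simp
  next
    case False
    have "n \<sigma> \<tau> = 0 \<and> n \<tau> \<sigma> = 0"
    proof (cases "\<sigma> \<inter> \<tau> = {}")
      case True
      then have e: "H \<sigma> \<inter> H \<tau> = {}" using False by blast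
      have "H (\<sigma> - {i}) \<inter> H \<tau> = {}" "H (\<tau> - {i}) \<inter> H \<sigma> = {}" for i
        using e H_mono[of "\<sigma> - {i}" \<sigma>] H_mono[of "\<tau> - {i}" \<tau>] by blast+
      then show ?thesis unfolding 2[OF \<sigma> \<tau>] 2[OF \<tau> \<sigma>] by simp
    next
      case False
      then show ?thesis unfolding 2[OF \<sigma> \<tau>] 2[OF \<tau> \<sigma>] by (simp add: Int_commute)
    qed
    then show ?thesis using False unfolding h_def by simp
  qed
  define N where "N = (\<Sum>\<sigma>\<in>\<Delta>. \<Sum>\<tau>\<in>\<Delta>. n \<sigma> \<tau> * c \<sigma> \<tau>)"
  \<comment> \<open>Adding the sum with both arguments exchanged replaces the individual piercing
    numbers by twice the symmetric \<open>h\<close>, whose diagonal is zero.\<close>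
  have "N = (\<Sum>\<tau>\<in>\<Delta>. \<Sum>\<sigma>\<in>\<Delta>. n \<sigma> \<tau> * c \<sigma> \<tau>)" unfolding N_def by (rule sum.swap)
  then have "N = (\<Sum>\<sigma>\<in>\<Delta>. \<Sum>\<tau>\<in>\<Delta>. n \<tau> \<sigma> * c \<sigma> \<tau>)" by (simp only: csym)
  then have "2 * N = (\<Sum>\<sigma>\<in>\<Delta>. \<Sum>\<tau>\<in>\<Delta>. (n \<sigma> \<tau> + n \<tau> \<sigma>) * c \<sigma> \<tau>)"
    unfolding mult_2 by (subst (1) N_def) (simp add: sum.distrib distrib_right)
  also have "\<dots> = (\<Sum>\<sigma>\<in>\<Delta>. \<Sum>\<tau>\<in>\<Delta>. 2 * h \<sigma> \<tau>)" using 3 by (intro sum.cong refl) auto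
  also have "\<dots> = 2 * (\<Sum>\<sigma>\<in>\<Delta>. \<Sum>\<tau>\<in>\<Delta>. h \<sigma> \<tau>)" by (simp add: sum_distrib_left)
  finally have "N = (\<Sum>\<sigma>\<in>\<Delta>. \<Sum>\<tau>\<in>\<Delta>. h \<sigma> \<tau>)" by simp
  also have "even \<dots>"
  proof (rule even_symmetric_sum[OF fin\<Delta>])
    show "h x y = h y x" for x y unfolding h_def using csym by (simp add: Int_commute)
    show "h x x = 0" if "x \<in> \<Delta>" for x unfolding h_def using c3[OF that] by auto
  qed
  finally have evN: "even N" .
  have "(\<Sum>e\<in>edges. \<Sum>\<sigma>\<in>\<Delta>. \<Sum>\<tau>\<in>\<Delta>. q e \<sigma> \<tau> * c \<sigma> \<tau>) = (\<Sum>\<sigma>\<in>\<Delta>. \<Sum>e\<in>edges. \<Sum>\<tau>\<in>\<Delta>. q e \<sigma> \<tau> * c \<sigma> \<tau>)" by (rule sum.swap)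
  also have "\<dots> = (\<Sum>\<sigma>\<in>\<Delta>. \<Sum>\<tau>\<in>\<Delta>. \<Sum>e\<in>edges. q e \<sigma> \<tau> * c \<sigma> \<tau>)" by (intro sum.cong refl sum.swap)
  also have "\<dots> = N" unfolding N_def n_def by (simp add: sum_distrib_right)
  finally have "(\<Sum>e\<in>edges. \<Sum>\<sigma>\<in>\<Delta>. \<Sum>\<tau>\<in>\<Delta>. q e \<sigma> \<tau> * c \<sigma> \<tau>) = N" .
  moreover have "even (\<Sum>e\<in>edges. (\<Sum>\<sigma>\<in>\<Delta>. \<Sum>\<tau>\<in>\<Delta>. q e \<sigma> \<tau> * c \<sigma> \<tau>) + of_bool (e \<in> twisted) * card (pierce e))"
    using 1 by (intro dvd_sum) blast
  ultimately show ?thesis using evN by (simp add: sum.distrib)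
qed

text \<open>The colour changes once for every triangle pierced by a traversed edge and once for
  every crossing counted by \<open>walk_twists\<close>.\<close>

lemma walk_parity:
  fixes W :: "nat \<Rightarrow> nat \<Rightarrow> nat \<Rightarrow> bool"
  assumes W: "\<And>v a b. {v, a, b} \<in> \<Delta> \<Longrightarrow> (W v a b = W a v b) = even (card (pierced v a))"
    "\<And>v a b. {v, a, b} \<in> \<Delta> \<Longrightarrow> W v a b = W v b a"
    "\<And>v a b c. wedge v a b c \<Longrightarrow> (W v a b = W v a c) = (or v a b \<noteq> or v a c)"
    and fw: "flag_walk \<Delta> (f # fs)"
  shows "(case f of (v, a, b) \<Rightarrow> W v a b) = (case last (f # fs) of (v, a, b) \<Rightarrow> W v a b) \<longleftrightarrow>
    even ((\<Sum>(v, a)\<leftarrow>walk_edges (f # fs). card (pierce {v, a})) + walk_twists or (f # fs))"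
  using fw
proof (induction fs arbitrary: f)
  case (Cons g fs)
  obtain v a b v' a' b' where f: "f = (v, a, b)" and g: "g = (v', a', b')" by (metis prod_cases3)
  have st: "flag_step \<Delta> f g" and wk: "flag_walk \<Delta> (g # fs)" using Cons.prems by simp_all
  have fd: "{v, a, b} \<in> \<Delta>" "{v', a', b'} \<in> \<Delta>" using st f g by simp_all
  have d: "v \<noteq> a" "v \<noteq> b" "a \<noteq> b" using c3[OF fd(1)] by (auto simp: card_insert_if split: if_splits)
  have s1: "(W v a b = W v' a' b') = even ((\<Sum>(v, a)\<leftarrow>step_edges f g. card (pierce {v, a})) + step_twists or f g)"
  proof -
    consider "v' = a" "a' = v" "b' = b" | "v' = v" "a' = b" "b' = a" | "v' = v" "a' = a" "b' \<noteq> b"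
      using st unfolding f g by auto
    then show ?thesis
    proof cases
      case 1
      have "{min v a, max v a} = {v, a}" by (auto simp: min_def max_def)
      then show ?thesis using W(1)[OF fd(1)] d unfolding f g 1 pierced_eq by simp
    next
      case 2
      then show ?thesis using W(2)[OF fd(1)] d unfolding f g by simp
    next
      case 3
      obtain c where w: "wedge v a b c" using wedge_exists[OF fd(1)] .
      have "{v, a, b'} = {v, a, b} \<or> {v, a, b'} = {v, a, c}" using wedgeD(4)[OF w] fd(2) 3 by blast
      moreover have "b' \<notin> {v, a}" using c3[OF fd(2)] unfolding 3 by (auto simp: card_insert_if split: if_splits)
      ultimately have "b' = c" using 3(3) by blast
      then show ?thesis using W(3)[OF w] d unfolding f g 3(1,2) by simp
    qed
  qed
  have s2: "(W v' a' b' = (case last (g # fs) of (v, a, b) \<Rightarrow> W v a b)) =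
    even ((\<Sum>(v, a)\<leftarrow>walk_edges (g # fs). card (pierce {v, a})) + walk_twists or (g # fs))"
    using Cons.IH[OF wk] g by simp
  have s3: "(\<Sum>(v, a)\<leftarrow>walk_edges (f # g # fs). card (pierce {v, a})) + walk_twists or (f # g # fs) =
    ((\<Sum>(v, a)\<leftarrow>step_edges f g. card (pierce {v, a})) + step_twists or f g) +
    ((\<Sum>(v, a)\<leftarrow>walk_edges (g # fs). card (pierce {v, a})) + walk_twists or (g # fs))" by simp
  have s4: "(case f of (v, a, b) \<Rightarrow> W v a b) = W v a b" "last (f # g # fs) = last (g # fs)" using f by simp_all
  show ?case unfolding s3 s4 even_add s1[symmetric, unfolded even_add] s2[symmetric, unfolded even_add] by auto
qed simp

lemma walk_edges_subset:
  assumes "flag_walk \<Delta> (f # fs)"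
  shows "set (walk_edges (f # fs)) \<subseteq> {(v, a). v < a \<and> {v, a} \<in> edges}"
  using assms
proof (induction fs arbitrary: f)
  case (Cons g fs)
  obtain v a b v' a' b' where f: "f = (v, a, b)" and g: "g = (v', a', b')" by (metis prod_cases3)
  have fd: "{v, a, b} \<in> \<Delta>" "flag_walk \<Delta> (g # fs)" using Cons.prems f g by simp_all
  have d: "v \<noteq> a" using c3[OF fd(1)] by (auto simp: card_insert_if split: if_splits)
  have "{v, a} \<in> edges" unfolding edges_def using fd(1) d by auto
  moreover have "{min v a, max v a} = {v, a}" "min v a < max v a" using d by (auto simp: min_def max_def)
  ultimately have "set (step_edges f g) \<subseteq> {(v, a). v < a \<and> {v, a} \<in> edges}" unfolding f g by (auto split: if_splits)
  then show ?case using Cons.IH[OF fd(2)] by simp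
qed simp

text \<open>A closed walk returns to its initial colour, so its piercings and twists are together
  even in number. Modulo 2 it traverses each twisted edge once and no other edge, so its piercings
  are even by \<open>twisted_pierce_even\<close>; this leaves an even number of twists.\<close>

theorem walk_contradiction:
  assumes fw: "flag_walk \<Delta> (f # fs)" "last (f # fs) = f"
    and tw: "\<And>v a b c. wedge v a b c \<Longrightarrow> v < a \<Longrightarrow> odd (count_list (walk_edges (f # fs)) (v, a)) = (or v a b = or v a c)"
    and odd: "odd (walk_twists or (f # fs))"
  shows False
proof (rule colours)
  fix W :: "nat \<Rightarrow> nat \<Rightarrow> nat \<Rightarrow> bool" and C :: "nat set set \<Rightarrow> bool"
  assume W: "\<And>v a b. {v, a, b} \<in> \<Delta> \<Longrightarrow> (W v a b = W a v b) = even (card (pierced v a))"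
    "\<And>v a b. {v, a, b} \<in> \<Delta> \<Longrightarrow> W v a b = W v b a"
    "\<And>v a b c. wedge v a b c \<Longrightarrow> (W v a b = W v a c) = (or v a b \<noteq> or v a c)"
    and C: "\<And>v a b c \<tau>. wedge v a b c \<Longrightarrow> \<tau> \<in> pierced v a \<Longrightarrow>
      (C {{v, a, b}, \<tau>} = C {{v, a, c}, \<tau>}) = (or v a b \<noteq> or v a c)"
  let ?xs = "walk_edges (f # fs)" and ?A = "{(v, a). v < a \<and> {v, a} \<in> edges}"
  let ?s = "\<lambda>(v :: nat, a). {v, a}"
  have bij: "bij_betw ?s ?A edges"
    unfolding bij_betw_def
  proof
    show "inj_on ?s ?A" by (auto simp: inj_on_def doubleton_eq_iff)
    show "?s ` ?A = edges"
    proof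
      show "edges \<subseteq> ?s ` ?A"
      proof
        fix e assume e: "e \<in> edges"
        then obtain v a b c where "wedge v a b c" "e = {v, a}" "v < a" by (rule edge_wedge)
        then show "e \<in> ?s ` ?A" using e by (intro image_eqI[of _ _ "(v, a)"]) auto
      qed
    qed auto
  qed
  have finA: "finite ?A" using bij finite_edges bij_betw_finite by blast
  have "(\<Sum>(v, a)\<leftarrow>?xs. card (pierce {v, a})) = (\<Sum>x\<in>?A. count_list ?xs x * (case x of (v, a) \<Rightarrow> card (pierce {v, a})))"
    by (rule sum_list_map_eq_sum_count2[OF walk_edges_subset[OF fw(1)] finA])
  moreover have "(\<Sum>e\<in>edges. of_bool (e \<in> twisted) * card (pierce e)) =
      (\<Sum>x\<in>?A. of_bool (?s x \<in> twisted) * card (pierce (?s x)))"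
    by (rule sum.reindex_bij_betw[OF bij, symmetric])
  moreover have "even (\<Sum>x\<in>?A. count_list ?xs x * (case x of (v, a) \<Rightarrow> card (pierce {v, a})) + of_bool (?s x \<in> twisted) * card (pierce (?s x)))"
  proof (rule dvd_sum, clarify)
    fix v a :: nat assume va: "v < a" "{v, a} \<in> edges"
    obtain v' a' b c where w: "wedge v' a' b c" "{v, a} = {v', a'}" "v' < a'" using edge_wedge[OF va(2)] by metis
    then have "v' = v" "a' = a" using va(1) by (auto simp: doubleton_eq_iff)
    then have "odd (count_list ?xs (v, a)) = ({v, a} \<in> twisted)" using tw[OF w(1,3)] twisted_iff[OF w(1)] by simp
    then show "even (count_list ?xs (v, a) * card (pierce {v, a}) + of_bool ({v, a} \<in> twisted) * card (pierce {v, a}))" by auto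
  qed
  ultimately have "even (\<Sum>(v, a)\<leftarrow>?xs. card (pierce {v, a}))"
    using twisted_pierce_even[OF C] by (simp add: sum.distrib)
  then show False using walk_parity[OF W fw(1)] odd unfolding fw(2) by simp
qed

end

section \<open>Triple points and general position\<close>

context generic_surface begin

text \<open>Of the six edges of two intersecting triangles exactly two pierce. A neighbour of one
  triangle with all vertices in the union contains an edge of it and a vertex of the other triangle;
  by \<open>H_Int\<close> this edge does not pierce. Only four edges remain, and distinct neighbours
  use distinct edges.\<close>

lemma pair_condition_if_meet:
  assumes K: "triangles K = \<Delta>" and \<sigma>: "\<sigma> \<in> \<Delta>" and \<tau>: "\<tau> \<in> \<Delta>" and dis: "\<sigma> \<inter> \<tau> = {}" and meet: "H \<sigma> \<inter> H \<tau> \<noteq> {}"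
  shows "pair_condition K \<sigma> \<tau>"
proof -
  define X where "X = {T\<in>\<Delta>. (adjacent_triangles T \<sigma> \<or> adjacent_triangles T \<tau>) \<and> T \<subseteq> \<sigma> \<union> \<tau>}"
  define I J where "I = {i\<in>\<sigma>. H (\<sigma> - {i}) \<inter> H \<tau> = {}}" "J = {i\<in>\<tau>. H \<sigma> \<inter> H (\<tau> - {i}) = {}}"
  define NP where "NP = (\<lambda>i. \<sigma> - {i}) ` I \<union> (\<lambda>i. \<tau> - {i}) ` J"
  have fin: "finite I" "finite J" unfolding I_J_def using fin\<sigma>[OF \<sigma>] fin\<sigma>[OF \<tau>] by simp_all
  have cI: "card I + card {i\<in>\<sigma>. H (\<sigma> - {i}) \<inter> H \<tau> \<noteq> {}} = 3"
  proof -
    have "I \<union> {i\<in>\<sigma>. H (\<sigma> - {i}) \<inter> H \<tau> \<noteq> {}} = \<sigma>" unfolding I_J_def by blast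
    then show ?thesis using c3[OF \<sigma>] card_Un_disjoint[of I "{i\<in>\<sigma>. H (\<sigma> - {i}) \<inter> H \<tau> \<noteq> {}}"] fin(1) fin\<sigma>[OF \<sigma>] unfolding I_J_def by auto
  qed
  have cJ: "card J + card {i\<in>\<tau>. H \<sigma> \<inter> H (\<tau> - {i}) \<noteq> {}} = 3"
  proof -
    have "J \<union> {i\<in>\<tau>. H \<sigma> \<inter> H (\<tau> - {i}) \<noteq> {}} = \<tau>" unfolding I_J_def by blast
    then show ?thesis using c3[OF \<tau>] card_Un_disjoint[of J "{i\<in>\<tau>. H \<sigma> \<inter> H (\<tau> - {i}) \<noteq> {}}"] fin(2) fin\<sigma>[OF \<tau>] unfolding I_J_def by auto
  qed
  have "card NP \<le> card I + card J"
    unfolding NP_def by (rule order_trans[OF card_Un_le]) (use fin in \<open>intro add_mono card_image_le\<close>)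
  then have NP4: "card NP \<le> 4" using cI cJ pair_two_piercings[OF \<sigma> \<tau> dis meet] by linarith
  \<comment> \<open>The edge that \<open>T\<close> shares with \<open>\<sigma>\<close> or, failing
    that, with \<open>\<tau>\<close>: the injection into the nonpiercing edges.\<close>
  define g where "g T = (if card (T \<inter> \<sigma>) = 2 then T \<inter> \<sigma> else T \<inter> \<tau>)" for T
  have key: "T \<inter> \<alpha> \<in> (\<lambda>i. \<alpha> - {i}) ` {i\<in>\<alpha>. H (\<alpha> - {i}) \<inter> H \<beta> = {}} \<and> T \<inter> \<beta> \<noteq> {}"
    if T: "T \<in> \<Delta>" "T \<subseteq> \<alpha> \<union> \<beta>" "card (T \<inter> \<alpha>) = 2" and ab: "\<alpha> \<in> \<Delta>" "\<beta> \<in> \<Delta>" "\<alpha> \<inter> \<beta> = {}" for T \<alpha> \<beta>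
  proof -
    have ne: "T \<inter> \<beta> \<noteq> {}"
    proof
      assume "T \<inter> \<beta> = {}"
      then have "T \<inter> \<alpha> = T" using T(2) by blast
      then show False using T(3) c3[OF T(1)] by simp
    qed
    have "card (\<alpha> - T \<inter> \<alpha>) = 1" using c3[OF ab(1)] T(3) fin\<sigma>[OF ab(1)] by (subst card_Diff_subset) auto
    then obtain i where "\<alpha> - T \<inter> \<alpha> = {i}" by (rule card_1_singletonE)
    then have i: "i \<in> \<alpha>" "T \<inter> \<alpha> = \<alpha> - {i}" by blast+
    have "H (T \<inter> \<alpha>) \<inter> H \<beta> = H (T \<inter> \<alpha> \<inter> \<beta>)" by (rule H_Int[OF T(1) ab(2) ne]) auto
    also have "T \<inter> \<alpha> \<inter> \<beta> = {}" using ab(3) by blast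
    finally have "H (\<alpha> - {i}) \<inter> H \<beta> = {}" unfolding i(2) by simp
    then show ?thesis using i ne by blast
  qed
  have XD: "T \<in> \<Delta>" "T \<subseteq> \<sigma> \<union> \<tau>" "T \<subseteq> \<tau> \<union> \<sigma>" "card (T \<inter> \<sigma>) = 2 \<or> card (T \<inter> \<tau>) = 2" if "T \<in> X" for T
    using that unfolding X_def adjacent_triangles_def by auto
  have dis': "\<tau> \<inter> \<sigma> = {}" using dis by blast
  have J': "J = {i\<in>\<tau>. H (\<tau> - {i}) \<inter> H \<sigma> = {}}" unfolding I_J_def by blast
  have gN: "g T \<in> NP" if "T \<in> X" for T
    using key[OF XD(1,2)[OF that] _ \<sigma> \<tau> dis] key[OF XD(1,3)[OF that] _ \<tau> \<sigma> dis'] XD(4)[OF that]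
    unfolding g_def NP_def J' I_J_def(1) by auto
  \<comment> \<open>Besides \<open>\<alpha>\<close> only one triangle contains the edge
    \<open>e\<close>.\<close>
  have uniq: "T = T'" if e: "card e = 2" "e \<subseteq> \<alpha>" "e \<subseteq> T" "e \<subseteq> T'" and \<Delta>: "\<alpha> \<in> \<Delta>" "T \<in> \<Delta>" "T' \<in> \<Delta>" "T \<noteq> \<alpha>" "T' \<noteq> \<alpha>" for e \<alpha> T T'
  proof (rule ccontr)
    assume "T \<noteq> T'"
    then have "card {\<alpha>, T, T'} = 3" using \<Delta> by auto
    moreover have "card {\<alpha>, T, T'} \<le> card {\<sigma>\<in>\<Delta>. e \<subseteq> \<sigma>}" using fin\<Delta> e \<Delta> by (intro card_mono) auto
    ultimately show False using closed2[OF e(1)] by auto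
  qed
  have neq: "T \<noteq> \<sigma>" if "T \<in> X" "card (T \<inter> \<sigma>) = 2" for T
    using key[OF XD(1,2)[OF that(1)] that(2) \<sigma> \<tau> dis] dis by blast
  have neq': "T \<noteq> \<tau>" if "T \<in> X" "card (T \<inter> \<tau>) = 2" for T
    using key[OF XD(1,3)[OF that(1)] that(2) \<tau> \<sigma> dis'] dis by blast
  have "inj_on g X"
  proof (rule inj_onI)
    fix T T' assume T: "T \<in> X" "T' \<in> X" "g T = g T'"
    have g2: "card (g T) = 2" if "T \<in> X" for T using XD(4)[OF that] unfolding g_def by auto
    have gne: "g T \<noteq> {}" using g2[OF T(1)] by auto
    show "T = T'"
    proof (cases "card (T \<inter> \<sigma>) = 2")
      case True
      have "g T \<subseteq> \<sigma>" using True by (simp add: g_def)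
      then have "card (T' \<inter> \<sigma>) = 2" using T(3) gne dis unfolding g_def by (auto split: if_splits)
      then show ?thesis
        using uniq[OF g2[OF T(1)], of \<sigma> T T'] T True neq[OF T(1) True] neq[OF T(2)] XD(1)[OF T(1)] XD(1)[OF T(2)] \<sigma> by (auto simp: g_def)
    next
      case False
      then have c: "card (T \<inter> \<tau>) = 2" using XD(4)[OF T(1)] by blast
      have "g T \<subseteq> \<tau>" using False by (simp add: g_def)
      then have f: "card (T' \<inter> \<sigma>) \<noteq> 2" using T(3) gne dis unfolding g_def by (auto split: if_splits)
      then have "card (T' \<inter> \<tau>) = 2" using XD(4)[OF T(2)] by blast
      then show ?thesis
        using uniq[OF g2[OF T(1)], of \<tau> T T'] T False f neq'[OF T(1) c] neq'[OF T(2)] XD(1)[OF T(1)] XD(1)[OF T(2)] \<tau> by (auto simp: g_def)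
    qed
  qed
  then have "card X \<le> card NP" using gN fin unfolding NP_def by (intro card_inj_on_le[of g]) auto
  then have "card X \<le> 4" using NP4 by simp
  then show ?thesis unfolding pair_condition_def K X_def .
qed

lemma no_triple_points:
  assumes K: "triangles K = \<Delta>" "triple_points_infeasible K"
    and \<Delta>: "\<rho> \<in> \<Delta>" "\<sigma> \<in> \<Delta>" "\<tau> \<in> \<Delta>" and dis: "\<rho> \<inter> \<sigma> = {}" "\<rho> \<inter> \<tau> = {}" "\<sigma> \<inter> \<tau> = {}"
  shows "H \<rho> \<inter> H \<sigma> \<inter> H \<tau> = {}"
proof (rule ccontr)
  assume "\<not> ?thesis"
  then have "H \<rho> \<inter> H \<sigma> \<noteq> {}" "H \<rho> \<inter> H \<tau> \<noteq> {}" "H \<sigma> \<inter> H \<tau> \<noteq> {}" by blast+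
  then have "pair_condition K \<rho> \<sigma>" "pair_condition K \<rho> \<tau>" "pair_condition K \<sigma> \<tau>"
    using pair_condition_if_meet[OF K(1)] \<Delta> dis by blast+
  then show False using K(2) \<Delta> dis unfolding triple_points_infeasible_def K(1) by blast
qed

end

text \<open>By compactness, points of \<open>\<sigma>\<close> and \<open>\<tau>\<close> with
  disjoint supports have images at distance at least some \<open>m > 0\<close>, while the
  perturbation changes differences by at most \<open>h * R\<close>. Disjointness of supports, a
  closed condition, replaces the open condition that the points differ.\<close>

lemma dependence_free_perturb:
  fixes \<psi> \<mu> :: "'v \<Rightarrow> real^3"
  assumes fin: "finite \<sigma>" "finite \<tau>" and free: "dependence_free \<psi> \<sigma> \<tau>"
  shows "eventually (\<lambda>h. dependence_free (\<lambda>v. \<psi> v + h *\<^sub>R \<mu> v) \<sigma> \<tau>) (at_right 0)"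
proof -
  let ?V = "\<sigma> \<union> \<tau>"
  define P where "P S = {t :: 'v \<Rightarrow> real. (\<forall>v. 0 \<le> t v) \<and> (\<forall>v. v \<notin> S \<longrightarrow> t v = 0) \<and> sum t S = 1}" for S
  have cP: "compact (P S)" if "finite S" for S
  proof -
    have "P S = underlying_space (faces_of {S})"
      unfolding P_def using underlying_space_faces_of[of S "{S}"] that by auto
    then show ?thesis using compact_underlying_space[of "{S}"] that by simp
  qed
  define D where "D = (P \<sigma> \<times> P \<tau>) \<inter> {x. (\<Sum>v\<in>?V. fst x v * snd x v) = 0}"
  have co: "continuous_on A (\<lambda>x :: ('v \<Rightarrow> real) \<times> ('v \<Rightarrow> real). fst x v)" "continuous_on A (\<lambda>x :: ('v \<Rightarrow> real) \<times> ('v \<Rightarrow> real). snd x v)" for A v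
    by (rule continuous_on_product_then_coordinatewise, intro continuous_intros)+
  have "closed {x :: ('v \<Rightarrow> real) \<times> ('v \<Rightarrow> real). (\<Sum>v\<in>?V. fst x v * snd x v) = 0}"
    by (intro closed_Collect_eq continuous_intros co)
  then have cD: "compact D" unfolding D_def using fin by (intro compact_Int_closed compact_Times cP)
  define f where "f x = norm (\<Sum>v\<in>?V. (fst x v - snd x v) *\<^sub>R \<psi> v)" for x :: "('v \<Rightarrow> real) \<times> ('v \<Rightarrow> real)"
  have pos: "0 < f x" if x: "x \<in> D" for x
  proof (rule ccontr)
    assume "\<not> ?thesis"
    then have z: "(\<Sum>v\<in>?V. (fst x v - snd x v) *\<^sub>R \<psi> v) = 0" unfolding f_def by simp
    have s: "\<forall>v. 0 \<le> fst x v" "\<forall>v. v \<notin> \<sigma> \<longrightarrow> fst x v = 0" "sum (fst x) \<sigma> = 1"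
      and t: "\<forall>v. 0 \<le> snd x v" "\<forall>v. v \<notin> \<tau> \<longrightarrow> snd x v = 0" "sum (snd x) \<tau> = 1"
      and st: "(\<Sum>v\<in>?V. fst x v * snd x v) = 0" using x unfolding D_def P_def by auto
    have "sum (fst x) ?V = sum (fst x) \<sigma>" by (rule sum.mono_neutral_right) (use fin s in auto)
    moreover have "sum (snd x) ?V = sum (snd x) \<tau>" by (rule sum.mono_neutral_right) (use fin t in auto)
    ultimately have "sum (fst x) ?V = 1" "sum (snd x) ?V = 1" using s(3) t(3) by simp_all
    then have sm: "(\<Sum>v\<in>?V. fst x v - snd x v) = 0" by (simp add: sum_subtractf)
    have eq: "fst x v - snd x v = 0" for v
    proof (rule dependence_freeD[OF free _ _ sm z])
      show "u \<in> \<sigma>" if "0 < fst x u - snd x u" for u using that s(2) t(1) by (metis diff_0 neg_0_less_iff_less not_less)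
      show "u \<in> \<tau>" if "fst x u - snd x u < 0" for u using that t(2) s(1) by (metis diff_0_right not_less)
    qed
    have "fst x v * snd x v = 0" if "v \<in> ?V" for v
      using st that fin s(1) t(1) by (subst (asm) sum_nonneg_eq_0_iff) auto
    then have "fst x v = 0" if "v \<in> ?V" for v using eq[of v] that by (metis eq_iff_diff_eq_0 mult_eq_0_iff)
    then show False using s(3) by simp
  qed
  obtain m where m: "0 < m" "\<And>x. x \<in> D \<Longrightarrow> m \<le> f x"
  proof (cases "D = {}")
    case True
    then show ?thesis using that[of 1] by simp
  next
    case False
    have "continuous_on D f" unfolding f_def by (intro continuous_intros co)
    then obtain x0 where "x0 \<in> D" "\<forall>x\<in>D. f x0 \<le> f x" using continuous_attains_inf[OF cD False] by blast
    then show ?thesis using that[of "f x0"] pos by blast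
  qed
  define R where "R = (\<Sum>v\<in>?V. norm (\<mu> v))"
  have R0: "0 \<le> R" unfolding R_def by (simp add: sum_nonneg)
  have "eventually (\<lambda>h. 0 < h \<and> h < m / (R + 1)) (at_right (0::real))"
    using m(1) R0 by (intro eventually_conj eventually_at_right_less order_tendstoD(2)[OF tendsto_ident_at]) auto
  then show ?thesis
  proof eventually_elim
    case (elim h)
    show ?case unfolding dependence_free_def
    proof (intro allI impI, elim conjE, rule ccontr)
      fix d :: "'v \<Rightarrow> real" and u
      assume d: "\<forall>v. 0 < d v \<longrightarrow> v \<in> \<sigma>" "\<forall>v. d v < 0 \<longrightarrow> v \<in> \<tau>" "sum d ?V = 0" "(\<Sum>v\<in>?V. d v *\<^sub>R (\<psi> v + h *\<^sub>R \<mu> v)) = 0" and u: "d u \<noteq> 0"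
      \<comment> \<open>The positive and the negative part of \<open>d\<close> have equal sums, so
        half the sum of absolute values normalises both to total weight 1.\<close>
      define N where "N = (\<Sum>v\<in>?V. \<bar>d v\<bar>) / 2"
      have uV: "u \<in> ?V" using u d(1,2) by (metis UnCI linorder_neqE_linordered_idom)
      have "0 < \<bar>d u\<bar>" using u by simp
      also have "\<dots> \<le> (\<Sum>v\<in>?V. \<bar>d v\<bar>)" using uV fin by (intro member_le_sum) auto
      finally have N: "0 < N" unfolding N_def by simp
      define s t where "s v = (\<bar>d v\<bar> + d v) / (2 * N)" "t v = (\<bar>d v\<bar> - d v) / (2 * N)" for v
      have st: "s v - t v = d v / N" for v unfolding s_t_def using N by (simp add: field_simps)
      have sP: "s \<in> P \<sigma>"
      proof -
        have nn: "0 \<le> s v" for v unfolding s_t_def using N by simp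
        have out: "s v = 0" if "v \<notin> \<sigma>" for v using d(1) that unfolding s_t_def by (cases "0 < d v") auto
        have "sum s \<sigma> = sum s ?V" using fin out by (intro sum.mono_neutral_left) auto
        also have "\<dots> = ((\<Sum>v\<in>?V. \<bar>d v\<bar>) + sum d ?V) / (2 * N)" unfolding s_t_def by (simp add: sum.distrib flip: sum_divide_distrib)
        also have "\<dots> = 1" unfolding d(3) using N unfolding N_def by simp
        finally show ?thesis using nn out unfolding P_def by simp
      qed
      have tP: "t \<in> P \<tau>"
      proof -
        have nn: "0 \<le> t v" for v unfolding s_t_def using N by simp
        have out: "t v = 0" if "v \<notin> \<tau>" for v using d(2) that unfolding s_t_def by (cases "d v < 0") auto
        have "sum t \<tau> = sum t ?V" using fin out by (intro sum.mono_neutral_left) auto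
        also have "\<dots> = ((\<Sum>v\<in>?V. \<bar>d v\<bar>) - sum d ?V) / (2 * N)" unfolding s_t_def by (simp add: sum_subtractf flip: sum_divide_distrib)
        also have "\<dots> = 1" unfolding d(3) using N unfolding N_def by simp
        finally show ?thesis using nn out unfolding P_def by simp
      qed
      have "s v * t v = 0" for v unfolding s_t_def by (cases "0 \<le> d v") auto
      then have "(\<Sum>v\<in>?V. s v * t v) = 0" by (intro sum.neutral) blast
      then have stD: "(s, t) \<in> D" unfolding D_def using sP tP by simp
      have le1: "\<bar>s v - t v\<bar> \<le> 1" if "v \<in> ?V" for v
      proof -
        have "\<bar>d v\<bar> \<le> N"
        proof -
          have "\<bar>d v\<bar> \<le> \<bar>sum d (?V - {v})\<bar>" using d(3) that fin by (simp add: sum.remove[of _ v])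
          also have "\<dots> \<le> (\<Sum>v\<in>?V - {v}. \<bar>d v\<bar>)" by (rule sum_abs)
          also have "\<dots> = 2 * N - \<bar>d v\<bar>"
          proof -
            have "2 * N = \<bar>d v\<bar> + (\<Sum>v\<in>?V - {v}. \<bar>d v\<bar>)" unfolding N_def using that fin by (simp add: sum.remove[of _ v])
            then show ?thesis by simp
          qed
          finally show ?thesis by simp
        qed
        then show ?thesis unfolding st using N by simp
      qed
      have "(\<Sum>v\<in>?V. (s v - t v) *\<^sub>R \<psi> v) + h *\<^sub>R (\<Sum>v\<in>?V. (s v - t v) *\<^sub>R \<mu> v) = (1 / N) *\<^sub>R (\<Sum>v\<in>?V. d v *\<^sub>R (\<psi> v + h *\<^sub>R \<mu> v))"
        unfolding st scaleR_sum_right sum.distrib[symmetric] by (intro sum.cong refl) (simp add: algebra_simps)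
      then have "(\<Sum>v\<in>?V. (s v - t v) *\<^sub>R \<psi> v) = - (h *\<^sub>R (\<Sum>v\<in>?V. (s v - t v) *\<^sub>R \<mu> v))"
        unfolding d(4) by (simp add: eq_neg_iff_add_eq_0)
      then have "f (s, t) = h * norm (\<Sum>v\<in>?V. (s v - t v) *\<^sub>R \<mu> v)" unfolding f_def using elim by simp
      also have "norm (\<Sum>v\<in>?V. (s v - t v) *\<^sub>R \<mu> v) \<le> (\<Sum>v\<in>?V. norm ((s v - t v) *\<^sub>R \<mu> v))" by (rule norm_sum)
      also have "\<dots> \<le> R" unfolding R_def
      proof (rule sum_mono)
        fix v assume "v \<in> ?V"
        from mult_right_mono[OF le1[OF this] norm_ge_zero[of "\<mu> v"]] show "norm ((s v - t v) *\<^sub>R \<mu> v) \<le> norm (\<mu> v)" by simp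
      qed
      finally have "f (s, t) \<le> h * R" using elim by (simp add: mult_left_mono)
      also have "\<dots> < m"
      proof -
        have "h * (R + 1) < m" using elim R0 by (simp add: field_simps)
        then show ?thesis using elim by (simp add: algebra_simps)
      qed
      finally show False using m(2)[OF stD] by simp
    qed
  qed
qed

definition moment_curve :: "nat \<Rightarrow> real^3" where
  "moment_curve n = vector [real n, real n ^ 2, real n ^ 3]"

text \<open>The determinant is a cubic polynomial in \<open>h\<close> whose leading coefficient is
  the determinant for the moment curve. That is a Vandermonde determinant, nonzero for distinct
  labels, so only finitely many \<open>h\<close> fail.\<close>

lemma eventually_gp_perturb:
  fixes \<psi> :: "nat \<Rightarrow> real^3"
  assumes "distinct [a, b, c, d]"
  shows "eventually (\<lambda>h. triple_product ((\<psi> b + h *\<^sub>R moment_curve b) - (\<psi> a + h *\<^sub>R moment_curve a))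
    ((\<psi> c + h *\<^sub>R moment_curve c) - (\<psi> a + h *\<^sub>R moment_curve a))
    ((\<psi> d + h *\<^sub>R moment_curve d) - (\<psi> a + h *\<^sub>R moment_curve a)) \<noteq> 0) (at_right 0)"
proof -
  define u1 u2 u3 where "u1 = \<psi> b - \<psi> a" "u2 = \<psi> c - \<psi> a" "u3 = \<psi> d - \<psi> a"
  define w1 w2 w3 where "w1 = moment_curve b - moment_curve a" "w2 = moment_curve c - moment_curve a" "w3 = moment_curve d - moment_curve a"
  define p where "p = [:triple_product u1 u2 u3, triple_product w1 u2 u3 + triple_product u1 w2 u3 + triple_product u1 u2 w3,
    triple_product w1 w2 u3 + triple_product w1 u2 w3 + triple_product u1 w2 w3, triple_product w1 w2 w3:]"
  have "triple_product w1 w2 w3 = (real b - real a) * (real c - real a) * (real d - real a) * (real c - real b) * (real d - real b) * (real d - real c)"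
    unfolding triple_product_def w1_w2_w3_def moment_curve_def by simp algebra
  then have "triple_product w1 w2 w3 \<noteq> 0" using assms by simp
  then have "p \<noteq> 0" unfolding p_def by simp
  then have "finite {h. poly p h = 0}" by (rule poly_roots_finite)
  then have "eventually (\<lambda>h. \<forall>r\<in>{h. poly p h = 0}. h \<noteq> r) (at_right 0)"
  proof (rule eventually_ball_finite, intro ballI)
    fix r :: real
    show "eventually (\<lambda>h. h \<noteq> r) (at_right 0)"
    proof (cases "0 < r")
      case True
      then have "eventually (\<lambda>h. h < r) (at_right 0)" by (rule order_tendstoD(2)[OF tendsto_ident_at])
      then show ?thesis by eventually_elim simp
    next
      case False
      have "eventually (\<lambda>h. 0 < h) (at_right (0::real))" by (rule eventually_at_right_less)
      then show ?thesis by eventually_elim (use False in simp)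
    qed
  qed
  note ev = this
  have tp: "triple_product ((\<psi> b + h *\<^sub>R moment_curve b) - (\<psi> a + h *\<^sub>R moment_curve a))
    ((\<psi> c + h *\<^sub>R moment_curve c) - (\<psi> a + h *\<^sub>R moment_curve a))
    ((\<psi> d + h *\<^sub>R moment_curve d) - (\<psi> a + h *\<^sub>R moment_curve a)) = poly p h" for h
  proof -
    have "(\<psi> b + h *\<^sub>R moment_curve b) - (\<psi> a + h *\<^sub>R moment_curve a) = u1 + h *\<^sub>R w1"
      "(\<psi> c + h *\<^sub>R moment_curve c) - (\<psi> a + h *\<^sub>R moment_curve a) = u2 + h *\<^sub>R w2"
      "(\<psi> d + h *\<^sub>R moment_curve d) - (\<psi> a + h *\<^sub>R moment_curve a) = u3 + h *\<^sub>R w3"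
      unfolding u1_u2_u3_def w1_w2_w3_def by (simp_all add: algebra_simps)
    then show ?thesis unfolding p_def by (simp add: triple_product_linear algebra_simps)
  qed
  show ?thesis using ev by eventually_elim (use tp in auto)
qed

text \<open>The parity of the number of ascents in the cyclic word \<open>v a b\<close>, a formula
  visibly invariant under rotation. For distinct labels it is true for a decreasing cyclic order and
  false for an increasing one.\<close>

definition orient :: "nat \<Rightarrow> nat \<Rightarrow> nat \<Rightarrow> bool" where
  "orient v a b \<longleftrightarrow> (v < a) = ((a < b) = (b < v))"

text \<open>Finitely many conditions, each valid for all small \<open>h > 0\<close>, give one
  perturbation that is in general position and still free of dependences. The combinatorial
  exclusion of triple points applies to it directly, and the closed walk gives the
  contradiction.\<close>

theorem not_realizable_if_triple_points_infeasible:
  assumes fin: "finite \<Delta>" and c3: "\<And>\<sigma>. \<sigma> \<in> \<Delta> \<Longrightarrow> card \<sigma> = 3"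
    and closed2: "\<And>e. card e = 2 \<Longrightarrow> card {\<sigma>\<in>\<Delta>. e \<subseteq> \<sigma>} \<in> {0, 2}"
    and inf: "triple_points_infeasible (faces_of \<Delta>)"
    and fw: "flag_walk \<Delta> (f # fs)" "last (f # fs) = f"
    and tw: "\<And>v a b c. {v, a, b} \<in> \<Delta> \<Longrightarrow> {v, a, c} \<in> \<Delta> \<Longrightarrow> b \<noteq> c \<Longrightarrow> v < a \<Longrightarrow>
      odd (count_list (walk_edges (f # fs)) (v, a)) = (orient v a b = orient v a c)"
    and odd: "odd (walk_twists orient (f # fs))"
  shows "\<not> polyhedrally_realizable (faces_of \<Delta>)"
proof
  assume "polyhedrally_realizable (faces_of \<Delta>)"
  then obtain \<psi> where \<psi>: "locally_injective_on (underlying_space (faces_of \<Delta>)) (simplexwise_linear_map (faces_of \<Delta>) \<psi>)"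
    unfolding polyhedrally_realizable_def by blast
  have fin\<sigma>: "finite \<sigma>" if "\<sigma> \<in> \<Delta>" for \<sigma> using c3[OF that] card.infinite by fastforce
  have finV: "finite (\<Union>\<Delta>)" using fin fin\<sigma> by blast
  define \<phi> where "\<phi> h v = \<psi> v + h *\<^sub>R moment_curve v" for h v
  have "eventually (\<lambda>h. \<forall>x\<in>\<Delta> \<times> \<Delta>. fst x \<inter> snd x \<noteq> {} \<longrightarrow> dependence_free (\<phi> h) (fst x) (snd x)) (at_right 0)"
  proof (rule eventually_ball_finite, use fin in simp, intro ballI)
    fix x assume x: "x \<in> \<Delta> \<times> \<Delta>"
    show "eventually (\<lambda>h. fst x \<inter> snd x \<noteq> {} \<longrightarrow> dependence_free (\<phi> h) (fst x) (snd x)) (at_right 0)"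
    proof (cases "fst x \<inter> snd x = {}")
      case False
      have "dependence_free \<psi> (fst x) (snd x)"
        using x False by (intro locally_injective_imp_dependence_free[OF finV \<psi>]) auto
      then have "eventually (\<lambda>h. dependence_free (\<phi> h) (fst x) (snd x)) (at_right 0)"
        unfolding \<phi>_def using x fin\<sigma> by (intro dependence_free_perturb) auto
      then show ?thesis by eventually_elim simp
    qed simp
  qed
  moreover have "eventually (\<lambda>h. \<forall>x\<in>\<Union>\<Delta> \<times> \<Union>\<Delta> \<times> \<Union>\<Delta> \<times> \<Union>\<Delta>. case x of (a, b, c, d) \<Rightarrow> distinct [a, b, c, d] \<longrightarrow>
      triple_product (\<phi> h b - \<phi> h a) (\<phi> h c - \<phi> h a) (\<phi> h d - \<phi> h a) \<noteq> 0) (at_right 0)"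
  proof (rule eventually_ball_finite)
    show "finite (\<Union>\<Delta> \<times> \<Union>\<Delta> \<times> \<Union>\<Delta> \<times> \<Union>\<Delta>)" using finV by (intro finite_cartesian_product)
    show "\<forall>x\<in>\<Union>\<Delta> \<times> \<Union>\<Delta> \<times> \<Union>\<Delta> \<times> \<Union>\<Delta>. eventually (\<lambda>h. case x of (a, b, c, d) \<Rightarrow> distinct [a, b, c, d] \<longrightarrow>
      triple_product (\<phi> h b - \<phi> h a) (\<phi> h c - \<phi> h a) (\<phi> h d - \<phi> h a) \<noteq> 0) (at_right 0)"
    proof
      fix x :: "nat \<times> nat \<times> nat \<times> nat"
      obtain a b c d where x: "x = (a, b, c, d)" by (rule prod_cases4)
      show "eventually (\<lambda>h. case x of (a, b, c, d) \<Rightarrow> distinct [a, b, c, d] \<longrightarrow>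
        triple_product (\<phi> h b - \<phi> h a) (\<phi> h c - \<phi> h a) (\<phi> h d - \<phi> h a) \<noteq> 0) (at_right 0)"
      proof (cases "distinct [a, b, c, d]")
        case True
        from eventually_gp_perturb[OF True, of \<psi>] show ?thesis unfolding x \<phi>_def prod.case by eventually_elim blast
      next
        case False
        show ?thesis unfolding x prod.case by (intro always_eventually allI impI notI) (use False in blast)
      qed
    qed
  qed
  ultimately have "eventually (\<lambda>h. (\<forall>x\<in>\<Delta> \<times> \<Delta>. fst x \<inter> snd x \<noteq> {} \<longrightarrow> dependence_free (\<phi> h) (fst x) (snd x)) \<and>
    (\<forall>x\<in>\<Union>\<Delta> \<times> \<Union>\<Delta> \<times> \<Union>\<Delta> \<times> \<Union>\<Delta>. case x of (a, b, c, d) \<Rightarrow> distinct [a, b, c, d] \<longrightarrow>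
      triple_product (\<phi> h b - \<phi> h a) (\<phi> h c - \<phi> h a) (\<phi> h d - \<phi> h a) \<noteq> 0)) (at_right 0)"
    by (rule eventually_conj)
  then obtain h where h: "\<forall>x\<in>\<Delta> \<times> \<Delta>. fst x \<inter> snd x \<noteq> {} \<longrightarrow> dependence_free (\<phi> h) (fst x) (snd x)"
    "\<forall>x\<in>\<Union>\<Delta> \<times> \<Union>\<Delta> \<times> \<Union>\<Delta> \<times> \<Union>\<Delta>. case x of (a, b, c, d) \<Rightarrow> distinct [a, b, c, d] \<longrightarrow>
      triple_product (\<phi> h b - \<phi> h a) (\<phi> h c - \<phi> h a) (\<phi> h d - \<phi> h a) \<noteq> 0"
    by (drule_tac eventually_happens) auto
  interpret generic_surface "\<phi> h" \<Delta>
  proof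
    fix a b c d assume "distinct [a, b, c, d]" "{a, b, c, d} \<subseteq> \<Union>\<Delta>"
    then show "triple_product (\<phi> h b - \<phi> h a) (\<phi> h c - \<phi> h a) (\<phi> h d - \<phi> h a) \<noteq> 0"
      using bspec[OF h(2), of "(a, b, c, d)"] by simp
  next
    fix \<sigma> \<tau> assume "\<sigma> \<in> \<Delta>" "\<tau> \<in> \<Delta>" "\<sigma> \<inter> \<tau> \<noteq> {}"
    then show "dependence_free (\<phi> h) \<sigma> \<tau>" using bspec[OF h(1), of "(\<sigma>, \<tau>)"] by simp
  qed (use fin c3 closed2 in blast)+
  have tri: "triangles (faces_of \<Delta>) = \<Delta>"
  proof
    show "triangles (faces_of \<Delta>) \<subseteq> \<Delta>"
    proof
      fix F assume "F \<in> triangles (faces_of \<Delta>)"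
      then obtain T where T: "T \<in> \<Delta>" "F \<subseteq> T" "card F = 3" unfolding triangles_def faces_of_def by auto
      then have "F = T" using c3[OF T(1)] fin\<sigma>[OF T(1)] by (intro card_subset_eq) auto
      then show "F \<in> \<Delta>" using T by simp
    qed
    show "\<Delta> \<subseteq> triangles (faces_of \<Delta>)"
    proof
      fix T assume T: "T \<in> \<Delta>"
      then have "T \<noteq> {}" using c3[OF T] by auto
      then show "T \<in> triangles (faces_of \<Delta>)" unfolding triangles_def faces_of_def using T c3[OF T] by auto
    qed
  qed
  have dist: "distinct [v, a, b]" if "{v, a, b} \<in> \<Delta>" for v a b
    using c3[OF that] by (auto simp: card_insert_if split: if_splits)
  interpret oriented_surface "\<phi> h" \<Delta> orient
  proof
    show "orient a b v = orient v a b" for v a b unfolding orient_def by blast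
    show "orient v b a = (\<not> orient v a b)" if "{v, a, b} \<in> \<Delta>" for v a b
      using dist[OF that] unfolding orient_def by (simp add: not_less order_le_less) (metis less_asym linorder_neqE_nat)
    show "H \<rho> \<inter> H \<sigma> \<inter> H \<tau> = {}" if "\<rho> \<in> \<Delta>" "\<sigma> \<in> \<Delta>" "\<tau> \<in> \<Delta>" "\<rho> \<inter> \<sigma> = {}" "\<rho> \<inter> \<tau> = {}" "\<sigma> \<inter> \<tau> = {}" for \<rho> \<sigma> \<tau>
      by (rule no_triple_points[OF tri inf that])
  qed
  show False
  proof (rule walk_contradiction[OF fw _ odd])
    fix v a b c assume w: "wedge v a b c" "v < a"
    have "b \<noteq> c" using wedgeD(3)[OF w(1)] by simp
    then show "odd (count_list (walk_edges (f # fs)) (v, a)) = (orient v a b = orient v a c)"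
      using tw[OF wedgeD(1,2)[OF w(1)]] w(2) by blast
  qed
qed

section \<open>Certificates\<close>

definition disjoint_triples :: "nat list \<Rightarrow> nat list \<Rightarrow> bool" where
  "disjoint_triples s t \<longleftrightarrow> (\<forall>x\<in>set s. x \<notin> set t)"

definition adjacent_triples :: "nat list \<Rightarrow> nat list \<Rightarrow> bool" where
  "adjacent_triples s t \<longleftrightarrow> s \<noteq> t \<and> length (filter (\<lambda>x. x \<in> set t) s) = 2"

definition pair_condition_list :: "nat list list \<Rightarrow> nat list \<Rightarrow> nat list \<Rightarrow> bool" where
  "pair_condition_list l s t \<longleftrightarrow>
    length (filter (\<lambda>r. (\<forall>x\<in>set r. x \<in> set s \<or> x \<in> set t) \<and> (adjacent_triples r s \<or> adjacent_triples r t)) l) \<le> 4"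

text \<open>The admissible partners of \<open>s\<close> are filtered once, before pairs among them
  are examined; this keeps the evaluation short.\<close>

definition infeasible_list :: "nat list list \<Rightarrow> bool" where
  "infeasible_list l \<longleftrightarrow>
    (let g = (\<lambda>s. filter (\<lambda>t. disjoint_triples s t \<and> pair_condition_list l s t) l) in
      \<forall>s\<in>set l. let us = g s in \<forall>t\<in>set us. \<forall>u\<in>set us. \<not> (disjoint_triples t u \<and> pair_condition_list l t u))"

definition closed_list :: "nat list list \<Rightarrow> bool" where
  "closed_list l \<longleftrightarrow> (\<forall>t\<in>set l. \<forall>x\<in>set t. \<forall>y\<in>set t. x \<noteq> y \<longrightarrow> length (filter (\<lambda>s. x \<in> set s \<and> y \<in> set s) l) = 2)"

text \<open>For sorted triples these are the flags with \<open>v < a\<close>: every edge of every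
  triangle once.\<close>

definition flags_of :: "nat list list \<Rightarrow> (nat \<times> nat \<times> nat) list" where
  "flags_of l = concat (map (\<lambda>t. case t of [x, y, z] \<Rightarrow> [(x, y, z), (x, z, y), (y, z, x)] | _ \<Rightarrow> []) l)"

fun step_ok :: "nat \<times> nat \<times> nat \<Rightarrow> nat \<times> nat \<times> nat \<Rightarrow> bool" where
  "step_ok (v, a, b) (v', a', b') \<longleftrightarrow>
    (v' = a \<and> a' = v \<and> b' = b \<or> v' = v \<and> a' = b \<and> b' = a \<or> v' = v \<and> a' = a \<and> b' \<noteq> b)"

fun steps_ok :: "(nat \<times> nat \<times> nat) list \<Rightarrow> bool" where
  "steps_ok (f # g # fs) \<longleftrightarrow> step_ok f g \<and> steps_ok (g # fs)"
| "steps_ok _ \<longleftrightarrow> True"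

text \<open>\<open>es\<close> is \<open>walk_edges fs\<close> as a literal list, so that counting
  its entries does not evaluate the walk again.\<close>

definition walk_ok :: "nat list list \<Rightarrow> (nat \<times> nat \<times> nat) list \<Rightarrow> (nat \<times> nat) list \<Rightarrow> bool" where
  "walk_ok l fs es \<longleftrightarrow> fs \<noteq> [] \<and> last fs = hd fs \<and> (\<forall>(v, a, b)\<in>set fs. sort [v, a, b] \<in> set l) \<and> steps_ok fs \<and>
    walk_edges fs = es \<and> odd (walk_twists orient fs) \<and>
    (\<forall>(v, a, b)\<in>set (flags_of l). \<forall>(v', a', c)\<in>set (flags_of l). v = v' \<and> a = a' \<and> b \<noteq> c \<longrightarrow>
      odd (count_list es (v, a)) = (orient v a b = orient v a c))"

lemma card_inter_triple:
  assumes "distinct s"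
  shows "card (set s \<inter> set t) = length (filter (\<lambda>x. x \<in> set t) s)"
proof -
  have "set s \<inter> set t = set (filter (\<lambda>x. x \<in> set t) s)" by auto
  then show ?thesis using assms distinct_card[of "filter (\<lambda>x. x \<in> set t) s"] by simp
qed

lemma triple_set_inj:
  assumes "sorted_triples l" "s \<in> set l" "t \<in> set l"
  shows "set s = set t \<longleftrightarrow> s = t"
  using assms unfolding sorted_triples_def by (meson sorted_distinct_set_unique)

lemma triangles_facets: "sorted_triples l \<Longrightarrow> triangles (faces_of (facets l)) = facets l"
  unfolding triangles_def by (rule triangles_faces_of_facets)

lemma pair_condition_facets:
  assumes l: "sorted_triples l" and s: "s \<in> set l" "t \<in> set l"
  shows "pair_condition (faces_of (facets l)) (set s) (set t) \<longleftrightarrow> pair_condition_list l s t"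
proof -
  have adj: "adjacent_triangles (set r) (set s) \<longleftrightarrow> adjacent_triples r s" if "r \<in> set l" "s \<in> set l" for r s
    using that l triple_set_inj[OF l that] card_inter_triple[of r s]
    unfolding adjacent_triangles_def adjacent_triples_def sorted_triples_def by auto
  have "card {T \<in> facets l. (adjacent_triangles T (set s) \<or> adjacent_triangles T (set t)) \<and> T \<subseteq> set s \<union> set t} =
    length (filter (\<lambda>r. (adjacent_triangles (set r) (set s) \<or> adjacent_triangles (set r) (set t)) \<and> set r \<subseteq> set s \<union> set t) l)"
    by (rule card_facets_filter[OF l])
  also have "filter (\<lambda>r. (adjacent_triangles (set r) (set s) \<or> adjacent_triangles (set r) (set t)) \<and> set r \<subseteq> set s \<union> set t) l =
    filter (\<lambda>r. (\<forall>x\<in>set r. x \<in> set s \<or> x \<in> set t) \<and> (adjacent_triples r s \<or> adjacent_triples r t)) l"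
    by (rule filter_cong[OF refl]) (use adj s in auto)
  finally show ?thesis unfolding pair_condition_def triangles_facets[OF l] pair_condition_list_def by simp
qed

lemma infeasible_facets:
  assumes l: "sorted_triples l" and inf: "infeasible_list l"
  shows "triple_points_infeasible (faces_of (facets l))"
proof -
  have "False" if h: "A \<in> facets l" "B \<in> facets l" "C \<in> facets l" "A \<inter> B = {}" "A \<inter> C = {}" "B \<inter> C = {}"
    "pair_condition (faces_of (facets l)) A B" "pair_condition (faces_of (facets l)) A C" "pair_condition (faces_of (facets l)) B C" for A B C
  proof -
    obtain s t u where stu: "s \<in> set l" "t \<in> set l" "u \<in> set l" "A = set s" "B = set t" "C = set u"
      using h(1-3) unfolding facets_def by blast
    have "disjoint_triples s t" "disjoint_triples s u" "disjoint_triples t u"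
      using h(4-6) unfolding stu(4-6) disjoint_triples_def by blast+
    moreover have "pair_condition_list l s t" "pair_condition_list l s u" "pair_condition_list l t u"
      using h(7-9) unfolding stu(4-6) using pair_condition_facets[OF l] stu(1-3) by blast+
    ultimately have tu: "t \<in> set (filter (\<lambda>t. disjoint_triples s t \<and> pair_condition_list l s t) l)"
      "u \<in> set (filter (\<lambda>t. disjoint_triples s t \<and> pair_condition_list l s t) l)"
      "disjoint_triples t u \<and> pair_condition_list l t u" using stu(2,3) by simp_all
    from bspec[OF bspec[OF bspec[OF inf[unfolded infeasible_list_def Let_def] stu(1)] tu(1)] tu(2)] tu(3)
    show False by blast
  qed
  then show ?thesis unfolding triple_points_infeasible_def triangles_facets[OF l] by blast
qed

lemma closed_facets:
  assumes l: "sorted_triples l" and cl: "closed_list l" and e: "card e = 2"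
  shows "card {\<sigma> \<in> facets l. e \<subseteq> \<sigma>} \<in> {0, 2}"
proof -
  obtain x y where xy: "e = {x, y}" "x \<noteq> y" using e by (auto simp: card_2_iff)
  have c: "card {\<sigma> \<in> facets l. e \<subseteq> \<sigma>} = length (filter (\<lambda>s. x \<in> set s \<and> y \<in> set s) l)"
    unfolding xy card_facets_filter[OF l] by simp
  show ?thesis
  proof (cases "\<exists>t\<in>set l. x \<in> set t \<and> y \<in> set t")
    case True
    then show ?thesis using cl xy(2) unfolding c closed_list_def by blast
  next
    case False
    then have "filter (\<lambda>s. x \<in> set s \<and> y \<in> set s) l = []" by (simp add: filter_empty_conv)
    then show ?thesis unfolding c by simp
  qed
qed

lemma flags_of_facets:
  assumes l: "sorted_triples l" and v: "{v, a, b} \<in> facets l" "v < a"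
  shows "(v, a, b) \<in> set (flags_of l)"
proof -
  obtain t where t: "t \<in> set l" "{v, a, b} = set t" using v(1) unfolding facets_def by auto
  then have t': "length t = 3" "distinct t" "sorted t" using l unfolding sorted_triples_def by auto
  then obtain x y z where xyz: "t = [x, y, z]" by (auto simp: numeral_3_eq_3 length_Suc_conv)
  have lt: "x < y" "y < z" using t' unfolding xyz by auto
  have "card {v, a, b} = 3" unfolding t(2) using t' distinct_card by metis
  then have d: "v \<noteq> b" "a \<noteq> b" by (auto simp: card_insert_if split: if_splits)
  have "v \<in> {x, y, z}" "a \<in> {x, y, z}" "b \<in> {x, y, z}" using t(2) unfolding xyz by auto
  then have "(v, a, b) \<in> {(x, y, z), (x, z, y), (y, z, x)}" using v(2) d lt by auto
  then show ?thesis unfolding flags_of_def using t(1) xyz by force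
qed

lemma flag_walk_facets:
  assumes "\<forall>(v, a, b)\<in>set fs. sort [v, a, b] \<in> set l" "steps_ok fs"
  shows "flag_walk (facets l) fs"
  using assms
proof (induction fs rule: steps_ok.induct)
  case (1 f g fs)
  obtain v a b v' a' b' where f: "f = (v, a, b)" and g: "g = (v', a', b')" by (metis prod_cases3)
  have "sort [v, a, b] \<in> set l" "sort [v', a', b'] \<in> set l" using 1(2) f g by simp_all
  then have "set (sort [v, a, b]) \<in> facets l" "set (sort [v', a', b']) \<in> facets l" unfolding facets_def by blast+
  then have "{v, a, b} \<in> facets l" "{v', a', b'} \<in> facets l" unfolding set_sort3 .
  then have "flag_step (facets l) f g" using 1(3) unfolding f g by auto
  then show ?case using 1 by simp
qed simp_all

theorem infeasible_not_realizable:
  assumes l: "sorted_triples l" and cl: "closed_list l" and inf: "infeasible_list l" and wk: "walk_ok l fs es"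
  shows "triple_points_infeasible (faces_of (facets l)) \<and> \<not> polyhedrally_realizable (faces_of (facets l))"
proof
  show ti: "triple_points_infeasible (faces_of (facets l))" by (rule infeasible_facets[OF l inf])
  obtain f gs where fs: "fs = f # gs" using wk unfolding walk_ok_def by (cases fs) auto
  note w2 = conjunct2[OF wk[unfolded walk_ok_def fs]]
  note w3 = conjunct2[OF w2]
  note w4 = conjunct2[OF w3]
  note w5 = conjunct2[OF w4]
  note w7 = conjunct2[OF conjunct2[OF w5]]
  show "\<not> polyhedrally_realizable (faces_of (facets l))"
  proof (rule not_realizable_if_triple_points_infeasible)
    show "finite (facets l)" unfolding facets_def by simp
    show "card \<sigma> = 3" if "\<sigma> \<in> facets l" for \<sigma>
      using that l distinct_card unfolding facets_def sorted_triples_def by fastforce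
    show "card {\<sigma> \<in> facets l. e \<subseteq> \<sigma>} \<in> {0, 2}" if "card e = 2" for e by (rule closed_facets[OF l cl that])
    show "triple_points_infeasible (faces_of (facets l))" by (rule ti)
    show "flag_walk (facets l) (f # gs)" 
    proof (rule flag_walk_facets)
      show "\<forall>(v, a, b)\<in>set (f # gs). sort [v, a, b] \<in> set l" "steps_ok (f # gs)"
        by (rule conjunct1[OF w3] conjunct1[OF w4])+
    qed
    show "last (f # gs) = f" "odd (walk_twists orient (f # gs))" using wk unfolding walk_ok_def fs by auto
    show "odd (count_list (walk_edges (f # gs)) (v, a)) = (orient v a b = orient v a c)"
      if h: "{v, a, b} \<in> facets l" "{v, a, c} \<in> facets l" "b \<noteq> c" "v < a" for v a b c
    proof -
      have W: "\<forall>(v, a, b)\<in>set (flags_of l). \<forall>(v', a', c)\<in>set (flags_of l). v = v' \<and> a = a' \<and> b \<noteq> c \<longrightarrow>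
        odd (count_list es (v, a)) = (orient v a b = orient v a c)" and es: "walk_edges (f # gs) = es"
        by (rule w7 conjunct1[OF w5])+
      from bspec[OF W flags_of_facets[OF l h(1,4)]]
      have "\<forall>(v', a', c)\<in>set (flags_of l). v = v' \<and> a = a' \<and> b \<noteq> c \<longrightarrow>
        odd (count_list es (v, a)) = (orient v a b = orient v a c)" unfolding prod.case .
      from bspec[OF this flags_of_facets[OF l h(2,4)]] show ?thesis unfolding prod.case es using h(3) by blast
    qed
  qed
qed

lemma card_vertices: "length (remdups (concat l)) = n \<Longrightarrow> card (\<Union>(facets l)) = n"
proof -
  have "\<Union>(facets l) = set (concat l)" unfolding facets_def by simp
  then show "length (remdups (concat l)) = n \<Longrightarrow> card (\<Union>(facets l)) = n" by (simp add: length_remdups_card_conv)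
qed

section \<open>An isomorphism invariant finer than the degree sequence\<close>

definition vertex_class :: "'v set set \<Rightarrow> nat set \<Rightarrow> 'v \<Rightarrow> nat" where
  "vertex_class K D v = card {F \<in> K. card F = 3 \<and> v \<in> F \<and> degree_in K ` F = D}"

text \<open>Degrees refined twice. Degrees alone do not suffice: \<open>infeasible2\<close> and
  \<open>infeasible3\<close> both have the degrees 4, 6, 6, 6, 7, 7, 8, 8, 8.\<close>

definition triangle_class :: "'v set set \<Rightarrow> nat set \<Rightarrow> nat set \<Rightarrow> nat" where
  "triangle_class K D E = card {F \<in> K. card F = 3 \<and> vertex_class K D ` F = E}"

lemma combinatorially_isomorphic_triangle_class:
  assumes "combinatorially_isomorphic K L"
  shows "triangle_class K D E = triangle_class L D E"
proof -
  obtain f where f: "bij_betw f (\<Union>K) (\<Union>L)" "(\<lambda>F. f ` F) ` K = L"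
    using assms unfolding combinatorially_isomorphic_def by blast
  have inj: "inj_on f (\<Union>K)" using f(1) by (rule bij_betw_imp_inj_on)
  then have injK: "inj_on ((`) f) K" by (rule inj_on_image)
  have cardF: "card (f ` F) = card F" if "F \<in> K" for F
    using that inj by (intro card_image) (meson Union_upper inj_on_subset)
  have memF: "f v \<in> f ` F \<longleftrightarrow> v \<in> F" if "F \<in> K" "v \<in> \<Union>K" for F v
    using that inj by (meson Union_upper inj_on_image_mem_iff)
  \<comment> \<open>Properties of triangles that correspond under \<open>f\<close> have equal
    counts; degrees, vertex classes and triangle classes follow in turn.\<close>
  have key: "card {F \<in> L. card F = 3 \<and> P' F} = card {F \<in> K. card F = 3 \<and> P F}"
    if "\<And>F. F \<in> K \<Longrightarrow> P' (f ` F) = P F" for P P'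
  proof -
    have "{F \<in> L. card F = 3 \<and> P' F} = (`) f ` {F \<in> K. card (f ` F) = 3 \<and> P' (f ` F)}"
      unfolding f(2)[symmetric] by (rule Collect_image)
    also have "{F \<in> K. card (f ` F) = 3 \<and> P' (f ` F)} = {F \<in> K. card F = 3 \<and> P F}"
      using cardF that by auto
    finally show ?thesis using card_image[OF inj_on_subset[OF injK, of "{F \<in> K. card F = 3 \<and> P F}"]] by auto
  qed
  have deg: "degree_in L (f v) = degree_in K v" if "v \<in> \<Union>K" for v
    unfolding degree_in_def by (rule key) (rule memF[OF _ that])
  have im: "degree_in L ` f ` F = degree_in K ` F" if "F \<in> K" for F
    unfolding image_image using deg that by (intro image_cong) auto
  have vc: "vertex_class L D (f v) = vertex_class K D v" if "v \<in> \<Union>K" for v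
    unfolding vertex_class_def by (rule key) (simp only: memF[OF _ that] im)
  have "vertex_class L D ` f ` F = vertex_class K D ` F" if "F \<in> K" for F
    unfolding image_image using vc that by (intro image_cong) auto
  then show ?thesis unfolding triangle_class_def by (intro key[symmetric]) simp
qed

text \<open>\<open>ds\<close> and \<open>cs\<close> are the claimed tables of degrees and vertex
  classes, indexed by label. Labels start at 1, so both tables have a leading 0.\<close>

definition class_ok :: "nat list list \<Rightarrow> nat set \<Rightarrow> nat set \<Rightarrow> nat list \<Rightarrow> nat list \<Rightarrow> nat \<Rightarrow> bool" where
  "class_ok l D E ds cs n \<longleftrightarrow> (\<forall>t\<in>set l. \<forall>x\<in>set t. x < length ds) \<and>
    map (\<lambda>v. length (filter (\<lambda>t. v \<in> set t) l)) [0..<length ds] = ds \<and>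
    map (\<lambda>v. length (filter (\<lambda>t. v \<in> set t \<and> (!) ds ` set t = D) l)) [0..<length ds] = cs \<and>
    length (filter (\<lambda>t. (!) cs ` set t = E) l) = n"

lemma triangle_class_facets:
  assumes l: "sorted_triples l" and ok: "class_ok l D E ds cs n"
  shows "triangle_class (faces_of (facets l)) D E = n"
proof -
  let ?K = "faces_of (facets l)"
  have c: "card {F \<in> ?K. card F = 3 \<and> P F} = length (filter (\<lambda>t. P (set t)) l)" for P
  proof -
    have "{F \<in> ?K. card F = 3 \<and> P F} = {F \<in> {F \<in> ?K. card F = 3}. P F}" by blast
    then show ?thesis unfolding triangles_faces_of_facets[OF l] card_facets_filter[OF l, symmetric] by simp
  qed
  have o: "\<And>t x. t \<in> set l \<Longrightarrow> x \<in> set t \<Longrightarrow> x < length ds"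
    and ds: "map (\<lambda>v. length (filter (\<lambda>t. v \<in> set t) l)) [0..<length ds] = ds"
    and cs: "map (\<lambda>v. length (filter (\<lambda>t. v \<in> set t \<and> (!) ds ` set t = D) l)) [0..<length ds] = cs"
    and n: "length (filter (\<lambda>t. (!) cs ` set t = E) l) = n"
    using ok unfolding class_ok_def by blast+
  have dg: "degree_in ?K v = ds ! v" if "v < length ds" for v
  proof -
    have "ds ! v = map (\<lambda>v. length (filter (\<lambda>t. v \<in> set t) l)) [0..<length ds] ! v" using ds by simp
    then show ?thesis unfolding degree_in_def c using that by simp
  qed
  have dgi: "degree_in ?K ` set t = (!) ds ` set t" if "t \<in> set l" for t
    using dg o[OF that] by (intro image_cong) auto
  have vc: "vertex_class ?K D v = cs ! v" if "v < length ds" for v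
  proof -
    have "vertex_class ?K D v = length (filter (\<lambda>t. v \<in> set t \<and> degree_in ?K ` set t = D) l)"
      unfolding vertex_class_def by (rule c)
    also have "\<dots> = length (filter (\<lambda>t. v \<in> set t \<and> (!) ds ` set t = D) l)"
      by (intro arg_cong[where f = length] filter_cong refl) (simp add: dgi)
    also have "\<dots> = map (\<lambda>v. length (filter (\<lambda>t. v \<in> set t \<and> (!) ds ` set t = D) l)) [0..<length ds] ! v"
      using that by simp
    finally show ?thesis unfolding cs .
  qed
  have "vertex_class ?K D ` set t = (!) cs ` set t" if "t \<in> set l" for t
    using vc o[OF that] by (intro image_cong) auto
  then have "length (filter (\<lambda>t. vertex_class ?K D ` set t = E) l) = length (filter (\<lambda>t. (!) cs ` set t = E) l)"
    by (intro arg_cong[where f = length] filter_cong refl) simp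
  then show ?thesis unfolding triangle_class_def c n .
qed

lemma distinct_triangle_class:
  assumes "distinct (map (\<lambda>K. triangle_class K D E) Ks)"
  shows "card (set Ks) = length Ks" "pairwise (\<lambda>K L. \<not> combinatorially_isomorphic K L) (set Ks)"
proof -
  show "card (set Ks) = length Ks" using assms distinct_map distinct_card by metis
  have inj: "inj_on (\<lambda>K. triangle_class K D E) (set Ks)" using assms by (simp add: distinct_map)
  show "pairwise (\<lambda>K L. \<not> combinatorially_isomorphic K L) (set Ks)"
  proof (rule pairwiseI, rule notI)
    fix K L assume "K \<in> set Ks" "L \<in> set Ks" "K \<noteq> L" "combinatorially_isomorphic K L"
    then show False using inj combinatorially_isomorphic_triangle_class[of K L D E] unfolding inj_on_def by blast
  qed
qed

section \<open>The triangulations\<close>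

definition rp9_list :: "nat list list" where
  "rp9_list = [[1, 3, 7], [1, 5, 8], [3, 5, 9], [1, 3, 5], [1, 4, 7], [1, 6, 8], [4, 6, 9], [1, 4, 6], [2, 3, 7], [2, 6, 8], [3, 6, 9], [2, 3, 6], [2, 4, 7], [2, 5, 8], [4, 5, 9], [2, 4, 5]]"

text \<open>The quotient of the icosahedron by the antipodal map, in which any two of the six
  vertices are adjacent.\<close>

definition rp6_list :: "nat list list" where
  "rp6_list = [[3, 4, 6], [3, 4, 5], [2, 5, 6], [1, 5, 6], [1, 2, 4], [1, 2, 3], [1, 3, 5], [1, 4, 6], [2, 3, 6], [2, 4, 5]]"

definition n2_list :: "nat list list" where
  "n2_list = [[3, 4, 6], [3, 4, 5], [2, 5, 6], [1, 5, 6], [1, 2, 4], [1, 3, 5], [1, 4, 6], [2, 3, 6], [2, 4, 5], [3, 7, 9], [3, 7, 8], [2, 8, 9], [1, 8, 9], [1, 2, 7], [1, 3, 8], [1, 7, 9], [2, 3, 9], [2, 7, 8]]"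

definition n3_list :: "nat list list" where
  "n3_list = [[3, 4, 6], [3, 4, 5], [2, 5, 6], [1, 5, 6], [1, 3, 5], [1, 4, 6], [2, 3, 6], [2, 4, 5], [3, 7, 9], [3, 7, 8], [2, 8, 9], [1, 8, 9], [1, 2, 7], [1, 3, 8], [1, 7, 9], [2, 3, 9], [2, 7, 8], [4, 10, 12], [4, 10, 11], [2, 11, 12], [1, 11, 12], [1, 2, 10], [1, 10, 11], [1, 4, 12], [2, 10, 12], [2, 4, 11]]"

text \<open>A nine-vertex triangulation from which a few flips lead to each of the seven
  examples.\<close>

definition n39_list :: "nat list list" where
  "n39_list = [[1, 2, 3], [2, 3, 4], [1, 5, 7], [2, 5, 7], [2, 6, 9], [3, 6, 9], [4, 5, 9], [4, 7, 9], [1, 4, 5], [1, 7, 9], [2, 5, 8], [3, 5, 8], [3, 5, 9], [1, 2, 6], [3, 4, 6], [1, 4, 6], [2, 8, 9], [1, 8, 9], [1, 3, 8], [2, 4, 7]]"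

text \<open>The octahedron vertices 7, 8 and 9 have degree four; for each of them one flip lowers
  the degree to three, and the vertex is removed.\<close>

lemma rp6_moves: "moves_ok [Flip 3 7 1 2, Unstar 7 1 2 4, Flip 1 8 5 6, Unstar 8 5 6 2, Flip 5 9 3 4, Unstar 9 3 4 6] rp9_list \<and> moves_apply [Flip 3 7 1 2, Unstar 7 1 2 4, Flip 1 8 5 6, Unstar 8 5 6 2, Flip 5 9 3 4, Unstar 9 3 4 6] rp9_list = rp6_list"
  by code_simp

lemma projective_plane_rp6: "projective_plane (space_of rp6_list)"
proof -
  have "facets rp9_list = RP2_9" unfolding facets_def rp9_list_def RP2_9_def by simp
  then have "projective_plane (space_of rp9_list)" unfolding space_of_def using projective_plane_RP2_9 by simp
  then show ?thesis using projective_plane_moves rp6_moves by metis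
qed

lemma nonorientable_surface_n2: "nonorientable_surface 2 (space_of n2_list)"
proof -
  \<comment> \<open>The copy shares only the labels 1, 2, 3 of the triangle to be glued.\<close>
  let ?ms = "[Rename 4 7, Rename 5 8, Rename 6 9]"
  have ok: "moves_ok ?ms rp6_list" by code_simp
  have glue: "glue_ok [1, 2, 3] rp6_list (moves_apply ?ms rp6_list)" by code_simp
  have eq: "filter (\<lambda>s. set s \<noteq> set [1, 2, 3]) (rp6_list @ moves_apply ?ms rp6_list) = n2_list" by code_simp
  show ?thesis
    using nonorientable_surface_glue[OF nonorientable_surface.base[OF projective_plane_rp6] projective_plane_moves[OF projective_plane_rp6 ok] glue]
    unfolding eq by (simp add: numeral_2_eq_2)
qed

lemma nonorientable_surface_n3: "nonorientable_surface 3 (space_of n3_list)"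
proof -
  \<comment> \<open>The first gluing has used up the triangle 1, 2, 3; the triangle 1, 2, 4 is still
    present on both sides.\<close>
  let ?ms = "[Rename 3 10, Rename 5 11, Rename 6 12]"
  have ok: "moves_ok ?ms rp6_list" by code_simp
  have glue: "glue_ok [1, 2, 4] n2_list (moves_apply ?ms rp6_list)" by code_simp
  have eq: "filter (\<lambda>s. set s \<noteq> set [1, 2, 4]) (n2_list @ moves_apply ?ms rp6_list) = n3_list" by code_simp
  show ?thesis
    using nonorientable_surface_glue[OF nonorientable_surface_n2 projective_plane_moves[OF projective_plane_rp6 ok] glue]
    unfolding eq by (simp add: numeral_3_eq_3 numeral_2_eq_2)
qed

lemma nonorientable_surface_n39: "nonorientable_surface 3 (space_of n39_list)"
proof -
  \<comment> \<open>The vertices 7, 12 and 5 are brought to degree three by flips and removed, which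
    leaves nine; the final renamings close the gaps in the labels.\<close>
  let ?ms = "[Flip 1 2 10 7, Flip 5 6 2 1, Flip 1 7 9 10, Flip 7 9 10 3, Flip 3 7 8 10, Unstar 7 2 8 10, Flip 1 10 9 11, Flip 4 12 1 10, Flip 10 11 4 9, Flip 2 3 6 9, Flip 2 12 10 11, Unstar 12 1 10 11, Flip 4 5 2 3, Unstar 5 1 2 3, Rename 10 5, Rename 11 7]"
  have "moves_ok ?ms n3_list \<and> moves_apply ?ms n3_list = n39_list" by code_simp
  then show ?thesis using nonorientable_surface_moves[OF nonorientable_surface_n3] by metis
qed

definition triangulation_ok :: "nat list list \<Rightarrow> move list \<Rightarrow> bool" where
  "triangulation_ok l ms \<longleftrightarrow> sorted_triples l \<and> moves_ok ms n39_list \<and> moves_apply ms n39_list = l \<and>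
    length (remdups (concat l)) = 9"

lemma triangulation_okD:
  assumes "triangulation_ok l ms"
  shows "faces_of (facets l) \<in> triangulations_N 3 9" "sorted_triples l"
proof -
  note ok = assms[unfolded triangulation_ok_def]
  have "nonorientable_surface 3 (space_of l)"
    using nonorientable_surface_moves[OF nonorientable_surface_n39] ok by metis
  then show "faces_of (facets l) \<in> triangulations_N 3 9"
    using ok card_vertices by (intro triangulations_N_facets) (auto simp: sorted_triples_def)
  show "sorted_triples l" using ok by blast
qed

section \<open>Realizable triangulations with integer coordinates\<close>

definition realizable1 :: "nat list list" where
  "realizable1 = [[1, 5, 6], [4, 5, 6], [1, 7, 8], [7, 8, 9], [2, 3, 7], [3, 4, 7], [1, 2, 3], [1, 5, 7], [2, 5, 7], [2, 6, 9], [3, 6, 9], [4, 5, 9], [4, 7, 9], [2, 5, 8], [3, 5, 8], [3, 5, 9], [1, 2, 6], [3, 4, 6], [2, 8, 9], [1, 3, 8]]"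

definition coordinates1 :: "ivec list" where
  "coordinates1 = [(52, 29, 55), (8, 60, 25), (-20, 85, 55), (10, 55, 24), (23, 44, 5), (9, 56, 25), (21, 46, 8), (12, 59, 24), (10, 54, 24)]"

text \<open>
  Row \<open>i\<close> lists, for the triangles \<open>j > i\<close>, a linear functional separating triangle \<open>i\<close> from triangle \<open>j\<close> off their
  common vertices; the zero functional stands for disjoint triangles, where nothing is required.
\<close>

definition separators1 :: "ivec list list" where
  "separators1 = [[(42, 59, -6), (-24, -33, 4), (0, 0, 0), (0, 0, 0), (0, 0, 0), (-2, -4, -1), (-595, -827, 97), (-2, -7, 3), (29, 7, 16), (3, 2, 0), (17, 20, 0), (0, 0, 0), (-1, -4, 2), (-1, -4, 2), (12, 6, 5), (-165, -305, -38), (171, 202, -30), (0, 0, 0), (-2, -4, -1)],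
    [(0, 0, 0), (0, 0, 0), (0, 0, 0), (-113, -81, -31), (0, 0, 0), (-5, -4, -1), (-9, -8, -1), (29, 7, 16), (5, 4, 0), (-1, 4, -3), (-50, 3, -36), (-1, -1, 0), (-2, -5, 2), (12, 6, 5), (-1, -1, -1), (-1, 0, -1), (0, 0, 0), (0, 0, 0)],
    [(963, 887, -179), (4, 2, 1), (1, 1, 0), (3, 2, -2), (-79, 8, 55), (3, -1, 3), (0, 0, 0), (0, 0, 0), (0, 0, 0), (3, 1, 1), (4, -16, 15), (3, -14, 13), (0, 0, 0), (5, 3, -4), (0, 0, 0), (1, 0, 0), (116, 41, -110)],
    [(2, -1, 2), (13, -4, 11), (0, 0, 0), (-2, 1, -1), (3, -1, 3), (1, 0, 0), (1, 0, 0), (51, -2, 36), (8, -3, 7), (4, -16, 15), (3, -14, 13), (14, 5, 7), (0, 0, 0), (0, 0, 0), (55, -22, -39), (-1, -1, -2)],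
    [(206, 225, -7), (-195, -12, -172), (-2, -1, 0), (-1, -7, 5), (-4, 1, -4), (-3, 5, -7), (0, 0, 0), (-1, 2, -2), (-6, -13, 6), (-3, -25, 18), (13, 10, 3), (-4, 1, -4), (4, 10, -5), (-3, 2, -4), (-7, -5, -3)],
    [(-3, -2, -1), (-1, 0, 0), (-4, -5, 1), (0, 0, 0), (282, 221, 59), (6, 9, -1), (7, 5, 2), (0, 0, 0), (-3, -8, 4), (41, 26, 14), (0, 0, 0), (101, 70, 30), (0, 0, 0), (-2, -1, -1)],
    [(2, 3, 0), (0, -1, 1), (1, 1, 1), (5, 4, 1), (0, 0, 0), (0, 0, 0), (-1, -2, 2), (-3, -25, 18), (3, 2, 1), (12, 18, 1), (6, 5, 1), (0, 0, 1), (-427, -549, 39)],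
    [(-97, -157, 40), (0, 0, 0), (0, 0, 0), (8, 4, 3), (2, 0, 1), (-1, -5, 3), (-1, -5, 3), (8, 4, 3), (1, 0, -1), (0, 0, 0), (0, 0, 0), (-2, -3, 0)],
    [(3, 1, 1), (0, 0, 0), (16, 16, 1), (-3, 1, -3), (-4, -15, 9), (-2, -18, 13), (10, 6, 3), (0, 1, -1), (0, 0, 0), (-1, 1, -2), (0, 0, 0)],
    [(-1, 0, -1), (-4, -1, -1), (-4, -1, -1), (-2, -2, 1), (0, 0, 0), (7, 2, 4), (0, 0, -1), (-36, -5, -30), (0, -1, 6), (0, 0, 0)],
    [(-4, -1, -1), (-4, -1, -1), (0, 0, 0), (-1, -7, 5), (155, 84, 66), (-3, -2, 0), (-32, -2, -29), (0, -1, 3), (-2, -1, -1)],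
    [(-35, 0, -24), (-1, -4, 2), (0, -3, 2), (298, 167, 116), (0, 0, 0), (-1, -1, -1), (-4, 1, -17), (0, 0, 0)],
    [(0, 0, 0), (0, 0, 0), (11, 3, 6), (0, 0, 0), (-1, -1, -1), (-4, 1, -17), (0, 0, 0)],
    [(-33, -332, 243), (1, 1, 0), (1, 1, -2), (0, 0, 0), (0, 1, -1), (-1, -1, -1)],
    [(44, 62, -13), (0, 0, 0), (4, 9, -4), (1, 12, -9), (-19, -21, -2)],
    [(0, 0, 0), (-32, -15, -16), (-7, -2, -4), (-2, -1, -1)],
    [(171, 202, -30), (-1, -1, 5), (-5, -8, -1)],
    [(0, 0, 0), (-3, -2, -1)],
    [(-1, -1, -1)],
    []]"

lemma realizable1: "triangulation_ok realizable1 [Flip 2 4 3 7, Flip 1 9 7 8, Flip 1 4 5 6]" "polyhedrally_realizable (faces_of (facets realizable1))"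
proof -
  show "triangulation_ok realizable1 [Flip 2 4 3 7, Flip 1 9 7 8, Flip 1 4 5 6]" by code_simp
  \<comment> \<open>Vertices are numbered from 1, list positions from 0.\<close>
  have "rows_ok (\<lambda>v. coordinates1 ! (v - 1)) realizable1 separators1" by code_simp
  then show "polyhedrally_realizable (faces_of (facets realizable1))" by (rule rows_ok_realizable)
qed

definition realizable2 :: "nat list list" where
  "realizable2 = [[3, 4, 5], [3, 4, 9], [3, 6, 7], [4, 6, 7], [1, 7, 8], [7, 8, 9], [2, 3, 7], [1, 2, 3], [1, 5, 7], [2, 5, 7], [2, 6, 9], [3, 6, 9], [4, 7, 9], [1, 4, 5], [2, 5, 8], [3, 5, 8], [1, 2, 6], [1, 4, 6], [2, 8, 9], [1, 3, 8]]"

definition coordinates2 :: "ivec list" where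
  "coordinates2 = [(0, 50, 48), (0, 32, 8), (-60, 52, 0), (2, -10, 0), (1, 22, 0), (0, -46, -22), (40, 0, -4), (-52, 0, 60), (-2, 0, -1)]"

definition separators2 :: "ivec list list" where
  "separators2 = [[(1, 1, 7), (-1, -3, 20), (-1, 0, 1), (0, 0, 0), (0, 0, 0), (-14, -29, 28), (-1, -3, -2), (-1, -1, 0), (-1, -1, 0), (0, 0, 0), (4, 3, 77), (0, 1, 11), (-64, -2, -1), (-1, -1, -2), (-30, -61, -49), (0, 0, 0), (0, 2, -3), (0, 0, 0), (0, -1, -2)],
    [(-1, -2, 7), (-1, 0, 1), (0, 0, 0), (-1, -1, -1), (-2, -3, -1), (-1, -2, -1), (0, 0, 0), (0, 0, 0), (-2, -1, 3), (-92, -107, 228), (0, 1, 10), (-3, -1, -2), (0, 0, 0), (-1, -2, -3), (0, 0, 0), (0, 2, -3), (-1, -1, -1), (0, -1, -2)],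
    [(3, 456, -1172), (-1, 0, -2), (0, 1, -3), (-2, -1, -37), (-1, -2, -2), (-3, -5, -5), (-1, -1, -5), (1, 2, -6), (79, 122, -328), (0, 1, -3), (0, 0, 0), (0, 0, 0), (-1, -2, -6), (1, 2, -6), (0, 1, -2), (0, 0, 0), (0, 0, -1)],
    [(-1, 1, -2), (0, -2, -1), (0, -1, 1), (0, 0, 0), (0, -1, 0), (0, -1, 1), (2, -1, 2), (2, -1, 2), (81, -229, 197), (2, -1, 0), (0, 0, 0), (0, 0, 0), (9, -1, 1), (215, 106, -193), (0, 0, 0), (0, 0, 0)],
    [(16, -11, 23), (0, -1, 1), (0, -2, 1), (-12, -202, 185), (0, -1, 1), (0, 0, 0), (0, 0, 0), (1, 0, 2), (2, -2, 3), (2, -1, 2), (1, 0, 1), (2, -2, 3), (2, -2, 3), (2, -1, 2), (41, -40, 11)],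
    [(0, -2, 1), (0, 0, 0), (-1, -3, 1), (-1, -2, 1), (2, -1, 3), (1, 0, 2), (1, 2, 14), (0, 0, 0), (2, -4, 1), (0, -3, -1), (0, 0, 0), (0, 0, 0), (61, -18, 50), (1, -3, -1)],
    [(-5, -21, -15), (7, 15, -15), (65, 142, -162), (1, 2, -3), (1, 2, -2), (1, 2, 1), (0, 0, 0), (5, 11, -13), (14, 29, -28), (1, 2, -3), (0, 0, 0), (1, 2, -4), (1, 0, -2)],
    [(0, 2, -1), (-2, 0, 1), (-1, 1, 1), (1, 2, 0), (0, 0, 0), (-2, 2, -1), (0, 1, 0), (2, 5, 1), (23, 60, -27), (-1, 1, -1), (0, 1, 0), (415, -102, -523)],
    [(-62, -123, 72), (0, 0, 0), (0, 0, 0), (1, 2, 1), (428, 473, -267), (2, -1, 1), (1, 1, 0), (29, 1, 0), (1, 1, -1), (0, 0, 0), (1, 0, -1)],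
    [(2, 1, -2), (0, 0, 0), (1, 2, 1), (1, 1, -1), (10, 1, 0), (1, 1, 0), (2, 1, -2), (0, 0, 0), (2, 1, -2), (0, 0, 0)],
    [(41, 31, -64), (-1, 1, -3), (0, 0, 0), (3, -1, 2), (0, 0, 0), (-22, 5, -13), (-2, 1, -2), (-17, 5, -14), (0, 0, 0)],
    [(-1, 0, -2), (0, 0, 0), (0, 0, 0), (-1, -2, -3), (-11, 0, -1), (-1, 1, -2), (-1, 0, -1), (0, 0, -1)],
    [(0, -1, -13), (0, 0, 0), (0, 0, 0), (0, 0, 0), (1, 2, -3), (1, -1, -1), (0, 0, 0)],
    [(2, -1, 1), (2, 0, 1), (36, 1, 0), (6, 1, -1), (0, 0, 0), (1, 0, 0)],
    [(170, 125, 196), (-3, 1, -2), (0, 0, 0), (-341, 117, -269), (1, -2, -1)],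
    [(0, 0, 0), (0, 0, 0), (-9, 3, -7), (-93, -237, -193)],
    [(-103, 35, -48), (8, -1, 2), (2, -1, -1)],
    [(0, 0, 0), (2, -1, 0)],
    [(1, -2, -1)],
    []]"

lemma realizable2: "triangulation_ok realizable2 [Flip 2 4 3 7, Flip 1 9 7 8, Flip 3 4 7 6, Flip 5 9 3 4]" "polyhedrally_realizable (faces_of (facets realizable2))"
proof -
  show "triangulation_ok realizable2 [Flip 2 4 3 7, Flip 1 9 7 8, Flip 3 4 7 6, Flip 5 9 3 4]" by code_simp
  have "rows_ok (\<lambda>v. coordinates2 ! (v - 1)) realizable2 separators2" by code_simp
  then show "polyhedrally_realizable (faces_of (facets realizable2))" by (rule rows_ok_realizable)
qed

definition realizable3 :: "nat list list" where
  "realizable3 = [[2, 7, 8], [5, 7, 8], [3, 5, 6], [5, 6, 9], [2, 6, 8], [6, 8, 9], [1, 2, 3], [2, 3, 4], [1, 5, 7], [4, 5, 9], [4, 7, 9], [1, 4, 5], [1, 7, 9], [3, 5, 8], [1, 2, 6], [3, 4, 6], [1, 4, 6], [1, 8, 9], [1, 3, 8], [2, 4, 7]]"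

definition coordinates3 :: "ivec list" where
  "coordinates3 = [(0, 22, -58), (-53, 0, 24), (0, 1, 6), (58, 0, -4), (56, -44, 0), (1, 24, 0), (-31, 0, -9), (0, -58, 60), (-9, -4, 0)]"

definition separators3 :: "ivec list list" where
  "separators3 = [[(11, 38, 27), (0, 0, 0), (0, 0, 0), (-218, -499, -483), (-2, -1, 0), (-1, -2, -1), (-1, -3, -1), (-1, 0, 1), (0, 0, 0), (-1, -1, 0), (0, 0, 0), (-1, -1, 0), (-2, -2, -1), (0, -4, -1), (0, 0, 0), (0, 0, 0), (-3, -2, -1), (-2, -1, 0), (-3, -4, -2)],
    [(-2, -3, -1), (-2, -4, -1), (0, -1, -1), (-1, -4, -3), (0, 0, 0), (0, 0, 0), (-278, -591, -202), (-2, -4, -1), (0, -2, -1), (-1, -1, 0), (-1, -3, -1), (-333, -528, -434), (0, 0, 0), (0, 0, 0), (0, 0, 0), (-4, -9, -6), (-4, -9, -6), (0, -2, -1)],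
    [(68, 55, 223), (0, -1, -2), (4, -1, -2), (1, 1, 1), (-1, -1, -5), (1, 1, 2), (1, 1, 12), (0, 0, 0), (-1, 0, 1), (0, 0, 0), (111, 130, 61), (1, 0, 1), (-44, -38, -153), (-1, -1, 1), (0, 0, 0), (2, 1, 1), (0, 0, 0)],
    [(0, -1, -2), (14, -5, -7), (0, 0, 0), (0, 0, 0), (1, 2, 4), (8, 13, 148), (1, 0, 17), (-1, 0, 2), (1, 0, 1), (0, 1, -8), (2, -2, 1), (-1, -1, -5), (-1, -1, 1), (3, 3, 2), (0, 0, 0), (0, 0, 0)],
    [(-26, 293, 400), (1, 2, 4), (1, 3, 4), (0, 0, 0), (0, 0, 0), (0, 0, 0), (0, 0, 0), (0, 0, 0), (-2, 3, 4), (16, 21, 57), (0, 1, 2), (-1, 0, 1), (0, 1, 1), (-2, 3, 4), (1, 3, 4)],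
    [(0, 0, 0), (0, 0, 0), (0, 0, 0), (-1, 1, 2), (0, 1, 2), (0, 0, 0), (1, 1, 1), (-11, 4, 5), (2, -2, 1), (-4, 1, 2), (-1, 0, 1), (192, 202, 153), (-11, 4, 5), (0, 0, 0)],
    [(-29, -137, -93), (1, 4, 2), (0, 0, 0), (0, 0, 0), (-2, 0, 1), (0, 3, 1), (-1, 0, -1), (58, -710, -153), (-1, -1, -1), (-1, -1, 0), (0, 3, 1), (313, 3392, 1113), (0, 19, 1)],
    [(0, 0, 0), (1, 7, 6), (0, 2, 1), (0, 1, 1), (0, 0, 0), (1, 5, 4), (1, -3, 0), (26, -22, 153), (0, -3, 1), (0, 0, 0), (1, 6, 4), (28, 515, 111)],
    [(-1, -2, -3), (0, -1, -1), (-193, -191, -31), (-195, -997, -571), (-1, -1, -2), (0, -3, -1), (0, 0, 0), (-1, -2, -1), (-3, -7, -5), (-3, -7, -5), (0, -1, -1)],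
    [(68, -613, 526), (-282, 49, 398), (1, 0, 1), (0, 1, -8), (0, 0, 0), (-1, -3, -6), (0, -1, 0), (3, 3, 2), (0, 0, 0), (1, -18, -1)],
    [(-1, 2, 2), (-1, 71, 34), (0, 0, 0), (0, 0, 0), (-1, -5, -6), (-1, -3, 1), (-1, 32, 15), (0, 0, 0), (5, -173, -89)],
    [(2, 0, -1), (1, 0, -1), (1, -1, -1), (0, -1, -2), (12, -15, -19), (3, 1, -1), (2, 0, -1), (1, -1, -2)],
    [(0, 0, 0), (1, -4, -1), (0, 0, 0), (-1, -1, 0), (-164, 59, 1), (-5, 1, 0), (1, -38, -18)],
    [(0, 0, 0), (-1, -2, -1), (0, 0, 0), (1, 1, 1), (50, 54, 59), (0, 0, 0)],
    [(-1, 0, -1), (-12, -23, 1), (-1, 2, 0), (-1, 1, 0), (-1, 3, 0)],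
    [(-20, -89, 249), (0, 0, 0), (1, 1, 1), (1, 39, 2)],
    [(1, 1, 0), (1, 1, 0), (1, 4, -1)],
    [(-88, -59, -40), (0, 0, 0)],
    [(0, 0, 0)],
    []]"

lemma realizable3: "triangulation_ok realizable3 [Flip 2 9 6 8, Flip 3 9 5 6, Flip 2 5 8 7]" "polyhedrally_realizable (faces_of (facets realizable3))"
proof -
  show "triangulation_ok realizable3 [Flip 2 9 6 8, Flip 3 9 5 6, Flip 2 5 8 7]" by code_simp
  have "rows_ok (\<lambda>v. coordinates3 ! (v - 1)) realizable3 separators3" by code_simp
  then show "polyhedrally_realizable (faces_of (facets realizable3))" by (rule rows_ok_realizable)
qed

definition realizable4 :: "nat list list" where
  "realizable4 = [[1, 2, 4], [2, 4, 6], [2, 6, 8], [6, 8, 9], [2, 3, 7], [3, 4, 7], [1, 2, 3], [1, 5, 7], [2, 5, 7], [3, 6, 9], [4, 5, 9], [4, 7, 9], [1, 4, 5], [1, 7, 9], [2, 5, 8], [3, 5, 8], [3, 5, 9], [3, 4, 6], [1, 8, 9], [1, 3, 8]]"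

definition coordinates4 :: "ivec list" where
  "coordinates4 = [(16, 135, -136), (-153, 132, -16), (-163, -10, 62), (102, 0, -30), (27, -83, 13), (-12, 11, -11), (3, 0, 1), (21, -3, -53), (-1, -22, 29)]"

definition separators4 :: "ivec list list" where
  "separators4 = [[(712, 1315, 570), (2, 3, 1), (0, 0, 0), (2, 3, 1), (1, 2, 1), (2433, 3701, 3519), (1, 2, 2), (1, 2, -2), (0, 0, 0), (0, 1, 0), (1, 2, 1), (12889, 39882, 40336), (1, 2, 2), (2, 3, 1), (0, 0, 0), (0, 0, 0), (1, 2, 1), (1, 2, 2), (1, 2, 2)],
    [(1781, 2151, 1830), (1, 2, 1), (1, 0, -10), (-1, 0, -4), (2, 2, 3), (0, 0, 0), (1, 0, -10), (1, 2, 1), (-1, 0, -2), (-1, 0, -4), (0, 2, 3), (0, 0, 0), (5, 6, 6), (0, 0, 0), (0, 0, 0), (-288, 551, -2047), (0, 0, 0), (0, 0, 0)],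
    [(-686, 741, -786), (0, -1, -8), (0, 0, 0), (6, 5, 9), (0, 0, 0), (2, 1, -11), (0, 1, -1), (0, 0, 0), (0, 0, 0), (0, 0, 0), (0, 0, 0), (5674, 5931, 5043), (0, 1, 0), (0, 0, 0), (-1, 1, -2), (-2, -1, -1), (8, 8, 13)],
    [(0, 0, 0), (0, 0, 0), (0, 0, 0), (0, 0, 0), (0, 0, 0), (1423, -499, -803), (-1, 0, -1), (-3, -3, -2), (0, 0, 0), (-2, -1, -1), (1, 1, 1), (1, 1, 1), (1, 1, 0), (-8, -36, -27), (-11685, -4018, -4066), (1, 0, 1)],
    [(-369, -487, -1084), (1543, 1520, 2965), (0, 1, 2), (4114, 7633, 21516), (5, 22, 17), (0, 0, 0), (-1, 0, -1), (0, 0, 0), (-1, -1, -1), (2, 3, 7), (1, 2, 2), (-1, 2, -3), (3, 12, 10), (0, 0, 0), (1, 2, 3)],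
    [(1, 0, 1), (1, 1, 3), (1, 1, 3), (11, 49, 37), (-1, 1, -2), (-31, -96, -99), (1, 3, 4), (-4, -14, -13), (0, 0, 0), (1, 2, 2), (-1, 2, -3), (302, 1289, 1010), (0, 0, 0), (1, 1, 2)],
    [(-3, -1, -2), (-2, -2, -3), (-1, 2, -1), (0, 0, 0), (0, 0, 0), (-1, 0, 0), (-3, -1, -2), (-6, -5, -9), (-1, 2, -1), (-1, 0, -2), (-1, 2, -1), (-2, 0, -1), (-1517, 3865, 1459)],
    [(6792, 996, -6695), (0, 0, 0), (-3, -1, -3), (-1, -1, -2), (-1713, 1936, 2959), (-57, -28, -33), (5, 3, 4), (5, 3, 4), (0, 0, -1), (0, 0, 0), (120, 28, 39), (4, 2, 3)],
    [(0, 0, 0), (-2, -1, -3), (-1, -1, -1), (-1, 1, 2), (-1, -1, -1), (2657, 2764, 4000), (3, 4, 5), (0, 0, -1), (0, 0, 0), (0, 0, 0), (0, 0, 0)],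
    [(-1, 0, 0), (-2, -5, -4), (0, 0, 0), (-2, -1, -1), (0, 0, 0), (1, 2, 2), (-155, 1246, -1214), (-575, -2578, -1931), (-1, 0, 0), (1, 0, 2)],
    [(183, -248, 227), (443, 583, 1898), (2, 0, 1), (2, 1, 2), (2, 1, 2), (725, 172, 613), (1, -3, 1), (1, 0, 1), (0, 0, 0)],
    [(0, 2, 3), (-32, -194, -157), (0, 0, 0), (0, 0, 0), (1, 1, 0), (4, 15, 13), (65, 15, 21), (0, 0, 0)],
    [(1, 0, 0), (8, 4, 5), (5, 3, 4), (0, 0, -1), (0, -2, -3), (7, 1, 1), (4, 2, 3)],
    [(0, 0, 0), (0, 0, 0), (1, 1, 0), (0, 0, 0), (370, 85, 119), (5, 3, 4)],
    [(5152, 6135, 6968), (0, 0, -1), (0, 0, 0), (-1, -1, -1), (8, 8, 13)],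
    [(-4976, -5861, -10563), (-1, -2, -2), (-1, -1, -1), (1091, -1702, 1642)],
    [(0, -1, 0), (-1, -1, 0), (1, 0, 2)],
    [(0, 0, 0), (1, 0, 2)],
    [(2959, 2261, 3581)],
    []]"

lemma realizable4: "triangulation_ok realizable4 [Flip 2 4 3 7, Flip 2 9 6 8, Flip 1 6 4 2]" "polyhedrally_realizable (faces_of (facets realizable4))"
proof -
  show "triangulation_ok realizable4 [Flip 2 4 3 7, Flip 2 9 6 8, Flip 1 6 4 2]" by code_simp
  have "rows_ok (\<lambda>v. coordinates4 ! (v - 1)) realizable4 separators4" by code_simp
  then show "polyhedrally_realizable (faces_of (facets realizable4))" by (rule rows_ok_realizable)
qed

section \<open>Triangulations with infeasible triple points\<close>

definition infeasible1 :: "nat list list" where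
  "infeasible1 = [[3, 4, 9], [3, 7, 9], [3, 5, 6], [5, 6, 9], [1, 2, 9], [1, 6, 9], [1, 7, 8], [7, 8, 9], [2, 3, 7], [1, 2, 3], [1, 5, 7], [2, 5, 7], [4, 5, 9], [1, 4, 5], [2, 5, 8], [3, 5, 8], [3, 4, 6], [1, 4, 6], [2, 8, 9], [1, 3, 8]]"

text \<open>
  The walk traces the edges along which \<open>orient\<close> is inconsistent by an Euler tour, rotating around the vertices in between.
\<close>

definition walk1 :: "(nat \<times> nat \<times> nat) list" where
  "walk1 = [(3, 4, 9), (4, 3, 9), (4, 9, 3), (4, 9, 5), (4, 5, 9), (5, 4, 9), (5, 4, 1), (5, 1, 4), (5, 1, 7), (5, 7, 1), (5, 7, 2), (5, 2, 7), (2, 5, 7), (2, 7, 5), (2, 7, 3), (2, 3, 7), (2, 3, 1), (2, 1, 3), (1, 2, 3), (1, 2, 9), (1, 9, 2), (9, 1, 2), (9, 2, 1), (9, 2, 8), (9, 8, 2), (8, 9, 2), (8, 9, 7), (8, 7, 9), (8, 7, 1), (8, 1, 7), (1, 8, 7), (1, 7, 8), (1, 7, 5), (1, 5, 7), (1, 5, 4), (1, 4, 5), (4, 1, 5), (4, 1, 6), (4, 6, 1), (6, 4, 1), (6, 4, 3), (6, 3, 4), (6, 3, 5), (6, 5, 3), (5, 6, 3), (5, 3, 6), (5, 3, 8), (5, 8, 3), (5, 8, 2), (5, 2, 8), (5, 2, 7), (5, 7, 2), (7, 5, 2), (7, 2, 5), (7, 2, 3), (7, 3, 2), (3, 7, 2),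 (3, 7, 9), (3, 9, 7), (9, 3, 7), (9, 3, 4), (9, 4, 3), (9, 4, 5), (9, 5, 4), (9, 5, 6), (9, 6, 5), (6, 9, 5), (6, 5, 9), (6, 5, 3), (6, 3, 5), (3, 6, 5), (3, 5, 6), (5, 3, 6), (5, 3, 8), (5, 8, 3), (8, 5, 3), (8, 3, 5), (8, 3, 1), (8, 1, 3), (8, 1, 7), (8, 7, 1), (7, 8, 1), (7, 1, 8), (7, 1, 5), (7, 5, 1), (7, 5, 2), (7, 2, 5), (2, 7, 5), (2, 7, 3), (2, 3, 7), (3, 2, 7), (3, 7, 2), (3, 7, 9), (3, 9, 7), (3, 9, 4), (3, 4, 9)]"

lemma infeasible1: "triangulation_ok infeasible1 [Flip 2 4 3 7, Flip 1 9 7 8, Flip 2 6 9 1, Flip 3 9 5 6, Flip 4 7 3 9]"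
  "triple_points_infeasible (faces_of (facets infeasible1)) \<and> \<not> polyhedrally_realizable (faces_of (facets infeasible1))"
proof -
  show ok: "triangulation_ok infeasible1 [Flip 2 4 3 7, Flip 1 9 7 8, Flip 2 6 9 1, Flip 3 9 5 6, Flip 4 7 3 9]" by code_simp
  have "closed_list infeasible1" by code_simp
  moreover have "infeasible_list infeasible1" by code_simp
  \<comment> \<open>The edges of the tour in order: every edge with disagreeing orientations occurs
    exactly once, and no other edge occurs.\<close>
  moreover have "walk_ok infeasible1 walk1 [(3, 4), (4, 5), (2, 5), (1, 2), (1, 9), (8, 9), (1, 8), (1, 4), (4, 6), (5, 6), (5, 7), (3, 7), (3, 9), (6, 9), (3, 6), (3, 5), (5, 8), (7, 8), (2, 7), (2, 3)]" by code_simp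
  ultimately show "triple_points_infeasible (faces_of (facets infeasible1)) \<and> \<not> polyhedrally_realizable (faces_of (facets infeasible1))"
    by (rule infeasible_not_realizable[OF triangulation_okD(2)[OF ok]])
qed

definition infeasible2 :: "nat list list" where
  "infeasible2 = [[1, 2, 5], [2, 4, 5], [2, 7, 8], [5, 7, 8], [2, 4, 6], [2, 3, 7], [3, 4, 7], [1, 2, 3], [1, 5, 7], [2, 6, 9], [3, 6, 9], [4, 5, 9], [4, 7, 9], [1, 7, 9], [3, 5, 8], [3, 5, 9], [3, 4, 6], [2, 8, 9], [1, 8, 9], [1, 3, 8]]"

definition walk2 :: "(nat \<times> nat \<times> nat) list" where
  "walk2 = [(2, 4, 6), (4, 2, 6), (4, 6, 2), (4, 6, 3), (4, 3, 6), (3, 4, 6), (3, 6, 4), (3, 6, 9), (3, 9, 6), (9, 3, 6), (9, 3, 5), (9, 5, 3), (9, 5, 4), (9, 4, 5), (4, 9, 5), (4, 5, 9), (5, 4, 9), (5, 4, 2), (5, 2, 4), (5, 2, 1), (5, 1, 2), (5, 1, 7), (5, 7, 1), (7, 5, 1), (7, 1, 5), (7, 1, 9), (7, 9, 1), (9, 7, 1), (9, 1, 7), (9, 1, 8), (9, 8, 1), (8, 9, 1), (8, 9, 2), (8, 2, 9), (8, 2, 7), (8, 7, 2), (7, 8, 2), (7, 2, 8), (7, 2, 3), (7, 3, 2), (7, 3, 4), (7, 4, 3), (4, 7, 3), (4, 3, 7), (4, 3, 6), (4, 6, 3), (6, 4, 3), (6, 3, 4), (6, 3, 9), (6, 9,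 3), (9, 6, 3), (9, 3, 6), (9, 3, 5), (9, 5, 3), (5, 9, 3), (5, 3, 9), (3, 5, 9), (3, 5, 8), (3, 8, 5), (3, 8, 1), (3, 1, 8), (3, 1, 2), (3, 2, 1), (2, 3, 1), (2, 1, 3), (1, 2, 3), (1, 3, 2), (1, 3, 8), (1, 8, 3), (1, 8, 9), (1, 9, 8), (9, 1, 8), (9, 8, 1), (9, 8, 2), (9, 2, 8), (2, 9, 8), (2, 9, 6), (2, 6, 9), (2, 6, 4), (2, 4, 6)]"

lemma infeasible2: "triangulation_ok infeasible2 [Flip 2 4 3 7, Flip 1 6 2 4, Flip 2 5 7 8, Flip 1 4 5 2]"
  "triple_points_infeasible (faces_of (facets infeasible2)) \<and> \<not> polyhedrally_realizable (faces_of (facets infeasible2))"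
proof -
  show ok: "triangulation_ok infeasible2 [Flip 2 4 3 7, Flip 1 6 2 4, Flip 2 5 7 8, Flip 1 4 5 2]" by code_simp
  have "closed_list infeasible2" by code_simp
  moreover have "infeasible_list infeasible2" by code_simp
  moreover have "walk_ok infeasible2 walk2 [(2, 4), (3, 4), (3, 9), (4, 9), (4, 5), (5, 7), (7, 9), (8, 9), (7, 8), (4, 7), (4, 6), (6, 9), (5, 9), (3, 5), (2, 3), (1, 2), (1, 9), (2, 9)]" by code_simp
  ultimately show "triple_points_infeasible (faces_of (facets infeasible2)) \<and> \<not> polyhedrally_realizable (faces_of (facets infeasible2))"
    by (rule infeasible_not_realizable[OF triangulation_okD(2)[OF ok]])
qed

definition infeasible3 :: "nat list list" where
  "infeasible3 = [[1, 2, 4], [2, 4, 6], [1, 4, 9], [1, 5, 9], [1, 7, 8], [7, 8, 9], [2, 3, 7], [3, 4, 7], [1, 2, 3], [1, 5, 7], [2, 5, 7], [2, 6, 9], [3, 6, 9], [4, 7, 9], [2, 5, 8], [3, 5, 8], [3, 5, 9], [3, 4, 6], [2, 8, 9], [1, 3, 8]]"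

definition walk3 :: "(nat \<times> nat \<times> nat) list" where
  "walk3 = [(3, 4, 6), (4, 3, 6), (4, 6, 3), (4, 6, 2), (4, 2, 6), (2, 4, 6), (2, 6, 4), (2, 6, 9), (2, 9, 6), (2, 9, 8), (2, 8, 9), (2, 8, 5), (2, 5, 8), (5, 2, 8), (5, 2, 7), (5, 7, 2), (7, 5, 2), (7, 2, 5), (2, 7, 5), (2, 7, 3), (2, 3, 7), (2, 3, 1), (2, 1, 3), (1, 2, 3), (1, 2, 4), (1, 4, 2), (1, 4, 9), (1, 9, 4), (9, 1, 4), (9, 4, 1), (9, 4, 7), (9, 7, 4), (9, 7, 8), (9, 8, 7), (8, 9, 7), (8, 7, 9), (8, 7, 1), (8, 1, 7), (1, 8, 7), (1, 7, 8), (1, 7, 5), (1, 5, 7), (5, 1, 7), (5, 1, 9), (5, 9, 1), (9, 5, 1), (9, 5, 3), (9, 3, 5), (3, 9, 5), (3, 5, 9), (5, 3, 9), (5, 3, 8), (5, 8, 3), (8, 5, 3), (8, 3, 5), (8, 3, 1), (8, 1, 3), (8, 1, 7), (8, 7, 1), (7, 8, 1), (7, 8, 9), (7, 9, 8), (7, 9, 4), (7, 4, 9), (4, 7, 9), (4, 7, 3), (4, 3, 7), (4, 3, 6), (4, 6, 3), (6, 4, 3), (6, 3, 4), (6, 3, 9), (6, 9, 3), (9, 6, 3), (9, 6, 2), (9, 2, 6), (2, 9, 6), (2, 6, 9), (2, 6, 4), (2, 4, 6), (2, 4, 1), (2, 1, 4), (2, 1, 3), (2, 3, 1), (3, 2,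 1), (3, 2, 7), (3, 7, 2), (3, 7, 4), (3, 4, 7), (3, 4, 6)]"

lemma infeasible3: "triangulation_ok infeasible3 [Flip 2 4 3 7, Flip 1 9 7 8, Flip 4 5 1 9, Flip 1 6 2 4]"
  "triple_points_infeasible (faces_of (facets infeasible3)) \<and> \<not> polyhedrally_realizable (faces_of (facets infeasible3))"
proof -
  show ok: "triangulation_ok infeasible3 [Flip 2 4 3 7, Flip 1 9 7 8, Flip 4 5 1 9, Flip 1 6 2 4]" by code_simp
  have "closed_list infeasible3" by code_simp
  moreover have "infeasible_list infeasible3" by code_simp
  moreover have "walk_ok infeasible3 walk3 [(3, 4), (2, 4), (2, 5), (5, 7), (2, 7), (1, 2), (1, 9), (8, 9), (1, 8), (1, 5), (5, 9), (3, 9), (3, 5), (5, 8), (7, 8), (4, 7), (4, 6), (6, 9), (2, 9), (2, 3)]" by code_simp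
  ultimately show "triple_points_infeasible (faces_of (facets infeasible3)) \<and> \<not> polyhedrally_realizable (faces_of (facets infeasible3))"
    by (rule infeasible_not_realizable[OF triangulation_okD(2)[OF ok]])
qed

text \<open>The degree set \<open>{6, 7}\<close> and the class set \<open>{0, 3}\<close> are
  selected so that the four counts 4, 1, 0, 2 differ.\<close>

lemma realizable_distinct:
  fixes Ks defines "Ks \<equiv> map (\<lambda>l. faces_of (facets l)) [realizable1, realizable2, realizable3, realizable4]"
  shows "card (set Ks) = 4" "pairwise (\<lambda>K L. \<not> combinatorially_isomorphic K L) (set Ks)"
proof -
  have c1: "triangle_class (faces_of (facets realizable1)) {6, 7} {0, 3} = 4"
    by (rule triangle_class_facets[OF triangulation_okD(2)[OF realizable1(1)], where ds = "[0, 6, 7, 8, 5, 8, 6, 7, 6, 7]" and cs = "[0, 2, 3, 0, 0, 0, 2, 2, 3, 3]"]) code_simp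
  have c2: "triangle_class (faces_of (facets realizable2)) {6, 7} {0, 3} = 1"
    by (rule triangle_class_facets[OF triangulation_okD(2)[OF realizable2(1)], where ds = "[0, 7, 7, 8, 6, 6, 6, 8, 6, 6]" and cs = "[0, 3, 4, 0, 2, 2, 3, 0, 2, 2]"]) code_simp
  have c3: "triangle_class (faces_of (facets realizable3)) {6, 7} {0, 3} = 0"
    by (rule triangle_class_facets[OF triangulation_okD(2)[OF realizable3(1)], where ds = "[0, 8, 6, 6, 7, 7, 7, 6, 7, 6]" and cs = "[0, 0, 4, 4, 5, 5, 5, 4, 5, 4]"]) code_simp
  have c4: "triangle_class (faces_of (facets realizable4)) {6, 7} {0, 3} = 2"
    by (rule triangle_class_facets[OF triangulation_okD(2)[OF realizable4(1)], where ds = "[0, 7, 7, 8, 7, 7, 5, 6, 6, 7]" and cs = "[0, 3, 2, 0, 1, 3, 0, 4, 2, 3]"]) code_simp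
  have m: "map (\<lambda>K. triangle_class K {6, 7} {0, 3}) Ks = [4, 1, 0, 2]"
    unfolding Ks_def list.map c1 c2 c3 c4 ..
  have d: "distinct (map (\<lambda>K. triangle_class K {6, 7} {0, 3}) Ks)" unfolding m by simp
  show "card (set Ks) = 4" using distinct_triangle_class(1)[OF d] unfolding Ks_def by simp
  show "pairwise (\<lambda>K L. \<not> combinatorially_isomorphic K L) (set Ks)" by (rule distinct_triangle_class(2)[OF d])
qed

text \<open>Here \<open>{7, 8}\<close> and \<open>{0, 1}\<close> give the counts 0, 12, 6, which
  also separate the two complexes with equal degree sequences.\<close>

lemma infeasible_distinct:
  fixes Ks defines "Ks \<equiv> map (\<lambda>l. faces_of (facets l)) [infeasible1, infeasible2, infeasible3]"
  shows "card (set Ks) = 3" "pairwise (\<lambda>K L. \<not> combinatorially_isomorphic K L) (set Ks)"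
proof -
  have c1: "triangle_class (faces_of (facets infeasible1)) {7, 8} {0, 1} = 0"
    by (rule triangle_class_facets[OF triangulation_okD(2)[OF infeasible1(1)], where ds = "[0, 8, 6, 8, 5, 8, 5, 6, 6, 8]" and cs = "[0, 0, 0, 0, 0, 0, 0, 0, 0, 0]"]) code_simp
  have c2: "triangle_class (faces_of (facets infeasible2)) {7, 8} {0, 1} = 12"
    by (rule triangle_class_facets[OF triangulation_okD(2)[OF infeasible2(1)], where ds = "[0, 6, 8, 8, 6, 7, 4, 7, 6, 8]" and cs = "[0, 0, 1, 2, 0, 1, 0, 1, 0, 1]"]) code_simp
  have c3: "triangle_class (faces_of (facets infeasible3)) {7, 8} {0, 1} = 6"
    by (rule triangle_class_facets[OF triangulation_okD(2)[OF infeasible3(1)], where ds = "[0, 7, 8, 8, 6, 6, 4, 7, 6, 8]" and cs = "[0, 1, 2, 2, 0, 0, 0, 1, 0, 0]"]) code_simp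
  have m: "map (\<lambda>K. triangle_class K {7, 8} {0, 1}) Ks = [0, 12, 6]"
    unfolding Ks_def list.map c1 c2 c3 ..
  have d: "distinct (map (\<lambda>K. triangle_class K {7, 8} {0, 1}) Ks)" unfolding m by simp
  show "card (set Ks) = 3" using distinct_triangle_class(1)[OF d] unfolding Ks_def by simp
  show "pairwise (\<lambda>K L. \<not> combinatorially_isomorphic K L) (set Ks)" by (rule distinct_triangle_class(2)[OF d])
qed

theorem theorem5p4:
  shows "(\<exists>\<T>. \<T> \<subseteq> triangulations_N 3 9 \<and> card \<T> = 4 \<and>
              pairwise (\<lambda>K L. \<not> combinatorially_isomorphic K L) \<T> \<and>
              (\<forall>K \<in> \<T>. polyhedrally_realizable K)) \<and>
         (\<exists>\<T>. \<T> \<subseteq> triangulations_N 3 9 \<and> card \<T> = 3 \<and>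
              pairwise (\<lambda>K L. \<not> combinatorially_isomorphic K L) \<T> \<and>
              (\<forall>K \<in> \<T>. triple_points_infeasible K \<and> \<not> polyhedrally_realizable K))"
proof
  let ?\<A> = "set (map (\<lambda>l. faces_of (facets l)) [realizable1, realizable2, realizable3, realizable4])"
  have "?\<A> \<subseteq> triangulations_N 3 9"
    using realizable1(1) realizable2(1) realizable3(1) realizable4(1) by (simp add: triangulation_okD(1))
  moreover have "\<forall>K\<in>?\<A>. polyhedrally_realizable K"
    using realizable1(2) realizable2(2) realizable3(2) realizable4(2) by simp
  ultimately show "\<exists>\<T>. \<T> \<subseteq> triangulations_N 3 9 \<and> card \<T> = 4 \<and>
      pairwise (\<lambda>K L. \<not> combinatorially_isomorphic K L) \<T> \<and> (\<forall>K \<in> \<T>. polyhedrally_realizable K)"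
    using realizable_distinct by blast
  let ?\<B> = "set (map (\<lambda>l. faces_of (facets l)) [infeasible1, infeasible2, infeasible3])"
  have "?\<B> \<subseteq> triangulations_N 3 9"
    using infeasible1(1) infeasible2(1) infeasible3(1) by (simp add: triangulation_okD(1))
  moreover have "\<forall>K\<in>?\<B>. triple_points_infeasible K \<and> \<not> polyhedrally_realizable K"
    using infeasible1(2) infeasible2(2) infeasible3(2) by simp
  ultimately show "\<exists>\<T>. \<T> \<subseteq> triangulations_N 3 9 \<and> card \<T> = 3 \<and>
      pairwise (\<lambda>K L. \<not> combinatorially_isomorphic K L) \<T> \<and>
      (\<forall>K \<in> \<T>. triple_points_infeasible K \<and> \<not> polyhedrally_realizable K)"
    using infeasible_distinct by blast
qed

end
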